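(* Let $n\ge2$, let $\bm{m}=(m_1,\dots,m_n)$ be a tuple of integers $m_j\ge1$, and let $\bm{T}=(T_1,\dots,T_n)$ be a doubly commuting $B_{\bm{m}}$-contractive tuple on a Hilbert space $\mathcal{H}$. Then there exist Hilbert spaces $\mathcal{E}_k$ and partially isometric multipliers $\theta_k\in\mathcal{M}(A^2_1(\mathcal{E}_k),A^2_{m_k}(\mathcal{D}_{\bm{m},\bm{T}}))$, $k=1,\dots,n$, such that $$\mathcal{H}\cong\mathcal{Q}_\Theta:=A^2_{\bm{m}}(\mathcal{D}_{\bm{m},\bm{T}})\Big/\sum_{i=1}^n\Theta_iA^2_{\hat{\bm{m}}_i}(\mathcal{E}_i)$$ and $$(T_1,\dots,T_n)\cong\big(P_{\mathcal{Q}_\Theta}M_{z_1}|_{\mathcal{Q}_\Theta},\dots,P_{\mathcal{Q}_\Theta}M_{z_n}|_{\mathcal{Q}_\Theta}\big),$$ where, for $i=1,\dots,n$, $\Theta_i$ is the one-variable multiplier $\Theta_i(\bm{z})=\theta_i(z_i)$, $\bm{z}\in\mathbb{D}^n$, from $A^2_{\hat{\bm{m}}_i}(\mathcal{E}_i)$ to $A^2_{\bm{m}}(\mathcal{D}_{\bm{m},\bm{T}})$.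
   Context: $\mathbb{D}$ is the open unit disc, $\mathbb{D}^n$ the open unit polydisc; $P_{\mathcal{S}}$ is the orthogonal projection onto a closed subspace $\mathcal{S}$. Tuples $\bm{T}$ on $\mathcal{H}$ and $\bm{S}$ on $\mathcal{K}$ are jointly unitarily equivalent, $\bm{T}\cong\bm{S}$, if there is a unitary $U:\mathcal{H}\to\mathcal{K}$ with $UT_i=S_iU$ for all $i$. A quotient of a Hilbert space by a subspace is identified with the orthogonal complement of that subspace; in particular $P_{\mathcal{Q}_\Theta}$ is the orthogonal projection onto this orthogonal complement. Spaces. For an integer $m\ge1$, $A^2_m$ is the reproducing kernel Hilbert space on $\mathbb{D}$ with kernel $B_m(z,w)=(1-z\bar w)^{-m}$; so $A^2_1=H^2$ is the Hardy space. For $\bm{m}=(m_1,\dots,m_n)$ with $m_i\ge1$, $A^2_{\bm{m}}\cong A^2_{m_1}\otimes\cdots\otimes A^2_{m_n}$ is the reproducing kernel Hilbert space on $\mathbb{D}^n$ with kernel $B_{\bm{m}}(\bm{z},\bm{w})=\prod_{i=1}^n(1-z_i\bar w_i)^{-m_i}$. For a Hilbert space $\mathcal{E}$, $A^2_m(\mathcal{E})\cong A^2_m\otimes\mathcal{E}$ and $A^2_{\bm{m}}(\mathcal{E})\cong A^2_{\bm{m}}\otimes\mathcal{E}$ are the corresponding $\mathcal{E}$-valued spaces. $M_{z_i}$ is multiplication by $z_i$. For $1\le j\le n$, $\hat{\bm{m}}_j=(m_1,\dots,m_{j-1},1,m_{j+1},\dots,m_n)$ ($1$ in the $j$-th place).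 Multipliers. $\mathcal{M}(A^2_{p}(\mathcal{E}_1),A^2_{q}(\mathcal{E}_2))$ is the set of holomorphic $\theta:\mathbb{D}\to\mathcal{B}(\mathcal{E}_1,\mathcal{E}_2)$ with $\theta f\in A^2_q(\mathcal{E}_2)$ for all $f\in A^2_p(\mathcal{E}_1)$; $M_\theta f=\theta f$; $\theta$ is partially isometric if $M_\theta$ is a partial isometry. Given $\theta_j\in\mathcal{M}(A^2_1(\mathcal{E}_j),A^2_{m_j}(\mathcal{E}))$, the function $\Theta_j(\bm{z})=\theta_j(z_j)$ defines the multiplication operator $M_{\Theta_j}=\big(\bigotimes_{i\ne j}I_{A^2_{m_i}}\big)\otimes M_{\theta_j}:A^2_{\hat{\bm{m}}_j}(\mathcal{E}_j)\to A^2_{\bm{m}}(\mathcal{E})$. Operators. A tuple $\bm{T}=(T_1,\dots,T_n)$ of bounded operators is doubly commuting if $T_iT_j=T_jT_i$ for all $i,j$ and $T_iT_j^*=T_j^*T_i$ for $i\ne j$. A bounded operator $T$ is a $B_m$-contraction if $T^{*l}\to0$ strongly as $l\to\infty$ and $\sum_{k=0}^m(-1)^k\binom mkT^kT^{*k}\ge0$. For a polynomial $p(\bm{z},\bm{w})=\sum a_{\bm{p}\bm{q}}\bm{z}^{\bm{p}}\bar{\bm{w}}^{\bm{q}}$ and a commuting tuple $\bm{T}$, put $p(\bm{z},\bm{w})(\bm{T},\bm{T}^* )=\sum a_{\bm{p}\bm{q}}\bm{T}^{\bm{p}}\bm{T}^{*\bm{q}}$. A commuting tuple $\bm{T}$ is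 $B_{\bm{m}}$-contractive if each $T_i$ is a $B_{m_i}$-contraction and $B_{\bm{m}}^{-1}(\bm{z},\bm{w})(\bm{T},\bm{T}^* ):=\big(\prod_{i=1}^n(1-z_i\bar w_i)^{m_i}\big)(\bm{T},\bm{T}^* )\ge0$. Its defect operator is $D_{\bm{m},\bm{T}}=\big(B_{\bm{m}}^{-1}(\bm{z},\bm{w})(\bm{T},\bm{T}^* )\big)^{1/2}$ and its defect space is $\mathcal{D}_{\bm{m},\bm{T}}=\overline{\operatorname{ran}}\,D_{\bm{m},\bm{T}}$. *)

theory Defs
  imports "HOL-Analysis.Analysis" "HOL-Library.Function_Algebras" "HOL-Library.Poly_Mapping"
begin

class complex_vector = ab_group_add +
  fixes scaleC :: "complex \<Rightarrow> 'a \<Rightarrow> 'a"  (infixr \<open>*\<^sub>C\<close> 75)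
  assumes scaleC_add_right: "a *\<^sub>C (x + y) = a *\<^sub>C x + a *\<^sub>C y"
    and scaleC_add_left: "(a + b) *\<^sub>C x = a *\<^sub>C x + b *\<^sub>C x"
    and scaleC_scaleC: "a *\<^sub>C (b *\<^sub>C x) = (a * b) *\<^sub>C x"
    and scaleC_one: "1 *\<^sub>C x = x"

instantiation complex :: complex_vector
begin

definition scaleC_complex :: "complex \<Rightarrow> complex \<Rightarrow> complex"
  where "scaleC_complex c x = c * x"

instance
  by standard (simp_all add: scaleC_complex_def algebra_simps)

end

instantiation "fun" :: (type, complex_vector) complex_vector
begin

definition scaleC_fun :: "complex \<Rightarrow> ('a \<Rightarrow> 'b) \<Rightarrow> 'a \<Rightarrow> 'b"
  where "scaleC_fun c f = (\<lambda>x. c *\<^sub>C f x)"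

instance
  by standard
    (auto simp: scaleC_fun_def fun_eq_iff scaleC_add_right scaleC_add_left scaleC_scaleC scaleC_one)

end

text \<open>
  A Hilbert space consists of a complex linear subspace of some type of vectors together with an
  inner product, linear in its first argument. The inner product is only meaningful on the carrier.
  In this way subspaces, spaces of functions and existentially quantified Hilbert spaces are all
  objects of the same kind.
\<close>

record 'a hilbert =
  hcarrier :: "'a set"
  hinner :: "'a \<Rightarrow> 'a \<Rightarrow> complex"

definition hnorm :: "'a hilbert \<Rightarrow> 'a \<Rightarrow> real"
  where "hnorm H x = sqrt (Re (hinner H x x))"

text \<open>
  The value 0 outside the carrier is needed because the locale \<open>Metric_space\<close> of the library asks
  for nonnegativity and symmetry of the distance on the whole type.
\<close>

definition hdist :: "'a::complex_vector hilbert \<Rightarrow> 'a \<Rightarrow> 'a \<Rightarrow> real"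
  where "hdist H x y = (if x \<in> hcarrier H \<and> y \<in> hcarrier H then hnorm H (x - y) else 0)"

locale hilbert_space =
  fixes H :: "'a::complex_vector hilbert"
  assumes zero_mem: "0 \<in> hcarrier H"
    and add_mem: "\<lbrakk>x \<in> hcarrier H; y \<in> hcarrier H\<rbrakk> \<Longrightarrow> x + y \<in> hcarrier H"
    and scaleC_mem: "x \<in> hcarrier H \<Longrightarrow> c *\<^sub>C x \<in> hcarrier H"
    and inner_add: "\<lbrakk>x \<in> hcarrier H; y \<in> hcarrier H; z \<in> hcarrier H\<rbrakk>
          \<Longrightarrow> hinner H (x + y) z = hinner H x z + hinner H y z"
    and inner_scaleC: "\<lbrakk>x \<in> hcarrier H; y \<in> hcarrier H\<rbrakk>
          \<Longrightarrow> hinner H (c *\<^sub>C x) y = c * hinner H x y"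
    and inner_commute: "\<lbrakk>x \<in> hcarrier H; y \<in> hcarrier H\<rbrakk>
          \<Longrightarrow> hinner H x y = cnj (hinner H y x)"
    and inner_nonneg: "x \<in> hcarrier H \<Longrightarrow> 0 \<le> Re (hinner H x x)"
    and inner_eq_zero: "\<lbrakk>x \<in> hcarrier H; hinner H x x = 0\<rbrakk> \<Longrightarrow> x = 0"
    and complete: "Metric_space.mcomplete (hcarrier H) (hdist H)"

definition hclosure :: "'a::complex_vector hilbert \<Rightarrow> 'a set \<Rightarrow> 'a set"
  where "hclosure H S = Metric_space.mtopology (hcarrier H) (hdist H) closure_of S"

definition subspace_of :: "'a hilbert \<Rightarrow> 'a set \<Rightarrow> 'a hilbert"
  where "subspace_of H S = H\<lparr>hcarrier := S\<rparr>"

definition orth_compl :: "'a hilbert \<Rightarrow> 'a set \<Rightarrow> 'a set"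
  where "orth_compl H S = {x \<in> hcarrier H. \<forall>y\<in>S. hinner H x y = 0}"

definition orth_proj :: "'a::complex_vector hilbert \<Rightarrow> 'a set \<Rightarrow> 'a \<Rightarrow> 'a"
  where "orth_proj H S x = (THE y. y \<in> S \<and> x - y \<in> orth_compl H S)"

definition sum_of_subspaces :: "nat \<Rightarrow> (nat \<Rightarrow> 'a::comm_monoid_add set) \<Rightarrow> 'a set"
  where "sum_of_subspaces n S = {\<Sum>i\<in>{1..n}. g i | g. \<forall>i\<in>{1..n}. g i \<in> S i}"

text \<open>Operators are functions on the ambient types; only their values on the carrier matter.\<close>

definition bounded_operator ::
    "'a::complex_vector hilbert \<Rightarrow> 'b::complex_vector hilbert \<Rightarrow> ('a \<Rightarrow> 'b) \<Rightarrow> bool"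
  where "bounded_operator H K A \<longleftrightarrow>
    (\<forall>x\<in>hcarrier H. A x \<in> hcarrier K) \<and>
    (\<forall>x\<in>hcarrier H. \<forall>y\<in>hcarrier H. A (x + y) = A x + A y) \<and>
    (\<forall>c. \<forall>x\<in>hcarrier H. A (c *\<^sub>C x) = c *\<^sub>C A x) \<and>
    (\<exists>C. \<forall>x\<in>hcarrier H. hnorm K (A x) \<le> C * hnorm H x)"

definition adjoint :: "'a hilbert \<Rightarrow> 'b hilbert \<Rightarrow> ('a \<Rightarrow> 'b) \<Rightarrow> 'b \<Rightarrow> 'a"
  where "adjoint H K A y =
    (THE x. x \<in> hcarrier H \<and> (\<forall>u\<in>hcarrier H. hinner K (A u) y = hinner H u x))"

definition positive_operator :: "'a::complex_vector hilbert \<Rightarrow> ('a \<Rightarrow> 'a) \<Rightarrow> bool"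
  where "positive_operator H A \<longleftrightarrow>
    bounded_operator H H A \<and> (\<forall>x\<in>hcarrier H. hinner H (A x) x \<in> \<real>\<^sub>\<ge>\<^sub>0)"

text \<open>The positive square root is unique on the carrier.\<close>

definition operator_sqrt :: "'a::complex_vector hilbert \<Rightarrow> ('a \<Rightarrow> 'a) \<Rightarrow> 'a \<Rightarrow> 'a"
  where "operator_sqrt H A =
    (SOME B. positive_operator H B \<and> (\<forall>x\<in>hcarrier H. B (B x) = A x))"

definition partial_isometry ::
    "'a::complex_vector hilbert \<Rightarrow> 'b::complex_vector hilbert \<Rightarrow> ('a \<Rightarrow> 'b) \<Rightarrow> bool"
  where "partial_isometry H K V \<longleftrightarrow>
    bounded_operator H K V \<and>
    (\<forall>x \<in> orth_compl H {y \<in> hcarrier H. V y = 0}. hnorm K (V x) = hnorm H x)"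

definition unitary ::
    "'a::complex_vector hilbert \<Rightarrow> 'b::complex_vector hilbert \<Rightarrow> ('a \<Rightarrow> 'b) \<Rightarrow> bool"
  where "unitary H K U \<longleftrightarrow>
    bounded_operator H K U \<and> U ` hcarrier H = hcarrier K \<and>
    (\<forall>x\<in>hcarrier H. \<forall>y\<in>hcarrier H. hinner K (U x) (U y) = hinner H x y)"

definition hilbert_isomorphic ::
    "'a::complex_vector hilbert \<Rightarrow> 'b::complex_vector hilbert \<Rightarrow> bool"
  where "hilbert_isomorphic H K \<longleftrightarrow> (\<exists>U. unitary H K U)"

definition jointly_unitarily_equivalent ::
    "nat \<Rightarrow> 'a::complex_vector hilbert \<Rightarrow> (nat \<Rightarrow> 'a \<Rightarrow> 'a) \<Rightarrow>
     'b::complex_vector hilbert \<Rightarrow> (nat \<Rightarrow> 'b \<Rightarrow> 'b) \<Rightarrow> bool"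
  where "jointly_unitarily_equivalent n H T K S \<longleftrightarrow>
    (\<exists>U. unitary H K U \<and> (\<forall>i\<in>{1..n}. \<forall>x\<in>hcarrier H. U (T i x) = S i (U x)))"

definition commuting_tuple :: "nat \<Rightarrow> 'a::complex_vector hilbert \<Rightarrow> (nat \<Rightarrow> 'a \<Rightarrow> 'a) \<Rightarrow> bool"
  where "commuting_tuple n H T \<longleftrightarrow>
    (\<forall>i\<in>{1..n}. bounded_operator H H (T i)) \<and>
    (\<forall>i\<in>{1..n}. \<forall>j\<in>{1..n}. \<forall>x\<in>hcarrier H. T i (T j x) = T j (T i x))"

definition doubly_commuting :: "nat \<Rightarrow> 'a::complex_vector hilbert \<Rightarrow> (nat \<Rightarrow> 'a \<Rightarrow> 'a) \<Rightarrow> bool"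
  where "doubly_commuting n H T \<longleftrightarrow>
    commuting_tuple n H T \<and>
    (\<forall>i\<in>{1..n}. \<forall>j\<in>{1..n}. i \<noteq> j \<longrightarrow>
      (\<forall>x\<in>hcarrier H. T i (adjoint H H (T j) x) = adjoint H H (T j) (T i x)))"

definition B_contraction :: "'a::complex_vector hilbert \<Rightarrow> nat \<Rightarrow> ('a \<Rightarrow> 'a) \<Rightarrow> bool"
  where "B_contraction H m T \<longleftrightarrow>
    bounded_operator H H T \<and>
    (\<forall>x\<in>hcarrier H. (\<lambda>l. hnorm H ((adjoint H H T ^^ l) x)) \<longlonglongrightarrow> 0) \<and>
    positive_operator H
      (\<lambda>x. \<Sum>k\<le>m. ((- 1) ^ k * of_nat (m choose k)) *\<^sub>C (T ^^ k) ((adjoint H H T ^^ k) x))"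

text \<open>
  A polynomial in \<open>z\<close> and the conjugate of \<open>w\<close>: the key \<open>(p, q)\<close> carries the coefficient of the
  monomial with exponent \<open>p\<close> in \<open>z\<close> and exponent \<open>q\<close> in the conjugate of \<open>w\<close>.
\<close>

type_synonym hereditary_poly = "((nat \<Rightarrow>\<^sub>0 nat) \<times> (nat \<Rightarrow>\<^sub>0 nat)) \<Rightarrow>\<^sub>0 complex"

definition z_var :: "nat \<Rightarrow> hereditary_poly"
  where "z_var i = Poly_Mapping.single (Poly_Mapping.single i 1, 0) 1"

definition w_cnj_var :: "nat \<Rightarrow> hereditary_poly"
  where "w_cnj_var i = Poly_Mapping.single (0, Poly_Mapping.single i 1) 1"

definition tuple_power :: "nat \<Rightarrow> (nat \<Rightarrow> 'a \<Rightarrow> 'a) \<Rightarrow> (nat \<Rightarrow>\<^sub>0 nat) \<Rightarrow> 'a \<Rightarrow> 'a"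
  where "tuple_power n T p = foldr (\<lambda>i A. (T i ^^ Poly_Mapping.lookup p i) \<circ> A) [1..<Suc n] id"

definition hereditary_eval ::
    "nat \<Rightarrow> 'a::complex_vector hilbert \<Rightarrow> (nat \<Rightarrow> 'a \<Rightarrow> 'a) \<Rightarrow> hereditary_poly \<Rightarrow> 'a \<Rightarrow> 'a"
  where "hereditary_eval n H T P x =
    (\<Sum>(p, q) \<in> Poly_Mapping.keys P.
       Poly_Mapping.lookup P (p, q) *\<^sub>C
         tuple_power n T p (tuple_power n (\<lambda>i. adjoint H H (T i)) q x))"

definition inverse_kernel_poly :: "nat \<Rightarrow> (nat \<Rightarrow> nat) \<Rightarrow> hereditary_poly"
  where "inverse_kernel_poly n m = (\<Prod>i\<in>{1..n}. (1 - z_var i * w_cnj_var i) ^ m i)"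

definition B_contractive ::
    "nat \<Rightarrow> (nat \<Rightarrow> nat) \<Rightarrow> 'a::complex_vector hilbert \<Rightarrow> (nat \<Rightarrow> 'a \<Rightarrow> 'a) \<Rightarrow> bool"
  where "B_contractive n m H T \<longleftrightarrow>
    commuting_tuple n H T \<and>
    (\<forall>i\<in>{1..n}. B_contraction H (m i) (T i)) \<and>
    positive_operator H (hereditary_eval n H T (inverse_kernel_poly n m))"

definition defect_operator ::
    "nat \<Rightarrow> (nat \<Rightarrow> nat) \<Rightarrow> 'a::complex_vector hilbert \<Rightarrow> (nat \<Rightarrow> 'a \<Rightarrow> 'a) \<Rightarrow> 'a \<Rightarrow> 'a"
  where "defect_operator n m H T =
    operator_sqrt H (hereditary_eval n H T (inverse_kernel_poly n m))"

definition defect_space ::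
    "nat \<Rightarrow> (nat \<Rightarrow> nat) \<Rightarrow> 'a::complex_vector hilbert \<Rightarrow> (nat \<Rightarrow> 'a \<Rightarrow> 'a) \<Rightarrow> 'a hilbert"
  where "defect_space n m H T =
    subspace_of H (hclosure H (defect_operator n m H T ` hcarrier H))"

text \<open>
  \<open>R\<close> is the Hilbert space of \<open>E\<close>-valued functions on \<open>X\<close> whose reproducing kernel is the scalar
  kernel \<open>k\<close> times the identity of \<open>E\<close>. Functions on \<open>X\<close> are represented by functions that vanish
  outside \<open>X\<close>. By the Moore-Aronszajn theorem such a space exists for every positive semidefinite
  \<open>k\<close>, and its carrier and its inner product on the carrier are unique.
\<close>

definition is_rkhs ::
    "'x set \<Rightarrow> ('x \<Rightarrow> 'x \<Rightarrow> complex) \<Rightarrow> 'e::complex_vector hilbert \<Rightarrow> ('x \<Rightarrow> 'e) hilbert \<Rightarrow> bool"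
  where "is_rkhs X k E R \<longleftrightarrow>
    hilbert_space R \<and>
    (\<forall>f\<in>hcarrier R. (\<forall>z\<in>X. f z \<in> hcarrier E) \<and> (\<forall>z. z \<notin> X \<longrightarrow> f z = 0)) \<and>
    (\<forall>w\<in>X. \<forall>e\<in>hcarrier E.
      (\<lambda>z. if z \<in> X then k z w *\<^sub>C e else 0) \<in> hcarrier R \<and>
      (\<forall>f\<in>hcarrier R.
        hinner R f (\<lambda>z. if z \<in> X then k z w *\<^sub>C e else 0) = hinner E (f w) e))"

definition rkhs ::
    "'x set \<Rightarrow> ('x \<Rightarrow> 'x \<Rightarrow> complex) \<Rightarrow> 'e::complex_vector hilbert \<Rightarrow> ('x \<Rightarrow> 'e) hilbert"
  where "rkhs X k E = (SOME R. is_rkhs X k E R)"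

abbreviation unit_disc :: "complex set"
  where "unit_disc \<equiv> ball 0 1"

definition polydisc :: "nat \<Rightarrow> (nat \<Rightarrow> complex) set"
  where "polydisc n = (\<Pi>\<^sub>E i\<in>{1..n}. unit_disc)"

definition disc_kernel :: "nat \<Rightarrow> complex \<Rightarrow> complex \<Rightarrow> complex"
  where "disc_kernel m z w = 1 / (1 - z * cnj w) ^ m"

definition polydisc_kernel ::
    "nat \<Rightarrow> (nat \<Rightarrow> nat) \<Rightarrow> (nat \<Rightarrow> complex) \<Rightarrow> (nat \<Rightarrow> complex) \<Rightarrow> complex"
  where "polydisc_kernel n m z w = (\<Prod>i\<in>{1..n}. disc_kernel (m i) (z i) (w i))"

definition A2_disc :: "nat \<Rightarrow> 'e::complex_vector hilbert \<Rightarrow> (complex \<Rightarrow> 'e) hilbert"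
  where "A2_disc m E = rkhs unit_disc (disc_kernel m) E"

definition A2_polydisc ::
    "nat \<Rightarrow> (nat \<Rightarrow> nat) \<Rightarrow> 'e::complex_vector hilbert \<Rightarrow> ((nat \<Rightarrow> complex) \<Rightarrow> 'e) hilbert"
  where "A2_polydisc n m E = rkhs (polydisc n) (polydisc_kernel n m) E"

definition mult_operator ::
    "'x set \<Rightarrow> ('x \<Rightarrow> 'e \<Rightarrow> 'd::zero) \<Rightarrow> ('x \<Rightarrow> 'e) \<Rightarrow> 'x \<Rightarrow> 'd"
  where "mult_operator X \<theta> f = (\<lambda>z. if z \<in> X then \<theta> z (f z) else 0)"

definition mult_coordinate ::
    "nat \<Rightarrow> ((nat \<Rightarrow> complex) \<Rightarrow> 'e::complex_vector) \<Rightarrow> (nat \<Rightarrow> complex) \<Rightarrow> 'e"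
  where "mult_coordinate i f = (\<lambda>z. z i *\<^sub>C f z)"

text \<open>
  Holomorphy with respect to the operator norm: \<open>L\<close> is the derivative of \<open>\<theta>\<close> at \<open>z\<close>, and the
  last inequality bounds the operator norm of the remainder of the first-order expansion.
\<close>

definition operator_holomorphic_on ::
    "complex set \<Rightarrow> 'e::complex_vector hilbert \<Rightarrow> 'd::complex_vector hilbert \<Rightarrow>
     (complex \<Rightarrow> 'e \<Rightarrow> 'd) \<Rightarrow> bool"
  where "operator_holomorphic_on X E D \<theta> \<longleftrightarrow>
    (\<forall>z\<in>X. bounded_operator E D (\<theta> z)) \<and>
    (\<forall>z\<in>X. \<exists>L. bounded_operator E D L \<and>
      (\<forall>\<epsilon>>0. \<exists>\<delta>>0. \<forall>w\<in>X. dist w z < \<delta> \<longrightarrow>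
        (\<forall>x\<in>hcarrier E.
          hnorm D (\<theta> w x - \<theta> z x - (w - z) *\<^sub>C L x) \<le> \<epsilon> * dist w z * hnorm E x)))"

definition multipliers ::
    "nat \<Rightarrow> 'e::complex_vector hilbert \<Rightarrow> nat \<Rightarrow> 'd::complex_vector hilbert \<Rightarrow>
     (complex \<Rightarrow> 'e \<Rightarrow> 'd) set"
  where "multipliers p E q D =
    {\<theta>. operator_holomorphic_on unit_disc E D \<theta> \<and>
        (\<forall>f\<in>hcarrier (A2_disc p E). mult_operator unit_disc \<theta> f \<in> hcarrier (A2_disc q D))}"

definition partially_isometric_multiplier ::
    "nat \<Rightarrow> 'e::complex_vector hilbert \<Rightarrow> nat \<Rightarrow> 'd::complex_vector hilbert \<Rightarrow>
     (complex \<Rightarrow> 'e \<Rightarrow> 'd) \<Rightarrow> bool"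
  where "partially_isometric_multiplier p E q D \<theta> \<longleftrightarrow>
    \<theta> \<in> multipliers p E q D \<and>
    partial_isometry (A2_disc p E) (A2_disc q D) (mult_operator unit_disc \<theta>)"

definition quotient_space ::
    "nat \<Rightarrow> (nat \<Rightarrow> nat) \<Rightarrow> 'd::complex_vector hilbert \<Rightarrow> (nat \<Rightarrow> 'e::complex_vector hilbert) \<Rightarrow>
     (nat \<Rightarrow> complex \<Rightarrow> 'e \<Rightarrow> 'd) \<Rightarrow> ((nat \<Rightarrow> complex) \<Rightarrow> 'd) hilbert"
  where "quotient_space n m D E \<theta> =
    subspace_of (A2_polydisc n m D)
      (orth_compl (A2_polydisc n m D)
        (sum_of_subspaces n
          (\<lambda>i. mult_operator (polydisc n) (\<lambda>z. \<theta> i (z i)) `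
                 hcarrier (A2_polydisc n (m(i := 1)) (E i)))))"

definition compressed_shift ::
    "nat \<Rightarrow> (nat \<Rightarrow> nat) \<Rightarrow> 'd::complex_vector hilbert \<Rightarrow> ((nat \<Rightarrow> complex) \<Rightarrow> 'd) set \<Rightarrow>
     nat \<Rightarrow> ((nat \<Rightarrow> complex) \<Rightarrow> 'd) \<Rightarrow> (nat \<Rightarrow> complex) \<Rightarrow> 'd"
  where "compressed_shift n m D Q i f = orth_proj (A2_polydisc n m D) Q (mult_coordinate i f)"

end

theory Submission
  imports Defs
begin

text \<open>
  Write \<open>T\<^sub>k\<^sup>*\<close> for the adjoint of \<open>T\<^sub>k\<close> and \<open>\<Delta>\<^sub>k = \<Sum>\<^sub>j (-1)\<^sup>j \<open>binom\<close>(m\<^sub>k, j) T\<^sub>k\<^sup>j T\<^sub>k\<^sup>*\<^sup>j\<close>. Let \<open>c\<^sub>q\<close> be the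
  coefficients of \<open>(1 - x)\<^bsup>-m\<^sub>k\<^esup>\<close>. For one operator, the purity of \<open>T\<^sub>k\<close> and the positivity of \<open>\<Delta>\<^sub>k\<close>
  give the resolution of the identity \<open>\<Sum>\<^sub>q c\<^sub>q T\<^sub>k\<^sup>q \<Delta>\<^sub>k T\<^sub>k\<^sup>*\<^sup>q = I\<close> (\<open>hypercontraction_resolution\<close>). By
  double commutativity \<open>\<Delta>\<^sub>k\<close> commutes with \<open>T\<^sub>j\<close> and \<open>T\<^sub>j\<^sup>*\<close> for \<open>j \<noteq> k\<close>. Hence the square of the defect
  operator \<open>B\<close> of the tuple is the product of all \<open>\<Delta>\<^sub>k\<close> (\<open>hereditary_eval_inverse_kernel\<close>), and the
  resolutions can be iterated over the variables (\<open>joint_resolution\<close>). In other words,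
  \<open>V h = B \<Prod>\<^sub>k (1 - z\<^sub>k T\<^sub>k\<^sup>*)\<^bsup>-m\<^sub>k\<^esup> h\<close> is an isometry from \<open>H\<close> into the space of the defect space on the
  polydisc. It intertwines \<open>T\<^sub>k\<^sup>*\<close> with the adjoint of \<open>M\<^bsub>z\<^sub>k\<^esub>\<close> (\<open>V_shift\<close>), so \<open>T\<close> is unitarily equivalent
  to the compression of the multiplications to the range of \<open>V\<close>.

  It remains to describe the orthogonal complement of this range. For each \<open>k\<close> let \<open>Q\<^sub>k\<close> be the closure
  of the set of all functions \<open>B (1 - z T\<^sub>k\<^sup>*)\<^bsup>-m\<^sub>k\<^esup> h\<close> of one variable. Its complement is invariant under
  multiplication by \<open>z\<close>, so by the Beurling theorem for the weighted spaces
  (\<open>invariant_subspace_multiplier\<close>) it is the range of a partially isometric multiplier \<open>\<theta>\<^sub>k\<close> on a Hardy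
  space. A function on the polydisc is orthogonal to the range of \<open>\<Theta>\<^sub>k\<close> if and only if all its slices in
  the \<open>k\<close>-th variable lie in \<open>Q\<^sub>k\<close> (\<open>orth_variable_multiplier_iff\<close>). The range of \<open>V\<close> has this property
  for all \<open>k\<close>, and the point is the converse (\<open>model_coeffs_eq\<close>). Since the square of \<open>B\<close> is \<open>\<Delta>\<^sub>k\<close> times
  an operator that commutes with \<open>T\<^sub>k\<close>, the projection of \<open>z\<^sup>q B y\<close> onto \<open>Q\<^sub>k\<close> is
  \<open>B (1 - z T\<^sub>k\<^sup>*)\<^bsup>-m\<^sub>k\<^esup> T\<^sub>k\<^sup>q \<Delta>\<^sub>k y\<close> (\<open>annihilator_orth_component\<close>). Applied to one variable after the
  other, this replaces the inner product of a function of the joint model with a monomial \<open>z\<^sup>p B y\<close> by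
  its inner product with a vector of the range of \<open>V\<close> (\<open>tail_expansion\<close>). So a function of the joint
  model that is orthogonal to this range vanishes.

  All function spaces are handled through the square-summable families of their power series
  coefficients. This is justified because a reproducing kernel space is determined by its kernel
  (\<open>is_rkhs_unique\<close>): whatever space with this kernel is chosen, it is the space of power series.
\<close>


interpretation cvec: vector_space "scaleC :: complex \<Rightarrow> 'a::complex_vector \<Rightarrow> 'a"
  by standard (simp_all add: scaleC_add_right scaleC_add_left scaleC_scaleC scaleC_one)

section \<open>Hilbert spaces on carriers\<close>

lemma quadratic_nonneg_imp_linear_zero:
  fixes a b :: real
  assumes "\<And>t. 0 \<le> t\<^sup>2 * a + 2 * t * b"
  shows "b = 0"
proof (rule ccontr)
  assume b: "b \<noteq> 0"
  define d where "d = \<bar>a\<bar> + 1"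
  have d: "d > 0" "a \<le> d - 1" by (auto simp: d_def)
  have "0 \<le> (- b / d)\<^sup>2 * a + 2 * (- b / d) * b" by (rule assms)
  also have "\<dots> = (b\<^sup>2 / d\<^sup>2) * (a - 2 * d)"
    using d by (simp add: field_simps power2_eq_square)
  also have "\<dots> < 0"
    using b d by (intro mult_pos_neg) (auto simp: divide_pos_pos)
  finally show False by simp
qed

text \<open>
  The algebraic part of \<^locale>\<open>hilbert_space\<close>. It is separate because the completeness of a space of
  families or of functions is shown after its norm has been studied.
\<close>

locale pre_hilbert =
  fixes H :: "'a::complex_vector hilbert"
  assumes zero_mem [simp]: "0 \<in> hcarrier H"
    and add_mem [simp]: "\<lbrakk>x \<in> hcarrier H; y \<in> hcarrier H\<rbrakk> \<Longrightarrow> x + y \<in> hcarrier H"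
    and scaleC_mem [simp]: "x \<in> hcarrier H \<Longrightarrow> c *\<^sub>C x \<in> hcarrier H"
    and inner_add_left: "\<lbrakk>x \<in> hcarrier H; y \<in> hcarrier H; z \<in> hcarrier H\<rbrakk>
          \<Longrightarrow> hinner H (x + y) z = hinner H x z + hinner H y z"
    and inner_scaleC_left: "\<lbrakk>x \<in> hcarrier H; y \<in> hcarrier H\<rbrakk>
          \<Longrightarrow> hinner H (c *\<^sub>C x) y = c * hinner H x y"
    and inner_commute: "\<lbrakk>x \<in> hcarrier H; y \<in> hcarrier H\<rbrakk>
          \<Longrightarrow> hinner H x y = cnj (hinner H y x)"
    and inner_nonneg: "x \<in> hcarrier H \<Longrightarrow> 0 \<le> Re (hinner H x x)"
    and inner_eq_zero: "\<lbrakk>x \<in> hcarrier H; hinner H x x = 0\<rbrakk> \<Longrightarrow> x = 0"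
begin

lemma uminus_mem [simp]: "x \<in> hcarrier H \<Longrightarrow> - x \<in> hcarrier H"
  using scaleC_mem[of x "- 1"] by simp

lemma diff_mem [simp]: "\<lbrakk>x \<in> hcarrier H; y \<in> hcarrier H\<rbrakk> \<Longrightarrow> x - y \<in> hcarrier H"
  using add_mem[of x "- y"] by simp

lemma sum_mem [simp]: "(\<And>i. i \<in> A \<Longrightarrow> f i \<in> hcarrier H) \<Longrightarrow> sum f A \<in> hcarrier H"
  by (induction A rule: infinite_finite_induct) auto

lemma inner_add_right:
  "\<lbrakk>x \<in> hcarrier H; y \<in> hcarrier H; z \<in> hcarrier H\<rbrakk>
    \<Longrightarrow> hinner H x (y + z) = hinner H x y + hinner H x z"
  by (metis add_mem complex_cnj_add inner_add_left inner_commute)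

lemma inner_scaleC_right:
  "\<lbrakk>x \<in> hcarrier H; y \<in> hcarrier H\<rbrakk> \<Longrightarrow> hinner H x (c *\<^sub>C y) = cnj c * hinner H x y"
  by (metis complex_cnj_mult inner_commute inner_scaleC_left scaleC_mem)

lemma inner_zero_left [simp]: "x \<in> hcarrier H \<Longrightarrow> hinner H 0 x = 0"
  using inner_scaleC_left[of 0 x 0] by simp

lemma inner_zero_right [simp]: "x \<in> hcarrier H \<Longrightarrow> hinner H x 0 = 0"
  using inner_scaleC_right[of x 0 0] by simp

lemma inner_uminus_left:
  "\<lbrakk>x \<in> hcarrier H; y \<in> hcarrier H\<rbrakk> \<Longrightarrow> hinner H (- x) y = - hinner H x y"
  using inner_scaleC_left[of x y "- 1"] by simp

lemma inner_uminus_right: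
  "\<lbrakk>x \<in> hcarrier H; y \<in> hcarrier H\<rbrakk> \<Longrightarrow> hinner H x (- y) = - hinner H x y"
  using inner_scaleC_right[of x y "- 1"] by simp

lemma inner_diff_left:
  "\<lbrakk>x \<in> hcarrier H; y \<in> hcarrier H; z \<in> hcarrier H\<rbrakk>
    \<Longrightarrow> hinner H (x - y) z = hinner H x z - hinner H y z"
  using inner_add_left[of x "- y" z] by (simp add: inner_uminus_left)

lemma inner_diff_right:
  "\<lbrakk>x \<in> hcarrier H; y \<in> hcarrier H; z \<in> hcarrier H\<rbrakk>
    \<Longrightarrow> hinner H x (y - z) = hinner H x y - hinner H x z"
  using inner_add_right[of x y "- z"] by (simp add: inner_uminus_right)

lemma inner_sum_left:
  "\<lbrakk>\<And>i. i \<in> A \<Longrightarrow> f i \<in> hcarrier H; y \<in> hcarrier H\<rbrakk>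
    \<Longrightarrow> hinner H (sum f A) y = (\<Sum>i\<in>A. hinner H (f i) y)"
  by (induction A rule: infinite_finite_induct) (auto simp: inner_add_left)

lemma inner_sum_right:
  "\<lbrakk>\<And>i. i \<in> A \<Longrightarrow> f i \<in> hcarrier H; y \<in> hcarrier H\<rbrakk>
    \<Longrightarrow> hinner H y (sum f A) = (\<Sum>i\<in>A. hinner H y (f i))"
  by (induction A rule: infinite_finite_induct) (auto simp: inner_add_right)

lemmas inner_simps = inner_add_left inner_add_right inner_diff_left inner_diff_right
  inner_scaleC_left inner_scaleC_right inner_uminus_left inner_uminus_right

lemma hnorm_sq: "x \<in> hcarrier H \<Longrightarrow> (hnorm H x)\<^sup>2 = Re (hinner H x x)"
  by (simp add: hnorm_def inner_nonneg)

lemma hnorm_nonneg [simp]: "x \<in> hcarrier H \<Longrightarrow> 0 \<le> hnorm H x"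
  by (simp add: hnorm_def inner_nonneg)

lemma inner_self_Im [simp]: "x \<in> hcarrier H \<Longrightarrow> Im (hinner H x x) = 0"
  using inner_commute[of x x] by (auto simp: complex_eq_iff)

lemma inner_self: "x \<in> hcarrier H \<Longrightarrow> hinner H x x = complex_of_real ((hnorm H x)\<^sup>2)"
  by (simp add: complex_eq_iff hnorm_sq del: of_real_power)

lemma hnorm_eq_0 [simp]: "x \<in> hcarrier H \<Longrightarrow> hnorm H x = 0 \<longleftrightarrow> x = 0"
  using inner_self[of x] inner_eq_zero[of x] by (auto simp: hnorm_def)

lemma hnorm_zero [simp]: "hnorm H 0 = 0"
  by simp

lemma hnorm_scaleC: "x \<in> hcarrier H \<Longrightarrow> hnorm H (c *\<^sub>C x) = cmod c * hnorm H x"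
proof -
  assume x: "x \<in> hcarrier H"
  have "(hnorm H (c *\<^sub>C x))\<^sup>2 = Re (c * cnj c * hinner H x x)"
    using x by (simp add: hnorm_sq inner_simps mult.assoc)
  also have "\<dots> = (cmod c * hnorm H x)\<^sup>2"
    using x by (simp add: inner_self complex_norm_square[symmetric] power_mult_distrib
        flip: of_real_power of_real_mult)
  finally show ?thesis
    using x by (simp add: power2_eq_iff_nonneg)
qed

lemma hnorm_uminus: "x \<in> hcarrier H \<Longrightarrow> hnorm H (- x) = hnorm H x"
  using hnorm_scaleC[of x "- 1"] by simp

lemma hnorm_minus_commute:
  "\<lbrakk>x \<in> hcarrier H; y \<in> hcarrier H\<rbrakk> \<Longrightarrow> hnorm H (x - y) = hnorm H (y - x)"
  using hnorm_uminus[of "x - y"] by simp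

lemma hnorm_add_sq:
  "\<lbrakk>x \<in> hcarrier H; y \<in> hcarrier H\<rbrakk>
    \<Longrightarrow> (hnorm H (x + y))\<^sup>2 = (hnorm H x)\<^sup>2 + 2 * Re (hinner H x y) + (hnorm H y)\<^sup>2"
  using inner_commute[of y x] by (simp add: hnorm_sq inner_simps)

lemma hnorm_diff_sq:
  "\<lbrakk>x \<in> hcarrier H; y \<in> hcarrier H\<rbrakk>
    \<Longrightarrow> (hnorm H (x - y))\<^sup>2 = (hnorm H x)\<^sup>2 - 2 * Re (hinner H x y) + (hnorm H y)\<^sup>2"
  using inner_commute[of y x] by (simp add: hnorm_sq inner_simps)

lemma inner_real_imp_hermitian:
  assumes A: "\<And>x. x \<in> hcarrier H \<Longrightarrow> A x \<in> hcarrier H"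
    "\<And>x y. \<lbrakk>x \<in> hcarrier H; y \<in> hcarrier H\<rbrakk> \<Longrightarrow> A (x + y) = A x + A y"
    "\<And>c x. x \<in> hcarrier H \<Longrightarrow> A (c *\<^sub>C x) = c *\<^sub>C A x"
    and real: "\<And>x. x \<in> hcarrier H \<Longrightarrow> Im (hinner H (A x) x) = 0"
    and x: "x \<in> hcarrier H" and y: "y \<in> hcarrier H"
  shows "hinner H (A x) y = hinner H x (A y)"
proof -
  define p q where "p = hinner H (A x) y" and "q = hinner H (A y) x"
  have "Im (hinner H (A (x + y)) (x + y)) = Im (p + q)"
    using x y real[of x] real[of y] by (simp add: A inner_simps p_def q_def)
  then have 1: "Im (p + q) = 0" using real[of "x + y"] x y by simp
  have "Im (hinner H (A (x + \<i> *\<^sub>C y)) (x + \<i> *\<^sub>C y)) = Im (- \<i> * p + \<i> * q)"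
    using x y real[of x] real[of y] by (simp add: A inner_simps p_def q_def)
  then have 2: "Im (- \<i> * p + \<i> * q) = 0" using real[of "x + \<i> *\<^sub>C y"] x y by simp
  have "p = cnj q" using 1 2 by (simp add: complex_eq_iff)
  then show ?thesis using inner_commute[of x "A y"] x y A by (simp add: p_def q_def)
qed

text \<open>
  Stated for the possibly degenerate form of a positive operator, because the construction of square
  roots compares \<open>A\<^sup>2\<close> with \<open>A\<close>. The inequality for the inner product itself is the case of the identity.
\<close>

lemma positive_Cauchy_Schwarz:
  assumes A: "\<And>x. x \<in> hcarrier H \<Longrightarrow> A x \<in> hcarrier H"
    "\<And>x y. \<lbrakk>x \<in> hcarrier H; y \<in> hcarrier H\<rbrakk> \<Longrightarrow> A (x + y) = A x + A y"
    "\<And>c x. x \<in> hcarrier H \<Longrightarrow> A (c *\<^sub>C x) = c *\<^sub>C A x"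
    and pos: "\<And>x. x \<in> hcarrier H \<Longrightarrow> hinner H (A x) x \<in> \<real>\<^sub>\<ge>\<^sub>0"
    and x: "x \<in> hcarrier H" and y: "y \<in> hcarrier H"
  shows "(cmod (hinner H (A x) y))\<^sup>2 \<le> Re (hinner H (A x) x) * Re (hinner H (A y) y)"
proof -
  have real: "Im (hinner H (A u) u) = 0" "0 \<le> Re (hinner H (A u) u)" if "u \<in> hcarrier H" for u
    using pos[OF that] by (auto simp: complex_nonneg_Reals_iff)
  define p where "p = hinner H (A x) y"
  define a b d where "a = Re (hinner H (A x) x)" and "b = (cmod p)\<^sup>2"
    and "d = Re (hinner H (A y) y)"
  have q: "hinner H (A y) x = cnj p"
    using inner_real_imp_hermitian[OF A real(1) y x] inner_commute[of y "A x"] x y A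
    by (simp add: p_def)
  have key: "0 \<le> a - 2 * t * b + t\<^sup>2 * b * d" for t :: real
  proof -
    define c where "c = - complex_of_real t * p"
    have "Re (hinner H (A (x + c *\<^sub>C y)) (x + c *\<^sub>C y))
        = a + Re (cnj c * p) + Re (c * cnj p) + Re (c * cnj c * hinner H (A y) y)"
      using x y q by (simp add: A inner_simps p_def a_def algebra_simps)
    also have "cnj c * p = of_real (- t * b)"
      using complex_norm_square[of p] by (simp add: c_def b_def mult.commute mult.left_commute)
    also have "c * cnj p = of_real (- t * b)"
      using complex_norm_square[of p] by (simp add: c_def b_def)
    also have "c * cnj c = of_real (t\<^sup>2 * b)"
      using complex_norm_square[of p] by (simp add: c_def b_def power2_eq_square mult_ac)
    finally have "Re (hinner H (A (x + c *\<^sub>C y)) (x + c *\<^sub>C y)) = a - 2 * t * b + t\<^sup>2 * b * d"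
      by (simp add: d_def)
    then show ?thesis using real(2)[of "x + c *\<^sub>C y"] x y by simp
  qed
  have d0: "d \<ge> 0" "a \<ge> 0" using real x y by (auto simp: d_def a_def)
  have b0: "b \<ge> 0" by (simp add: b_def)
  have "b \<le> a * d"
  proof (cases "d = 0")
    case True
    have "b = 0"
    proof (rule ccontr)
      assume "b \<noteq> 0"
      then have "b > 0" using b0 by simp
      have "0 \<le> a - 2 * (a / b + 1) * b" using key[of "a / b + 1"] True by simp
      also have "\<dots> = - a - 2 * b" using \<open>b > 0\<close> by (simp add: field_simps)
      finally show False using \<open>b > 0\<close> d0 by simp
    qed
    then show ?thesis using True by simp
  next
    case False
    then have "d > 0" using d0 by simp
    have "0 \<le> a - b / d" using key[of "1 / d"] \<open>d > 0\<close> by (simp add: power2_eq_square)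
    then show ?thesis using \<open>d > 0\<close> by (simp add: field_simps)
  qed
  then show ?thesis by (simp add: a_def b_def d_def p_def)
qed

lemma Cauchy_Schwarz:
  assumes "x \<in> hcarrier H" "y \<in> hcarrier H"
  shows "cmod (hinner H x y) \<le> hnorm H x * hnorm H y"
proof -
  have "(cmod (hinner H x y))\<^sup>2 \<le> (hnorm H x * hnorm H y)\<^sup>2"
    using positive_Cauchy_Schwarz[of "\<lambda>x. x" x y] assms
    by (simp add: complex_nonneg_Reals_iff inner_nonneg hnorm_sq power_mult_distrib)
  then show ?thesis using assms by (simp add: power2_le_iff_abs_le)
qed

lemma hnorm_triangle:
  assumes "x \<in> hcarrier H" "y \<in> hcarrier H"
  shows "hnorm H (x + y) \<le> hnorm H x + hnorm H y"
proof -
  have "Re (hinner H x y) \<le> hnorm H x * hnorm H y"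
    using Cauchy_Schwarz[OF assms] complex_Re_le_cmod order_trans by blast
  then have "(hnorm H (x + y))\<^sup>2 \<le> (hnorm H x + hnorm H y)\<^sup>2"
    using assms by (simp add: hnorm_add_sq power2_sum)
  then show ?thesis using assms by (simp add: power2_le_iff_abs_le)
qed

lemma hnorm_triangle_diff:
  assumes "x \<in> hcarrier H" "y \<in> hcarrier H" "z \<in> hcarrier H"
  shows "hnorm H (x - z) \<le> hnorm H (x - y) + hnorm H (y - z)"
  using hnorm_triangle[of "x - y" "y - z"] assms by simp

lemma eq_if_inner_eq:
  assumes "x \<in> hcarrier H" "y \<in> hcarrier H"
    and "\<And>u. u \<in> hcarrier H \<Longrightarrow> hinner H x u = hinner H y u"
  shows "x = y"
  using inner_eq_zero[of "x - y"] assms by (simp add: inner_simps)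

lemma eq_if_inner_eq_right:
  assumes "x \<in> hcarrier H" "y \<in> hcarrier H"
    and "\<And>u. u \<in> hcarrier H \<Longrightarrow> hinner H u x = hinner H u y"
  shows "x = y"
  using inner_eq_zero[of "x - y"] assms by (simp add: inner_simps)

lemma metric: "Metric_space (hcarrier H) (hdist H)"
proof
  fix x y z
  show "0 \<le> hdist H x y" by (simp add: hdist_def)
  show "hdist H x y = hdist H y x" by (auto simp: hdist_def hnorm_minus_commute)
  show "x \<in> hcarrier H \<Longrightarrow> y \<in> hcarrier H \<Longrightarrow> (hdist H x y = 0) = (x = y)"
    by (simp add: hdist_def)
  show "x \<in> hcarrier H \<Longrightarrow> y \<in> hcarrier H \<Longrightarrow> z \<in> hcarrier H
    \<Longrightarrow> hdist H x z \<le> hdist H x y + hdist H y z"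
    by (simp add: hdist_def hnorm_triangle_diff)
qed

end

definition converges_in :: "'a::complex_vector hilbert \<Rightarrow> (nat \<Rightarrow> 'a) \<Rightarrow> 'a \<Rightarrow> bool"
  where "converges_in H s x \<longleftrightarrow>
    x \<in> hcarrier H \<and> (\<forall>n. s n \<in> hcarrier H) \<and> (\<lambda>n. hnorm H (s n - x)) \<longlonglongrightarrow> 0"

definition cauchy_in :: "'a::complex_vector hilbert \<Rightarrow> (nat \<Rightarrow> 'a) \<Rightarrow> bool"
  where "cauchy_in H s \<longleftrightarrow>
    (\<forall>n. s n \<in> hcarrier H) \<and> (\<forall>\<epsilon>>0. \<exists>N. \<forall>m\<ge>N. \<forall>n\<ge>N. hnorm H (s m - s n) < \<epsilon>)"

context pre_hilbert
begin

lemma converges_inner: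
  assumes "converges_in H s x" "converges_in H t y"
  shows "(\<lambda>n. hinner H (s n) (t n)) \<longlonglongrightarrow> hinner H x y"
proof -
  have m: "x \<in> hcarrier H" "y \<in> hcarrier H" "s n \<in> hcarrier H" "t n \<in> hcarrier H" for n
    using assms by (auto simp: converges_in_def)
  have lim: "(\<lambda>n. hnorm H (s n - x)) \<longlonglongrightarrow> 0" "(\<lambda>n. hnorm H (t n - y)) \<longlonglongrightarrow> 0"
    using assms by (auto simp: converges_in_def)
  have "(\<lambda>n. hnorm H (s n - x) * hnorm H (t n - y) + hnorm H (s n - x) * hnorm H y
      + hnorm H x * hnorm H (t n - y)) \<longlonglongrightarrow> 0 * 0 + 0 * hnorm H y + hnorm H x * 0"
    by (intro tendsto_intros lim)
  then have *: "(\<lambda>n. hnorm H (s n - x) * hnorm H (t n - y) + hnorm H (s n - x) * hnorm H y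
      + hnorm H x * hnorm H (t n - y)) \<longlonglongrightarrow> 0" by simp
  have "(\<lambda>n. hinner H (s n) (t n) - hinner H x y) \<longlonglongrightarrow> 0"
  proof (rule Lim_null_comparison[OF _ *], rule always_eventually, rule allI)
    fix n
    have "hinner H (s n) (t n) - hinner H x y
        = hinner H (s n - x) (t n - y) + hinner H (s n - x) y + hinner H x (t n - y)"
      using m by (simp add: inner_simps)
    also have "norm \<dots> \<le> hnorm H (s n - x) * hnorm H (t n - y) + hnorm H (s n - x) * hnorm H y
      + hnorm H x * hnorm H (t n - y)"
      using m by (intro norm_triangle_mono Cauchy_Schwarz) auto
    finally show "norm (hinner H (s n) (t n) - hinner H x y) \<le>
      hnorm H (s n - x) * hnorm H (t n - y) + hnorm H (s n - x) * hnorm H y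
      + hnorm H x * hnorm H (t n - y)" .
  qed
  then show ?thesis by (simp add: LIM_zero_iff)
qed

lemma converges_const: "x \<in> hcarrier H \<Longrightarrow> converges_in H (\<lambda>_. x) x"
  by (simp add: converges_in_def)

lemma converges_hnorm:
  assumes "converges_in H s x"
  shows "(\<lambda>n. hnorm H (s n)) \<longlonglongrightarrow> hnorm H x"
  using converges_inner[OF assms assms] unfolding hnorm_def
  by (intro tendsto_intros)

lemma converges_add:
  assumes "converges_in H s x" "converges_in H t y"
  shows "converges_in H (\<lambda>n. s n + t n) (x + y)"
proof -
  have m: "x \<in> hcarrier H" "y \<in> hcarrier H" "s n \<in> hcarrier H" "t n \<in> hcarrier H" for n
    using assms by (auto simp: converges_in_def)
  have lim: "(\<lambda>n. hnorm H (s n - x)) \<longlonglongrightarrow> 0" "(\<lambda>n. hnorm H (t n - y)) \<longlonglongrightarrow> 0"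
    using assms by (auto simp: converges_in_def)
  have *: "(\<lambda>n. hnorm H (s n - x) + hnorm H (t n - y)) \<longlonglongrightarrow> 0"
    using tendsto_add[OF lim] by simp
  have "(\<lambda>n. hnorm H (s n + t n - (x + y))) \<longlonglongrightarrow> 0"
  proof (rule Lim_null_comparison[OF _ *], rule always_eventually, rule allI)
    fix n
    show "norm (hnorm H (s n + t n - (x + y))) \<le> hnorm H (s n - x) + hnorm H (t n - y)"
      using hnorm_triangle[of "s n - x" "t n - y"] m by (simp add: add_diff_add)
  qed
  then show ?thesis using m by (simp add: converges_in_def)
qed

lemma converges_scaleC:
  assumes "converges_in H s x"
  shows "converges_in H (\<lambda>n. c *\<^sub>C s n) (c *\<^sub>C x)"
proof -
  have "(\<lambda>n. cmod c * hnorm H (s n - x)) \<longlonglongrightarrow> cmod c * 0"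
    using assms by (intro tendsto_intros) (auto simp: converges_in_def)
  moreover have "hnorm H (c *\<^sub>C s n - c *\<^sub>C x) = cmod c * hnorm H (s n - x)" for n
    using assms hnorm_scaleC[of "s n - x" c]
    by (simp add: converges_in_def cvec.scale_right_diff_distrib)
  ultimately show ?thesis using assms by (simp add: converges_in_def)
qed

lemma converges_unique:
  assumes "converges_in H s x" "converges_in H s y"
  shows "x = y"
proof (rule eq_if_inner_eq)
  show "x \<in> hcarrier H" "y \<in> hcarrier H" using assms by (auto simp: converges_in_def)
  fix u assume "u \<in> hcarrier H"
  then have "(\<lambda>n. hinner H (s n) u) \<longlonglongrightarrow> hinner H x u" "(\<lambda>n. hinner H (s n) u) \<longlonglongrightarrow> hinner H y u"
    using assms by (auto intro!: converges_inner converges_const)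
  then show "hinner H x u = hinner H y u" by (rule LIMSEQ_unique)
qed

lemma converges_imp_cauchy:
  assumes "converges_in H s x"
  shows "cauchy_in H s"
  unfolding cauchy_in_def
proof (intro conjI allI impI)
  fix \<epsilon> :: real assume "\<epsilon> > 0"
  then have "\<forall>\<^sub>F n in sequentially. hnorm H (s n - x) < \<epsilon> / 2"
    using assms unfolding converges_in_def by (intro order_tendstoD) auto
  then obtain N where N: "\<And>n. n \<ge> N \<Longrightarrow> hnorm H (s n - x) < \<epsilon> / 2"
    by (auto simp: eventually_sequentially)
  have m: "x \<in> hcarrier H" "s n \<in> hcarrier H" for n using assms by (auto simp: converges_in_def)
  show "\<exists>N. \<forall>m\<ge>N. \<forall>n\<ge>N. hnorm H (s m - s n) < \<epsilon>"
  proof (intro exI allI impI)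
    fix m n assume "m \<ge> N" "n \<ge> N"
    then show "hnorm H (s m - s n) < \<epsilon>"
      using hnorm_triangle_diff[of "s m" x "s n"] N[of m] N[of n] hnorm_minus_commute[of x "s n"] m
      by simp
  qed
qed (use assms in \<open>auto simp: converges_in_def\<close>)

lemma mcomplete_iff:
  "Metric_space.mcomplete (hcarrier H) (hdist H) \<longleftrightarrow>
    (\<forall>s. cauchy_in H s \<longrightarrow> (\<exists>x. converges_in H s x))"
proof -
  interpret M: Metric_space "hcarrier H" "hdist H" by (rule metric)
  have C: "M.MCauchy s \<longleftrightarrow> cauchy_in H s" for s
    unfolding M.MCauchy_def cauchy_in_def by (auto simp: hdist_def image_subset_iff)
  have L: "limitin M.mtopology s x sequentially \<longleftrightarrow> converges_in H s x"
    if s: "\<And>n. s n \<in> hcarrier H" for s x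
    unfolding M.limit_metric_sequentially converges_in_def LIMSEQ_def
    using s by (auto simp: hdist_def cong: conj_cong)
  show ?thesis
    unfolding M.mcomplete_def C using L by (metis cauchy_in_def)
qed

lemma hilbert_spaceI:
  assumes "\<And>s. cauchy_in H s \<Longrightarrow> \<exists>x. converges_in H s x"
  shows "hilbert_space H"
  by unfold_locales
    (use assms in \<open>auto simp: mcomplete_iff inner_simps inner_nonneg intro: inner_commute inner_eq_zero\<close>)

end

sublocale hilbert_space \<subseteq> pre_hilbert
  by unfold_locales
    (auto intro: zero_mem add_mem scaleC_mem inner_add inner_scaleC inner_commute inner_nonneg inner_eq_zero)

lemma (in hilbert_space) cauchy_converges: "cauchy_in H s \<Longrightarrow> \<exists>x. converges_in H s x"
  using complete mcomplete_iff by blast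

section \<open>Closed subspaces, the Riesz representation and adjoints\<close>

definition closed_subspace :: "'a::complex_vector hilbert \<Rightarrow> 'a set \<Rightarrow> bool"
  where "closed_subspace H S \<longleftrightarrow>
    S \<subseteq> hcarrier H \<and> 0 \<in> S \<and> (\<forall>x\<in>S. \<forall>y\<in>S. x + y \<in> S) \<and> (\<forall>c. \<forall>x\<in>S. c *\<^sub>C x \<in> S) \<and>
    (\<forall>s x. (\<forall>n. s n \<in> S) \<and> converges_in H s x \<longrightarrow> x \<in> S)"

lemma subspace_of_simps [simp]:
  "hcarrier (subspace_of H S) = S"
  "hinner (subspace_of H S) = hinner H"
  "hnorm (subspace_of H S) = hnorm H"
  by (auto simp: subspace_of_def hnorm_def fun_eq_iff)

context hilbert_space
begin

lemma closed_subspaceD: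
  assumes "closed_subspace H S"
  shows "S \<subseteq> hcarrier H" "x \<in> S \<Longrightarrow> x \<in> hcarrier H" "0 \<in> S"
    "x \<in> S \<Longrightarrow> y \<in> S \<Longrightarrow> x + y \<in> S" "x \<in> S \<Longrightarrow> c *\<^sub>C x \<in> S"
    "\<lbrakk>\<And>n. s n \<in> S; converges_in H s x\<rbrakk> \<Longrightarrow> x \<in> S"
  using assms unfolding closed_subspace_def by blast+

lemma closed_subspace_hilbert:
  assumes S: "closed_subspace H S"
  shows "hilbert_space (subspace_of H S)"
proof -
  note D = closed_subspaceD[OF S]
  interpret S: pre_hilbert "subspace_of H S"
  proof (unfold_locales, unfold subspace_of_simps)
    show "hinner H x y = cnj (hinner H y x)" if "x \<in> S" "y \<in> S" for x y
      using that D by (intro inner_commute)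
    show "x = 0" if "x \<in> S" "hinner H x x = 0" for x
      using that D by (intro inner_eq_zero)
  qed (use D in \<open>simp_all add: inner_add_left inner_scaleC_left inner_nonneg\<close>)
  show ?thesis
  proof (rule S.hilbert_spaceI)
    fix s assume s: "cauchy_in (subspace_of H S) s"
    then have "cauchy_in H s" using D by (auto simp: cauchy_in_def)
    then obtain x where x: "converges_in H s x" using cauchy_converges by blast
    have sS: "s n \<in> S" for n using s by (simp add: cauchy_in_def)
    then have "x \<in> S" using x by (rule D(6))
    then have "converges_in (subspace_of H S) s x"
      using x sS by (simp add: converges_in_def)
    then show "\<exists>x. converges_in (subspace_of H S) s x" ..
  qed
qed

lemma orth_compl_closed_subspace:
  assumes S: "S \<subseteq> hcarrier H"
  shows "closed_subspace H (orth_compl H S)"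
  unfolding closed_subspace_def
proof (intro conjI allI ballI impI)
  fix s x assume *: "(\<forall>n. s n \<in> orth_compl H S) \<and> converges_in H s x"
  show "x \<in> orth_compl H S"
    unfolding orth_compl_def
  proof (intro CollectI conjI ballI)
    show "x \<in> hcarrier H" using * by (simp add: converges_in_def)
    fix y assume "y \<in> S"
    then have "(\<lambda>n. hinner H (s n) y) \<longlonglongrightarrow> hinner H x y"
      using * S by (intro converges_inner converges_const) auto
    moreover have "hinner H (s n) y = 0" for n using * \<open>y \<in> S\<close> by (auto simp: orth_compl_def)
    ultimately show "hinner H x y = 0" by (simp add: LIMSEQ_const_iff)
  qed
qed (use S in \<open>auto simp: orth_compl_def inner_simps subset_iff\<close>)

lemma hclosure_iff:
  assumes S: "S \<subseteq> hcarrier H"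
  shows "x \<in> hclosure H S \<longleftrightarrow> (\<exists>s. (\<forall>n. s n \<in> S) \<and> converges_in H s x)"
proof -
  interpret M: Metric_space "hcarrier H" "hdist H" by (rule metric)
  have "x \<in> hclosure H S \<longleftrightarrow> x \<in> hcarrier H \<and> (\<forall>r>0. \<exists>y\<in>S. hnorm H (y - x) < r)"
  proof -
    have "hdist H x y < r \<longleftrightarrow> hnorm H (y - x) < r" if "x \<in> hcarrier H" "y \<in> S" for y r
      using that S hnorm_minus_commute[of x y] by (simp add: hdist_def subset_iff)
    then show ?thesis
      unfolding hclosure_def M.metric_closure_of M.in_mball using S by blast
  qed
  also have "\<dots> \<longleftrightarrow> (\<exists>s. (\<forall>n. s n \<in> S) \<and> converges_in H s x)"
  proof safe
    assume x: "x \<in> hcarrier H" and *: "\<forall>r>0. \<exists>y\<in>S. hnorm H (y - x) < r"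
    have "\<forall>n. \<exists>y\<in>S. hnorm H (y - x) < 1 / Suc n" using * by simp
    then obtain s where s: "\<And>n. s n \<in> S" "\<And>n. hnorm H (s n - x) < 1 / Suc n" by metis
    have "(\<lambda>n. hnorm H (s n - x)) \<longlonglongrightarrow> 0"
      by (rule Lim_null_comparison[OF _ LIMSEQ_inverse_real_of_nat])
        (use s x S in \<open>auto intro!: always_eventually simp: inverse_eq_divide less_imp_le subset_iff\<close>)
    then show "\<exists>s. (\<forall>n. s n \<in> S) \<and> converges_in H s x"
      using s x S by (auto simp: converges_in_def)
  next
    fix s and r :: real assume s: "\<forall>n. s n \<in> S" "converges_in H s x" and "r > 0"
    then have "\<forall>\<^sub>F n in sequentially. hnorm H (s n - x) < r"
      unfolding converges_in_def by (intro order_tendstoD) auto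
    then show "\<exists>y\<in>S. hnorm H (y - x) < r"
      using s by (auto simp: eventually_sequentially)
  qed (auto simp: converges_in_def)
  finally show ?thesis .
qed

lemma hclosure_closed_subspace:
  assumes S: "S \<subseteq> hcarrier H" "0 \<in> S" "\<And>x y. \<lbrakk>x \<in> S; y \<in> S\<rbrakk> \<Longrightarrow> x + y \<in> S"
    "\<And>c x. x \<in> S \<Longrightarrow> c *\<^sub>C x \<in> S"
  shows "closed_subspace H (hclosure H S)"
  unfolding closed_subspace_def
proof (intro conjI allI ballI impI)
  show "0 \<in> hclosure H S"
    using S converges_const[of 0] by (auto simp: hclosure_iff intro!: exI[of _ "\<lambda>_. 0"])
  show "hclosure H S \<subseteq> hcarrier H" using S by (auto simp: hclosure_iff converges_in_def)
  fix x y assume "x \<in> hclosure H S" "y \<in> hclosure H S"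
  then obtain s t where "\<And>n. s n \<in> S" "converges_in H s x" "\<And>n. t n \<in> S" "converges_in H t y"
    using S by (auto simp: hclosure_iff)
  then show "x + y \<in> hclosure H S"
    using S converges_add by (auto simp: hclosure_iff intro!: exI[of _ "\<lambda>n. s n + t n"])
next
  fix c x assume "x \<in> hclosure H S"
  then obtain s where "\<And>n. s n \<in> S" "converges_in H s x"
    using S by (auto simp: hclosure_iff)
  then show "c *\<^sub>C x \<in> hclosure H S"
    using S converges_scaleC by (auto simp: hclosure_iff intro!: exI[of _ "\<lambda>n. c *\<^sub>C s n"])
next
  fix s x assume *: "(\<forall>n. s n \<in> hclosure H S) \<and> converges_in H s x"
  interpret M: Metric_space "hcarrier H" "hdist H" by (rule metric)
  have L: "limitin M.mtopology s x sequentially"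
    using * unfolding M.limit_metric_sequentially converges_in_def LIMSEQ_def
    by (auto simp: hdist_def)
  show "x \<in> hclosure H S"
    unfolding hclosure_def
    by (rule limitin_closedin[OF L]) (use * in \<open>auto simp: hclosure_def\<close>)
qed

lemma subset_hclosure: "S \<subseteq> hcarrier H \<Longrightarrow> S \<subseteq> hclosure H S"
  using converges_const by (fastforce simp: hclosure_iff)

lemma orth_hclosure:
  assumes S: "S \<subseteq> hcarrier H" and x: "x \<in> hcarrier H" "\<And>y. y \<in> S \<Longrightarrow> hinner H x y = 0"
    and y: "y \<in> hclosure H S"
  shows "hinner H x y = 0"
proof -
  obtain s where s: "\<And>n. s n \<in> S" "converges_in H s y" using y S by (auto simp: hclosure_iff)
  have "(\<lambda>n. hinner H x (s n)) \<longlonglongrightarrow> hinner H x y"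
    using s x by (intro converges_inner converges_const) auto
  then show ?thesis using x s by (simp add: LIMSEQ_const_iff)
qed

text \<open>
  The representing vector minimises \<open>\<parallel>x\<parallel>\<^sup>2 - 2 Re (\<phi> x)\<close>: minimising sequences are Cauchy by the
  parallelogram law, and the first variation at the minimum gives the representation.
\<close>

theorem Riesz_representation:
  assumes add: "\<And>x y. \<lbrakk>x \<in> hcarrier H; y \<in> hcarrier H\<rbrakk> \<Longrightarrow> \<phi> (x + y) = \<phi> x + \<phi> y"
    and scale: "\<And>c x. x \<in> hcarrier H \<Longrightarrow> \<phi> (c *\<^sub>C x) = c * \<phi> x"
    and bounded: "\<And>x. x \<in> hcarrier H \<Longrightarrow> cmod (\<phi> x) \<le> C * hnorm H x"
  shows "\<exists>x\<in>hcarrier H. \<forall>u\<in>hcarrier H. \<phi> u = hinner H u x"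
proof -
  define J where "J x = (hnorm H x)\<^sup>2 - 2 * Re (\<phi> x)" for x
  have lower: "- C\<^sup>2 \<le> J x" if "x \<in> hcarrier H" for x
  proof -
    have "Re (\<phi> x) \<le> C * hnorm H x"
      using bounded[OF that] complex_Re_le_cmod order_trans by blast
    then show ?thesis
      using zero_le_power2[of "hnorm H x - C"] by (simp add: J_def power2_diff algebra_simps)
  qed
  define I where "I = Inf (J ` hcarrier H)"
  have bdd: "bdd_below (J ` hcarrier H)" using lower by (auto intro!: bdd_belowI)
  have I_le: "I \<le> J x" if "x \<in> hcarrier H" for x
    unfolding I_def using bdd that by (auto intro: cInf_lower)
  have "\<exists>x\<in>hcarrier H. J x < I + 1 / Suc n" for n
  proof -
    have "Inf (J ` hcarrier H) < I + 1 / Suc n" by (simp add: I_def)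
    moreover have "J ` hcarrier H \<noteq> {}" using zero_mem by blast
    ultimately show ?thesis using bdd by (simp add: cInf_less_iff)
  qed
  then obtain s where s: "\<And>n. s n \<in> hcarrier H" "\<And>n. J (s n) < I + 1 / Suc n" by metis
  have para: "(hnorm H (x - y))\<^sup>2 \<le> 2 * (J x - I) + 2 * (J y - I)"
    if "x \<in> hcarrier H" "y \<in> hcarrier H" for x y
  proof -
    have "I \<le> J ((1 / 2) *\<^sub>C (x + y))" using that by (intro I_le) auto
    also have "\<dots> = (hnorm H (x + y))\<^sup>2 / 4 - Re (\<phi> x + \<phi> y)"
      using that by (simp add: J_def hnorm_scaleC scale add power_mult_distrib power_divide add_divide_distrib)
    finally show ?thesis
      using that by (simp add: J_def hnorm_add_sq hnorm_diff_sq field_simps)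
  qed
  have "cauchy_in H s"
    unfolding cauchy_in_def
  proof (intro conjI allI impI)
    fix \<epsilon> :: real assume \<epsilon>: "\<epsilon> > 0"
    obtain N where N: "1 / Suc N < \<epsilon>\<^sup>2 / 4"
      using reals_Archimedean[of "\<epsilon>\<^sup>2 / 4"] \<epsilon> by (auto simp: inverse_eq_divide)
    show "\<exists>N. \<forall>m\<ge>N. \<forall>n\<ge>N. hnorm H (s m - s n) < \<epsilon>"
    proof (intro exI allI impI)
      fix m n assume mn: "N \<le> m" "N \<le> n"
      define r where "r k = 1 / real (Suc k)" for k
      have "r m \<le> r N" "r n \<le> r N"
        using mn by (auto simp: r_def intro!: divide_left_mono)
      moreover have "r N < \<epsilon>\<^sup>2 / 4" "J (s m) < I + r m" "J (s n) < I + r n"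
        using N s(2) by (simp_all add: r_def)
      ultimately have "(hnorm H (s m - s n))\<^sup>2 < \<epsilon>\<^sup>2"
        using para[OF s(1)[of m] s(1)[of n]] by argo
      then show "hnorm H (s m - s n) < \<epsilon>" using \<epsilon> by (rule power2_less_imp_less[OF _ less_imp_le])
    qed
  qed (use s in auto)
  then obtain x where x: "converges_in H s x" using cauchy_converges by blast
  have xm: "x \<in> hcarrier H" using x by (simp add: converges_in_def)
  have "(\<lambda>n. \<phi> (s n) - \<phi> x) \<longlonglongrightarrow> 0"
  proof (rule Lim_null_comparison)
    show "(\<lambda>n. C * hnorm H (s n - x)) \<longlonglongrightarrow> 0"
      using x by (auto simp: converges_in_def intro: tendsto_mult_right_zero)
    have "\<phi> (s n - x) = \<phi> (s n) - \<phi> x" for n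
      using add[of "s n - x" x] s xm by simp
    then have "norm (\<phi> (s n) - \<phi> x) \<le> C * hnorm H (s n - x)" for n
      using bounded[of "s n - x"] s xm by simp
    then show "\<forall>\<^sub>F n in sequentially. norm (\<phi> (s n) - \<phi> x) \<le> C * hnorm H (s n - x)"
      by simp
  qed
  then have "(\<lambda>n. \<phi> (s n)) \<longlonglongrightarrow> \<phi> x" by (simp add: LIM_zero_iff)
  then have "(\<lambda>n. J (s n)) \<longlonglongrightarrow> J x"
    unfolding J_def by (intro tendsto_intros converges_hnorm x)
  moreover have "(\<lambda>n. I + 1 / Suc n) \<longlonglongrightarrow> I + 0"
    using LIMSEQ_inverse_real_of_nat by (intro tendsto_intros) (simp add: inverse_eq_divide)
  ultimately have "J x \<le> I"
    using s(2) by (intro LIMSEQ_le[of "\<lambda>n. J (s n)" _ "\<lambda>n. I + 1 / Suc n"]) (auto intro: less_imp_le)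
  then have min: "J x \<le> J y" if "y \<in> hcarrier H" for y using I_le[OF that] by simp
  have Re_eq: "Re (\<phi> u) = Re (hinner H u x)" if u: "u \<in> hcarrier H" for u
  proof -
    have "Re (hinner H x u - \<phi> u) = 0"
    proof (rule quadratic_nonneg_imp_linear_zero)
      fix t :: real
      have "J (x + of_real t *\<^sub>C u) = J x + (t\<^sup>2 * (hnorm H u)\<^sup>2 + 2 * t * Re (hinner H x u - \<phi> u))"
        using u xm
        by (simp add: J_def hnorm_add_sq add scale inner_simps hnorm_scaleC power_mult_distrib
            algebra_simps)
      then show "0 \<le> t\<^sup>2 * (hnorm H u)\<^sup>2 + 2 * t * Re (hinner H x u - \<phi> u)"
        using min[of "x + of_real t *\<^sub>C u"] u xm by simp
    qed
    then show ?thesis using inner_commute[of x u] u xm by simp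
  qed
  have "\<phi> u = hinner H u x" if u: "u \<in> hcarrier H" for u
    using Re_eq[OF u] Re_eq[of "\<i> *\<^sub>C u"] u xm by (simp add: scale inner_simps complex_eq_iff)
  then show ?thesis using xm by blast
qed

end

lemma bounded_operatorI:
  assumes "\<And>x. x \<in> hcarrier H \<Longrightarrow> A x \<in> hcarrier K"
    "\<And>x y. \<lbrakk>x \<in> hcarrier H; y \<in> hcarrier H\<rbrakk> \<Longrightarrow> A (x + y) = A x + A y"
    "\<And>c x. x \<in> hcarrier H \<Longrightarrow> A (c *\<^sub>C x) = c *\<^sub>C A x"
    "\<And>x. x \<in> hcarrier H \<Longrightarrow> hnorm K (A x) \<le> C * hnorm H x"
  shows "bounded_operator H K A"
  using assms unfolding bounded_operator_def by blast

lemma bounded_operatorD: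
  assumes "bounded_operator H K A"
  shows "x \<in> hcarrier H \<Longrightarrow> A x \<in> hcarrier K"
    "\<lbrakk>x \<in> hcarrier H; y \<in> hcarrier H\<rbrakk> \<Longrightarrow> A (x + y) = A x + A y"
    "x \<in> hcarrier H \<Longrightarrow> A (c *\<^sub>C x) = c *\<^sub>C A x"
  using assms unfolding bounded_operator_def by blast+

lemma bounded_operator_bound:
  assumes A: "bounded_operator H K A" and H: "pre_hilbert H"
  obtains C where "C > 0" "\<And>x. x \<in> hcarrier H \<Longrightarrow> hnorm K (A x) \<le> C * hnorm H x"
proof -
  interpret H: pre_hilbert H by (rule H)
  obtain C where C: "\<And>x. x \<in> hcarrier H \<Longrightarrow> hnorm K (A x) \<le> C * hnorm H x"
    using A unfolding bounded_operator_def by blast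
  have "hnorm K (A x) \<le> (\<bar>C\<bar> + 1) * hnorm H x" if x: "x \<in> hcarrier H" for x
  proof -
    have "C * hnorm H x \<le> (\<bar>C\<bar> + 1) * hnorm H x" using x by (intro mult_right_mono) auto
    then show ?thesis using C[OF x] by simp
  qed
  then show ?thesis using that[of "\<bar>C\<bar> + 1"] by auto
qed

lemma bounded_operator_diff:
  assumes "bounded_operator H K A" "pre_hilbert H" "x \<in> hcarrier H" "y \<in> hcarrier H"
  shows "A (x - y) = A x - A y"
proof -
  interpret H: pre_hilbert H by fact
  have "A (x - y + y) = A (x - y) + A y"
    using assms by (intro bounded_operatorD(2)[OF assms(1)]) auto
  then show ?thesis by simp
qed

lemma bounded_operator_zero:
  assumes "bounded_operator H K A" "pre_hilbert H"
  shows "A 0 = 0"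
proof -
  interpret H: pre_hilbert H by fact
  show ?thesis using bounded_operatorD(3)[OF assms(1) H.zero_mem, of 0] by simp
qed

lemma bounded_operator_sum:
  assumes "bounded_operator H K A" "pre_hilbert H" "\<And>i. i \<in> I \<Longrightarrow> f i \<in> hcarrier H"
  shows "A (sum f I) = (\<Sum>i\<in>I. A (f i))"
proof -
  interpret H: pre_hilbert H by fact
  show ?thesis using assms(3)
    by (induction I rule: infinite_finite_induct)
      (auto simp: bounded_operator_zero[OF assms(1,2)] bounded_operatorD(2)[OF assms(1)])
qed

lemma bounded_operator_compose:
  assumes A: "bounded_operator H K A" and B: "bounded_operator K L B"
    and H: "pre_hilbert H" and K: "pre_hilbert K"
  shows "bounded_operator H L (\<lambda>x. B (A x))"
proof -
  obtain C where C: "C > 0" "\<And>x. x \<in> hcarrier H \<Longrightarrow> hnorm K (A x) \<le> C * hnorm H x"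
    using bounded_operator_bound[OF A H] by blast
  obtain D where D: "D > 0" "\<And>x. x \<in> hcarrier K \<Longrightarrow> hnorm L (B x) \<le> D * hnorm K x"
    using bounded_operator_bound[OF B K] by blast
  note a = bounded_operatorD[OF A] and b = bounded_operatorD[OF B]
  show ?thesis
  proof (rule bounded_operatorI[where C = "D * C"])
    fix x assume x: "x \<in> hcarrier H"
    have "hnorm L (B (A x)) \<le> D * hnorm K (A x)" using D a x by blast
    also have "\<dots> \<le> D * (C * hnorm H x)" using C(2)[OF x] D by (intro mult_left_mono) auto
    finally show "hnorm L (B (A x)) \<le> D * C * hnorm H x" by (simp add: mult.assoc)
  qed (use a b in auto)
qed

lemma bounded_operator_id: "bounded_operator H H (\<lambda>x. x)"
  by (rule bounded_operatorI[where C = 1]) auto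

lemma bounded_operator_funpow:
  assumes "bounded_operator H H A" "pre_hilbert H"
  shows "bounded_operator H H (A ^^ k)"
proof (induction k)
  case 0
  then show ?case using bounded_operator_id by (simp add: id_def)
next
  case (Suc k)
  then show ?case
    using bounded_operator_compose[OF Suc assms(1) assms(2) assms(2)] by (simp add: o_def)
qed

lemma bounded_operator_add:
  assumes A: "bounded_operator H K A" and B: "bounded_operator H K B"
    and H: "pre_hilbert H" and K: "pre_hilbert K"
  shows "bounded_operator H K (\<lambda>x. A x + B x)"
proof -
  interpret K: pre_hilbert K by (rule K)
  obtain C where C: "C > 0" "\<And>x. x \<in> hcarrier H \<Longrightarrow> hnorm K (A x) \<le> C * hnorm H x"
    using bounded_operator_bound[OF A H] by blast
  obtain D where D: "D > 0" "\<And>x. x \<in> hcarrier H \<Longrightarrow> hnorm K (B x) \<le> D * hnorm H x"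
    using bounded_operator_bound[OF B H] by blast
  note a = bounded_operatorD[OF A] and b = bounded_operatorD[OF B]
  show ?thesis
  proof (rule bounded_operatorI[where C = "C + D"])
    fix x assume x: "x \<in> hcarrier H"
    show "hnorm K (A x + B x) \<le> (C + D) * hnorm H x"
      using K.hnorm_triangle[of "A x" "B x"] C(2)[OF x] D(2)[OF x] a b x
      by (simp add: algebra_simps)
  qed (use a b in \<open>auto simp: scaleC_add_right\<close>)
qed

lemma bounded_operator_scaleC:
  assumes A: "bounded_operator H K A" and H: "pre_hilbert H" and K: "pre_hilbert K"
  shows "bounded_operator H K (\<lambda>x. c *\<^sub>C A x)"
proof -
  interpret K: pre_hilbert K by (rule K)
  obtain C where C: "C > 0" "\<And>x. x \<in> hcarrier H \<Longrightarrow> hnorm K (A x) \<le> C * hnorm H x"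
    using bounded_operator_bound[OF A H] by blast
  note a = bounded_operatorD[OF A]
  show ?thesis
  proof (rule bounded_operatorI[where C = "cmod c * C"])
    fix x assume x: "x \<in> hcarrier H"
    show "hnorm K (c *\<^sub>C A x) \<le> cmod c * C * hnorm H x"
      using C(2)[OF x] a x by (simp add: K.hnorm_scaleC mult.assoc mult_left_mono)
  qed (use a in \<open>auto simp: scaleC_add_right scaleC_scaleC mult.commute\<close>)
qed

lemma adjoint_eqI:
  assumes H: "pre_hilbert H" and x: "x \<in> hcarrier H"
    and eq: "\<And>u. u \<in> hcarrier H \<Longrightarrow> hinner K (A u) y = hinner H u x"
  shows "adjoint H K A y = x"
  unfolding adjoint_def
proof (rule the_equality)
  interpret H: pre_hilbert H by (rule H)
  show "x \<in> hcarrier H \<and> (\<forall>u\<in>hcarrier H. hinner K (A u) y = hinner H u x)"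
    using x eq by blast
  show "x' = x" if "x' \<in> hcarrier H \<and> (\<forall>u\<in>hcarrier H. hinner K (A u) y = hinner H u x')" for x'
    using that x eq by (intro H.eq_if_inner_eq_right) auto
qed

lemma adjoint:
  assumes H: "hilbert_space H" and K: "pre_hilbert K"
    and A: "bounded_operator H K A" and y: "y \<in> hcarrier K"
  shows adjoint_mem: "adjoint H K A y \<in> hcarrier H"
    and adjoint_inner: "u \<in> hcarrier H \<Longrightarrow> hinner K (A u) y = hinner H u (adjoint H K A y)"
    and adjoint_inner': "u \<in> hcarrier H \<Longrightarrow> hinner K y (A u) = hinner H (adjoint H K A y) u"
proof -
  interpret H: hilbert_space H by (rule H)
  interpret K: pre_hilbert K by (rule K)
  obtain C where C: "C > 0" "\<And>x. x \<in> hcarrier H \<Longrightarrow> hnorm K (A x) \<le> C * hnorm H x"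
    using bounded_operator_bound[OF A] H.pre_hilbert_axioms by blast
  note a = bounded_operatorD[OF A]
  have "\<exists>x\<in>hcarrier H. \<forall>u\<in>hcarrier H. hinner K (A u) y = hinner H u x"
  proof (rule H.Riesz_representation)
    fix x assume x: "x \<in> hcarrier H"
    have "cmod (hinner K (A x) y) \<le> hnorm K (A x) * hnorm K y"
      using a x y by (intro K.Cauchy_Schwarz) auto
    also have "\<dots> \<le> (C * hnorm H x) * hnorm K y"
      using C(2)[OF x] y by (intro mult_right_mono) auto
    finally show "cmod (hinner K (A x) y) \<le> (C * hnorm K y) * hnorm H x" by (simp add: mult_ac)
  qed (use a y in \<open>auto simp: K.inner_simps\<close>)
  then obtain x where x: "x \<in> hcarrier H" "\<And>u. u \<in> hcarrier H \<Longrightarrow> hinner K (A u) y = hinner H u x"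
    by blast
  have eq: "adjoint H K A y = x"
    by (rule adjoint_eqI) (use x H.pre_hilbert_axioms in auto)
  show "adjoint H K A y \<in> hcarrier H" using eq x by simp
  show "hinner K (A u) y = hinner H u (adjoint H K A y)" if "u \<in> hcarrier H" using eq x that by simp
  show "hinner K y (A u) = hinner H (adjoint H K A y) u" if "u \<in> hcarrier H"
    using eq x that K.inner_commute[of y "A u"] H.inner_commute[of x u] a y by simp
qed

lemma adjoint_bounded:
  assumes H: "hilbert_space H" and K: "pre_hilbert K" and A: "bounded_operator H K A"
    and C: "\<And>x. x \<in> hcarrier H \<Longrightarrow> hnorm K (A x) \<le> C * hnorm H x"
    and C0: "0 \<le> C" and y: "y \<in> hcarrier K"
  shows "hnorm H (adjoint H K A y) \<le> C * hnorm K y"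
proof -
  interpret H: hilbert_space H by (rule H)
  interpret K: pre_hilbert K by (rule K)
  let ?x = "adjoint H K A y"
  have m: "?x \<in> hcarrier H" "A ?x \<in> hcarrier K"
    using adjoint_mem[OF H K A y] bounded_operatorD(1)[OF A] by auto
  have "(hnorm H ?x)\<^sup>2 = Re (hinner K (A ?x) y)"
    using adjoint_inner[OF H K A y m(1)] m by (simp add: H.hnorm_sq)
  also have "\<dots> \<le> hnorm K (A ?x) * hnorm K y"
    using K.Cauchy_Schwarz[OF m(2) y] complex_Re_le_cmod order_trans by blast
  also have "\<dots> \<le> (C * hnorm H ?x) * hnorm K y"
    using C[OF m(1)] y by (intro mult_right_mono) auto
  finally have *: "hnorm H ?x * hnorm H ?x \<le> hnorm H ?x * (C * hnorm K y)"
    by (simp add: power2_eq_square mult_ac)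
  show ?thesis
  proof (cases "hnorm H ?x = 0")
    case True
    then show ?thesis using C0 y by simp
  next
    case False
    then have "hnorm H ?x > 0" using m H.hnorm_nonneg[of ?x] by linarith
    then show ?thesis using * by simp
  qed
qed

context hilbert_space
begin

lemma projection_exists:
  assumes S: "closed_subspace H S" and x: "x \<in> hcarrier H"
  shows "\<exists>y\<in>S. x - y \<in> orth_compl H S"
proof -
  note D = closed_subspaceD[OF S]
  interpret S: hilbert_space "subspace_of H S" by (rule closed_subspace_hilbert[OF S])
  have "\<exists>y\<in>hcarrier (subspace_of H S). \<forall>u\<in>hcarrier (subspace_of H S).
      hinner H u x = hinner (subspace_of H S) u y"
  proof (rule S.Riesz_representation)
    show "cmod (hinner H u x) \<le> hnorm H x * hnorm (subspace_of H S) u"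
      if "u \<in> hcarrier (subspace_of H S)" for u
      using that Cauchy_Schwarz[of u x] D x by (simp add: mult.commute)
  qed (use D x in \<open>auto simp: inner_simps\<close>)
  then obtain y where y: "y \<in> S" "\<And>u. u \<in> S \<Longrightarrow> hinner H u x = hinner H u y" by auto
  have "hinner H (x - y) u = 0" if "u \<in> S" for u
  proof -
    have "hinner H u (x - y) = 0" using that y D x by (simp add: inner_simps)
    then show ?thesis using inner_commute[of "x - y" u] that y D x by simp
  qed
  then have "x - y \<in> orth_compl H S" using y D x by (simp add: orth_compl_def)
  then show ?thesis using y by blast
qed

lemma orth_proj_eqI:
  assumes S: "closed_subspace H S" and x: "x \<in> hcarrier H" and y: "y \<in> S"
    and orth: "x - y \<in> orth_compl H S"
  shows "orth_proj H S x = y"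
  unfolding orth_proj_def
proof (rule the_equality)
  note D = closed_subspaceD[OF S]
  show "y \<in> S \<and> x - y \<in> orth_compl H S" using y orth by simp
  fix y' assume y': "y' \<in> S \<and> x - y' \<in> orth_compl H S"
  have "y' - y \<in> S" using D(4)[of y' "- y"] D(5)[of y "- 1"] y y' by simp
  then have "hinner H (x - y) (y' - y) = 0" "hinner H (x - y') (y' - y) = 0"
    using orth y' by (auto simp: orth_compl_def)
  then have "hinner H ((x - y) - (x - y')) (y' - y) = 0"
    using y y' D(2) x by (subst inner_diff_left) auto
  then have "hinner H (y' - y) (y' - y) = 0" by simp
  then show "y' = y" using inner_eq_zero[of "y' - y"] y y' D(2) by simp
qed

lemma
  assumes S: "closed_subspace H S" and x: "x \<in> hcarrier H"
  shows orth_proj_mem: "orth_proj H S x \<in> S"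
    and orth_proj_inner: "u \<in> S \<Longrightarrow> hinner H u (orth_proj H S x) = hinner H u x"
proof -
  obtain y where y: "y \<in> S" "x - y \<in> orth_compl H S" using projection_exists[OF S x] by blast
  have eq: "orth_proj H S x = y" by (rule orth_proj_eqI[OF S x y])
  show "orth_proj H S x \<in> S" using y eq by simp
  show "hinner H u (orth_proj H S x) = hinner H u x" if u: "u \<in> S"
  proof -
    have m: "y \<in> hcarrier H" "u \<in> hcarrier H" using closed_subspaceD(2)[OF S] u y by auto
    have "hinner H (x - y) u = 0" using y u by (auto simp: orth_compl_def)
    then have "hinner H u (x - y) = 0" using inner_commute[of u "x - y"] m x by simp
    then show ?thesis using m x by (simp add: eq inner_simps)
  qed
qed

lemma double_orth_compl:
  assumes S: "closed_subspace H S" and x: "x \<in> hcarrier H"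
    and orth: "\<And>y. y \<in> orth_compl H S \<Longrightarrow> hinner H y x = 0"
  shows "x \<in> S"
proof -
  obtain y where y: "y \<in> S" "x - y \<in> orth_compl H S" using projection_exists[OF S x] by blast
  have m: "y \<in> hcarrier H" using closed_subspaceD(2)[OF S] y by auto
  have "hinner H (x - y) x = 0" "hinner H (x - y) y = 0"
    using orth[OF y(2)] y by (auto simp: orth_compl_def)
  then have "hinner H (x - y) (x - y) = 0" using m x by (simp add: inner_diff_right)
  then show ?thesis using inner_eq_zero[of "x - y"] m x y by simp
qed

end

section \<open>Square roots of positive operators\<close>

lemma positive_operatorD:
  assumes "positive_operator H A"
  shows "bounded_operator H H A" "x \<in> hcarrier H \<Longrightarrow> hinner H (A x) x \<in> \<real>\<^sub>\<ge>\<^sub>0"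
  using assms by (auto simp: positive_operator_def)

lemma positive_operator_hermitian:
  assumes A: "positive_operator H A" and H: "pre_hilbert H"
    and x: "x \<in> hcarrier H" and y: "y \<in> hcarrier H"
  shows "hinner H (A x) y = hinner H x (A y)"
  using pre_hilbert.inner_real_imp_hermitian[OF H] bounded_operatorD[OF positive_operatorD(1)[OF A]]
    positive_operatorD(2)[OF A] x y
  by (simp add: complex_nonneg_Reals_iff)

primrec root_iterate :: "('a::complex_vector \<Rightarrow> 'a) \<Rightarrow> nat \<Rightarrow> 'a \<Rightarrow> 'a" where
  "root_iterate X 0 = (\<lambda>x. 0)"
| "root_iterate X (Suc k) =
    (\<lambda>x. (1 / 2) *\<^sub>C (X x + root_iterate X k (root_iterate X k x)))"

primrec root_bound :: "nat \<Rightarrow> real" where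
  "root_bound 0 = 0"
| "root_bound (Suc k) = (1 + (root_bound k)\<^sup>2) / 2"

lemma root_bound_range: "0 \<le> root_bound k \<and> root_bound k \<le> 1"
  by (induction k) (auto simp: power_le_one)

lemma root_bound_mono: "root_bound k \<le> root_bound (Suc k)"
  using zero_le_power2[of "1 - root_bound k"] by (simp add: power2_eq_square algebra_simps)

lemma root_bound_Cauchy: "Cauchy root_bound"
proof -
  have "incseq root_bound" using root_bound_mono by (rule incseq_SucI)
  moreover have "Bseq root_bound"
    using root_bound_range by (intro BseqI'[where K = 1]) (auto simp: abs_of_nonneg)
  ultimately have "convergent root_bound"
    by (intro Bseq_mono_convergent) (auto simp: incseq_def)
  then show ?thesis by (rule convergent_Cauchy)
qed

text \<open>
  The positive root of \<open>I - X\<close> is \<open>I - Y\<close>, where \<open>Y = (X + Y\<^sup>2) / 2\<close>. The iterates of this equation,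
  started at 0, are polynomials in \<open>X\<close> with nonnegative coefficients. Hence the norm of the difference
  of two consecutive iterates is at most the same difference for \<open>X = 1\<close>, and there the iteration
  increases and stays below 1.
\<close>

theorem sqrt_one_minus_contraction:
  assumes H: "hilbert_space H" and X: "bounded_operator H H X"
    and herm: "\<And>x y. \<lbrakk>x \<in> hcarrier H; y \<in> hcarrier H\<rbrakk> \<Longrightarrow> hinner H (X x) y = hinner H x (X y)"
    and contr: "\<And>x. x \<in> hcarrier H \<Longrightarrow> hnorm H (X x) \<le> hnorm H x"
  shows "\<exists>B. positive_operator H B \<and> (\<forall>x\<in>hcarrier H. B (B x) = x - X x)"
proof -
  interpret H: hilbert_space H by (rule H)
  note x = bounded_operatorD[OF X]
  define R where "R = root_iterate X"
  define r where "r = root_bound"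
  have R0: "R 0 x = 0" and R_Suc: "R (Suc k) x = (1 / 2) *\<^sub>C (X x + R k (R k x))" for k x
    by (simp_all add: R_def)
  have r: "0 \<le> r k" "r k \<le> 1" "r k \<le> r (Suc k)" "r 0 = 0" "r (Suc k) = (1 + (r k)\<^sup>2) / 2" for k
    using root_bound_range root_bound_mono by (auto simp: r_def)
  have R: "(u \<in> hcarrier H \<longrightarrow> R k u \<in> hcarrier H) \<and>
      (u \<in> hcarrier H \<longrightarrow> v \<in> hcarrier H \<longrightarrow> R k (u + v) = R k u + R k v) \<and>
      (u \<in> hcarrier H \<longrightarrow> R k (c *\<^sub>C u) = c *\<^sub>C R k u)" for k u v c
    by (induction k arbitrary: u v c)
      (auto simp: R0 R_Suc x scaleC_add_right scaleC_scaleC mult.commute)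
  have R_mem [simp]: "R k u \<in> hcarrier H" if "u \<in> hcarrier H" for k u using R that by blast
  have R_diff: "R k (u - v) = R k u - R k v" if "u \<in> hcarrier H" "v \<in> hcarrier H" for k u v
  proof -
    have "R k (u - v + v) = R k (u - v) + R k v" using R[of "u - v" k v] that by simp
    then show ?thesis by simp
  qed
  have R_herm: "hinner H (R k u) v = hinner H u (R k v)"
    if "u \<in> hcarrier H" "v \<in> hcarrier H" for k u v
    using that by (induction k arbitrary: u v) (auto simp: R0 R_Suc x H.inner_simps herm)
  have R_norm: "hnorm H (R k u) \<le> r k * hnorm H u" if "u \<in> hcarrier H" for k u
    using that
  proof (induction k arbitrary: u)
    case 0
    then show ?case by (simp add: R0 r)
  next
    case (Suc k)
    have "hnorm H (R k (R k u)) \<le> r k * (r k * hnorm H u)"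
      using Suc.IH[of "R k u"] Suc.IH[of u] Suc.prems r(1)[of k]
      by (meson R_mem mult_left_mono order_trans)
    moreover have "hnorm H (R (Suc k) u) \<le> (1 / 2) * (hnorm H (X u) + hnorm H (R k (R k u)))"
      using H.hnorm_triangle[of "X u" "R k (R k u)"] Suc.prems x
      by (simp add: R_Suc H.hnorm_scaleC)
    ultimately show ?case
      using contr[OF Suc.prems] by (simp add: r(5) algebra_simps power2_eq_square)
  qed
  have R_step: "hnorm H (R (Suc k) u - R k u) \<le> (r (Suc k) - r k) * hnorm H u"
    if "u \<in> hcarrier H" for k u
    using that
  proof (induction k arbitrary: u)
    case 0
    then show ?case using R_norm[of u "Suc 0"] by (simp add: R0 r(4))
  next
    case (Suc k)
    let ?d = "r (Suc k) - r k"
    define p q where "p = R (Suc k) (R (Suc k) u - R k u)"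
      and "q = R (Suc k) (R k u) - R k (R k u)"
    have pq: "p \<in> hcarrier H" "q \<in> hcarrier H" using Suc.prems by (auto simp: p_def q_def)
    have d0: "0 \<le> ?d" using r(3) by simp
    have p: "hnorm H p \<le> r (Suc k) * (?d * hnorm H u)"
      using R_norm[of "R (Suc k) u - R k u" "Suc k"] Suc.IH[OF Suc.prems] Suc.prems r(1)[of "Suc k"]
      unfolding p_def by (meson H.diff_mem R_mem mult_left_mono order_trans)
    have "hnorm H q \<le> ?d * hnorm H (R k u)"
      using Suc.IH[of "R k u"] Suc.prems by (simp add: q_def)
    also have "\<dots> \<le> ?d * (r k * hnorm H u)"
      using R_norm[OF Suc.prems] d0 by (intro mult_left_mono) auto
    finally have q: "hnorm H q \<le> ?d * (r k * hnorm H u)" .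
    have "p + q = R (Suc k) (R (Suc k) u) - R k (R k u)"
      using R_diff[of "R (Suc k) u" "R k u" "Suc k"] Suc.prems by (simp add: p_def q_def)
    moreover have "R (Suc (Suc k)) u - R (Suc k) u
        = (1 / 2) *\<^sub>C (X u + R (Suc k) (R (Suc k) u)) - (1 / 2) *\<^sub>C (X u + R k (R k u))"
      by (metis R_Suc)
    ultimately have "R (Suc (Suc k)) u - R (Suc k) u = (1 / 2) *\<^sub>C (p + q)"
      by (simp flip: cvec.scale_right_diff_distrib)
    then have "hnorm H (R (Suc (Suc k)) u - R (Suc k) u) \<le> (1 / 2) * (hnorm H p + hnorm H q)"
      using H.hnorm_triangle[of p q] pq by (simp add: H.hnorm_scaleC)
    also have "\<dots> \<le> (1 / 2) * (r (Suc k) * (?d * hnorm H u) + ?d * (r k * hnorm H u))"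
      using p q by simp
    also have "\<dots> = (r (Suc (Suc k)) - r (Suc k)) * hnorm H u"
      by (simp add: r(5)[of "Suc k"] r(5)[of k] field_simps power2_eq_square)
    finally show ?case .
  qed
  have R_far: "hnorm H (R (k + j) u - R k u) \<le> (r (k + j) - r k) * hnorm H u"
    if "u \<in> hcarrier H" for k j u
  proof (induction j)
    case (Suc j)
    then show ?case
      using H.hnorm_triangle_diff[of "R (k + Suc j) u" "R (k + j) u" "R k u"] R_step[OF that, of "k + j"] that
      by (simp add: algebra_simps)
  qed (use that in simp)
  have R_far': "hnorm H (R m u - R k u) \<le> \<bar>r m - r k\<bar> * hnorm H u"
    if u: "u \<in> hcarrier H" for m k u
  proof (cases "k \<le> m")
    case True
    have "hnorm H (R m u - R k u) \<le> (r m - r k) * hnorm H u"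
      using R_far[OF u, of k "m - k"] True by simp
    also have "\<dots> \<le> \<bar>r m - r k\<bar> * hnorm H u" using u by (intro mult_right_mono) auto
    finally show ?thesis .
  next
    case False
    have "hnorm H (R m u - R k u) \<le> (r k - r m) * hnorm H u"
      using R_far[OF u, of m "k - m"] False u H.hnorm_minus_commute[of "R m u" "R k u"] by simp
    also have "\<dots> \<le> \<bar>r m - r k\<bar> * hnorm H u" using u by (intro mult_right_mono) auto
    finally show ?thesis .
  qed
  have "\<exists>v. converges_in H (\<lambda>k. R k u) v" if u: "u \<in> hcarrier H" for u
  proof (rule H.cauchy_converges, unfold cauchy_in_def, intro conjI allI impI)
    show "R k u \<in> hcarrier H" for k using u by simp
    fix \<epsilon> :: real assume "\<epsilon> > 0"
    define \<delta> where "\<delta> = \<epsilon> / (hnorm H u + 1)"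
    have hu: "0 < hnorm H u + 1" using H.hnorm_nonneg[OF u] by linarith
    have "\<delta> > 0" using \<open>\<epsilon> > 0\<close> hu by (simp add: \<delta>_def)
    then obtain N where N: "\<And>m n. m \<ge> N \<Longrightarrow> n \<ge> N \<Longrightarrow> \<bar>r m - r n\<bar> < \<delta>"
      using root_bound_Cauchy unfolding r_def Cauchy_def dist_real_def by metis
    show "\<exists>N. \<forall>m\<ge>N. \<forall>n\<ge>N. hnorm H (R m u - R n u) < \<epsilon>"
    proof (intro exI allI impI)
      fix m n assume "N \<le> m" "N \<le> n"
      have "hnorm H (R m u - R n u) \<le> \<bar>r m - r n\<bar> * hnorm H u" by (rule R_far'[OF u])
      also have "\<dots> \<le> \<delta> * hnorm H u"
        using N[OF \<open>N \<le> m\<close> \<open>N \<le> n\<close>] u by (intro mult_right_mono) auto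
      also have "\<dots> < \<delta> * (hnorm H u + 1)" using \<open>\<delta> > 0\<close> by simp
      also have "\<dots> = \<epsilon>" using hu by (simp add: \<delta>_def)
      finally show "hnorm H (R m u - R n u) < \<epsilon>" .
    qed
  qed
  then obtain Y where Y: "\<And>u. u \<in> hcarrier H \<Longrightarrow> converges_in H (\<lambda>k. R k u) (Y u)" by metis
  have Y_mem [simp]: "Y u \<in> hcarrier H" if "u \<in> hcarrier H" for u
    using Y[OF that] by (simp add: converges_in_def)
  have Y_add: "Y (u + v) = Y u + Y v" if "u \<in> hcarrier H" "v \<in> hcarrier H" for u v
  proof (rule H.converges_unique)
    show "converges_in H (\<lambda>k. R k (u + v)) (Y (u + v))" using Y that by simp
    have "R k (u + v) = R k u + R k v" for k using R that by blast
    then show "converges_in H (\<lambda>k. R k (u + v)) (Y u + Y v)"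
      using H.converges_add[OF Y Y] that by simp
  qed
  have Y_scale: "Y (c *\<^sub>C u) = c *\<^sub>C Y u" if "u \<in> hcarrier H" for c u
  proof (rule H.converges_unique)
    show "converges_in H (\<lambda>k. R k (c *\<^sub>C u)) (Y (c *\<^sub>C u))" using Y that by simp
    have "R k (c *\<^sub>C u) = c *\<^sub>C R k u" for k using R that by blast
    then show "converges_in H (\<lambda>k. R k (c *\<^sub>C u)) (c *\<^sub>C Y u)"
      using H.converges_scaleC[OF Y] that by simp
  qed
  have Y_norm: "hnorm H (Y u) \<le> hnorm H u" if u: "u \<in> hcarrier H" for u
  proof (rule LIMSEQ_le_const2[OF H.converges_hnorm[OF Y[OF u]]])
    have "hnorm H (R k u) \<le> hnorm H u" for k
    proof -
      have "r k * hnorm H u \<le> 1 * hnorm H u" using r(2) u by (intro mult_right_mono) auto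
      then show ?thesis using R_norm[OF u, of k] by simp
    qed
    then show "\<exists>N. \<forall>n\<ge>N. hnorm H (R n u) \<le> hnorm H u" by blast
  qed
  have Y_herm: "hinner H (Y u) v = hinner H u (Y v)"
    if "u \<in> hcarrier H" "v \<in> hcarrier H" for u v
  proof (rule LIMSEQ_unique)
    show "(\<lambda>k. hinner H (R k u) v) \<longlonglongrightarrow> hinner H (Y u) v"
      using that by (intro H.converges_inner Y H.converges_const)
    have "(\<lambda>k. hinner H u (R k v)) \<longlonglongrightarrow> hinner H u (Y v)"
      using that by (intro H.converges_inner Y H.converges_const)
    then show "(\<lambda>k. hinner H (R k u) v) \<longlonglongrightarrow> hinner H u (Y v)"
      using that by (simp add: R_herm)
  qed
  have Y_eq: "Y u = (1 / 2) *\<^sub>C (X u + Y (Y u))" if u: "u \<in> hcarrier H" for u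
  proof (rule H.eq_if_inner_eq)
    fix v assume v: "v \<in> hcarrier H"
    have 1: "(\<lambda>k. hinner H (R (Suc k) u) v) \<longlonglongrightarrow> hinner H (Y u) v"
      by (rule LIMSEQ_Suc) (use u v in \<open>intro H.converges_inner Y H.converges_const\<close>)
    have 2: "hinner H (R (Suc k) u) v = (hinner H (X u) v + hinner H (R k u) (R k v)) / 2" for k
      using u v x by (simp add: R_Suc H.inner_simps R_herm)
    have 3: "(\<lambda>k. (hinner H (X u) v + hinner H (R k u) (R k v)) / 2)
        \<longlonglongrightarrow> (hinner H (X u) v + hinner H (Y u) (Y v)) / 2"
      using u v by (intro tendsto_intros H.converges_inner Y)
        simp_all
    have "hinner H (Y u) v = (hinner H (X u) v + hinner H (Y u) (Y v)) / 2"
      by (rule LIMSEQ_unique[OF 1]) (unfold 2, rule 3)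
    then show "hinner H (Y u) v = hinner H ((1 / 2) *\<^sub>C (X u + Y (Y u))) v"
      using u v x by (simp add: H.inner_simps Y_herm)
  qed (use u x in auto)
  define B where "B u = u - Y u" for u
  have "positive_operator H B"
    unfolding positive_operator_def
  proof (intro conjI ballI)
    show "bounded_operator H H B"
    proof (rule bounded_operatorI[where C = 2])
      fix u assume u: "u \<in> hcarrier H"
      show "hnorm H (B u) \<le> 2 * hnorm H u"
        using H.hnorm_triangle[of u "- Y u"] Y_norm[OF u] u by (simp add: B_def H.hnorm_uminus)
    qed (auto simp: B_def Y_add Y_scale cvec.scale_right_diff_distrib)
    fix u assume u: "u \<in> hcarrier H"
    have "Im (hinner H (Y u) u) = 0"
      using Y_herm[OF u u] H.inner_commute[of u "Y u"] u by (simp add: complex_eq_iff)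
    moreover have "Re (hinner H (Y u) u) \<le> (hnorm H u)\<^sup>2"
    proof -
      have "Re (hinner H (Y u) u) \<le> hnorm H (Y u) * hnorm H u"
        using H.Cauchy_Schwarz[of "Y u" u] u complex_Re_le_cmod order_trans by (meson Y_mem)
      also have "\<dots> \<le> hnorm H u * hnorm H u" using Y_norm u by (intro mult_right_mono) auto
      finally show ?thesis by (simp add: power2_eq_square)
    qed
    ultimately show "hinner H (B u) u \<in> \<real>\<^sub>\<ge>\<^sub>0"
      using u by (simp add: B_def H.inner_simps complex_nonneg_Reals_iff H.hnorm_sq)
  qed
  moreover have "B (B u) = u - X u" if u: "u \<in> hcarrier H" for u
  proof -
    have "Y (u - Y u) = Y u - Y (Y u)"
      using Y_add[of u "(- 1) *\<^sub>C Y u"] Y_scale[of "Y u" "- 1"] u by simp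
    then have "B (B u) = u - Y u - (Y u - Y (Y u))" by (simp add: B_def)
    moreover have "Y u + Y u = X u + Y (Y u)"
      using arg_cong[OF Y_eq[OF u], of "\<lambda>w. 2 *\<^sub>C w"] scaleC_add_left[of 1 1 "Y u"]
      by (simp add: scaleC_scaleC)
    then have "X u = Y u + Y u - Y (Y u)" by simp
    ultimately show ?thesis by simp
  qed
  ultimately show ?thesis by blast
qed

text \<open>
  With a bound \<open>C\<close> of the norm of \<open>A\<close>, the operator \<open>X = I - A / C\<close> is a contraction, since
  \<open>\<parallel>A x\<parallel>\<^sup>2 \<le> C \<langle>A x, x\<rangle>\<close> by the Cauchy-Schwarz inequality for the form of \<open>A\<close>.
\<close>

corollary positive_operator_sqrt_exists:
  assumes H: "hilbert_space H" and A: "positive_operator H A"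
  shows "\<exists>B. positive_operator H B \<and> (\<forall>x\<in>hcarrier H. B (B x) = A x)"
proof -
  interpret H: hilbert_space H by (rule H)
  note P = H.pre_hilbert_axioms
  note Ab = positive_operatorD(1)[OF A]
  note a = bounded_operatorD[OF Ab]
  obtain C where C: "C > 0" "\<And>x. x \<in> hcarrier H \<Longrightarrow> hnorm H (A x) \<le> C * hnorm H x"
    using bounded_operator_bound[OF Ab P] by blast
  define X where "X x = x + (- 1 / complex_of_real C) *\<^sub>C A x" for x
  have X: "bounded_operator H H X"
    unfolding X_def by (intro bounded_operator_add bounded_operator_scaleC bounded_operator_id Ab P)
  have herm: "hinner H (X x) y = hinner H x (X y)" if "x \<in> hcarrier H" "y \<in> hcarrier H" for x y
    using that a positive_operator_hermitian[OF A P, of x y] by (simp add: X_def H.inner_simps)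
  have contr: "hnorm H (X x) \<le> hnorm H x" if x: "x \<in> hcarrier H" for x
  proof -
    define q where "q = Re (hinner H (A x) x)"
    have q: "0 \<le> q" using positive_operatorD(2)[OF A x] by (simp add: q_def complex_nonneg_Reals_iff)
    have "((hnorm H (A x))\<^sup>2)\<^sup>2 \<le> q * Re (hinner H (A (A x)) (A x))"
      using H.positive_Cauchy_Schwarz[OF a positive_operatorD(2)[OF A], of x "A x"] x a(1)
      by (simp add: q_def H.inner_self norm_power)
    also have "Re (hinner H (A (A x)) (A x)) \<le> C * (hnorm H (A x))\<^sup>2"
    proof -
      have "Re (hinner H (A (A x)) (A x)) \<le> hnorm H (A (A x)) * hnorm H (A x)"
        using H.Cauchy_Schwarz[of "A (A x)" "A x"] x a(1) complex_Re_le_cmod order_trans by meson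
      also have "\<dots> \<le> (C * hnorm H (A x)) * hnorm H (A x)"
        using C(2) a(1) x by (intro mult_right_mono) auto
      finally show ?thesis by (simp add: power2_eq_square mult.assoc)
    qed
    finally have "((hnorm H (A x))\<^sup>2) * (hnorm H (A x))\<^sup>2 \<le> (q * C) * (hnorm H (A x))\<^sup>2"
      using q by (simp add: mult_left_mono power2_eq_square mult.assoc)
    then have le: "(hnorm H (A x))\<^sup>2 \<le> q * C"
    proof (cases "(hnorm H (A x))\<^sup>2 = 0")
      case False
      then have "0 < (hnorm H (A x))\<^sup>2" by simp
      then show ?thesis using \<open>_ * _ \<le> (q * C) * _\<close> mult_right_le_imp_le by blast
    qed (use q C(1) in simp)
    have "(hnorm H (X x))\<^sup>2 = (hnorm H x)\<^sup>2 - 2 * q / C + (hnorm H (A x))\<^sup>2 / C\<^sup>2"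
      using x a(1) C(1) H.inner_commute[of x "A x"]
      by (simp add: X_def H.hnorm_diff_sq H.inner_simps H.hnorm_scaleC power_mult_distrib
          power_divide q_def norm_divide)
    also have "\<dots> \<le> (hnorm H x)\<^sup>2 - 2 * q / C + q * C / C\<^sup>2"
      using le by (intro add_left_mono divide_right_mono) auto
    also have "\<dots> = (hnorm H x)\<^sup>2 - q / C" using C(1) by (simp add: power2_eq_square)
    also have "\<dots> \<le> (hnorm H x)\<^sup>2" using q C(1) by simp
    finally show ?thesis
      by (rule power2_le_imp_le) (use x in simp)
  qed
  obtain B where B: "positive_operator H B" "\<And>x. x \<in> hcarrier H \<Longrightarrow> B (B x) = x - X x"
    using sqrt_one_minus_contraction[OF H X herm contr] by blast
  note b = bounded_operatorD[OF positive_operatorD(1)[OF B(1)]]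
  define c where "c = complex_of_real (sqrt C)"
  have c2: "c * c = complex_of_real C" using C(1) by (simp add: c_def flip: of_real_mult)
  define B' where "B' x = c *\<^sub>C B x" for x
  have "positive_operator H B'"
    unfolding positive_operator_def
  proof (intro conjI ballI)
    show "bounded_operator H H B'"
      unfolding B'_def by (intro bounded_operator_scaleC P positive_operatorD(1)[OF B(1)])
    fix x assume x: "x \<in> hcarrier H"
    have "hinner H (B' x) x = c * hinner H (B x) x" using x b by (simp add: B'_def H.inner_simps)
    then show "hinner H (B' x) x \<in> \<real>\<^sub>\<ge>\<^sub>0"
      using positive_operatorD(2)[OF B(1) x] C(1) by (simp add: c_def complex_nonneg_Reals_iff)
  qed
  moreover have "B' (B' x) = A x" if x: "x \<in> hcarrier H" for x
  proof -
    have "B' (B' x) = (c * c) *\<^sub>C (x - X x)"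
      using x b B(2) by (simp add: B'_def scaleC_scaleC)
    also have "\<dots> = A x"
      using C(1) unfolding c2 by (simp add: X_def scaleC_scaleC cvec.scale_minus_left flip: scaleC_scaleC)
        (simp add: scaleC_scaleC scaleC_one)
    finally show ?thesis .
  qed
  ultimately show ?thesis by blast
qed

lemma operator_sqrt:
  assumes "hilbert_space H" "positive_operator H A"
  shows "positive_operator H (operator_sqrt H A)"
    and "x \<in> hcarrier H \<Longrightarrow> operator_sqrt H A (operator_sqrt H A x) = A x"
  using someI_ex[OF positive_operator_sqrt_exists[OF assms]] unfolding operator_sqrt_def by blast+

section \<open>Square-summable families\<close>

definition l2_space :: "'i set \<Rightarrow> 'e::complex_vector hilbert \<Rightarrow> ('i \<Rightarrow> 'e) hilbert"
  where "l2_space I E =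
    \<lparr>hcarrier = {a. (\<forall>i\<in>I. a i \<in> hcarrier E) \<and> (\<forall>i. i \<notin> I \<longrightarrow> a i = 0) \<and>
        (\<lambda>i. (hnorm E (a i))\<^sup>2) summable_on I},
     hinner = (\<lambda>a b. \<Sum>\<^sub>\<infinity>i\<in>I. hinner E (a i) (b i))\<rparr>"

lemma l2_carrierI:
  assumes "\<And>i. i \<in> I \<Longrightarrow> a i \<in> hcarrier E" "\<And>i. i \<notin> I \<Longrightarrow> a i = 0"
    "(\<lambda>i. (hnorm E (a i))\<^sup>2) summable_on I"
  shows "a \<in> hcarrier (l2_space I E)"
  using assms by (simp add: l2_space_def)

lemma l2_carrierD:
  assumes "a \<in> hcarrier (l2_space I E)"
  shows "i \<in> I \<Longrightarrow> a i \<in> hcarrier E" "i \<notin> I \<Longrightarrow> a i = 0"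
    "(\<lambda>i. (hnorm E (a i))\<^sup>2) summable_on I"
  using assms by (auto simp: l2_space_def)

lemma l2_inner: "hinner (l2_space I E) a b = (\<Sum>\<^sub>\<infinity>i\<in>I. hinner E (a i) (b i))"
  by (simp add: l2_space_def)

context pre_hilbert
begin

lemma hnorm_add_sq_le:
  assumes "x \<in> hcarrier H" "y \<in> hcarrier H"
  shows "(hnorm H (x + y))\<^sup>2 \<le> 2 * (hnorm H x)\<^sup>2 + 2 * (hnorm H y)\<^sup>2"
  using hnorm_add_sq[of x y] hnorm_diff_sq[of x y] assms zero_le_power2[of "hnorm H (x - y)"]
  by linarith

lemma l2_inner_abs_summable:
  assumes "a \<in> hcarrier (l2_space I H)" "b \<in> hcarrier (l2_space I H)"
  shows "(\<lambda>i. cmod (hinner H (a i) (b i))) summable_on I"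
proof (rule summable_on_comparison_test)
  show "(\<lambda>i. (hnorm H (a i))\<^sup>2 + (hnorm H (b i))\<^sup>2) summable_on I"
    using assms by (intro summable_on_add l2_carrierD(3))
  fix i assume i: "i \<in> I"
  have "cmod (hinner H (a i) (b i)) \<le> hnorm H (a i) * hnorm H (b i)"
    using i by (intro Cauchy_Schwarz l2_carrierD(1)[OF assms(1)] l2_carrierD(1)[OF assms(2)])
  also have "\<dots> \<le> (hnorm H (a i))\<^sup>2 + (hnorm H (b i))\<^sup>2"
    using sum_squares_bound[of "hnorm H (a i)" "hnorm H (b i)"]
      zero_le_power2[of "hnorm H (a i)"] zero_le_power2[of "hnorm H (b i)"] by linarith
  finally show "cmod (hinner H (a i) (b i)) \<le> (hnorm H (a i))\<^sup>2 + (hnorm H (b i))\<^sup>2" .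
qed simp

lemma l2_inner_has_sum:
  assumes "a \<in> hcarrier (l2_space I H)" "b \<in> hcarrier (l2_space I H)"
  shows "((\<lambda>i. hinner H (a i) (b i)) has_sum hinner (l2_space I H) a b) I"
  unfolding l2_inner by (rule has_sum_infsum[OF abs_summable_summable[OF l2_inner_abs_summable[OF assms]]])

lemma l2_hnorm_has_sum:
  assumes a: "a \<in> hcarrier (l2_space I H)"
  shows "((\<lambda>i. (hnorm H (a i))\<^sup>2) has_sum (hnorm (l2_space I H) a)\<^sup>2) I"
proof -
  have "((\<lambda>i. Re (hinner H (a i) (a i))) has_sum Re (hinner (l2_space I H) a a)) I"
    by (rule has_sum_Re[OF l2_inner_has_sum[OF a a]])
  then have *: "((\<lambda>i. (hnorm H (a i))\<^sup>2) has_sum Re (hinner (l2_space I H) a a)) I"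
    by (rule has_sum_cong[THEN iffD1, rotated]) (simp add: hnorm_sq l2_carrierD(1)[OF a])
  moreover have "0 \<le> Re (hinner (l2_space I H) a a)"
    by (rule has_sum_nonneg[OF *]) simp
  ultimately show ?thesis by (simp add: hnorm_def)
qed

lemma l2_pre_hilbert: "pre_hilbert (l2_space I H)"
proof
  fix a b c :: "'b \<Rightarrow> 'a" and t :: complex
  let ?L = "l2_space I H"
  show "0 \<in> hcarrier ?L" by (rule l2_carrierI) auto
  show "a + b \<in> hcarrier ?L" if ab: "a \<in> hcarrier ?L" "b \<in> hcarrier ?L"
  proof (rule l2_carrierI)
    show "(\<lambda>i. (hnorm H ((a + b) i))\<^sup>2) summable_on I"
    proof (rule summable_on_comparison_test)
      show "(\<lambda>i. 2 * (hnorm H (a i))\<^sup>2 + 2 * (hnorm H (b i))\<^sup>2) summable_on I"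
        using ab by (intro summable_on_add summable_on_cmult_right l2_carrierD(3))
    qed (use ab in \<open>auto simp: l2_carrierD intro!: hnorm_add_sq_le\<close>)
  qed (use ab in \<open>auto simp: l2_carrierD\<close>)
  show "t *\<^sub>C a \<in> hcarrier ?L" if a: "a \<in> hcarrier ?L"
  proof (rule l2_carrierI)
    have "(\<lambda>i. (cmod t)\<^sup>2 * (hnorm H (a i))\<^sup>2) summable_on I"
      using a by (intro summable_on_cmult_right l2_carrierD(3))
    then show "(\<lambda>i. (hnorm H ((t *\<^sub>C a) i))\<^sup>2) summable_on I"
      by (rule summable_on_cong[THEN iffD1, rotated])
        (simp add: scaleC_fun_def hnorm_scaleC l2_carrierD(1)[OF a] power_mult_distrib)
  qed (use a in \<open>auto simp: l2_carrierD scaleC_fun_def\<close>)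
  show "hinner ?L (a + b) c = hinner ?L a c + hinner ?L b c"
    if m: "a \<in> hcarrier ?L" "b \<in> hcarrier ?L" "c \<in> hcarrier ?L"
  proof -
    have "((\<lambda>i. hinner H ((a + b) i) (c i)) has_sum (hinner ?L a c + hinner ?L b c)) I"
      using has_sum_add[OF l2_inner_has_sum[OF m(1,3)] l2_inner_has_sum[OF m(2,3)]]
      by (rule has_sum_cong[THEN iffD1, rotated]) (simp add: l2_carrierD(1)[OF m(1)] l2_carrierD(1)[OF m(2)] l2_carrierD(1)[OF m(3)] inner_simps)
    then show ?thesis unfolding l2_inner by (rule infsumI)
  qed
  show "hinner ?L (t *\<^sub>C a) b = t * hinner ?L a b"
    if m: "a \<in> hcarrier ?L" "b \<in> hcarrier ?L"
  proof -
    have "((\<lambda>i. hinner H ((t *\<^sub>C a) i) (b i)) has_sum (t * hinner ?L a b)) I"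
      using has_sum_cmult_right[OF l2_inner_has_sum[OF m], of t]
      by (rule has_sum_cong[THEN iffD1, rotated])
        (simp add: l2_carrierD(1)[OF m(1)] l2_carrierD(1)[OF m(2)] inner_simps scaleC_fun_def)
    then show ?thesis unfolding l2_inner by (rule infsumI)
  qed
  show "hinner ?L a b = cnj (hinner ?L b a)"
    if m: "a \<in> hcarrier ?L" "b \<in> hcarrier ?L"
  proof -
    have "((\<lambda>i. cnj (hinner H (b i) (a i))) has_sum cnj (hinner ?L b a)) I"
      using l2_inner_has_sum[OF m(2,1)] by simp
    then have "((\<lambda>i. hinner H (a i) (b i)) has_sum cnj (hinner ?L b a)) I"
      by (rule has_sum_cong[THEN iffD1, rotated])
        (rule inner_commute[symmetric, OF l2_carrierD(1)[OF m(1)] l2_carrierD(1)[OF m(2)]])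
    then show ?thesis unfolding l2_inner by (rule infsumI)
  qed
  show "0 \<le> Re (hinner ?L a a)" if a: "a \<in> hcarrier ?L"
  proof -
    have "((\<lambda>i. Re (hinner H (a i) (a i))) has_sum Re (hinner ?L a a)) I"
      by (rule has_sum_Re[OF l2_inner_has_sum[OF a a]])
    then show ?thesis
      by (rule has_sum_nonneg) (simp add: inner_nonneg l2_carrierD(1)[OF a])
  qed
  show "a = 0" if a: "a \<in> hcarrier ?L" and 0: "hinner ?L a a = 0"
  proof
    fix i
    have "((\<lambda>i. (hnorm H (a i))\<^sup>2) has_sum 0) I"
      using l2_hnorm_has_sum[OF a] 0 by (simp add: hnorm_def)
    then have "(hnorm H (a i))\<^sup>2 = 0" if "i \<in> I"
      by (rule nonneg_has_sum_le_0D[where A = I]) (use that in auto)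
    then show "a i = 0 i" using l2_carrierD(1,2)[OF a, of i] by (cases "i \<in> I") auto
  qed
qed

lemma l2_component_le:
  assumes a: "a \<in> hcarrier (l2_space I H)" and i: "i \<in> I"
  shows "hnorm H (a i) \<le> hnorm (l2_space I H) a"
proof -
  interpret L: pre_hilbert "l2_space I H" by (rule l2_pre_hilbert)
  have "(\<Sum>j\<in>{i}. (hnorm H (a j))\<^sup>2) \<le> (hnorm (l2_space I H) a)\<^sup>2"
    using i by (intro finite_sum_le_has_sum[OF l2_hnorm_has_sum[OF a]]) auto
  then show ?thesis using a by (simp add: power2_le_iff_abs_le l2_carrierD(1)[OF a i])
qed

definition l2_single :: "'i \<Rightarrow> 'a \<Rightarrow> 'i \<Rightarrow> 'a"
  where "l2_single i e = (\<lambda>j. if j = i then e else 0)"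

lemma l2_single_mem:
  assumes i: "i \<in> I" and e: "e \<in> hcarrier H"
  shows "l2_single i e \<in> hcarrier (l2_space I H)"
proof (rule l2_carrierI)
  have "(\<lambda>j. (hnorm H (l2_single i e j))\<^sup>2) summable_on {i}" by simp
  then show "(\<lambda>j. (hnorm H (l2_single i e j))\<^sup>2) summable_on I"
    by (rule summable_on_cong_neutral[THEN iffD1, rotated -1]) (use i in \<open>auto simp: l2_single_def\<close>)
qed (use i e in \<open>auto simp: l2_single_def\<close>)

lemma l2_single_inner:
  assumes i: "i \<in> I" and e: "e \<in> hcarrier H" and a: "a \<in> hcarrier (l2_space I H)"
  shows "hinner (l2_space I H) a (l2_single i e) = hinner H (a i) e"
proof -
  have "((\<lambda>j. hinner H (a j) (l2_single i e j)) has_sum hinner H (a i) e) {i}"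
    using has_sum_finite[of "{i}" "\<lambda>j. hinner H (a j) (l2_single i e j)"] by (simp add: l2_single_def)
  then have "((\<lambda>j. hinner H (a j) (l2_single i e j)) has_sum hinner H (a i) e) I"
    by (rule has_sum_cong_neutral[THEN iffD1, rotated -1])
      (use i l2_carrierD(1)[OF a] in \<open>auto simp: l2_single_def\<close>)
  then show ?thesis unfolding l2_inner by (rule infsumI)
qed

end

lemma (in hilbert_space) l2_hilbert: "hilbert_space (l2_space I H)"
proof -
  let ?L = "l2_space I H"
  interpret L: pre_hilbert ?L by (rule l2_pre_hilbert)
  show ?thesis
  proof (rule L.hilbert_spaceI)
    fix s assume s: "cauchy_in ?L s"
    have sm: "s n \<in> hcarrier ?L" for n using s by (simp add: cauchy_in_def)
    have comp: "hnorm H (s m i - s n i) \<le> hnorm ?L (s m - s n)" if "i \<in> I" for m n i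
      using l2_component_le[of "s m - s n" I i] sm that by simp
    have "\<exists>x. converges_in H (\<lambda>n. s n i) x" if i: "i \<in> I" for i
    proof (rule cauchy_converges, unfold cauchy_in_def, intro conjI allI impI)
      show "s n i \<in> hcarrier H" for n using l2_carrierD(1)[OF sm i] .
      fix \<epsilon> :: real assume "\<epsilon> > 0"
      then obtain N where "\<And>m n. m \<ge> N \<Longrightarrow> n \<ge> N \<Longrightarrow> hnorm ?L (s m - s n) < \<epsilon>"
        using s unfolding cauchy_in_def by blast
      then show "\<exists>N. \<forall>m\<ge>N. \<forall>n\<ge>N. hnorm H (s m i - s n i) < \<epsilon>"
        using comp[OF i] by (meson le_less_trans)
    qed
    then obtain a0 where a0: "\<And>i. i \<in> I \<Longrightarrow> converges_in H (\<lambda>n. s n i) (a0 i)" by metis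
    define a where "a i = (if i \<in> I then a0 i else 0)" for i
    have a: "converges_in H (\<lambda>n. s n i) (a i)" if "i \<in> I" for i using a0 that by (simp add: a_def)
    have am: "a i \<in> hcarrier H" if "i \<in> I" for i using a[OF that] by (simp add: converges_in_def)
    have key: "s n - a \<in> hcarrier ?L \<and> hnorm ?L (s n - a) \<le> \<epsilon>"
      if N: "\<And>m n. m \<ge> N \<Longrightarrow> n \<ge> N \<Longrightarrow> hnorm ?L (s m - s n) < \<epsilon>" and n: "n \<ge> N" and "\<epsilon> > 0"
      for \<epsilon> N n
    proof -
      have fin: "(\<Sum>i\<in>F. (hnorm H ((s n - a) i))\<^sup>2) \<le> \<epsilon>\<^sup>2" if F: "finite F" "F \<subseteq> I" for F
      proof (rule LIMSEQ_le_const2)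
        show "(\<lambda>m. \<Sum>i\<in>F. (hnorm H (s n i + (- 1) *\<^sub>C s m i))\<^sup>2)
            \<longlonglongrightarrow> (\<Sum>i\<in>F. (hnorm H ((s n - a) i))\<^sup>2)"
        proof (intro tendsto_sum tendsto_power)
          fix i assume "i \<in> F"
          then have "i \<in> I" using F by blast
          have "converges_in H (\<lambda>m. s n i + (- 1) *\<^sub>C s m i) (s n i + (- 1) *\<^sub>C a i)"
            by (intro converges_add converges_scaleC converges_const a \<open>i \<in> I\<close> l2_carrierD(1)[OF sm])
          from converges_hnorm[OF this]
          show "(\<lambda>m. hnorm H (s n i + (- 1) *\<^sub>C s m i)) \<longlonglongrightarrow> hnorm H ((s n - a) i)" by simp
        qed
        show "\<exists>M. \<forall>m\<ge>M. (\<Sum>i\<in>F. (hnorm H (s n i + (- 1) *\<^sub>C s m i))\<^sup>2) \<le> \<epsilon>\<^sup>2"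
        proof (intro exI[of _ N] allI impI)
          fix m assume m: "m \<ge> N"
          have "s n - s m \<in> hcarrier ?L" using sm by simp
          then have "(\<Sum>i\<in>F. (hnorm H ((s n - s m) i))\<^sup>2) \<le> (hnorm ?L (s n - s m))\<^sup>2"
            using F by (intro finite_sum_le_has_sum[OF l2_hnorm_has_sum[of "s n - s m"]]) auto
          also have "\<dots> \<le> \<epsilon>\<^sup>2"
            using N[OF n m] sm by (intro power_mono) auto
          finally show "(\<Sum>i\<in>F. (hnorm H (s n i + (- 1) *\<^sub>C s m i))\<^sup>2) \<le> \<epsilon>\<^sup>2" by simp
        qed
      qed
      have sum: "(\<lambda>i. (hnorm H ((s n - a) i))\<^sup>2) summable_on I"
        using fin by (intro nonneg_bdd_above_summable_on bdd_aboveI) auto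
      have mem: "s n - a \<in> hcarrier ?L"
        by (rule l2_carrierI[OF _ _ sum])
          (use am l2_carrierD(1)[OF sm] l2_carrierD(2)[OF sm] in \<open>auto simp: a_def\<close>)
      have "(hnorm ?L (s n - a))\<^sup>2 \<le> \<epsilon>\<^sup>2"
        using l2_hnorm_has_sum[OF mem] fin by (rule has_sum_le_finite_sums)
      then show ?thesis using mem \<open>\<epsilon> > 0\<close> by (auto intro: power2_le_imp_le)
    qed
    obtain N1 where N1: "\<And>m n. m \<ge> N1 \<Longrightarrow> n \<ge> N1 \<Longrightarrow> hnorm ?L (s m - s n) < 1"
      using s unfolding cauchy_in_def by (metis zero_less_one)
    have "s N1 - a \<in> hcarrier ?L" using key[of N1 1 N1] N1 by simp
    then have "s N1 - (s N1 - a) \<in> hcarrier ?L" by (rule L.diff_mem[OF sm])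
    then have aL: "a \<in> hcarrier ?L" by simp
    have "(\<lambda>n. hnorm ?L (s n - a)) \<longlonglongrightarrow> 0"
    proof (rule LIMSEQ_I)
      fix \<epsilon> :: real assume "\<epsilon> > 0"
      then have e2: "\<epsilon> / 2 > 0" by simp
      obtain N where N: "\<And>m n. m \<ge> N \<Longrightarrow> n \<ge> N \<Longrightarrow> hnorm ?L (s m - s n) < \<epsilon> / 2"
        using s e2 unfolding cauchy_in_def by metis
      have "norm (hnorm ?L (s n - a) - 0) < \<epsilon>" if "n \<ge> N" for n
        using key[of N "\<epsilon> / 2" n] N that e2 sm[of n] aL \<open>\<epsilon> > 0\<close> L.hnorm_nonneg[of "s n - a"] by auto
      then show "\<exists>N. \<forall>n\<ge>N. norm (hnorm ?L (s n - a) - 0) < \<epsilon>" by blast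
    qed
    then show "\<exists>x. converges_in ?L s x" using sm aL by (auto simp: converges_in_def)
  qed
qed

section \<open>Reproducing kernel spaces from square-summable features\<close>

inductive_set kernel_span ::
    "'x set \<Rightarrow> ('x \<Rightarrow> 'x \<Rightarrow> complex) \<Rightarrow> 'e::complex_vector hilbert \<Rightarrow> ('x \<Rightarrow> 'e) set"
  for X k E where
  zero: "0 \<in> kernel_span X k E"
| add: "\<lbrakk>f \<in> kernel_span X k E; w \<in> X; e \<in> hcarrier E\<rbrakk>
    \<Longrightarrow> f + (\<lambda>z. if z \<in> X then k z w *\<^sub>C e else 0) \<in> kernel_span X k E"

lemma is_rkhsD:
  assumes "is_rkhs X k E R"
  shows "hilbert_space R"
    "\<lbrakk>f \<in> hcarrier R; z \<in> X\<rbrakk> \<Longrightarrow> f z \<in> hcarrier E"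
    "\<lbrakk>f \<in> hcarrier R; z \<notin> X\<rbrakk> \<Longrightarrow> f z = 0"
    "\<lbrakk>w \<in> X; e \<in> hcarrier E\<rbrakk> \<Longrightarrow> (\<lambda>z. if z \<in> X then k z w *\<^sub>C e else 0) \<in> hcarrier R"
    "\<lbrakk>w \<in> X; e \<in> hcarrier E; f \<in> hcarrier R\<rbrakk>
      \<Longrightarrow> hinner R f (\<lambda>z. if z \<in> X then k z w *\<^sub>C e else 0) = hinner E (f w) e"
  using assms unfolding is_rkhs_def by blast+

text \<open>
  A vector orthogonal to all kernel functions vanishes at every point, by the reproducing property.
\<close>

lemma kernel_span_dense:
  assumes R: "is_rkhs X k E R" and E: "hilbert_space E" and f: "f \<in> hcarrier R"
  shows "\<exists>s. (\<forall>n. s n \<in> kernel_span X k E) \<and> converges_in R s f"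
proof -
  interpret R: hilbert_space R by (rule is_rkhsD(1)[OF R])
  interpret E: hilbert_space E by (rule E)
  let ?S = "kernel_span X k E"
  let ?\<kappa> = "\<lambda>w e z. if z \<in> X then k z w *\<^sub>C e else 0"
  have sub: "g \<in> hcarrier R" if "g \<in> ?S" for g
    using that
  proof induction
    case zero
    show ?case by (rule R.zero_mem)
  next
    case (add f w e)
    show ?case by (rule R.add_mem) (use add is_rkhsD(4)[OF R] in auto)
  qed
  have add: "g + h \<in> ?S" if "g \<in> ?S" "h \<in> ?S" for g h
    using that(2,1)
  proof induction
    case (add h w e)
    have "(g + h) + ?\<kappa> w e \<in> ?S" by (rule kernel_span.add) (use add in auto)
    then show ?case by (simp only: add.assoc)
  qed simp
  have scale: "c *\<^sub>C g \<in> ?S" if "g \<in> ?S" for c g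
    using that
  proof induction
    case zero
    have "c *\<^sub>C 0 \<in> ?S" by (simp add: kernel_span.zero)
    then show ?case .
  next
    case (add h w e)
    have "c *\<^sub>C h + ?\<kappa> w (c *\<^sub>C e) \<in> ?S" by (rule kernel_span.add) (use add in auto)
    also have "c *\<^sub>C h + ?\<kappa> w (c *\<^sub>C e) = c *\<^sub>C (h + ?\<kappa> w e)"
      by (auto simp: fun_eq_iff scaleC_fun_def scaleC_add_right scaleC_scaleC mult.commute)
    finally show ?case .
  qed
  have cl: "closed_subspace R (hclosure R ?S)"
    by (rule R.hclosure_closed_subspace) (use sub add scale kernel_span.zero in auto)
  have subS: "?S \<subseteq> hclosure R ?S" by (rule R.subset_hclosure) (use sub in auto)
  have "f \<in> hclosure R ?S"
  proof (rule R.double_orth_compl[OF cl f])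
    fix g assume g: "g \<in> orth_compl R (hclosure R ?S)"
    then have gR: "g \<in> hcarrier R" by (simp add: orth_compl_def)
    have "hinner E (g w) e = 0" if "w \<in> X" "e \<in> hcarrier E" for w e
    proof -
      have "0 + ?\<kappa> w e \<in> ?S" by (rule kernel_span.add[OF kernel_span.zero that])
      then have "hinner R g (?\<kappa> w e) = 0" using g subS by (auto simp: orth_compl_def)
      then show ?thesis using is_rkhsD(5)[OF R that gR] by simp
    qed
    then have "g w = 0" for w
      using is_rkhsD(2,3)[OF R gR, of w] E.inner_eq_zero[of "g w"] by (cases "w \<in> X") auto
    then have "g = 0" by (simp add: fun_eq_iff)
    then show "hinner R g f = 0" using f by simp
  qed
  then show ?thesis using sub by (subst (asm) R.hclosure_iff) auto
qed

text \<open>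
  The inner products of two spaces with the same kernel agree on the finite combinations of kernel
  functions, because they are prescribed by the kernel. Hence a sequence of such combinations that is
  Cauchy in one space is Cauchy in the other. The two limits agree, since evaluation at a point is an
  inner product with a kernel function.
\<close>

lemma is_rkhs_unique:
  assumes R: "is_rkhs X k E R" and R': "is_rkhs X k E R'" and E: "hilbert_space E"
    and f: "f \<in> hcarrier R"
  shows "f \<in> hcarrier R'"
    and "g \<in> hcarrier R \<Longrightarrow> hinner R f g = hinner R' f g"
proof -
  interpret R: hilbert_space R by (rule is_rkhsD(1)[OF R])
  interpret R': hilbert_space R' by (rule is_rkhsD(1)[OF R'])
  interpret E: hilbert_space E by (rule E)
  let ?S = "kernel_span X k E"
  let ?\<kappa> = "\<lambda>w e z. if z \<in> X then k z w *\<^sub>C e else 0"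
  have sub: "g \<in> hcarrier R \<and> g \<in> hcarrier R'" if "g \<in> ?S" for g
    using that
  proof induction
    case zero
    show ?case using R.zero_mem R'.zero_mem by blast
  next
    case (add f w e)
    then show ?case
      using R.add_mem R'.add_mem is_rkhsD(4)[OF R, of w e] is_rkhsD(4)[OF R', of w e] by blast
  qed
  have same: "hinner R h g = hinner R' h g" if "g \<in> ?S" "h \<in> ?S" for g h
    using that
  proof induction
    case zero
    have "hinner R h 0 = hinner R' h 0" using sub zero by simp
    then show ?case .
  next
    case (add g w e)
    then have "hinner R h (g + ?\<kappa> w e) = hinner R' h (g + ?\<kappa> w e)"
      using sub[of g] sub[of h] is_rkhsD(4)[OF R, of w e] is_rkhsD(4)[OF R', of w e]
        is_rkhsD(5)[OF R, of w e h] is_rkhsD(5)[OF R', of w e h]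
      by (simp add: R.inner_simps R'.inner_simps)
    then show ?case .
  qed
  have diff: "g - h \<in> ?S" if "g \<in> ?S" "h \<in> ?S" for g h
    using that(2,1)
  proof induction
    case (add h w e)
    have "(g - h) + ?\<kappa> w (- e) \<in> ?S" by (rule kernel_span.add) (use add in auto)
    also have "(g - h) + ?\<kappa> w (- e) = g - (h + ?\<kappa> w e)" by (auto simp: fun_eq_iff)
    finally show ?case .
  qed simp
  have approx: "\<exists>s. (\<forall>n. s n \<in> ?S) \<and> converges_in R s g \<and> converges_in R' s g"
    if g: "g \<in> hcarrier R" for g
  proof -
    obtain s where s: "\<And>n. s n \<in> ?S" "converges_in R s g"
      using kernel_span_dense[OF R E g] by blast
    have "hnorm R (s m - s n) = hnorm R' (s m - s n)" for m n
      using same diff s(1) by (simp add: hnorm_def)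
    then have "cauchy_in R' s"
      using R.converges_imp_cauchy[OF s(2)] sub[OF s(1)] by (simp add: cauchy_in_def)
    then obtain g' where g': "converges_in R' s g'" using R'.cauchy_converges by blast
    have gm: "g' \<in> hcarrier R'" using g' by (simp add: converges_in_def)
    have "g w = g' w" for w
    proof (cases "w \<in> X")
      case w: True
      show ?thesis
      proof (rule E.eq_if_inner_eq)
        show "g w \<in> hcarrier E" "g' w \<in> hcarrier E"
          using is_rkhsD(2)[OF R g w] is_rkhsD(2)[OF R' gm w] .
        fix e assume e: "e \<in> hcarrier E"
        have "(\<lambda>n. hinner R (s n) (?\<kappa> w e)) \<longlonglongrightarrow> hinner R g (?\<kappa> w e)"
          by (intro R.converges_inner s R.converges_const is_rkhsD(4)[OF R w e])
        moreover have "(\<lambda>n. hinner R' (s n) (?\<kappa> w e)) \<longlonglongrightarrow> hinner R' g' (?\<kappa> w e)"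
          by (intro R'.converges_inner g' R'.converges_const is_rkhsD(4)[OF R' w e])
        ultimately have "(\<lambda>n. hinner E (s n w) e) \<longlonglongrightarrow> hinner E (g w) e"
          "(\<lambda>n. hinner E (s n w) e) \<longlonglongrightarrow> hinner E (g' w) e"
          using is_rkhsD(5)[OF R w e] is_rkhsD(5)[OF R' w e] sub[OF s(1)] g gm by auto
        then show "hinner E (g w) e = hinner E (g' w) e" by (rule LIMSEQ_unique)
      qed
    next
      case False
      then show ?thesis using is_rkhsD(3)[OF R g] is_rkhsD(3)[OF R' gm] by simp
    qed
    then have "g = g'" by auto
    then show ?thesis using s g' by blast
  qed
  obtain s where s: "\<And>n. s n \<in> ?S" "converges_in R s f" "converges_in R' s f"
    using approx[OF f] by blast
  then show "f \<in> hcarrier R'" by (simp add: converges_in_def)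
  assume g: "g \<in> hcarrier R"
  obtain t where t: "\<And>n. t n \<in> ?S" "converges_in R t g" "converges_in R' t g"
    using approx[OF g] by blast
  have "(\<lambda>n. hinner R (s n) (t n)) \<longlonglongrightarrow> hinner R f g" by (intro R.converges_inner s t)
  moreover have "(\<lambda>n. hinner R (s n) (t n)) \<longlonglongrightarrow> hinner R' f g"
    using R'.converges_inner[OF s(3) t(3)] same s(1) t(1) by simp
  ultimately show "hinner R f g = hinner R' f g" by (rule LIMSEQ_unique)
qed

text \<open>
  A factorization \<open>k z w = \<Sum>\<^sub>p \<phi>\<^sub>p z \<open>cnj\<close> (\<phi>\<^sub>p w)\<close> of a kernel makes its space explicit: it consists of the
  functions \<open>\<Sum>\<^sub>p \<phi>\<^sub>p a\<^sub>p\<close> with square-summable coefficients \<open>a\<^sub>p\<close>. Independence of the features \<open>\<phi>\<^sub>p\<close> makes the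
  coefficients unique, so that they are coordinates.
\<close>

locale feature_kernel = E: hilbert_space E
  for E :: "'e::complex_vector hilbert" +
  fixes X :: "'x set" and k :: "'x \<Rightarrow> 'x \<Rightarrow> complex" and I :: "'i set"
    and \<phi> :: "'i \<Rightarrow> 'x \<Rightarrow> complex"
  assumes feature_summable: "z \<in> X \<Longrightarrow> (\<lambda>p. (cmod (\<phi> p z))\<^sup>2) summable_on I"
    and kernel_eq: "\<lbrakk>z \<in> X; w \<in> X\<rbrakk> \<Longrightarrow> ((\<lambda>p. \<phi> p z * cnj (\<phi> p w)) has_sum k z w) I"
    and feature_independent:
      "\<lbrakk>(\<lambda>p. (cmod (a p))\<^sup>2) summable_on I;
        \<And>z. z \<in> X \<Longrightarrow> ((\<lambda>p. \<phi> p z * a p) has_sum 0) I; p \<in> I\<rbrakk> \<Longrightarrow> a p = 0"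
begin

abbreviation "L \<equiv> l2_space I E"

definition coeff_kernel :: "'x \<Rightarrow> 'e \<Rightarrow> 'i \<Rightarrow> 'e"
  where "coeff_kernel z e = (\<lambda>p. if p \<in> I then cnj (\<phi> p z) *\<^sub>C e else 0)"

text \<open>
  The value at \<open>z\<close> is \<open>\<Sum>\<^sub>p \<phi>\<^sub>p z a\<^sub>p\<close>. Defining it by the adjoint of \<^const>\<open>coeff_kernel\<close> avoids the
  convergence of series of vectors: only series of inner products with a fixed vector occur.
\<close>

definition synth :: "('i \<Rightarrow> 'e) \<Rightarrow> 'x \<Rightarrow> 'e"
  where "synth a = (\<lambda>z. if z \<in> X then adjoint E L (coeff_kernel z) a else 0)"

sublocale L: hilbert_space L by (rule E.l2_hilbert)

lemma coeff_kernel_bounded: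
  assumes z: "z \<in> X"
  shows "bounded_operator E L (coeff_kernel z)"
proof (rule bounded_operatorI[where C = "sqrt (\<Sum>\<^sub>\<infinity>p\<in>I. (cmod (\<phi> p z))\<^sup>2)"])
  fix e assume e: "e \<in> hcarrier E"
  have "((\<lambda>p. (cmod (\<phi> p z))\<^sup>2 * (hnorm E e)\<^sup>2) has_sum
      (\<Sum>\<^sub>\<infinity>p\<in>I. (cmod (\<phi> p z))\<^sup>2) * (hnorm E e)\<^sup>2) I"
    by (intro has_sum_cmult_left has_sum_infsum feature_summable z)
  then have *: "((\<lambda>p. (hnorm E (coeff_kernel z e p))\<^sup>2) has_sum
      (\<Sum>\<^sub>\<infinity>p\<in>I. (cmod (\<phi> p z))\<^sup>2) * (hnorm E e)\<^sup>2) I"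
    by (rule has_sum_cong[THEN iffD1, rotated])
      (simp add: coeff_kernel_def E.hnorm_scaleC e power_mult_distrib)
  show m: "coeff_kernel z e \<in> hcarrier L"
    by (rule l2_carrierI[OF _ _ has_sum_imp_summable[OF *]]) (auto simp: coeff_kernel_def e)
  have "(hnorm L (coeff_kernel z e))\<^sup>2 = (\<Sum>\<^sub>\<infinity>p\<in>I. (cmod (\<phi> p z))\<^sup>2) * (hnorm E e)\<^sup>2"
    using E.l2_hnorm_has_sum[OF m] * by (rule has_sum_unique)
  then have "hnorm L (coeff_kernel z e) = sqrt (\<Sum>\<^sub>\<infinity>p\<in>I. (cmod (\<phi> p z))\<^sup>2) * hnorm E e"
    using m e by (metis L.hnorm_nonneg E.hnorm_nonneg real_sqrt_mult real_sqrt_unique)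
  then show "hnorm L (coeff_kernel z e) \<le> sqrt (\<Sum>\<^sub>\<infinity>p\<in>I. (cmod (\<phi> p z))\<^sup>2) * hnorm E e" by simp
qed (auto simp: coeff_kernel_def fun_eq_iff scaleC_fun_def scaleC_add_right scaleC_scaleC mult.commute)

lemma coeff_kernel_mem: "\<lbrakk>z \<in> X; e \<in> hcarrier E\<rbrakk> \<Longrightarrow> coeff_kernel z e \<in> hcarrier L"
  using bounded_operatorD(1)[OF coeff_kernel_bounded] .

lemma coeff_kernel_inner:
  assumes "z \<in> X" "a \<in> hcarrier L" "e \<in> hcarrier E"
  shows "((\<lambda>p. \<phi> p z * hinner E (a p) e) has_sum hinner L a (coeff_kernel z e)) I"
  using E.l2_inner_has_sum[OF assms(2) coeff_kernel_mem[OF assms(1,3)]]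
  by (rule has_sum_cong[THEN iffD1, rotated])
    (simp add: coeff_kernel_def E.inner_simps assms l2_carrierD(1)[OF assms(2)])

lemma synth_mem: "\<lbrakk>z \<in> X; a \<in> hcarrier L\<rbrakk> \<Longrightarrow> synth a z \<in> hcarrier E"
  using adjoint_mem[OF E.hilbert_space_axioms L.pre_hilbert_axioms coeff_kernel_bounded]
  by (simp add: synth_def)

lemma synth_inner_eq:
  "\<lbrakk>z \<in> X; a \<in> hcarrier L; e \<in> hcarrier E\<rbrakk> \<Longrightarrow> hinner E (synth a z) e = hinner L a (coeff_kernel z e)"
  using adjoint_inner'[OF E.hilbert_space_axioms L.pre_hilbert_axioms coeff_kernel_bounded]
  by (simp add: synth_def)

lemma synth_inner:
  assumes "z \<in> X" "a \<in> hcarrier L" "e \<in> hcarrier E"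
  shows "((\<lambda>p. \<phi> p z * hinner E (a p) e) has_sum hinner E (synth a z) e) I"
  using coeff_kernel_inner[OF assms] synth_inner_eq[OF assms] by simp

lemma synth_eqI:
  assumes a: "a \<in> hcarrier L" and f: "\<And>z. z \<in> X \<Longrightarrow> f z \<in> hcarrier E"
    "\<And>z. z \<notin> X \<Longrightarrow> f z = 0"
    and sum: "\<And>z e. \<lbrakk>z \<in> X; e \<in> hcarrier E\<rbrakk>
        \<Longrightarrow> ((\<lambda>p. \<phi> p z * hinner E (a p) e) has_sum hinner E (f z) e) I"
  shows "synth a = f"
proof
  fix z
  show "synth a z = f z"
  proof (cases "z \<in> X")
    case True
    then show ?thesis
      using synth_mem[OF True a] f(1) synth_inner[OF True a] sum[OF True]
      by (intro E.eq_if_inner_eq) (auto dest: has_sum_unique)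
  qed (simp add: synth_def f)
qed

lemma synth_add: "\<lbrakk>a \<in> hcarrier L; b \<in> hcarrier L\<rbrakk> \<Longrightarrow> synth (a + b) = synth a + synth b"
proof
  fix z assume m: "a \<in> hcarrier L" "b \<in> hcarrier L"
  show "synth (a + b) z = (synth a + synth b) z"
  proof (cases "z \<in> X")
    case z: True
    show ?thesis
      by (rule E.eq_if_inner_eq)
        (use z m in \<open>auto simp: synth_mem synth_inner_eq E.inner_simps L.inner_simps coeff_kernel_mem\<close>)
  qed (simp add: synth_def)
qed

lemma synth_scaleC: "a \<in> hcarrier L \<Longrightarrow> synth (c *\<^sub>C a) = c *\<^sub>C synth a"
proof
  fix z assume m: "a \<in> hcarrier L"
  have app: "(c *\<^sub>C synth a) z = c *\<^sub>C synth a z" by (simp add: scaleC_fun_def)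
  show "synth (c *\<^sub>C a) z = (c *\<^sub>C synth a) z"
  proof (cases "z \<in> X")
    case z: True
    show ?thesis
      unfolding app
      by (rule E.eq_if_inner_eq)
        (use z m in \<open>auto simp: synth_mem synth_inner_eq E.inner_simps L.inner_simps coeff_kernel_mem\<close>)
  qed (simp add: synth_def scaleC_fun_def)
qed

lemma synth_eq_0:
  assumes a: "a \<in> hcarrier L" and 0: "synth a = 0"
  shows "a = 0"
proof
  fix p
  show "a p = 0 p"
  proof (cases "p \<in> I")
    case p: True
    have ap: "a q \<in> hcarrier E" if "q \<in> I" for q using l2_carrierD(1)[OF a that] .
    have "hinner E (a p) e = 0" if e: "e \<in> hcarrier E" for e
    proof (rule feature_independent[OF _ _ p])
      show "(\<lambda>p. (cmod (hinner E (a p) e))\<^sup>2) summable_on I"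
      proof (rule summable_on_comparison_test)
        show "(\<lambda>p. (hnorm E (a p))\<^sup>2 * (hnorm E e)\<^sup>2) summable_on I"
          by (intro summable_on_cmult_left l2_carrierD(3)[OF a])
        show "(cmod (hinner E (a p) e))\<^sup>2 \<le> (hnorm E (a p))\<^sup>2 * (hnorm E e)\<^sup>2" if "p \<in> I" for p
          using E.Cauchy_Schwarz[OF ap[OF that] e] power_mono[of "cmod (hinner E (a p) e)" _ 2]
          by (simp flip: power_mult_distrib)
      qed auto
      show "((\<lambda>p. \<phi> p z * hinner E (a p) e) has_sum 0) I" if "z \<in> X" for z
        using synth_inner[OF that a e] 0 e by simp
    qed
    then show ?thesis using E.inner_eq_zero[of "a p"] ap[OF p] by simp
  qed (simp add: l2_carrierD(2)[OF a])
qed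

lemma synth_inj: "inj_on synth (hcarrier L)"
proof (rule inj_onI)
  fix a b assume m: "a \<in> hcarrier L" "b \<in> hcarrier L" and eq: "synth a = synth b"
  have "synth (a + (- 1) *\<^sub>C b) = 0" using m eq by (simp only: synth_add synth_scaleC L.scaleC_mem) simp
  then have "a + (- 1) *\<^sub>C b = 0" using m by (intro synth_eq_0) auto
  then show "a = b" by simp
qed

text \<open>
  The inner product of \<open>\<ell>\<^sup>2\<close>, transported to functions.
\<close>

definition feature_space :: "('x \<Rightarrow> 'e) hilbert"
  where "feature_space = \<lparr>hcarrier = synth ` hcarrier L,
    hinner = (\<lambda>f g. hinner L (the_inv_into (hcarrier L) synth f) (the_inv_into (hcarrier L) synth g))\<rparr>"

lemma feature_space_inner:
  "\<lbrakk>a \<in> hcarrier L; b \<in> hcarrier L\<rbrakk> \<Longrightarrow> hinner feature_space (synth a) (synth b) = hinner L a b"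
  by (simp add: feature_space_def the_inv_into_f_f[OF synth_inj])

lemma feature_space_hilbert: "hilbert_space feature_space"
proof -
  have c: "hcarrier feature_space = synth ` hcarrier L" by (simp add: feature_space_def)
  have "synth 0 = 0" using synth_scaleC[of 0 0] by simp
  interpret F: pre_hilbert feature_space
  proof
    show "0 \<in> hcarrier feature_space" unfolding c using \<open>synth 0 = 0\<close> L.zero_mem by (metis image_eqI)
    fix f g h :: "'x \<Rightarrow> 'e" and t :: complex
    assume "f \<in> hcarrier feature_space"
    then obtain a where a: "a \<in> hcarrier L" "f = synth a" by (auto simp: c)
    show "t *\<^sub>C f \<in> hcarrier feature_space"
      unfolding c a(2) using a(1) by (metis L.scaleC_mem image_eqI synth_scaleC)
    show "0 \<le> Re (hinner feature_space f f)" using a by (simp add: feature_space_inner L.inner_nonneg)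
    show "f = 0" if "hinner feature_space f f = 0"
      using that a \<open>synth 0 = 0\<close> L.inner_eq_zero[of a] by (simp add: feature_space_inner)
    assume "g \<in> hcarrier feature_space"
    then obtain b where b: "b \<in> hcarrier L" "g = synth b" by (auto simp: c)
    show "f + g \<in> hcarrier feature_space"
      unfolding c a(2) b(2) using a(1) b(1) by (metis L.add_mem image_eqI synth_add)
    show "hinner feature_space (t *\<^sub>C f) g = t * hinner feature_space f g"
      using a b by (simp add: feature_space_inner L.inner_simps flip: synth_scaleC)
    show "hinner feature_space f g = cnj (hinner feature_space g f)"
      using a b L.inner_commute[of a b] by (simp add: feature_space_inner)
    assume "h \<in> hcarrier feature_space"
    then obtain d where d: "d \<in> hcarrier L" "h = synth d" by (auto simp: c)
    show "hinner feature_space (f + g) h = hinner feature_space f h + hinner feature_space g h"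
      using a b d by (simp add: feature_space_inner L.inner_simps flip: synth_add)
  qed
  have synth_diff: "synth (a - b) = synth a - synth b" if "a \<in> hcarrier L" "b \<in> hcarrier L" for a b
    using synth_add[of a "(- 1) *\<^sub>C b"] synth_scaleC[of b "- 1"] that by simp
  have norm: "hnorm feature_space (synth a - synth b) = hnorm L (a - b)"
    if "a \<in> hcarrier L" "b \<in> hcarrier L" for a b
    using that by (simp add: hnorm_def feature_space_inner flip: synth_diff)
  show ?thesis
  proof (rule F.hilbert_spaceI)
    fix s assume s: "cauchy_in feature_space s"
    then have "\<forall>n. \<exists>a. a \<in> hcarrier L \<and> s n = synth a" by (auto simp: cauchy_in_def c)
    then obtain a where a: "\<And>n. a n \<in> hcarrier L" "\<And>n. s n = synth (a n)" by metis
    have "cauchy_in L a" using s a norm by (simp add: cauchy_in_def)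
    then obtain b where b: "converges_in L a b" using L.cauchy_converges by blast
    then have "converges_in feature_space s (synth b)"
      using a norm by (simp add: converges_in_def c)
    then show "\<exists>x. converges_in feature_space s x" by blast
  qed
qed

lemma feature_space_is_rkhs: "is_rkhs X k E feature_space"
  unfolding is_rkhs_def
proof (intro conjI ballI allI impI)
  show "hilbert_space feature_space" by (rule feature_space_hilbert)
  have c: "hcarrier feature_space = synth ` hcarrier L" by (simp add: feature_space_def)
  show "f z \<in> hcarrier E" if "f \<in> hcarrier feature_space" "z \<in> X" for f z
    using that synth_mem by (auto simp: c)
  show "f z = 0" if "f \<in> hcarrier feature_space" "z \<notin> X" for f z
    using that by (auto simp: c synth_def)
  fix w e assume w: "w \<in> X" and e: "e \<in> hcarrier E"
  have eq: "synth (coeff_kernel w e) = (\<lambda>z. if z \<in> X then k z w *\<^sub>C e else 0)"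
  proof (rule synth_eqI)
    fix z f assume z: "z \<in> X" and f: "f \<in> hcarrier E"
    have "((\<lambda>p. \<phi> p z * cnj (\<phi> p w) * hinner E e f) has_sum k z w * hinner E e f) I"
      by (rule has_sum_cmult_left[OF kernel_eq[OF z w]])
    then have "((\<lambda>p. \<phi> p z * hinner E (coeff_kernel w e p) f) has_sum k z w * hinner E e f) I"
      by (rule has_sum_cong[THEN iffD1, rotated]) (simp add: coeff_kernel_def E.inner_simps e f)
    then show "((\<lambda>p. \<phi> p z * hinner E (coeff_kernel w e p) f) has_sum
        hinner E (if z \<in> X then k z w *\<^sub>C e else 0) f) I"
      using z e f by (simp add: E.inner_simps)
  qed (auto simp: coeff_kernel_mem w e)
  show "(\<lambda>z. if z \<in> X then k z w *\<^sub>C e else 0) \<in> hcarrier feature_space"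
    unfolding eq[symmetric] c using coeff_kernel_mem[OF w e] by blast
  fix f assume "f \<in> hcarrier feature_space"
  then obtain a where a: "a \<in> hcarrier L" "f = synth a" by (auto simp: c)
  show "hinner feature_space f (\<lambda>z. if z \<in> X then k z w *\<^sub>C e else 0) = hinner E (f w) e"
    unfolding eq[symmetric] a(2)
    using a(1) w e by (simp add: feature_space_inner coeff_kernel_mem synth_inner_eq)
qed

theorem rkhs_is_rkhs: "is_rkhs X k E (rkhs X k E)"
  unfolding rkhs_def by (rule someI[of "is_rkhs X k E", OF feature_space_is_rkhs])

lemma rkhs_carrier: "hcarrier (rkhs X k E) = synth ` hcarrier L"
proof -
  have "hcarrier (rkhs X k E) = hcarrier feature_space"
    using is_rkhs_unique(1)[OF rkhs_is_rkhs feature_space_is_rkhs E.hilbert_space_axioms]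
      is_rkhs_unique(1)[OF feature_space_is_rkhs rkhs_is_rkhs E.hilbert_space_axioms] by blast
  then show ?thesis by (simp add: feature_space_def)
qed

lemma synth_carrier: "a \<in> hcarrier L \<Longrightarrow> synth a \<in> hcarrier (rkhs X k E)"
  by (simp add: rkhs_carrier)

lemma rkhs_inner:
  assumes "a \<in> hcarrier L" "b \<in> hcarrier L"
  shows "hinner (rkhs X k E) (synth a) (synth b) = hinner L a b"
proof -
  have "hinner (rkhs X k E) (synth a) (synth b) = hinner feature_space (synth a) (synth b)"
    using assms
    by (intro is_rkhs_unique(2)[OF rkhs_is_rkhs feature_space_is_rkhs E.hilbert_space_axioms] synth_carrier)
  then show ?thesis using feature_space_inner assms by simp
qed

lemma rkhs_hnorm: "a \<in> hcarrier L \<Longrightarrow> hnorm (rkhs X k E) (synth a) = hnorm L a"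
  by (simp add: hnorm_def rkhs_inner)

end

section \<open>Sums over multi-indices\<close>

text \<open>
  Multi-indices are undefined off \<open>A\<close>, in the same way as the points of the polydisc. So there is only
  one multi-index on the empty set, and splitting off a variable is a bijection.
\<close>

abbreviation multi :: "'i set \<Rightarrow> ('i \<Rightarrow> nat) set"
  where "multi A \<equiv> (\<Pi>\<^sub>E i\<in>A. UNIV)"

lemma multi_update: "\<lbrakk>k \<in> A; p \<in> multi (A - {k})\<rbrakk> \<Longrightarrow> p(k := q) \<in> multi A"
  by (auto simp: PiE_iff extensional_def)

lemma multi_restrict: "p \<in> multi A \<Longrightarrow> p(k := undefined) \<in> multi (A - {k})"
  by (auto simp: PiE_iff extensional_def)

lemma multi_split_bij:
  assumes k: "k \<in> A"
  shows "bij_betw (\<lambda>(p, q). p(k := q)) (multi (A - {k}) \<times> UNIV) (multi A)"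
proof (rule bij_betwI[where g = "\<lambda>p. (p(k := undefined), p k)"])
  show "(\<lambda>(p, q). p(k := q)) \<in> multi (A - {k}) \<times> UNIV \<rightarrow> multi A"
    using multi_update[OF k] by auto
  show "(\<lambda>p. (p(k := undefined), p k)) \<in> multi A \<rightarrow> multi (A - {k}) \<times> UNIV"
  proof
    fix p assume "p \<in> multi A"
    then show "(p(k := undefined), p k) \<in> multi (A - {k}) \<times> UNIV"
      using multi_restrict[of p A k] by (simp only: mem_Sigma_iff UNIV_I simp_thms)
  qed
  fix x :: "(_ \<Rightarrow> nat) \<times> nat" assume "x \<in> multi (A - {k}) \<times> UNIV"
  then obtain p q where x: "x = (p, q)" and p: "p \<in> multi (A - {k})" by blast
  have "p k = undefined" using PiE_arb[OF p] by blast
  then have "p(k := undefined) = p" by (metis fun_upd_triv)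
  then show "(\<lambda>p. (p(k := undefined), p k)) ((\<lambda>(p, q). p(k := q)) x) = x" by (simp add: x)
qed simp

lemma has_sum_multi_split:
  assumes k: "k \<in> A"
  shows "(f has_sum S) (multi A) \<longleftrightarrow>
    ((\<lambda>(p, q). f (p(k := q))) has_sum S) (multi (A - {k}) \<times> UNIV)"
  using has_sum_reindex_bij_betw[OF multi_split_bij[OF k], of f S] by (simp add: case_prod_unfold)

lemma summable_multi_split:
  assumes k: "k \<in> A"
  shows "f summable_on (multi A) \<longleftrightarrow>
    (\<lambda>(p, q). f (p(k := q))) summable_on (multi (A - {k}) \<times> UNIV)"
  using has_sum_multi_split[OF k] by (auto simp: summable_on_def)

lemma multi_split_sumD:
  fixes f :: "('i \<Rightarrow> nat) \<Rightarrow> 'b::banach"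
  assumes k: "k \<in> A" and f: "(f has_sum S) (multi A)"
  shows "p \<in> multi (A - {k}) \<Longrightarrow> (\<lambda>q. f (p(k := q))) summable_on UNIV"
    and "((\<lambda>p. \<Sum>\<^sub>\<infinity>q. f (p(k := q))) has_sum S) (multi (A - {k}))"
proof -
  have *: "((\<lambda>(p, q). f (p(k := q))) has_sum S) (multi (A - {k}) \<times> UNIV)"
    using f by (simp add: has_sum_multi_split[OF k])
  show inner: "(\<lambda>q. f (p(k := q))) summable_on UNIV" if "p \<in> multi (A - {k})" for p
  proof -
    have "(\<lambda>(p, q). f (p(k := q))) summable_on Pair p ` UNIV"
      by (rule summable_on_subset_banach[OF has_sum_imp_summable[OF *]]) (use that in blast)
    then show ?thesis by (subst (asm) summable_on_reindex) (auto simp: o_def inj_on_def)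
  qed
  show "((\<lambda>p. \<Sum>\<^sub>\<infinity>q. f (p(k := q))) has_sum S) (multi (A - {k}))"
    by (rule has_sum_SigmaD[OF *]) (use inner in auto)
qed

lemma multi_split_sum_unique:
  fixes f :: "('i \<Rightarrow> nat) \<Rightarrow> 'b::banach"
  assumes k: "k \<in> A" and f: "(f has_sum S) (multi A)"
    and inner: "\<And>p. p \<in> multi (A - {k}) \<Longrightarrow> ((\<lambda>q. f (p(k := q))) has_sum g p) UNIV"
  shows "(g has_sum S) (multi (A - {k}))"
  by (rule has_sum_cong[THEN iffD1, OF _ multi_split_sumD(2)[OF k f]]) (rule infsumI[OF inner])

lemma multi_split_sum_nonneg:
  fixes f :: "('i \<Rightarrow> nat) \<Rightarrow> real"
  assumes k: "k \<in> A"
    and inner: "\<And>p. p \<in> multi (A - {k}) \<Longrightarrow> ((\<lambda>q. f (p(k := q))) has_sum g p) UNIV"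
    and outer: "(g has_sum S) (multi (A - {k}))"
    and nonneg: "\<And>p. p \<in> multi A \<Longrightarrow> 0 \<le> f p"
  shows "(f has_sum S) (multi A)"
proof -
  have "(\<lambda>(p, q). f (p(k := q))) summable_on (multi (A - {k}) \<times> UNIV)"
    by (rule summable_on_SigmaI[where g = g])
      (use inner has_sum_imp_summable[OF outer] nonneg multi_update[OF k] in auto)
  then have "((\<lambda>(p, q). f (p(k := q))) has_sum S) (multi (A - {k}) \<times> UNIV)"
    by (intro has_sum_SigmaI[OF _ outer]) (use inner in auto)
  then show ?thesis by (simp add: has_sum_multi_split[OF k])
qed

lemma multi_split_sum_abs:
  fixes f :: "('i \<Rightarrow> nat) \<Rightarrow> 'b::banach"
  assumes k: "k \<in> A" and f: "(\<lambda>p. norm (f p)) summable_on multi A"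
    and inner: "\<And>p. p \<in> multi (A - {k}) \<Longrightarrow> ((\<lambda>q. f (p(k := q))) has_sum g p) UNIV"
    and outer: "(g has_sum S) (multi (A - {k}))"
  shows "(f has_sum S) (multi A)"
proof -
  have "(f has_sum infsum f (multi A)) (multi A)"
    using abs_summable_summable[OF f] by simp
  moreover from multi_split_sum_unique[OF k this inner]
  have "infsum f (multi A) = S" using outer has_sum_unique by blast
  ultimately show ?thesis by simp
qed

text \<open>
  The product of the kernels of the variables is the sum of the products of their terms. The absolute
  summability is part of the claim because the induction sums first over one variable.
\<close>

lemma has_sum_prod_multi:
  fixes f :: "'i \<Rightarrow> nat \<Rightarrow> complex"
  assumes "finite A" "\<And>i. i \<in> A \<Longrightarrow> (f i has_sum S i) UNIV"
    "\<And>i. i \<in> A \<Longrightarrow> (\<lambda>q. norm (f i q)) summable_on UNIV"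
  shows "(\<lambda>p. norm (\<Prod>i\<in>A. f i (p i))) summable_on multi A \<and>
    ((\<lambda>p. \<Prod>i\<in>A. f i (p i)) has_sum (\<Prod>i\<in>A. S i)) (multi A)"
  using assms
proof (induction A)
  case empty
  then show ?case using has_sum_finite[of "{\<lambda>_. undefined}" "\<lambda>_. 1 :: complex"] by simp
next
  case (insert k A)
  have A: "insert k A - {k} = A" using insert.hyps by simp
  have prod: "(\<Prod>i\<in>insert k A. f i ((p(k := q)) i)) = f k q * (\<Prod>i\<in>A. f i (p i))" for p q
  proof -
    have "(\<Prod>i\<in>A. f i ((p(k := q)) i)) = (\<Prod>i\<in>A. f i (p i))"
      using insert.hyps by (intro prod.cong) auto
    then show ?thesis using insert.hyps by simp
  qed
  have IH: "(\<lambda>p. norm (\<Prod>i\<in>A. f i (p i))) summable_on multi A"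
    "((\<lambda>p. \<Prod>i\<in>A. f i (p i)) has_sum (\<Prod>i\<in>A. S i)) (multi A)"
    using insert by auto
  define N where "N = (\<Sum>\<^sub>\<infinity>q. norm (f k q))"
  have N: "((\<lambda>q. norm (f k q)) has_sum N) UNIV" using insert.prems by (simp add: N_def)
  have "((\<lambda>p. norm (\<Prod>i\<in>insert k A. f i (p i))) has_sum
      (N * (\<Sum>\<^sub>\<infinity>p\<in>multi A. norm (\<Prod>i\<in>A. f i (p i))))) (multi (insert k A))"
  proof (rule multi_split_sum_nonneg[where k = k], unfold A prod norm_mult)
    show "((\<lambda>q. norm (f k q) * norm (\<Prod>i\<in>A. f i (p i))) has_sum
        (N * norm (\<Prod>i\<in>A. f i (p i)))) UNIV" for p
      by (rule has_sum_cmult_left[OF N])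
    show "((\<lambda>p. N * norm (\<Prod>i\<in>A. f i (p i))) has_sum
        (N * (\<Sum>\<^sub>\<infinity>p\<in>multi A. norm (\<Prod>i\<in>A. f i (p i))))) (multi A)"
      using IH(1) by (intro has_sum_cmult_right) simp
  qed auto
  then have 1: "(\<lambda>p. norm (\<Prod>i\<in>insert k A. f i (p i))) summable_on multi (insert k A)"
    by (rule has_sum_imp_summable)
  have 2: "((\<lambda>p. \<Prod>i\<in>insert k A. f i (p i)) has_sum (S k * (\<Prod>i\<in>A. S i))) (multi (insert k A))"
  proof (rule multi_split_sum_abs[OF _ 1, where k = k], unfold A prod)
    show "((\<lambda>q. f k q * (\<Prod>i\<in>A. f i (p i))) has_sum (S k * (\<Prod>i\<in>A. f i (p i)))) UNIV" for p
      using insert.prems by (intro has_sum_cmult_left) auto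
    show "((\<lambda>p. S k * (\<Prod>i\<in>A. f i (p i))) has_sum (S k * (\<Prod>i\<in>A. S i))) (multi A)"
      by (rule has_sum_cmult_right[OF IH(2)])
  qed simp
  show ?case using 1 2 insert.hyps by simp
qed

section \<open>Power series coordinates for the disc and the polydisc\<close>

text \<open>The coefficients of the power series of \<open>(1 - x)\<^bsup>-m\<^esup>\<close>.\<close>

definition neg_binom :: "nat \<Rightarrow> nat \<Rightarrow> real"
  where "neg_binom m q = real ((m + q - 1) choose q)"

text \<open>
  The orthonormal basis of the monomials for the weight \<open>m\<close>.
\<close>

definition disc_feature :: "nat \<Rightarrow> nat \<Rightarrow> complex \<Rightarrow> complex"
  where "disc_feature m q z = complex_of_real (sqrt (neg_binom m q)) * z ^ q"

definition polydisc_feature :: "nat set \<Rightarrow> (nat \<Rightarrow> nat) \<Rightarrow> (nat \<Rightarrow> nat) \<Rightarrow> (nat \<Rightarrow> complex) \<Rightarrow> complex"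
  where "polydisc_feature A m p z = (\<Prod>i\<in>A. disc_feature (m i) (p i) (z i))"

lemma neg_binom_pos: "m \<ge> 1 \<Longrightarrow> 0 < neg_binom m q"
  by (simp add: neg_binom_def)

lemma neg_binom_one [simp]: "neg_binom (Suc 0) q = 1"
  by (simp add: neg_binom_def)

lemma neg_binom_0 [simp]: "neg_binom m 0 = 1"
  by (simp add: neg_binom_def)

lemma neg_binom_mono: "m \<ge> 1 \<Longrightarrow> neg_binom m q \<le> neg_binom m (Suc q)"
proof -
  assume "m \<ge> 1"
  then obtain j where j: "m = Suc j" by (cases m) auto
  show ?thesis by (simp add: neg_binom_def j)
qed

lemma neg_binom_sums:
  assumes m: "m \<ge> 1" and x: "norm (x :: complex) < 1"
  shows "(\<lambda>q. complex_of_real (neg_binom m q) * x ^ q) sums (1 / (1 - x) ^ m)"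
proof -
  have "(\<lambda>q. ((- of_nat m) gchoose q) * (- x) ^ q) sums (1 + - x) powr (- of_nat m)"
    using x by (intro gen_binomial_complex) simp
  moreover have "((- of_nat m) gchoose q) * (- x) ^ q = complex_of_real (neg_binom m q) * x ^ q" for q
  proof -
    have "(- of_nat m :: complex) gchoose q = (- 1) ^ q * of_nat ((m + q - 1) choose q)"
      using m by (simp add: gbinomial_minus binomial_gbinomial of_nat_diff)
    moreover have "(- x) ^ q = (- 1) ^ q * x ^ q" by (rule power_minus)
    moreover have "(- 1) ^ q * (- 1) ^ q = (1 :: complex)" by (simp flip: power_mult_distrib)
    ultimately show ?thesis by (simp add: neg_binom_def)
  qed
  moreover have "(1 + - x) powr (- of_nat m) = 1 / (1 - x) ^ m"
  proof -
    have "1 - x \<noteq> 0" using x by auto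
    then show ?thesis by (simp add: powr_minus powr_nat' inverse_eq_divide)
  qed
  ultimately show ?thesis by simp
qed

lemma neg_binom_has_sum:
  assumes m: "m \<ge> 1" and x: "norm (x :: complex) < 1"
  shows "(\<lambda>q. norm (complex_of_real (neg_binom m q) * x ^ q)) summable_on UNIV"
    and "((\<lambda>q. complex_of_real (neg_binom m q) * x ^ q) has_sum (1 / (1 - x) ^ m)) UNIV"
proof -
  have "summable (\<lambda>q. complex_of_real (neg_binom m q) * complex_of_real (norm x) ^ q)"
    using neg_binom_sums[OF m, of "complex_of_real (norm x)"] x by (auto dest: sums_summable)
  then have "summable (\<lambda>q. complex_of_real (neg_binom m q * norm x ^ q))" by simp
  then have "summable (\<lambda>q. neg_binom m q * norm x ^ q)" by (simp only: summable_complex_of_real)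
  moreover have eq: "norm (complex_of_real (neg_binom m q) * x ^ q) = neg_binom m q * norm x ^ q" for q
    using neg_binom_pos[OF m] by (simp add: norm_mult norm_power less_imp_le)
  ultimately have s: "summable (\<lambda>q. norm (complex_of_real (neg_binom m q) * x ^ q))" by simp
  show "(\<lambda>q. norm (complex_of_real (neg_binom m q) * x ^ q)) summable_on UNIV"
    using s by (intro summable_nonneg_imp_summable_on) auto
  show "((\<lambda>q. complex_of_real (neg_binom m q) * x ^ q) has_sum (1 / (1 - x) ^ m)) UNIV"
    by (rule norm_summable_imp_has_sum[OF s neg_binom_sums[OF m x]])
qed

lemma disc_feature_mult:
  assumes m: "m \<ge> 1"
  shows "disc_feature m q z * cnj (disc_feature m q w) = complex_of_real (neg_binom m q) * (z * cnj w) ^ q"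
proof -
  have "complex_of_real (sqrt (neg_binom m q)) * complex_of_real (sqrt (neg_binom m q))
      = complex_of_real (neg_binom m q)"
    using neg_binom_pos[OF m, of q] by (simp flip: of_real_mult)
  then show ?thesis by (simp add: disc_feature_def power_mult_distrib mult_ac)
qed

lemma unit_disc_mult:
  assumes "z \<in> unit_disc" "w \<in> unit_disc"
  shows "norm (z * cnj w) < 1"
  using mult_strict_mono'[of "norm z" 1 "norm w" 1] assms by (simp add: norm_mult)

lemma disc_feature_kernel_sum:
  assumes m: "m \<ge> 1" and z: "z \<in> unit_disc" and w: "w \<in> unit_disc"
  shows "(\<lambda>q. norm (disc_feature m q z * cnj (disc_feature m q w))) summable_on UNIV"
    and "((\<lambda>q. disc_feature m q z * cnj (disc_feature m q w)) has_sum disc_kernel m z w) UNIV"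
  using neg_binom_has_sum[OF m unit_disc_mult[OF z w]]
  by (simp_all add: disc_feature_mult[OF m] disc_kernel_def)

text \<open>
  If the coefficients below \<open>q\<close> vanish, division by \<open>z\<^sup>q\<close> and the limit at 0 show that the coefficient at
  \<open>q\<close> vanishes.
\<close>

lemma disc_feature_independent:
  assumes m: "m \<ge> 1"
    and zero: "\<And>z. z \<in> unit_disc \<Longrightarrow> ((\<lambda>q. disc_feature m q z * a q) has_sum 0) UNIV"
  shows "a q = 0"
proof -
  define b where "b q = complex_of_real (sqrt (neg_binom m q)) * a q" for q
  have sums: "(\<lambda>q. b q * z ^ q) sums 0" if "norm z < 1" for z
    using has_sum_imp_sums[OF zero[of z]] that by (simp add: b_def disc_feature_def mult_ac)
  have "b q = 0" for q
  proof (induction q rule: less_induct)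
    case (less q)
    have "((\<lambda>_. 0) \<longlongrightarrow> b (q + 0)) (at (0 :: complex))"
    proof (rule powser_limit_0_strong[of 1 "\<lambda>j. b (q + j)"])
      fix x :: complex assume x: "x \<noteq> 0" "norm x < 1"
      have "(\<lambda>j. b (j + q) * x ^ (j + q)) sums (0 - (\<Sum>j<q. b j * x ^ j))"
        by (rule sums_split_initial_segment[OF sums[OF x(2)]])
      also have "(\<Sum>j<q. b j * x ^ j) = 0" using less by simp
      finally have "(\<lambda>j. (b (q + j) * x ^ j) * x ^ q) sums (0 * x ^ q)"
        by (simp add: power_add mult_ac add.commute)
      then show "(\<lambda>j. b (q + j) * x ^ j) sums 0"
        using x sums_mult2_iff[of "x ^ q" "\<lambda>j. b (q + j) * x ^ j" 0] by simp
    qed simp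
    then show ?case using LIM_unique[of "\<lambda>_. 0 :: complex" "b q" 0 0] by simp
  qed
  from this[of q] show ?thesis using neg_binom_pos[OF m, of q] by (simp add: b_def)
qed

lemma disc_feature_kernel:
  assumes E: "hilbert_space E" and m: "m \<ge> 1"
  shows "feature_kernel E unit_disc (disc_kernel m) UNIV (disc_feature m)"
proof -
  interpret hilbert_space E by (rule E)
  show ?thesis
  proof
    show "(\<lambda>p. (cmod (disc_feature m p z))\<^sup>2) summable_on UNIV" if "z \<in> unit_disc" for z
      using disc_feature_kernel_sum(1)[OF m that that]
      by (simp add: norm_mult power2_eq_square)
    show "((\<lambda>p. disc_feature m p z * cnj (disc_feature m p w)) has_sum disc_kernel m z w) UNIV"
      if "z \<in> unit_disc" "w \<in> unit_disc" for z w
      by (rule disc_feature_kernel_sum(2)[OF m that])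
    show "a p = 0" if "\<And>z. z \<in> unit_disc \<Longrightarrow> ((\<lambda>p. disc_feature m p z * a p) has_sum 0) UNIV" for a p
      by (rule disc_feature_independent[OF m that])
  qed
qed

lemma polydisc_feature_update:
  assumes "finite A" "k \<in> A"
  shows "polydisc_feature A m (p(k := q)) z
    = disc_feature (m k) q (z k) * polydisc_feature (A - {k}) m p z"
proof -
  have "polydisc_feature (A - {k}) m (p(k := q)) z = polydisc_feature (A - {k}) m p z"
    unfolding polydisc_feature_def by (intro prod.cong) auto
  then show ?thesis
    using assms by (simp add: polydisc_feature_def prod.remove[of A k])
qed

lemma polydisc_feature_cong:
  "(\<And>i. i \<in> A \<Longrightarrow> z i = w i) \<Longrightarrow> polydisc_feature A m p z = polydisc_feature A m p w"
  unfolding polydisc_feature_def by (intro prod.cong) auto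

text \<open>
  For fixed values of the other variables, the sums over these variables are the coefficients of a
  power series in one variable, so each of them vanishes. The absolute summability is a hypothesis
  because this regroups the terms; square-summable coefficients have it.
\<close>

lemma polydisc_feature_independent:
  assumes "finite A" "\<And>i. i \<in> A \<Longrightarrow> m i \<ge> 1"
    and "\<And>z. z \<in> (\<Pi>\<^sub>E i\<in>A. unit_disc) \<Longrightarrow>
        (\<lambda>p. norm (polydisc_feature A m p z * a p)) summable_on multi A"
    and "\<And>z. z \<in> (\<Pi>\<^sub>E i\<in>A. unit_disc) \<Longrightarrow>
        ((\<lambda>p. polydisc_feature A m p z * a p) has_sum 0) (multi A)"
    and "p \<in> multi A"
  shows "a p = 0"
  using assms
proof (induction A arbitrary: a p)
  case empty
  then have "((\<lambda>p. a p) has_sum 0) {\<lambda>_. undefined}" by (simp add: polydisc_feature_def)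
  moreover have "(a has_sum sum a {\<lambda>_. undefined}) {\<lambda>_. undefined}" by (rule has_sum_finite) simp
  ultimately have "sum a {\<lambda>_. undefined} = 0" using has_sum_unique by blast
  then have "a (\<lambda>_. undefined) = 0" by simp
  then show ?case using empty by simp
next
  case (insert k A)
  let ?A = "insert k A"
  have A: "?A - {k} = A" using insert.hyps by simp
  have mk: "m k \<ge> 1" using insert.prems by simp
  note upd = polydisc_feature_update[of ?A k m, unfolded A]
  have zpt: "z(k := w) \<in> (\<Pi>\<^sub>E i\<in>?A. unit_disc)" if "z \<in> (\<Pi>\<^sub>E i\<in>A. unit_disc)" "w \<in> unit_disc" for z w
    using that by (auto simp: PiE_iff extensional_def)
  have feat: "polydisc_feature ?A m (r(k := q)) (z(k := w)) =
      disc_feature (m k) q w * polydisc_feature A m r z" for r q z w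
  proof -
    have "polydisc_feature A m r (z(k := w)) = polydisc_feature A m r z"
      by (rule polydisc_feature_cong) (use insert.hyps in auto)
    then show ?thesis using upd[of r q "z(k := w)"] insert.hyps by simp
  qed
  have swap: "((\<lambda>(q, r). disc_feature (m k) q w * (polydisc_feature A m r z * a (r(k := q)))) has_sum 0)
        (UNIV \<times> multi A)"
    "(\<lambda>(q, r). norm (disc_feature (m k) q w * (polydisc_feature A m r z * a (r(k := q))))) summable_on
        (UNIV \<times> multi A)"
    if z: "z \<in> (\<Pi>\<^sub>E i\<in>A. unit_disc)" and w: "w \<in> unit_disc" for z w
  proof -
    have "((\<lambda>(r, q). polydisc_feature ?A m (r(k := q)) (z(k := w)) * a (r(k := q))) has_sum 0)
        (multi A \<times> UNIV)"
      by (rule iffD1[OF has_sum_multi_split[of k ?A, OF insertI1, unfolded A]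
            insert.prems(3)[OF zpt[OF z w]]])
    from has_sum_swap[THEN iffD1, OF this]
    show "((\<lambda>(q, r). disc_feature (m k) q w * (polydisc_feature A m r z * a (r(k := q)))) has_sum 0)
        (UNIV \<times> multi A)"
      by (simp add: feat mult.assoc case_prod_unfold)
    have "(\<lambda>(r, q). norm (polydisc_feature ?A m (r(k := q)) (z(k := w)) * a (r(k := q)))) summable_on
        (multi A \<times> UNIV)"
      by (rule iffD1[OF summable_multi_split[of k ?A, OF insertI1, unfolded A]
            insert.prems(2)[OF zpt[OF z w]]])
    from summable_on_swap[THEN iffD1, OF this]
    show "(\<lambda>(q, r). norm (disc_feature (m k) q w * (polydisc_feature A m r z * a (r(k := q))))) summable_on
        (UNIV \<times> multi A)"
      by (simp add: feat mult.assoc case_prod_unfold)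
  qed
  have abs: "(\<lambda>r. norm (polydisc_feature A m r z * a (r(k := q)))) summable_on multi A"
    if z: "z \<in> (\<Pi>\<^sub>E i\<in>A. unit_disc)" for z q
  proof -
    \<comment> \<open>Any point of the disc other than 0 would do: the feature must not vanish there.\<close>
    have half: "(1 / 2 :: complex) \<in> unit_disc" by simp
    have nz: "norm (disc_feature (m k) q (1 / 2)) \<noteq> 0"
      using neg_binom_pos[OF mk, of q] by (simp add: disc_feature_def)
    have "(\<lambda>r. norm (disc_feature (m k) q (1 / 2) * (polydisc_feature A m r z * a (r(k := q)))))
        summable_on multi A"
      by (rule summable_on_SigmaD1[where f = "\<lambda>q r. norm (disc_feature (m k) q (1 / 2) *
            (polydisc_feature A m r z * a (r(k := q))))", OF swap(2)[OF z half]]) simp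
    then show ?thesis
      using nz unfolding norm_mult[of "disc_feature (m k) q (1 / 2)"]
      by (subst (asm) summable_on_cmult_right') auto
  qed
  have zero: "((\<lambda>r. polydisc_feature A m r z * a (r(k := q))) has_sum 0) (multi A)"
    if z: "z \<in> (\<Pi>\<^sub>E i\<in>A. unit_disc)" for z q
  proof -
    define b where "b q = (\<Sum>\<^sub>\<infinity>r\<in>multi A. polydisc_feature A m r z * a (r(k := q)))" for q
    have b: "((\<lambda>r. polydisc_feature A m r z * a (r(k := q))) has_sum b q) (multi A)" for q
      using abs_summable_summable[OF abs[OF z, of q]] by (simp add: b_def)
    have "((\<lambda>q. disc_feature (m k) q w * b q) has_sum 0) UNIV" if w: "w \<in> unit_disc" for w
      by (rule has_sum_SigmaD[OF swap(1)[OF z w]]) (use b in \<open>auto intro: has_sum_cmult_right\<close>)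
    then have "b q = 0" by (rule disc_feature_independent[OF mk])
    then show ?thesis using b[of q] by simp
  qed
  have "a ((p(k := undefined))(k := p k)) = 0"
  proof (rule insert.IH[where a = "\<lambda>r. a (r(k := p k))"])
    show "p(k := undefined) \<in> multi A" using multi_restrict[OF insert.prems(4), of k] A by simp
  qed (use abs zero insert.prems(1) in auto)
  then show ?case by simp
qed

lemma polydisc_feature_kernel:
  assumes E: "hilbert_space E" and A: "finite A" and m: "\<And>i. i \<in> A \<Longrightarrow> m i \<ge> 1"
  shows "feature_kernel E (\<Pi>\<^sub>E i\<in>A. unit_disc) (\<lambda>z w. \<Prod>i\<in>A. disc_kernel (m i) (z i) (w i))
    (multi A) (polydisc_feature A m)"
proof -
  interpret hilbert_space E by (rule E)
  have sum: "(\<lambda>p. norm (polydisc_feature A m p z * cnj (polydisc_feature A m p w))) summable_on multi A \<and>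
      ((\<lambda>p. polydisc_feature A m p z * cnj (polydisc_feature A m p w)) has_sum
        (\<Prod>i\<in>A. disc_kernel (m i) (z i) (w i))) (multi A)"
    if "z \<in> (\<Pi>\<^sub>E i\<in>A. unit_disc)" "w \<in> (\<Pi>\<^sub>E i\<in>A. unit_disc)" for z w
  proof -
    have "(\<lambda>p. norm (\<Prod>i\<in>A. disc_feature (m i) (p i) (z i) * cnj (disc_feature (m i) (p i) (w i))))
          summable_on multi A \<and>
      ((\<lambda>p. \<Prod>i\<in>A. disc_feature (m i) (p i) (z i) * cnj (disc_feature (m i) (p i) (w i))) has_sum
        (\<Prod>i\<in>A. disc_kernel (m i) (z i) (w i))) (multi A)"
      using that m
      by (intro has_sum_prod_multi[OF A] disc_feature_kernel_sum) (auto simp: PiE_iff)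
    then show ?thesis by (simp add: polydisc_feature_def prod.distrib)
  qed
  have sq: "(\<lambda>p. (cmod (polydisc_feature A m p z))\<^sup>2) summable_on multi A"
    if "z \<in> (\<Pi>\<^sub>E i\<in>A. unit_disc)" for z
    using sum[OF that that] by (simp add: norm_mult power2_eq_square)
  show ?thesis
  proof
    show "(\<lambda>p. (cmod (polydisc_feature A m p z))\<^sup>2) summable_on multi A"
      if "z \<in> (\<Pi>\<^sub>E i\<in>A. unit_disc)" for z by (rule sq[OF that])
    show "((\<lambda>p. polydisc_feature A m p z * cnj (polydisc_feature A m p w)) has_sum
        (\<Prod>i\<in>A. disc_kernel (m i) (z i) (w i))) (multi A)"
      if "z \<in> (\<Pi>\<^sub>E i\<in>A. unit_disc)" "w \<in> (\<Pi>\<^sub>E i\<in>A. unit_disc)" for z w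
      using sum[OF that] by blast
    show "a p = 0"
      if a: "(\<lambda>p. (cmod (a p))\<^sup>2) summable_on multi A"
        and zero: "\<And>z. z \<in> (\<Pi>\<^sub>E i\<in>A. unit_disc) \<Longrightarrow>
          ((\<lambda>p. polydisc_feature A m p z * a p) has_sum 0) (multi A)" and p: "p \<in> multi A" for a p
    proof (rule polydisc_feature_independent[OF A m _ zero p])
      fix z :: "nat \<Rightarrow> complex" assume z: "z \<in> (\<Pi>\<^sub>E i\<in>A. unit_disc)"
      show "(\<lambda>p. norm (polydisc_feature A m p z * a p)) summable_on multi A"
      proof (rule summable_on_comparison_test)
        show "(\<lambda>p. (cmod (polydisc_feature A m p z))\<^sup>2 + (cmod (a p))\<^sup>2) summable_on multi A"
          by (intro summable_on_add sq z a)
        show "norm (polydisc_feature A m p z * a p) \<le> (cmod (polydisc_feature A m p z))\<^sup>2 + (cmod (a p))\<^sup>2" for p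
          using sum_squares_bound[of "cmod (polydisc_feature A m p z)" "cmod (a p)"]
            zero_le_power2[of "cmod (polydisc_feature A m p z)"] zero_le_power2[of "cmod (a p)"]
          unfolding norm_mult by linarith
      qed simp
    qed
  qed
qed

section \<open>The shift and the point evaluations on the disc\<close>

lemma isometry_preserves_inner:
  assumes H: "pre_hilbert H" and K: "pre_hilbert K"
    and V: "\<And>x. x \<in> hcarrier H \<Longrightarrow> V x \<in> hcarrier K"
      "\<And>x y. \<lbrakk>x \<in> hcarrier H; y \<in> hcarrier H\<rbrakk> \<Longrightarrow> V (x + y) = V x + V y"
      "\<And>c x. x \<in> hcarrier H \<Longrightarrow> V (c *\<^sub>C x) = c *\<^sub>C V x"
      "\<And>x. x \<in> hcarrier H \<Longrightarrow> hnorm K (V x) = hnorm H x"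
    and x: "x \<in> hcarrier H" and y: "y \<in> hcarrier H"
  shows "hinner K (V x) (V y) = hinner H x y"
proof -
  interpret H: pre_hilbert H by (rule H)
  interpret K: pre_hilbert K by (rule K)
  have Re: "Re (hinner K (V x) (V y)) = Re (hinner H x y)"
    if "x \<in> hcarrier H" "y \<in> hcarrier H" for x y
  proof -
    have "(hnorm K (V x + V y))\<^sup>2 = (hnorm H (x + y))\<^sup>2"
      using that V(4)[of "x + y"] by (simp add: V(2))
    then show ?thesis using that by (simp add: K.hnorm_add_sq H.hnorm_add_sq V(1,4))
  qed
  have "Im (hinner K (V x) (V y)) = Im (hinner H x y)"
    using Re[of x "\<i> *\<^sub>C y"] x y by (simp add: V K.inner_simps H.inner_simps)
  then show ?thesis using Re[OF x y] by (simp add: complex_eq_iff)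
qed

lemma scaleC_fun_apply: "(c *\<^sub>C f) x = c *\<^sub>C f x"
  by (simp add: scaleC_fun_def)

definition mult_z :: "(complex \<Rightarrow> 'e::complex_vector) \<Rightarrow> complex \<Rightarrow> 'e"
  where "mult_z f = (\<lambda>z. z *\<^sub>C f z)"

text \<open>
  Multiplication by \<open>z\<close> in the coordinates \<^const>\<open>disc_feature\<close>, which is a weighted shift. Its weights are
  at most 1, because the coefficients \<^const>\<open>neg_binom\<close> increase.
\<close>

definition l2_shift :: "nat \<Rightarrow> (nat \<Rightarrow> 'e::complex_vector) \<Rightarrow> nat \<Rightarrow> 'e"
  where "l2_shift m a q = (case q of 0 \<Rightarrow> 0
    | Suc r \<Rightarrow> complex_of_real (sqrt (neg_binom m r) / sqrt (neg_binom m (Suc r))) *\<^sub>C a r)"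

lemma has_sum_SucI:
  assumes f0: "f 0 = 0" and f: "((\<lambda>r. f (Suc r)) has_sum S) UNIV"
  shows "(f has_sum S) UNIV"
proof -
  have "(f has_sum S) (range Suc)"
    using f by (subst has_sum_reindex) (auto simp: o_def)
  then show ?thesis
  proof (rule has_sum_cong_neutral[THEN iffD1, rotated -1])
    show "f x = 0" if "x \<in> UNIV - range Suc" for x
      using that f0 by (cases x) auto
  qed auto
qed

locale disc_space = hilbert_space D for D :: "'e::complex_vector hilbert" +
  fixes m :: nat
  assumes m: "m \<ge> 1"
begin

sublocale F: feature_kernel D unit_disc "disc_kernel m" UNIV "disc_feature m"
  by (rule disc_feature_kernel[OF hilbert_space_axioms m])

abbreviation "R \<equiv> A2_disc m D"

lemma R_def: "R = rkhs unit_disc (disc_kernel m) D"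
  by (simp add: A2_disc_def)

lemma R_carrier: "hcarrier R = F.synth ` hcarrier F.L"
  by (simp add: R_def F.rkhs_carrier)

lemma R_inner: "\<lbrakk>a \<in> hcarrier F.L; b \<in> hcarrier F.L\<rbrakk> \<Longrightarrow> hinner R (F.synth a) (F.synth b) = hinner F.L a b"
  by (simp add: R_def F.rkhs_inner)

lemma R_hnorm: "a \<in> hcarrier F.L \<Longrightarrow> hnorm R (F.synth a) = hnorm F.L a"
  by (simp add: R_def F.rkhs_hnorm)

lemma R_rkhs: "is_rkhs unit_disc (disc_kernel m) D R"
  using F.rkhs_is_rkhs by (simp add: R_def)

sublocale R: hilbert_space R
  by (rule is_rkhsD(1)[OF R_rkhs])

lemma shift_ratio:
  "0 \<le> sqrt (neg_binom m r) / sqrt (neg_binom m (Suc r))"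
  "sqrt (neg_binom m r) / sqrt (neg_binom m (Suc r)) \<le> 1"
  using neg_binom_pos[OF m, of r] neg_binom_pos[OF m, of "Suc r"] neg_binom_mono[OF m, of r]
  by simp_all

lemma l2_shift_mem:
  assumes a: "a \<in> hcarrier F.L"
  shows "l2_shift m a \<in> hcarrier F.L"
    and "hnorm F.L (l2_shift m a) \<le> hnorm F.L a"
proof -
  let ?t = "\<lambda>q. if q = 0 then 0 else (hnorm D (a (q - 1)))\<^sup>2"
  have am: "a q \<in> hcarrier D" for q using l2_carrierD(1)[OF a] by simp
  have t: "(?t has_sum (hnorm F.L a)\<^sup>2) UNIV"
    by (rule has_sum_SucI) (use l2_hnorm_has_sum[OF a] in simp_all)
  have le: "(hnorm D (l2_shift m a q))\<^sup>2 \<le> ?t q" for q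
  proof (cases q)
    case (Suc r)
    have "hnorm D (l2_shift m a q) \<le> hnorm D (a r)"
    proof -
      define \<rho> where "\<rho> = sqrt (neg_binom m r) / sqrt (neg_binom m (Suc r))"
      have "hnorm D (l2_shift m a q) = \<rho> * hnorm D (a r)"
        using shift_ratio(1)[of r] am[of r] unfolding l2_shift_def Suc nat.case \<rho>_def[symmetric]
        by (simp add: hnorm_scaleC)
      then show ?thesis
        using shift_ratio[of r] am[of r] mult_left_le_one_le[of "hnorm D (a r)" \<rho>] by (simp add: \<rho>_def)
    qed
    then show ?thesis using am Suc
      by (auto intro!: power_mono simp: l2_shift_def)
  qed (simp add: l2_shift_def)
  have mem: "l2_shift m a q \<in> hcarrier D" for q
    using am by (auto simp: l2_shift_def split: nat.split)
  show L: "l2_shift m a \<in> hcarrier F.L"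
  proof (rule l2_carrierI)
    show "(\<lambda>q. (hnorm D (l2_shift m a q))\<^sup>2) summable_on UNIV"
      by (rule summable_on_comparison_test[OF has_sum_imp_summable[OF t]]) (use le in auto)
  qed (use mem in auto)
  have "(hnorm F.L (l2_shift m a))\<^sup>2 \<le> (hnorm F.L a)\<^sup>2"
    by (rule has_sum_mono[OF l2_hnorm_has_sum[OF L] t]) (rule le)
  then show "hnorm F.L (l2_shift m a) \<le> hnorm F.L a"
    using a by (auto intro: power2_le_imp_le)
qed

lemma synth_l2_shift:
  assumes a: "a \<in> hcarrier F.L"
  shows "F.synth (l2_shift m a) = mult_z (F.synth a)"
proof (rule F.synth_eqI[OF l2_shift_mem(1)[OF a]])
  show "mult_z (F.synth a) z \<in> hcarrier D" if "z \<in> unit_disc" for z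
    using F.synth_mem[OF that a] by (simp add: mult_z_def)
  show "mult_z (F.synth a) z = 0" if "z \<notin> unit_disc" for z
    using that by (simp add: mult_z_def F.synth_def)
  fix z e assume z: "z \<in> unit_disc" and e: "e \<in> hcarrier D"
  let ?g = "\<lambda>q. disc_feature m q z * hinner D (l2_shift m a q) e"
  have am: "a q \<in> hcarrier D" for q using l2_carrierD(1)[OF a] by simp
  have g: "?g (Suc r) = z * (disc_feature m r z * hinner D (a r) e)" for r
  proof -
    have "complex_of_real (sqrt (neg_binom m (Suc r))) *
        complex_of_real (sqrt (neg_binom m r) / sqrt (neg_binom m (Suc r)))
        = complex_of_real (sqrt (neg_binom m r))"
    proof -
      have "sqrt (neg_binom m (Suc r)) * (sqrt (neg_binom m r) / sqrt (neg_binom m (Suc r)))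
          = sqrt (neg_binom m r)"
        using neg_binom_pos[OF m, of "Suc r"] by simp
      then show ?thesis by (simp only: of_real_mult[symmetric])
    qed
    moreover have "?g (Suc r) = (complex_of_real (sqrt (neg_binom m (Suc r))) *
        complex_of_real (sqrt (neg_binom m r) / sqrt (neg_binom m (Suc r)))) * (z * z ^ r * hinner D (a r) e)"
      using am e by (simp add: l2_shift_def disc_feature_def inner_scaleC_left)
    ultimately show ?thesis by (simp add: disc_feature_def)
  qed
  have "((\<lambda>r. ?g (Suc r)) has_sum (z * hinner D (F.synth a z) e)) UNIV"
    unfolding g by (rule has_sum_cmult_right[OF F.synth_inner[OF z a e]])
  then have "(?g has_sum (z * hinner D (F.synth a z) e)) UNIV"
    by (rule has_sum_SucI[rotated]) (use e in \<open>simp add: l2_shift_def\<close>)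
  then show "(?g has_sum hinner D (mult_z (F.synth a) z) e) UNIV"
    using F.synth_mem[OF z a] e by (simp add: mult_z_def inner_scaleC_left)
qed

lemma mult_z_bounded: "bounded_operator R R mult_z"
  and mult_z_contraction: "f \<in> hcarrier R \<Longrightarrow> hnorm R (mult_z f) \<le> hnorm R f"
proof -
  have 1: "mult_z f \<in> hcarrier R \<and> hnorm R (mult_z f) \<le> hnorm R f" if f: "f \<in> hcarrier R" for f
  proof -
    obtain a where a: "a \<in> hcarrier F.L" "f = F.synth a" using f by (auto simp: R_carrier)
    have "mult_z f = F.synth (l2_shift m a)" using synth_l2_shift a by simp
    then show ?thesis using l2_shift_mem[OF a(1)] a by (simp add: R_carrier R_hnorm)
  qed
  then show "f \<in> hcarrier R \<Longrightarrow> hnorm R (mult_z f) \<le> hnorm R f" by simp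
  show "bounded_operator R R mult_z"
    by (rule bounded_operatorI[where C = 1])
      (use 1 in \<open>auto simp: mult_z_def fun_eq_iff scaleC_add_right scaleC_fun_def scaleC_scaleC mult.commute\<close>)
qed

lemma mult_z_funpow: "(mult_z ^^ l) f z = z ^ l *\<^sub>C f z"
  by (induction l) (auto simp: mult_z_def scaleC_scaleC scaleC_one)

text \<open>
  The coefficients of \<open>z\<^sup>l g\<close> vanish below \<open>l\<close>, so only the tail of the coefficients of \<open>f\<close> enters the
  inner product with \<open>f\<close>.
\<close>

lemma mult_z_pure:
  assumes f: "f \<in> hcarrier R"
  shows "\<exists>e. e \<longlonglongrightarrow> 0 \<and> (\<forall>l. \<forall>g\<in>hcarrier R. cmod (hinner R f ((mult_z ^^ l) g)) \<le> e l * hnorm R g)"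
proof -
  obtain a where a: "a \<in> hcarrier F.L" "f = F.synth a" using f by (auto simp: R_carrier)
  have am: "a q \<in> hcarrier D" for q using l2_carrierD(1)[OF a(1)] by simp
  define t where "t l = (\<lambda>q. if q < l then 0 else a q)" for l
  have tm: "t l q \<in> hcarrier D" for l q using am by (simp add: t_def)
  have sum: "((\<lambda>q. (hnorm D (a q))\<^sup>2) has_sum (hnorm F.L a)\<^sup>2) UNIV"
    by (rule l2_hnorm_has_sum[OF a(1)])
  have ts: "((\<lambda>q. (hnorm D (t l q))\<^sup>2) has_sum ((hnorm F.L a)\<^sup>2 - (\<Sum>q<l. (hnorm D (a q))\<^sup>2))) UNIV" for l
  proof -
    have fin: "((\<lambda>q. if q \<in> {..<l} then - (hnorm D (a q))\<^sup>2 else 0) has_sum (\<Sum>q<l. - (hnorm D (a q))\<^sup>2)) UNIV"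
      by (rule has_sum_cong_neutral[THEN iffD1, OF _ _ _ has_sum_finite[of "{..<l}"]]) auto
    have eq: "(hnorm D (a q))\<^sup>2 + (if q \<in> {..<l} then - (hnorm D (a q))\<^sup>2 else 0) = (hnorm D (t l q))\<^sup>2" for q
      by (simp add: t_def)
    show ?thesis using has_sum_add[OF sum fin] unfolding eq by (simp add: sum_negf)
  qed
  have tL: "t l \<in> hcarrier F.L" for l
    by (rule l2_carrierI[OF _ _ has_sum_imp_summable[OF ts]]) (use tm in auto)
  define e where "e l = hnorm F.L (t l)" for l
  have e2: "(e l)\<^sup>2 = (hnorm F.L a)\<^sup>2 - (\<Sum>q<l. (hnorm D (a q))\<^sup>2)" for l
    using has_sum_unique[OF l2_hnorm_has_sum[OF tL] ts] by (simp add: e_def)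
  have "(\<lambda>l. (e l)\<^sup>2) \<longlonglongrightarrow> (hnorm F.L a)\<^sup>2 - (hnorm F.L a)\<^sup>2"
    unfolding e2 using has_sum_imp_sums[OF sum] by (intro tendsto_intros) (simp add: sums_def)
  then have "(\<lambda>l. sqrt ((e l)\<^sup>2)) \<longlonglongrightarrow> sqrt 0" by (intro tendsto_real_sqrt) simp
  moreover have "0 \<le> e l" for l using tL by (simp add: e_def)
  ultimately have "e \<longlonglongrightarrow> 0" by simp
  moreover have "cmod (hinner R f ((mult_z ^^ l) g)) \<le> e l * hnorm R g" if g: "g \<in> hcarrier R" for l g
  proof -
    obtain b where b: "b \<in> hcarrier F.L" "g = F.synth b" using g by (auto simp: R_carrier)
    have sh: "(l2_shift m ^^ l) b \<in> hcarrier F.L \<and> hnorm F.L ((l2_shift m ^^ l) b) \<le> hnorm F.L b \<and>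
        (mult_z ^^ l) g = F.synth ((l2_shift m ^^ l) b) \<and> (\<forall>q<l. (l2_shift m ^^ l) b q = 0)"
    proof (induction l)
      case (Suc l)
      let ?b = "(l2_shift m ^^ l) b"
      have "hnorm F.L (l2_shift m ?b) \<le> hnorm F.L b" using l2_shift_mem(2)[of ?b] Suc by linarith
      moreover have "l2_shift m ?b q = 0" if "q < Suc l" for q
        using Suc that by (cases q) (simp_all add: l2_shift_def[of m ?b])
      ultimately show ?case using l2_shift_mem(1)[of ?b] synth_l2_shift[of ?b] Suc by simp
    qed (use b in simp)
    have "hinner R f ((mult_z ^^ l) g) = hinner F.L a ((l2_shift m ^^ l) b)"
      using sh a by (simp add: R_inner)
    also have "\<dots> = hinner F.L (t l) ((l2_shift m ^^ l) b)"
      unfolding l2_inner using sh am by (intro infsum_cong) (simp add: t_def)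
    also have "cmod \<dots> \<le> hnorm F.L (t l) * hnorm F.L ((l2_shift m ^^ l) b)"
      using sh by (intro F.L.Cauchy_Schwarz tL) simp
    also have "\<dots> \<le> e l * hnorm R g"
      using sh b tL by (simp add: e_def R_hnorm mult_left_mono)
    finally show ?thesis .
  qed
  ultimately show ?thesis by blast
qed

text \<open>
  The sum \<open>\<Sum>\<^sub>q c\<^sub>q a\<^sub>q\<close> in the weak sense, for square-summable \<open>c\<close>. Point evaluations and their derivatives
  have this form.
\<close>

definition coeff_functional :: "(nat \<Rightarrow> complex) \<Rightarrow> (nat \<Rightarrow> 'e) \<Rightarrow> 'e"
  where "coeff_functional c = adjoint D F.L (\<lambda>e q. cnj (c q) *\<^sub>C e)"

lemma coeff_functional:
  assumes c: "((\<lambda>q. (cmod (c q))\<^sup>2) has_sum C\<^sup>2) UNIV" and C: "0 \<le> C"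
  shows coeff_functional_inner: "\<lbrakk>a \<in> hcarrier F.L; e \<in> hcarrier D\<rbrakk>
      \<Longrightarrow> ((\<lambda>q. c q * hinner D (a q) e) has_sum hinner D (coeff_functional c a) e) UNIV"
    and coeff_functional_mem: "a \<in> hcarrier F.L \<Longrightarrow> coeff_functional c a \<in> hcarrier D"
    and coeff_functional_norm: "a \<in> hcarrier F.L \<Longrightarrow> hnorm D (coeff_functional c a) \<le> C * hnorm F.L a"
proof -
  have sum: "((\<lambda>q. (hnorm D (cnj (c q) *\<^sub>C e))\<^sup>2) has_sum (C\<^sup>2 * (hnorm D e)\<^sup>2)) UNIV"
    if "e \<in> hcarrier D" for e
    using has_sum_cmult_left[OF c, of "(hnorm D e)\<^sup>2"] that by (simp add: hnorm_scaleC power_mult_distrib)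
  have mem: "(\<lambda>q. cnj (c q) *\<^sub>C e) \<in> hcarrier F.L" if "e \<in> hcarrier D" for e
    by (rule l2_carrierI[OF _ _ has_sum_imp_summable[OF sum[OF that]]]) (use that in auto)
  have norm: "hnorm F.L (\<lambda>q. cnj (c q) *\<^sub>C e) \<le> C * hnorm D e" if "e \<in> hcarrier D" for e
  proof -
    have "(hnorm F.L (\<lambda>q. cnj (c q) *\<^sub>C e))\<^sup>2 = (C * hnorm D e)\<^sup>2"
      using has_sum_unique[OF l2_hnorm_has_sum[OF mem[OF that]] sum[OF that]]
      by (simp add: power_mult_distrib)
    then have "hnorm F.L (\<lambda>q. cnj (c q) *\<^sub>C e) = C * hnorm D e"
      by (rule power2_eq_imp_eq) (use C that mem in auto)
    then show ?thesis by simp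
  qed
  have bd: "bounded_operator D F.L (\<lambda>e q. cnj (c q) *\<^sub>C e)"
    by (rule bounded_operatorI[where C = C])
      (use mem norm in \<open>auto simp: fun_eq_iff scaleC_add_right scaleC_fun_def scaleC_scaleC mult.commute\<close>)
  note adj = adjoint[OF hilbert_space_axioms F.L.pre_hilbert_axioms bd]
  show "coeff_functional c a \<in> hcarrier D" if "a \<in> hcarrier F.L"
    using adj(1)[OF that] by (simp add: coeff_functional_def)
  show "hnorm D (coeff_functional c a) \<le> C * hnorm F.L a" if "a \<in> hcarrier F.L"
    unfolding coeff_functional_def
    by (rule adjoint_bounded[OF hilbert_space_axioms F.L.pre_hilbert_axioms bd norm C that])
  show "((\<lambda>q. c q * hinner D (a q) e) has_sum hinner D (coeff_functional c a) e) UNIV"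
    if a: "a \<in> hcarrier F.L" and e: "e \<in> hcarrier D"
  proof -
    have "((\<lambda>q. hinner D (a q) (cnj (c q) *\<^sub>C e)) has_sum hinner D (coeff_functional c a) e) UNIV"
      using l2_inner_has_sum[OF a mem[OF e]] adj(3)[OF a e] by (simp add: coeff_functional_def)
    then show ?thesis
      using l2_carrierD(1)[OF a] e by (simp add: inner_scaleC_right)
  qed
qed

lemma evaluation_bounded:
  assumes z: "z \<in> unit_disc"
  shows "bounded_operator R D (\<lambda>f. f z)"
proof -
  obtain C where C: "C > 0" "\<And>e. e \<in> hcarrier D \<Longrightarrow> hnorm F.L (F.coeff_kernel z e) \<le> C * hnorm D e"
    using bounded_operator_bound[OF F.coeff_kernel_bounded[OF z] pre_hilbert_axioms] by blast
  show ?thesis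
  proof (rule bounded_operatorI[where C = C])
    fix f assume "f \<in> hcarrier R"
    then obtain a where a: "a \<in> hcarrier F.L" "f = F.synth a" by (auto simp: R_carrier)
    show "f z \<in> hcarrier D" using F.synth_mem[OF z a(1)] a by simp
    have "hnorm D (F.synth a z) \<le> C * hnorm F.L a"
      unfolding F.synth_def
      using adjoint_bounded[OF hilbert_space_axioms F.L.pre_hilbert_axioms
          F.coeff_kernel_bounded[OF z] C(2) _ a(1)] C(1) z by simp
    then show "hnorm D (f z) \<le> C * hnorm R f" using R_hnorm[OF a(1)] a(2) by simp
  qed (auto simp: scaleC_fun_def)
qed

text \<open>
  One of the two factors \<open>K\<^sup>q\<close> absorbs \<open>q\<^sup>4\<close>, since \<open>q s\<^sup>q\<close> is bounded for \<open>s\<^sup>4 = K\<close>. The other one remains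
  for the convergence.
\<close>

lemma neg_binom_poly_summable:
  assumes K: "0 < K" "K < (1 :: real)"
  shows "(\<lambda>q. neg_binom m q * (real q ^ 4 * K ^ (2 * q))) summable_on UNIV"
proof -
  define s where "s = root 4 K"
  have s: "0 < s" "s < 1" "s ^ 4 = K" using K by (auto simp: s_def)
  have "(\<lambda>q. real q * s ^ q) \<longlonglongrightarrow> 0" using powser_times_n_limit_0[of s] s by simp
  then have "Bseq (\<lambda>q. real q * s ^ q)" by (intro convergent_imp_Bseq convergentI)
  then obtain B where B: "B > 0" "\<And>q. real q * s ^ q \<le> B"
    by (auto simp: Bseq_def abs_le_iff)
  have le: "real q ^ 4 * K ^ (2 * q) \<le> B ^ 4 * K ^ q" for q
  proof -
    have "(real q * s ^ q) ^ 4 \<le> B ^ 4" using B s by (intro power_mono) auto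
    also have "(real q * s ^ q) ^ 4 = real q ^ 4 * (s ^ 4) ^ q"
      by (simp add: power_mult_distrib flip: power_mult) (simp add: mult.commute)
    finally have "real q ^ 4 * K ^ q \<le> B ^ 4" by (simp add: s)
    then have "(real q ^ 4 * K ^ q) * K ^ q \<le> B ^ 4 * K ^ q"
      using K by (intro mult_right_mono) auto
    then show ?thesis by (simp add: mult_2 power_add mult.assoc)
  qed
  have "(\<lambda>q. norm (complex_of_real (neg_binom m q) * complex_of_real K ^ q)) summable_on UNIV"
    using K by (intro neg_binom_has_sum[OF m]) simp
  then have "(\<lambda>q. neg_binom m q * K ^ q) summable_on UNIV"
    using K neg_binom_pos[OF m] by (simp add: norm_mult norm_power less_imp_le)
  then have "(\<lambda>q. B ^ 4 * (neg_binom m q * K ^ q)) summable_on UNIV"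
    by (rule summable_on_cmult_right)
  then show ?thesis
  proof (rule summable_on_comparison_test)
    show "neg_binom m q * (real q ^ 4 * K ^ (2 * q)) \<le> B ^ 4 * (neg_binom m q * K ^ q)" for q
      using mult_left_mono[OF le[of q] less_imp_le[OF neg_binom_pos[OF m, of q]]] by (simp add: mult_ac)
    show "0 \<le> neg_binom m q * (real q ^ 4 * K ^ (2 * q))" for q
      using K neg_binom_pos[OF m, of q] by simp
  qed
qed

text \<open>
  Evaluation at \<open>z\<close> pairs the coefficients with the vector of the features at \<open>z\<close>. So it suffices to
  expand this vector to first order in the norm of \<open>\<ell>\<^sup>2\<close>.
\<close>

lemma evaluation_holomorphic:
  assumes z: "z \<in> unit_disc"
  shows "\<exists>L. bounded_operator R D L \<and>
      (\<forall>\<epsilon>>0. \<exists>\<delta>>0. \<forall>w\<in>unit_disc. dist w z < \<delta> \<longrightarrow>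
        (\<forall>f\<in>hcarrier R. hnorm D (f w - f z - (w - z) *\<^sub>C L f) \<le> \<epsilon> * dist w z * hnorm R f))"
proof -
  \<comment> \<open>The points close to \<open>z\<close> stay in the disc of radius \<open>K\<close>; \<open>W\<close> dominates the squares of the first and
    second derivatives of the features there.\<close>
  define K where "K = (1 + norm z) / 2"
  have K: "0 < K" "K < 1" "norm z < K" using z by (auto simp: K_def field_simps add_pos_nonneg)
  define W where "W q = neg_binom m q * (real q ^ 4 * K ^ (2 * q)) / K ^ 4" for q
  have W_sum: "W summable_on UNIV"
    unfolding W_def divide_inverse by (intro summable_on_cmult_left neg_binom_poly_summable K)
  have W0: "0 \<le> W q" for q using K neg_binom_pos[OF m, of q] by (simp add: W_def)
  have WK: "neg_binom m q * (real q * real (q - 1) * K ^ (q - 2))\<^sup>2 \<le> W q" for q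
  proof (cases "q < 2")
    case True
    then have "q = 0 \<or> q = 1" by auto
    then show ?thesis using W0[of q] by auto
  next
    case False
    have "(real q * real (q - 1))\<^sup>2 \<le> (real q * real q)\<^sup>2"
      by (intro power_mono mult_left_mono) auto
    also have "\<dots> = real q ^ 4" by (simp add: power2_eq_square power4_eq_xxxx mult.assoc)
    finally have le: "(real q * real (q - 1))\<^sup>2 \<le> real q ^ 4" .
    have "K ^ (2 * q) = K ^ (2 * (q - 2)) * K ^ 4"
      using False by (subst power_add[symmetric]) (intro arg_cong[of _ _ "power K"], simp)
    then have pow: "(K ^ (q - 2))\<^sup>2 = K ^ (2 * q) / K ^ 4" using K by (simp add: power_mult[symmetric] mult.commute)
    have "(real q * real (q - 1) * K ^ (q - 2))\<^sup>2 \<le> real q ^ 4 * (K ^ (2 * q) / K ^ 4)"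
      unfolding power_mult_distrib[of "real q * real (q - 1)"] pow
      using le K by (intro mult_right_mono) auto
    then have "neg_binom m q * (real q * real (q - 1) * K ^ (q - 2))\<^sup>2
        \<le> neg_binom m q * (real q ^ 4 * (K ^ (2 * q) / K ^ 4))"
      using neg_binom_pos[OF m, of q] by (intro mult_left_mono) auto
    then show ?thesis by (simp add: W_def)
  qed
  have WD: "neg_binom m q * (real q * norm z ^ (q - 1))\<^sup>2 \<le> W q" for q
  proof (cases "q = 0")
    case True
    then show ?thesis using W0[of q] by simp
  next
    case False
    have "norm z ^ (q - 1) \<le> K ^ (q - 1)" using K by (intro power_mono) auto
    then have "(real q * norm z ^ (q - 1))\<^sup>2 \<le> (real q * K ^ (q - 1))\<^sup>2"
      using K by (intro power_mono mult_left_mono) auto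
    also have "\<dots> = real q ^ 2 * (K ^ (2 * q) / K ^ 2)"
    proof -
      have "K ^ (2 * q) = K ^ (2 * (q - 1)) * K ^ 2"
        using False by (subst power_add[symmetric]) (intro arg_cong[of _ _ "power K"], simp)
      then have "(K ^ (q - 1))\<^sup>2 = K ^ (2 * q) / K ^ 2" using K by (simp add: power_mult[symmetric] mult.commute)
      then show ?thesis by (simp add: power_mult_distrib)
    qed
    also have "\<dots> \<le> real q ^ 4 * (K ^ (2 * q) / K ^ 4)"
    proof (rule mult_mono)
      show "real q ^ 2 \<le> real q ^ 4" using False by (intro power_increasing) auto
      have "K ^ 4 \<le> K ^ 2" using K by (intro power_decreasing) auto
      then show "K ^ (2 * q) / K ^ 2 \<le> K ^ (2 * q) / K ^ 4" using K by (intro divide_left_mono) auto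
    qed (use K in auto)
    finally have "neg_binom m q * (real q * norm z ^ (q - 1))\<^sup>2
        \<le> neg_binom m q * (real q ^ 4 * (K ^ (2 * q) / K ^ 4))"
      using neg_binom_pos[OF m, of q] by (intro mult_left_mono) auto
    then show ?thesis by (simp add: W_def)
  qed
  define M where "M = sqrt (\<Sum>\<^sub>\<infinity>q. W q)"
  have M: "0 \<le> M" "M\<^sup>2 = (\<Sum>\<^sub>\<infinity>q. W q)"
    using infsum_nonneg[of UNIV W] W0 by (auto simp: M_def)
  have l2: "\<exists>C. 0 \<le> C \<and> C \<le> t * M \<and> ((\<lambda>q. (cmod (c q))\<^sup>2) has_sum C\<^sup>2) UNIV"
    if c: "\<And>q. (cmod (c q))\<^sup>2 \<le> t\<^sup>2 * W q" and t: "0 \<le> t" for c t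
  proof -
    have Ws: "((\<lambda>q. t\<^sup>2 * W q) has_sum (t * M)\<^sup>2) UNIV"
      unfolding power_mult_distrib M by (intro has_sum_cmult_right) (use W_sum in simp)
    have "(\<lambda>q. (cmod (c q))\<^sup>2) summable_on UNIV"
      by (rule summable_on_comparison_test[OF has_sum_imp_summable[OF Ws]]) (use c in auto)
    then obtain S where S: "((\<lambda>q. (cmod (c q))\<^sup>2) has_sum S) UNIV" by (auto simp: summable_on_def)
    have "0 \<le> S" by (rule has_sum_nonneg[OF S]) simp
    moreover have "S \<le> (t * M)\<^sup>2" by (rule has_sum_mono[OF S Ws]) (rule c)
    ultimately show ?thesis
      using S M t by (intro exI[of _ "sqrt S"]) (auto intro: real_le_lsqrt)
  qed
  define c' where "c' q = complex_of_real (sqrt (neg_binom m q)) * (of_nat q * z ^ (q - 1))" for q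
  have sq: "(cmod (complex_of_real (sqrt (neg_binom m q)) * x))\<^sup>2 = neg_binom m q * (cmod x)\<^sup>2" for q x
    using neg_binom_pos[OF m, of q] by (simp add: norm_mult power_mult_distrib)
  have "(cmod (c' q))\<^sup>2 \<le> 1\<^sup>2 * W q" for q
    using WD[of q] unfolding c'_def sq by (simp add: norm_mult norm_power)
  from l2[OF this] obtain C' where C': "0 \<le> C'" "((\<lambda>q. (cmod (c' q))\<^sup>2) has_sum C'\<^sup>2) UNIV"
    by auto
  note f' = coeff_functional[OF C'(2,1)]
  define coeff where "coeff f = (SOME a. a \<in> hcarrier F.L \<and> F.synth a = f)" for f
  have coeff: "coeff f \<in> hcarrier F.L" "F.synth (coeff f) = f" if "f \<in> hcarrier R" for f
    using someI_ex[of "\<lambda>a. a \<in> hcarrier F.L \<and> F.synth a = f"] that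
    by (auto simp: coeff_def R_carrier)
  have coeff_synth: "coeff (F.synth a) = a" if "a \<in> hcarrier F.L" for a
    using coeff[of "F.synth a"] that inj_onD[OF F.synth_inj] by (auto simp: R_carrier)
  define L where "L f = coeff_functional c' (coeff f)" for f
  have L_inner: "((\<lambda>q. c' q * hinner D (coeff f q) e) has_sum hinner D (L f) e) UNIV"
    if "f \<in> hcarrier R" "e \<in> hcarrier D" for f e
    using f'(1)[OF coeff(1)[OF that(1)] that(2)] by (simp add: L_def)
  have L_mem: "L f \<in> hcarrier D" if "f \<in> hcarrier R" for f
    using f'(2)[OF coeff(1)[OF that]] by (simp add: L_def)
  have coeff_add: "coeff (f + g) = coeff f + coeff g" if "f \<in> hcarrier R" "g \<in> hcarrier R" for f g
  proof -
    have "F.synth (coeff f + coeff g) = f + g" using that coeff by (simp only: F.synth_add)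
    then show ?thesis using coeff_synth[of "coeff f + coeff g"] that coeff by simp
  qed
  have coeff_scale: "coeff (t *\<^sub>C f) = t *\<^sub>C coeff f" if "f \<in> hcarrier R" for f t
  proof -
    have "F.synth (t *\<^sub>C coeff f) = t *\<^sub>C f" using that coeff by (simp only: F.synth_scaleC)
    then show ?thesis using coeff_synth[of "t *\<^sub>C coeff f"] that coeff by simp
  qed
  have cm: "coeff f q \<in> hcarrier D" if "f \<in> hcarrier R" for f q
    using l2_carrierD(1)[OF coeff(1)[OF that]] by simp
  have "bounded_operator R D L"
  proof (rule bounded_operatorI[where C = C'])
    fix f g assume f: "f \<in> hcarrier R" and g: "g \<in> hcarrier R"
    show "L (f + g) = L f + L g"
    proof (rule eq_if_inner_eq)
      fix e assume e: "e \<in> hcarrier D"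
      have "((\<lambda>q. c' q * hinner D (coeff f q) e + c' q * hinner D (coeff g q) e) has_sum
          (hinner D (L f) e + hinner D (L g) e)) UNIV"
        using f g e by (intro has_sum_add L_inner)
      then have "((\<lambda>q. c' q * hinner D (coeff (f + g) q) e) has_sum
          (hinner D (L f) e + hinner D (L g) e)) UNIV"
        using f g e by (simp add: coeff_add inner_add_left cm distrib_left)
      then show "hinner D (L (f + g)) e = hinner D (L f + L g) e"
        using has_sum_unique[OF L_inner[of "f + g" e]] f g e by (simp add: inner_add_left L_mem)
    qed (use f g L_mem in auto)
  next
    fix t f assume f: "f \<in> hcarrier R"
    show "L (t *\<^sub>C f) = t *\<^sub>C L f"
    proof (rule eq_if_inner_eq)
      fix e assume e: "e \<in> hcarrier D"
      have "((\<lambda>q. t * (c' q * hinner D (coeff f q) e)) has_sum (t * hinner D (L f) e)) UNIV"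
        using f e by (intro has_sum_cmult_right L_inner)
      then have "((\<lambda>q. c' q * hinner D (coeff (t *\<^sub>C f) q) e) has_sum (t * hinner D (L f) e)) UNIV"
        using f e by (simp add: coeff_scale inner_scaleC_left cm scaleC_fun_apply mult_ac)
      then show "hinner D (L (t *\<^sub>C f)) e = hinner D (t *\<^sub>C L f) e"
        using has_sum_unique[OF L_inner[of "t *\<^sub>C f" e]] f e by (simp add: inner_scaleC_left L_mem)
    qed (use f L_mem in auto)
    show "hnorm D (L f) \<le> C' * hnorm R f"
      using f'(3)[OF coeff(1)[OF f]] R_hnorm[OF coeff(1)[OF f]] coeff(2)[OF f] by (simp add: L_def)
  qed (rule L_mem)
  moreover have "\<exists>\<delta>>0. \<forall>w\<in>unit_disc. dist w z < \<delta> \<longrightarrow>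
      (\<forall>f\<in>hcarrier R. hnorm D (f w - f z - (w - z) *\<^sub>C L f) \<le> \<epsilon> * dist w z * hnorm R f)"
    if eps: "\<epsilon> > 0" for \<epsilon>
  proof (intro exI[of _ "min ((1 - norm z) / 2) (\<epsilon> / (M + 1))"] conjI ballI impI)
    have M1: "M + 1 > 0" using M by simp
    show "0 < min ((1 - norm z) / 2) (\<epsilon> / (M + 1))" using z eps M1 by simp
    fix w f
    assume w: "w \<in> unit_disc" and d: "dist w z < min ((1 - norm z) / 2) (\<epsilon> / (M + 1))"
      and f: "f \<in> hcarrier R"
    define c where "c q = disc_feature m q w - disc_feature m q z - (w - z) * c' q" for q
    have wK: "norm w \<le> K"
      using d norm_triangle_ineq2[of w z] by (simp add: K_def dist_norm field_simps)
    have c_le: "(cmod (c q))\<^sup>2 \<le> ((dist w z)\<^sup>2)\<^sup>2 * W q" for q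
    proof (cases "w = z")
      case True
      then show ?thesis by (simp add: c_def)
    next
      case False
      define h where "h = w - z"
      have h: "h \<noteq> 0" "z + h = w" using False by (auto simp: h_def)
      have "norm (((z + h) ^ q - z ^ q) / h - of_nat q * z ^ (q - Suc 0)) \<le>
          of_nat q * of_nat (q - Suc 0) * K ^ (q - 2) * norm h"
        using h K wK by (intro lemma_termdiff3) auto
      then have "norm h * norm ((w ^ q - z ^ q) / h - of_nat q * z ^ (q - 1)) \<le>
          norm h * (real q * real (q - 1) * K ^ (q - 2) * norm h)"
        using h by (intro mult_left_mono) auto
      also have "norm h * norm ((w ^ q - z ^ q) / h - of_nat q * z ^ (q - 1))
          = norm (w ^ q - z ^ q - h * (of_nat q * z ^ (q - 1)))"
        unfolding norm_mult[symmetric] right_diff_distrib[of h]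
        using h by (simp only: times_divide_eq_right nonzero_mult_div_cancel_left not_False_eq_True)
      finally have "norm (w ^ q - z ^ q - h * (of_nat q * z ^ (q - 1))) \<le>
          (norm h)\<^sup>2 * (real q * real (q - 1) * K ^ (q - 2))" by (simp add: power2_eq_square mult_ac)
      from power_mono[OF this norm_ge_zero, of 2]
      have le: "(norm (w ^ q - z ^ q - h * (of_nat q * z ^ (q - 1))))\<^sup>2 \<le>
          ((norm h)\<^sup>2)\<^sup>2 * (real q * real (q - 1) * K ^ (q - 2))\<^sup>2"
        by (simp only: power_mult_distrib[of "(norm h)\<^sup>2"])
      have "c q = complex_of_real (sqrt (neg_binom m q)) * (w ^ q - z ^ q - h * (of_nat q * z ^ (q - 1)))"
        by (simp add: c_def c'_def disc_feature_def h_def algebra_simps)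
      then have "(cmod (c q))\<^sup>2 = neg_binom m q * (norm (w ^ q - z ^ q - h * (of_nat q * z ^ (q - 1))))\<^sup>2"
        by (simp only: sq)
      also have "\<dots> \<le> neg_binom m q * (((norm h)\<^sup>2)\<^sup>2 * (real q * real (q - 1) * K ^ (q - 2))\<^sup>2)"
        using le neg_binom_pos[OF m, of q] by (intro mult_left_mono) auto
      also have "\<dots> = ((norm h)\<^sup>2)\<^sup>2 * (neg_binom m q * (real q * real (q - 1) * K ^ (q - 2))\<^sup>2)"
        by (rule mult.left_commute)
      also have "\<dots> \<le> ((norm h)\<^sup>2)\<^sup>2 * W q" by (intro mult_left_mono WK) auto
      finally show ?thesis by (simp add: h_def dist_norm)
    qed
    from l2[OF c_le] obtain C where C: "0 \<le> C" "C \<le> (dist w z)\<^sup>2 * M"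
        "((\<lambda>q. (cmod (c q))\<^sup>2) has_sum C\<^sup>2) UNIV" by auto
    note fc = coeff_functional[OF C(3,1)]
    have fm: "f w \<in> hcarrier D" "f z \<in> hcarrier D"
      using is_rkhsD(2)[OF R_rkhs f] w z by auto
    have eq: "f w - f z - (w - z) *\<^sub>C L f = coeff_functional c (coeff f)"
    proof (rule eq_if_inner_eq)
      fix e assume e: "e \<in> hcarrier D"
      note s = F.synth_inner[OF _ coeff(1)[OF f] e, unfolded coeff(2)[OF f]]
      have "((\<lambda>q. disc_feature m q w * hinner D (coeff f q) e + (- 1) * (disc_feature m q z * hinner D (coeff f q) e)
          + (- (w - z)) * (c' q * hinner D (coeff f q) e)) has_sum
          (hinner D (f w) e + (- 1) * hinner D (f z) e + (- (w - z)) * hinner D (L f) e)) UNIV"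
        by (intro has_sum_add has_sum_cmult_right s w z L_inner f e)
      moreover have "disc_feature m q w * hinner D (coeff f q) e + (- 1) * (disc_feature m q z * hinner D (coeff f q) e)
          + (- (w - z)) * (c' q * hinner D (coeff f q) e) = c q * hinner D (coeff f q) e" for q
        by (simp add: c_def algebra_simps)
      ultimately have "((\<lambda>q. c q * hinner D (coeff f q) e) has_sum
          (hinner D (f w) e + (- 1) * hinner D (f z) e + (- (w - z)) * hinner D (L f) e)) UNIV"
        by simp
      from has_sum_unique[OF this fc(1)[OF coeff(1)[OF f] e]]
      show "hinner D (f w - f z - (w - z) *\<^sub>C L f) e = hinner D (coeff_functional c (coeff f)) e"
        using fm L_mem[OF f] e by (simp add: inner_simps algebra_simps)
    qed (use fm L_mem[OF f] fc(2)[OF coeff(1)[OF f]] in auto)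
    have "hnorm D (f w - f z - (w - z) *\<^sub>C L f) \<le> C * hnorm F.L (coeff f)"
      unfolding eq by (rule fc(3)[OF coeff(1)[OF f]])
    also have "hnorm F.L (coeff f) = hnorm R f"
      using R_hnorm[OF coeff(1)[OF f]] coeff(2)[OF f] by simp
    also have "C * hnorm R f \<le> (\<epsilon> * dist w z) * hnorm R f"
    proof (rule mult_right_mono)
      have "dist w z * M \<le> dist w z * (M + 1)" by (intro mult_left_mono) auto
      also have "\<dots> \<le> \<epsilon>" using d M1 by (simp add: field_simps)
      finally have "dist w z * (dist w z * M) \<le> dist w z * \<epsilon>" by (intro mult_left_mono) auto
      then show "C \<le> \<epsilon> * dist w z" using C(2) by (simp add: power2_eq_square mult_ac)
    qed (use f in simp)
    finally show "hnorm D (f w - f z - (w - z) *\<^sub>C L f) \<le> \<epsilon> * dist w z * hnorm R f" .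
  qed
  ultimately show ?thesis by blast
qed

end

section \<open>Invariant subspaces of the disc spaces\<close>

lemma adjoint_bounded_operator:
  assumes H: "hilbert_space H" and K: "pre_hilbert K" and A: "bounded_operator H K A"
  shows "bounded_operator K H (adjoint H K A)"
proof -
  interpret H: hilbert_space H by (rule H)
  interpret K: pre_hilbert K by (rule K)
  note a = bounded_operatorD[OF A]
  note adj = adjoint[OF H K A]
  obtain C where C: "C > 0" "\<And>x. x \<in> hcarrier H \<Longrightarrow> hnorm K (A x) \<le> C * hnorm H x"
    using bounded_operator_bound[OF A H.pre_hilbert_axioms] by blast
  show ?thesis
  proof (rule bounded_operatorI)
    fix x y assume "x \<in> hcarrier K" "y \<in> hcarrier K"
    then show "adjoint H K A (x + y) = adjoint H K A x + adjoint H K A y"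
      by (intro H.eq_if_inner_eq_right)
        (auto simp: a adj(1) H.inner_add_right K.inner_add_right simp flip: adj(2))
  next
    fix t x assume "x \<in> hcarrier K"
    then show "adjoint H K A (t *\<^sub>C x) = t *\<^sub>C adjoint H K A x"
      by (intro H.eq_if_inner_eq_right)
        (auto simp: a adj(1) H.inner_scaleC_right K.inner_scaleC_right simp flip: adj(2))
  next
    fix x assume "x \<in> hcarrier K"
    then show "hnorm H (adjoint H K A x) \<le> C * hnorm K x"
      using C by (intro adjoint_bounded[OF H K A]) auto
  qed (rule adj(1))
qed

lemma disc_feature_one [simp]: "disc_feature (Suc 0) q z = z ^ q"
  by (simp add: disc_feature_def)

text \<open>
  The isometric part of a pure contraction: for a contraction \<open>C\<close> with \<open>C\<^sup>*\<^sup>q \<rightarrow> 0\<close> and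
  \<open>G\<^sup>2 = I - C C\<^sup>*\<close>, the squares of the norms of \<open>G C\<^sup>*\<^sup>q s\<close> telescope, so \<open>s \<mapsto> (G C\<^sup>*\<^sup>q s)\<^sub>q\<close> is an
  isometry into \<open>\<ell>\<^sup>2\<close>.
\<close>

lemma pure_contraction_isometry:
  assumes E: "hilbert_space E"
    and C: "bounded_operator E E C" "\<And>x. x \<in> hcarrier E \<Longrightarrow> hnorm E (C x) \<le> hnorm E x"
    and pure: "\<And>x. x \<in> hcarrier E \<Longrightarrow> (\<lambda>l. hnorm E ((adjoint E E C ^^ l) x)) \<longlonglongrightarrow> 0"
  obtains G where "positive_operator E G"
    "\<And>x. x \<in> hcarrier E \<Longrightarrow> hnorm E (G x) \<le> hnorm E x"
    "\<And>x. x \<in> hcarrier E \<Longrightarrow> (\<lambda>q. G ((adjoint E E C ^^ q) x)) \<in> hcarrier (l2_space UNIV E)"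
    "\<And>x. x \<in> hcarrier E \<Longrightarrow> hnorm (l2_space UNIV E) (\<lambda>q. G ((adjoint E E C ^^ q) x)) = hnorm E x"
proof -
  interpret E: hilbert_space E by (rule E)
  note P = E.pre_hilbert_axioms
  define C' where "C' = adjoint E E C"
  note c = bounded_operatorD[OF C(1)]
  note adj = adjoint[OF E P C(1), folded C'_def]
  interpret L: pre_hilbert "l2_space UNIV E" by (rule E.l2_pre_hilbert)
  have C'_norm: "hnorm E (C' x) \<le> hnorm E x" if "x \<in> hcarrier E" for x
    using adjoint_bounded[OF E P C(1), of 1 x] C(2) that by (simp add: C'_def)
  have C'_bounded: "bounded_operator E E C'"
    unfolding C'_def by (rule adjoint_bounded_operator[OF E P C(1)])
  have X: "bounded_operator E E (\<lambda>x. C (C' x))"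
    by (rule bounded_operator_compose[OF C'_bounded C(1) P P])
  have "\<exists>G. positive_operator E G \<and> (\<forall>x\<in>hcarrier E. G (G x) = x - C (C' x))"
  proof (rule sqrt_one_minus_contraction[OF E X])
    show "hinner E (C (C' x)) y = hinner E x (C (C' y))"
      if "x \<in> hcarrier E" "y \<in> hcarrier E" for x y
      using that adj by simp
    show "hnorm E (C (C' x)) \<le> hnorm E x" if "x \<in> hcarrier E" for x
      using C(2)[of "C' x"] C'_norm[OF that] adj(1)[OF that] by linarith
  qed
  then obtain G where G: "positive_operator E G" "\<And>x. x \<in> hcarrier E \<Longrightarrow> G (G x) = x - C (C' x)"
    by blast
  note g = bounded_operatorD[OF positive_operatorD(1)[OF G(1)]]
  have G_sq: "(hnorm E (G x))\<^sup>2 = (hnorm E x)\<^sup>2 - (hnorm E (C' x))\<^sup>2" if x: "x \<in> hcarrier E" for x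
  proof -
    have "(hnorm E (G x))\<^sup>2 = Re (hinner E (G (G x)) x)"
      using positive_operator_hermitian[OF G(1) P, of "G x" x] g(1) x by (simp add: E.hnorm_sq)
    also have "\<dots> = (hnorm E x)\<^sup>2 - Re (hinner E (C (C' x)) x)"
      using x c adj(1) by (simp add: G(2) E.inner_simps E.hnorm_sq)
    also have "hinner E (C (C' x)) x = hinner E (C' x) (C' x)"
      using x adj by simp
    finally show ?thesis using x adj(1) by (simp add: E.hnorm_sq)
  qed
  have pow: "(C' ^^ q) x \<in> hcarrier E" if "x \<in> hcarrier E" for q x
    using that adj(1) by (induction q) auto
  have sum: "((\<lambda>q. (hnorm E (G ((C' ^^ q) x)))\<^sup>2) has_sum (hnorm E x)\<^sup>2) UNIV" if x: "x \<in> hcarrier E" for x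
  proof (rule sums_nonneg_imp_has_sum)
    have "(\<lambda>q. (hnorm E ((C' ^^ q) x))\<^sup>2 - (hnorm E ((C' ^^ Suc q) x))\<^sup>2) sums
        ((hnorm E ((C' ^^ 0) x))\<^sup>2 - 0\<^sup>2)"
      using pure[OF x] by (intro telescope_sums' tendsto_power) (simp add: C'_def)
    then show "(\<lambda>q. (hnorm E (G ((C' ^^ q) x)))\<^sup>2) sums (hnorm E x)\<^sup>2"
      using pow[OF x] by (simp add: G_sq)
  qed simp
  have mem: "(\<lambda>q. G ((C' ^^ q) x)) \<in> hcarrier (l2_space UNIV E)" if x: "x \<in> hcarrier E" for x
    by (rule l2_carrierI[OF _ _ has_sum_imp_summable[OF sum[OF x]]]) (use g pow[OF x] in auto)
  show ?thesis
  proof (rule that[OF G(1)])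
    show "hnorm E (G x) \<le> hnorm E x" if x: "x \<in> hcarrier E" for x
    proof (rule power2_le_imp_le)
      show "(hnorm E (G x))\<^sup>2 \<le> (hnorm E x)\<^sup>2" using G_sq[OF x] by simp
    qed (use x in simp)
    show "(\<lambda>q. G ((adjoint E E C ^^ q) x)) \<in> hcarrier (l2_space UNIV E)" if "x \<in> hcarrier E" for x
      using mem[OF that] by (simp add: C'_def)
    show "hnorm (l2_space UNIV E) (\<lambda>q. G ((adjoint E E C ^^ q) x)) = hnorm E x" if x: "x \<in> hcarrier E" for x
    proof (rule power2_eq_imp_eq)
      show "(hnorm (l2_space UNIV E) (\<lambda>q. G ((adjoint E E C ^^ q) x)))\<^sup>2 = (hnorm E x)\<^sup>2"
        using has_sum_unique[OF E.l2_hnorm_has_sum[OF mem[OF x]] sum[OF x]] by (simp add: C'_def)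
      show "0 \<le> hnorm (l2_space UNIV E) (\<lambda>q. G ((adjoint E E C ^^ q) x))"
        using L.hnorm_nonneg[OF mem[OF x]] by (simp add: C'_def)
    qed (use x in simp)
  qed
qed

text \<open>
  The Beurling theorem for the weighted spaces. Multiplication by \<open>z\<close> on \<open>S\<close> is a pure contraction, so
  the adjoint of the isometry above is a coisometry from the Hardy space of \<open>S\<close> onto \<open>S\<close>. It
  intertwines the multiplications by \<open>z\<close>, and therefore multiplies by \<open>\<theta>(z) e = (G e)(z)\<close>.
\<close>

theorem (in disc_space) invariant_subspace_multiplier:
  assumes S: "closed_subspace R S" and inv: "\<And>f. f \<in> S \<Longrightarrow> mult_z f \<in> S"
  shows "\<exists>\<theta>. partially_isometric_multiplier 1 (subspace_of R S) m D \<theta> \<and>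
    mult_operator unit_disc \<theta> ` hcarrier (A2_disc 1 (subspace_of R S)) = S"
proof -
  define E where "E = subspace_of R S"
  have E: "hilbert_space E" unfolding E_def by (rule R.closed_subspace_hilbert[OF S])
  interpret E: hilbert_space E by (rule E)
  note P = E.pre_hilbert_axioms
  have E_simps: "hcarrier E = S" "hinner E = hinner R" "hnorm E = hnorm R" by (simp_all add: E_def)
  note S' = R.closed_subspaceD[OF S]
  interpret H2: disc_space E "Suc 0" by unfold_locales simp
  note z = bounded_operatorD[OF mult_z_bounded]
  have C: "bounded_operator E E mult_z"
    by (rule bounded_operatorI[where C = 1])
      (use inv S' z mult_z_contraction in \<open>auto simp: E_simps\<close>)
  have C_contr: "hnorm E (mult_z x) \<le> hnorm E x" if "x \<in> hcarrier E" for x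
    using that S' mult_z_contraction by (simp add: E_simps)
  define C' where "C' = adjoint E E mult_z"
  note adj = adjoint[OF E P C, folded C'_def]
  have pow: "(mult_z ^^ q) x \<in> S" if "x \<in> S" for q x using that inv by (induction q) auto
  have pow': "(C' ^^ q) x \<in> S" if "x \<in> S" for q x
    using that adj(1) by (induction q) (auto simp: E_simps)
  have adj_pow: "hinner R ((mult_z ^^ q) x) y = hinner R x ((C' ^^ q) y)" if "x \<in> S" "y \<in> S" for q x y
    using that
  proof (induction q arbitrary: y)
    case (Suc q)
    have "hinner R (mult_z ((mult_z ^^ q) x)) y = hinner R ((mult_z ^^ q) x) (C' y)"
      using adj(2)[of y "(mult_z ^^ q) x"] Suc.prems pow by (simp add: E_simps)
    also have "\<dots> = hinner R x ((C' ^^ q) (C' y))"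
      using Suc.IH[of "C' y"] Suc.prems adj(1)[of y] by (simp add: E_simps)
    finally show ?case by (simp add: funpow_swap1)
  qed simp
  have pure: "(\<lambda>l. hnorm E ((C' ^^ l) x)) \<longlonglongrightarrow> 0" if x: "x \<in> hcarrier E" for x
  proof -
    have xR: "x \<in> S" "x \<in> hcarrier R" using x S' by (auto simp: E_simps)
    obtain e where e: "e \<longlonglongrightarrow> 0"
      "\<And>l g. g \<in> hcarrier R \<Longrightarrow> cmod (hinner R x ((mult_z ^^ l) g)) \<le> e l * hnorm R g"
      using mult_z_pure[OF xR(2)] by blast
    have le: "hnorm R ((C' ^^ l) x) \<le> \<bar>e l\<bar>" for l
    proof -
      let ?y = "(C' ^^ l) x"
      have y: "?y \<in> S" "?y \<in> hcarrier R" using pow'[OF xR(1)] S' by auto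
      have "(hnorm R ?y)\<^sup>2 = cmod (hinner R ?y ?y)"
        using R.inner_self[OF y(2)] by (simp add: norm_power y)
      also have "hinner R ?y ?y = hinner R ((mult_z ^^ l) ?y) x"
        using adj_pow[OF y(1) xR(1), of l] by simp
      also have "cmod \<dots> = cmod (hinner R x ((mult_z ^^ l) ?y))"
        using R.inner_commute[of x "(mult_z ^^ l) ?y"] xR pow[OF y(1)] S' by simp
      also have "\<dots> \<le> e l * hnorm R ?y" by (rule e(2)[OF y(2)])
      also have "\<dots> \<le> \<bar>e l\<bar> * hnorm R ?y" using y by (intro mult_right_mono) auto
      finally have *: "hnorm R ?y * hnorm R ?y \<le> \<bar>e l\<bar> * hnorm R ?y" by (simp add: power2_eq_square)
      show ?thesis
      proof (cases "hnorm R ?y = 0")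
        case False
        then have "0 < hnorm R ?y" using R.hnorm_nonneg[OF y(2)] by linarith
        then show ?thesis using * by simp
      qed simp
    qed
    have nn: "0 \<le> hnorm R ((C' ^^ l) x)" for l using pow'[OF xR(1)] S' by simp
    show ?thesis unfolding E_simps
      by (rule Lim_null_comparison[OF _ tendsto_rabs_zero[OF e(1)]]) (use le nn in auto)
  qed
  obtain G where G: "positive_operator E G" "\<And>x. x \<in> hcarrier E \<Longrightarrow> hnorm E (G x) \<le> hnorm E x"
    "\<And>x. x \<in> hcarrier E \<Longrightarrow> (\<lambda>q. G ((C' ^^ q) x)) \<in> hcarrier (l2_space UNIV E)"
    "\<And>x. x \<in> hcarrier E \<Longrightarrow> hnorm (l2_space UNIV E) (\<lambda>q. G ((C' ^^ q) x)) = hnorm E x"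
    using pure_contraction_isometry[OF E C C_contr pure[unfolded C'_def], folded C'_def] by metis
  note Gb = positive_operatorD(1)[OF G(1)]
  note g = bounded_operatorD[OF Gb, unfolded E_simps]
  have G_herm: "hinner R (G x) y = hinner R x (G y)" if "x \<in> S" "y \<in> S" for x y
    using positive_operator_hermitian[OF G(1) P, of x y] that by (simp add: E_simps)
  let ?L = "l2_space UNIV E"
  interpret L: hilbert_space ?L by (rule E.l2_hilbert)
  define V where "V x = (\<lambda>q. G ((C' ^^ q) x))" for x
  note c' = bounded_operatorD[OF bounded_operator_funpow[OF adjoint_bounded_operator[OF E P C] P],
      folded C'_def, unfolded E_simps]
  have pow_add: "(C' ^^ q) (x + y) = (C' ^^ q) x + (C' ^^ q) y" if "x \<in> S" "y \<in> S" for q x y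
    using c'(2) that by blast
  have pow_scale: "(C' ^^ q) (t *\<^sub>C x) = t *\<^sub>C (C' ^^ q) x" if "x \<in> S" for q x t
    using c'(3) that by blast
  have V_mem: "V x \<in> hcarrier ?L" if "x \<in> S" for x using G(3) that by (simp add: V_def E_simps)
  have V_add: "V (x + y) = V x + V y" if "x \<in> S" "y \<in> S" for x y
    using that by (simp add: V_def fun_eq_iff pow_add g pow')
  have V_scale: "V (t *\<^sub>C x) = t *\<^sub>C V x" if "x \<in> S" for x t
    using that by (simp add: V_def fun_eq_iff pow_scale g pow' scaleC_fun_apply)
  have V_norm: "hnorm ?L (V x) = hnorm E x" if "x \<in> S" for x
    using G(4) that by (simp add: V_def E_simps)
  have V: "bounded_operator E ?L V"
    by (rule bounded_operatorI[where C = 1]) (use V_mem V_add V_scale V_norm in \<open>auto simp: E_simps(1)\<close>)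
  have V_inner: "hinner ?L (V x) (V y) = hinner E x y" if "x \<in> S" "y \<in> S" for x y
    by (rule isometry_preserves_inner[OF P L.pre_hilbert_axioms, where V = V])
      (use V_mem V_add V_scale V_norm that in \<open>auto simp: E_simps(1)\<close>)
  define A where "A = adjoint E ?L V"
  note A = adjoint[OF E L.pre_hilbert_axioms V, folded A_def]
  have A_norm: "hnorm E (A b) \<le> hnorm ?L b" if "b \<in> hcarrier ?L" for b
    using adjoint_bounded[OF E L.pre_hilbert_axioms V, of 1 b] V_norm that by (simp add: A_def E_simps(1))
  have AV: "A (V x) = x" if "x \<in> S" for x
    using that unfolding A_def by (intro adjoint_eqI[OF P]) (auto simp: E_simps(1) V_inner)
  define \<theta> where "\<theta> z e = G e z" for z e
  have G_R: "G e \<in> hcarrier R" if "e \<in> S" for e using g(1)[OF that] S' by simp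
  \<comment> \<open>Let \<open>p\<close> be the vector of \<open>S\<close> that represents the evaluation at \<open>z\<close> in the direction \<open>d\<close>. The adjoint of
    multiplication by \<open>z\<close> on \<open>S\<close> multiplies \<open>p\<close> by the conjugate of \<open>z\<close>, so \<open>V p\<close> consists of the
    coefficients of the kernel function of the Hardy space at \<open>z\<close> in the direction \<open>G p\<close>.\<close>
  have main: "\<theta> z (H2.F.synth b z) = A b z" if b: "b \<in> hcarrier ?L" and w: "z \<in> unit_disc" for b z
  proof (rule eq_if_inner_eq)
    define f where "f = H2.F.synth b z"
    have f: "f \<in> S" using H2.F.synth_mem[OF w b] by (simp add: f_def E_simps)
    have AbS: "A b \<in> S" using A(1)[OF b] by (simp add: E_simps)
    show "\<theta> z (H2.F.synth b z) \<in> hcarrier D"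
      unfolding \<theta>_def f_def[symmetric] by (rule is_rkhsD(2)[OF R_rkhs G_R[OF f] w])
    show "A b z \<in> hcarrier D" by (rule is_rkhsD(2)[OF R_rkhs S'(2)[OF AbS] w])
    fix d assume d: "d \<in> hcarrier D"
    define \<kappa> where "\<kappa> = (\<lambda>w. if w \<in> unit_disc then disc_kernel m w z *\<^sub>C d else 0)"
    have \<kappa>: "\<kappa> \<in> hcarrier R" "\<And>h. h \<in> hcarrier R \<Longrightarrow> hinner R h \<kappa> = hinner D (h z) d"
      using is_rkhsD(4,5)[OF R_rkhs w d] by (auto simp: \<kappa>_def)
    define p where "p = orth_proj R S \<kappa>"
    have p: "p \<in> S" "\<And>u. u \<in> S \<Longrightarrow> hinner R u p = hinner D (u z) d"
      using R.orth_proj_mem[OF S \<kappa>(1)] R.orth_proj_inner[OF S \<kappa>(1)] \<kappa>(2) S' by (auto simp: p_def)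
    have bS: "b q \<in> S" for q using l2_carrierD(1)[OF b, of q] by (simp add: E_simps)
    have coord: "hinner E (b q) (V p q) = z ^ q * hinner E (b q) (G p)" for q
    proof -
      have gz: "G (b q) z \<in> hcarrier D" by (rule is_rkhsD(2)[OF R_rkhs G_R[OF bS] w])
      have "hinner R (b q) (G ((C' ^^ q) p)) = hinner R (G (b q)) ((C' ^^ q) p)"
        using G_herm bS pow' p(1) by simp
      also have "\<dots> = hinner R ((mult_z ^^ q) (G (b q))) p"
        using adj_pow g(1) bS p(1) by simp
      also have "\<dots> = hinner D (((mult_z ^^ q) (G (b q))) z) d"
        using p(2) pow g(1) bS by simp
      also have "\<dots> = z ^ q * hinner D (G (b q) z) d"
        using gz d by (simp add: mult_z_funpow inner_scaleC_left)
      also have "hinner D (G (b q) z) d = hinner R (b q) (G p)"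
        using p(2)[of "G (b q)"] g(1) bS G_herm p(1) by simp
      finally show ?thesis by (simp add: V_def E_simps)
    qed
    have "((\<lambda>q. hinner E (b q) (V p q)) has_sum hinner ?L b (V p)) UNIV"
      by (rule E.l2_inner_has_sum[OF b V_mem[OF p(1)]])
    then have "((\<lambda>q. z ^ q * hinner E (b q) (G p)) has_sum hinner ?L b (V p)) UNIV"
      by (simp add: coord)
    moreover have "((\<lambda>q. z ^ q * hinner E (b q) (G p)) has_sum hinner E f (G p)) UNIV"
      using H2.F.synth_inner[OF w b, of "G p"] g(1) p(1) by (simp add: f_def E_simps(1))
    ultimately have "hinner E f (G p) = hinner ?L b (V p)" by (metis has_sum_unique)
    also have "\<dots> = hinner E (A b) p" using A(3)[OF b, of p] p(1) by (simp add: E_simps(1))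
    also have "\<dots> = hinner D (A b z) d" using p(2)[OF AbS] by (simp add: E_simps)
    finally have "hinner D (A b z) d = hinner R (G f) p" using G_herm f p(1) by (simp add: E_simps)
    then show "hinner D (\<theta> z (H2.F.synth b z)) d = hinner D (A b z) d"
      using p(2)[of "G f"] g(1) f by (simp add: \<theta>_def f_def)
  qed
  have M_eq: "mult_operator unit_disc \<theta> (H2.F.synth b) = A b" if b: "b \<in> hcarrier ?L" for b
  proof
    fix z
    have "A b \<in> hcarrier R" using A(1)[OF b] S' by (simp add: E_simps)
    then show "mult_operator unit_disc \<theta> (H2.F.synth b) z = A b z"
      using main[OF b] is_rkhsD(3)[OF R_rkhs] by (simp add: mult_operator_def)
  qed
  note H2_carrier = H2.R_carrier and H2_inner = H2.R_inner and H2_hnorm = H2.R_hnorm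
  have range: "mult_operator unit_disc \<theta> ` hcarrier (A2_disc (Suc 0) E) = S"
  proof
    show "mult_operator unit_disc \<theta> ` hcarrier (A2_disc (Suc 0) E) \<subseteq> S"
      using A(1) by (auto simp: H2_carrier M_eq E_simps(1))
    show "S \<subseteq> mult_operator unit_disc \<theta> ` hcarrier (A2_disc (Suc 0) E)"
    proof
      fix x assume x: "x \<in> S"
      have "mult_operator unit_disc \<theta> (H2.F.synth (V x)) = x" using M_eq[OF V_mem[OF x]] AV[OF x] by simp
      then show "x \<in> mult_operator unit_disc \<theta> ` hcarrier (A2_disc (Suc 0) E)"
        unfolding H2_carrier using V_mem[OF x] by (metis image_eqI)
    qed
  qed
  have ev: "bounded_operator E D (\<theta> z)" if w: "z \<in> unit_disc" for z
  proof -
    obtain c where c: "c > 0" "\<And>f. f \<in> hcarrier R \<Longrightarrow> hnorm D (f z) \<le> c * hnorm R f"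
      using bounded_operator_bound[OF evaluation_bounded[OF w] R.pre_hilbert_axioms] by blast
    show ?thesis
    proof (rule bounded_operatorI[where C = c])
      fix e assume e: "e \<in> hcarrier E"
      then have eS: "e \<in> S" by (simp add: E_simps)
      show "\<theta> z e \<in> hcarrier D" unfolding \<theta>_def by (rule is_rkhsD(2)[OF R_rkhs G_R[OF eS] w])
      have "hnorm D (G e z) \<le> c * hnorm R (G e)" by (rule c(2)[OF G_R[OF eS]])
      also have "\<dots> \<le> c * hnorm R e" using G(2)[OF e] c(1) by (simp add: E_simps)
      finally show "hnorm D (\<theta> z e) \<le> c * hnorm E e" by (simp add: \<theta>_def E_simps)
    qed (auto simp: \<theta>_def g E_simps(1) scaleC_fun_apply)
  qed
  have hol: "operator_holomorphic_on unit_disc E D \<theta>"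
    unfolding operator_holomorphic_on_def
  proof (intro conjI ballI)
    fix z :: complex assume w: "z \<in> unit_disc"
    show "bounded_operator E D (\<theta> z)" by (rule ev[OF w])
    obtain L where L: "bounded_operator R D L"
      "\<forall>\<epsilon>>0. \<exists>\<delta>>0. \<forall>w\<in>unit_disc. dist w z < \<delta> \<longrightarrow>
        (\<forall>f\<in>hcarrier R. hnorm D (f w - f z - (w - z) *\<^sub>C L f) \<le> \<epsilon> * dist w z * hnorm R f)"
      using evaluation_holomorphic[OF w] by blast
    have incl: "bounded_operator E R G"
      by (rule bounded_operatorI[where C = 1]) (use G(2) G_R g in \<open>auto simp: E_simps\<close>)
    have LG: "bounded_operator E D (\<lambda>e. L (G e))"
      by (rule bounded_operator_compose[OF incl L(1) P R.pre_hilbert_axioms])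
    show "\<exists>L. bounded_operator E D L \<and> (\<forall>\<epsilon>>0. \<exists>\<delta>>0. \<forall>w\<in>unit_disc. dist w z < \<delta> \<longrightarrow>
        (\<forall>x\<in>hcarrier E. hnorm D (\<theta> w x - \<theta> z x - (w - z) *\<^sub>C L x) \<le> \<epsilon> * dist w z * hnorm E x))"
    proof (intro exI[of _ "\<lambda>e. L (G e)"] conjI LG allI impI)
      fix \<epsilon> :: real assume eps: "\<epsilon> > 0"
      then obtain \<delta> where \<delta>: "\<delta> > 0" "\<And>w f. w \<in> unit_disc \<Longrightarrow> dist w z < \<delta> \<Longrightarrow> f \<in> hcarrier R \<Longrightarrow>
          hnorm D (f w - f z - (w - z) *\<^sub>C L f) \<le> \<epsilon> * dist w z * hnorm R f"
        using L(2) by meson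
      show "\<exists>\<delta>>0. \<forall>w\<in>unit_disc. dist w z < \<delta> \<longrightarrow>
          (\<forall>x\<in>hcarrier E. hnorm D (\<theta> w x - \<theta> z x - (w - z) *\<^sub>C L (G x)) \<le> \<epsilon> * dist w z * hnorm E x)"
      proof (intro exI[of _ \<delta>] conjI ballI impI \<delta>(1))
        fix w e assume w: "w \<in> unit_disc" "dist w z < \<delta>" and e: "e \<in> hcarrier E"
        have "hnorm D (G e w - G e z - (w - z) *\<^sub>C L (G e)) \<le> \<epsilon> * dist w z * hnorm R (G e)"
          using e by (intro \<delta>(2) w G_R) (simp add: E_simps)
        also have "\<dots> \<le> \<epsilon> * dist w z * hnorm R e"
          using G(2)[OF e] eps by (intro mult_left_mono) (auto simp: E_simps)
        finally show "hnorm D (\<theta> w e - \<theta> z e - (w - z) *\<^sub>C L (G e)) \<le> \<epsilon> * dist w z * hnorm E e"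
          by (simp add: \<theta>_def E_simps)
      qed
    qed
  qed
  have partial: "partial_isometry (A2_disc (Suc 0) E) R (mult_operator unit_disc \<theta>)"
    unfolding partial_isometry_def
  proof (intro conjI ballI)
    show "bounded_operator (A2_disc (Suc 0) E) R (mult_operator unit_disc \<theta>)"
    proof (rule bounded_operatorI[where C = 1])
      fix x assume "x \<in> hcarrier (A2_disc (Suc 0) E)"
      then obtain b where b: "b \<in> hcarrier ?L" "x = H2.F.synth b" by (auto simp: H2_carrier)
      show "mult_operator unit_disc \<theta> x \<in> hcarrier R"
        using A(1)[OF b(1)] S' by (simp add: b M_eq E_simps(1))
      show "hnorm R (mult_operator unit_disc \<theta> x) \<le> 1 * hnorm (A2_disc (Suc 0) E) x"
        using A_norm[OF b(1)] b M_eq by (simp add: E_simps(3) H2_hnorm)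
      have xS: "x z \<in> hcarrier E" if "z \<in> unit_disc" for z
        using H2.F.synth_mem[OF that b(1)] b by simp
      show "mult_operator unit_disc \<theta> (c *\<^sub>C x) = c *\<^sub>C mult_operator unit_disc \<theta> x" for c
        using bounded_operatorD(3)[OF ev] xS by (auto simp: mult_operator_def fun_eq_iff scaleC_fun_apply)
      fix y assume "y \<in> hcarrier (A2_disc (Suc 0) E)"
      then have yS: "y z \<in> hcarrier E" if "z \<in> unit_disc" for z
        using H2.F.synth_mem[OF that] by (auto simp: H2_carrier)
      show "mult_operator unit_disc \<theta> (x + y) = mult_operator unit_disc \<theta> x + mult_operator unit_disc \<theta> y"
        using bounded_operatorD(2)[OF ev] xS yS by (auto simp: mult_operator_def fun_eq_iff)
    qed
    fix x assume x: "x \<in> orth_compl (A2_disc (Suc 0) E) {y \<in> hcarrier (A2_disc (Suc 0) E). mult_operator unit_disc \<theta> y = 0}"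
    then obtain b where b: "b \<in> hcarrier ?L" "x = H2.F.synth b" by (auto simp: H2_carrier orth_compl_def)
    have AbS: "A b \<in> S" using A(1)[OF b(1)] by (simp add: E_simps)
    define k where "k = b - V (A b)"
    have k: "k \<in> hcarrier ?L" using b V_mem[OF AbS] by (simp add: k_def)
    have "A k = 0"
      unfolding A_def
    proof (rule adjoint_eqI[OF P])
      fix u assume u: "u \<in> hcarrier E"
      then have "hinner ?L (V u) k = hinner ?L (V u) b - hinner E u (A b)"
        using V_mem b AbS V_inner by (simp add: k_def L.inner_diff_right E_simps(1))
      then show "hinner ?L (V u) k = hinner E u 0" using A(2)[OF b(1) u] u by simp
    qed simp
    then have "mult_operator unit_disc \<theta> (H2.F.synth k) = 0" using M_eq[OF k] by simp
    then have "hinner (A2_disc (Suc 0) E) x (H2.F.synth k) = 0"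
      using x k by (auto simp: orth_compl_def H2_carrier)
    then have "hinner ?L b k = 0" using b k by (simp add: H2_inner)
    then have "hinner ?L b b = hinner ?L b (V (A b))"
      using b V_mem[OF AbS] by (simp add: k_def L.inner_diff_right)
    also have "\<dots> = hinner E (A b) (A b)" using A(3)[OF b(1), of "A b"] AbS by (simp add: E_simps(1))
    finally have "hnorm ?L b = hnorm E (A b)" by (simp add: hnorm_def)
    then show "hnorm R (mult_operator unit_disc \<theta> x) = hnorm (A2_disc (Suc 0) E) x"
      using b M_eq H2_hnorm by (simp add: E_simps(3))
  qed
  have "\<theta> \<in> multipliers (Suc 0) E m D"
    unfolding multipliers_def using hol range S'(1) by auto
  then show ?thesis
    using partial range unfolding partially_isometric_multiplier_def E_def[symmetric] One_nat_def by blast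
qed

text \<open>
  The index sets \<open>{1..n}\<close> and the Hardy weight 1 keep the form that they have in the definitions of the
  spaces.
\<close>

declare One_nat_def [simp del]

section \<open>Slices and multipliers in one variable of the polydisc\<close>

definition slice :: "'i \<Rightarrow> (('i \<Rightarrow> nat) \<Rightarrow> 'e) \<Rightarrow> ('i \<Rightarrow> nat) \<Rightarrow> nat \<Rightarrow> 'e"
  where "slice k a p = (\<lambda>q. a (p(k := q)))"

text \<open>
  The operator \<open>I \<otimes> G \<otimes> I\<close> with \<open>G\<close> in the \<open>k\<close>-th factor.
\<close>

definition tensor_op ::
    "'i set \<Rightarrow> 'i \<Rightarrow> ((nat \<Rightarrow> 'e) \<Rightarrow> nat \<Rightarrow> 'd::zero) \<Rightarrow> (('i \<Rightarrow> nat) \<Rightarrow> 'e) \<Rightarrow> ('i \<Rightarrow> nat) \<Rightarrow> 'd"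
  where "tensor_op A k G a = (\<lambda>p. if p \<in> multi A then G (slice k a p) (p k) else 0)"

text \<open>
  The tensor \<open>\<delta>\<^sub>r \<otimes> b\<close> with \<open>b\<close> in the \<open>k\<close>-th factor: \<open>b\<close> is the slice at \<open>r\<close>, all other slices are 0.
\<close>

definition slice_embed ::
    "'i set \<Rightarrow> 'i \<Rightarrow> ('i \<Rightarrow> nat) \<Rightarrow> (nat \<Rightarrow> 'e::zero) \<Rightarrow> ('i \<Rightarrow> nat) \<Rightarrow> 'e"
  where "slice_embed A k r b = (\<lambda>p. if p \<in> multi A \<and> p(k := undefined) = r then b (p k) else 0)"

lemma slice_update [simp]: "slice k a (p(k := q)) = slice k a p"
  by (simp add: slice_def)

lemma slice_tensor_op: "\<lbrakk>k \<in> A; p \<in> multi (A - {k})\<rbrakk> \<Longrightarrow> slice k (tensor_op A k G a) p = G (slice k a p)"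
  unfolding slice_def[of k "tensor_op A k G a"] by (simp add: tensor_op_def multi_update)

lemma slice_slice_embed:
  assumes "k \<in> A" "p \<in> multi (A - {k})"
  shows "slice k (slice_embed A k r b) p = (if p = r then b else 0)"
proof -
  have "p k = undefined" using PiE_arb[OF assms(2), of k] by simp
  then have "p(k := undefined) = p" by (metis fun_upd_triv)
  then show ?thesis
    using assms by (auto simp: slice_def slice_embed_def multi_update fun_eq_iff zero_fun_def)
qed

context pre_hilbert
begin

lemma
  assumes k: "k \<in> A" and a: "a \<in> hcarrier (l2_space (multi A) H)"
  shows slice_mem: "p \<in> multi (A - {k}) \<Longrightarrow> slice k a p \<in> hcarrier (l2_space UNIV H)"
    and slice_hnorm_has_sum: "((\<lambda>p. (hnorm (l2_space UNIV H) (slice k a p))\<^sup>2) has_sum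
        (hnorm (l2_space (multi A) H) a)\<^sup>2) (multi (A - {k}))"
proof -
  note sum = l2_hnorm_has_sum[OF a]
  show mem: "slice k a p \<in> hcarrier (l2_space UNIV H)" if p: "p \<in> multi (A - {k})" for p
  proof (rule l2_carrierI)
    show "slice k a p q \<in> hcarrier H" for q
      unfolding slice_def by (rule l2_carrierD(1)[OF a multi_update[OF k p]])
    show "(\<lambda>q. (hnorm H (slice k a p q))\<^sup>2) summable_on UNIV"
      using multi_split_sumD(1)[OF k sum p] by (simp add: slice_def)
  qed simp
  show "((\<lambda>p. (hnorm (l2_space UNIV H) (slice k a p))\<^sup>2) has_sum
        (hnorm (l2_space (multi A) H) a)\<^sup>2) (multi (A - {k}))"
  proof (rule multi_split_sum_unique[OF k sum])
    show "((\<lambda>q. (hnorm H (a (p(k := q))))\<^sup>2) has_sum (hnorm (l2_space UNIV H) (slice k a p))\<^sup>2) UNIV"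
      if "p \<in> multi (A - {k})" for p
      using l2_hnorm_has_sum[OF mem[OF that]] by (simp add: slice_def)
  qed
qed

lemma slice_mem':
  assumes k: "k \<in> A" and a: "a \<in> hcarrier (l2_space (multi A) H)" and p: "p \<in> multi A"
  shows "slice k a p \<in> hcarrier (l2_space UNIV H)"
  using slice_mem[OF k a multi_restrict[OF p, of k]] by simp

lemma slice_inner_has_sum:
  assumes k: "k \<in> A" and a: "a \<in> hcarrier (l2_space (multi A) H)"
    and b: "b \<in> hcarrier (l2_space (multi A) H)"
  shows "((\<lambda>p. hinner (l2_space UNIV H) (slice k a p) (slice k b p)) has_sum
        hinner (l2_space (multi A) H) a b) (multi (A - {k}))"
proof (rule multi_split_sum_unique[OF k l2_inner_has_sum[OF a b]])
  show "((\<lambda>q. hinner H (a (p(k := q))) (b (p(k := q)))) has_sum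
      hinner (l2_space UNIV H) (slice k a p) (slice k b p)) UNIV" if "p \<in> multi (A - {k})" for p
    using l2_inner_has_sum[OF slice_mem[OF k a that] slice_mem[OF k b that]] by (simp add: slice_def)
qed

lemma tensor_op_mem:
  assumes k: "k \<in> A" and E: "pre_hilbert E" and a: "a \<in> hcarrier (l2_space (multi A) E)"
    and G: "\<And>b. b \<in> hcarrier (l2_space UNIV E) \<Longrightarrow> G b \<in> hcarrier (l2_space UNIV H)"
      "\<And>b. b \<in> hcarrier (l2_space UNIV E) \<Longrightarrow> hnorm (l2_space UNIV H) (G b) \<le> C * hnorm (l2_space UNIV E) b"
  shows "tensor_op A k G a \<in> hcarrier (l2_space (multi A) H)"
proof (rule l2_carrierI)
  interpret E: pre_hilbert E by (rule E)
  interpret LH: pre_hilbert "l2_space UNIV H" by (rule l2_pre_hilbert)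
  note sm = E.slice_mem[OF k a] and sm' = E.slice_mem'[OF k a]
  show "tensor_op A k G a p \<in> hcarrier H" if "p \<in> multi A" for p
    using l2_carrierD(1)[OF G(1)[OF sm'[OF that]]] that by (simp add: tensor_op_def)
  show "tensor_op A k G a p = 0" if "p \<notin> multi A" for p
    using that by (simp add: tensor_op_def)
  let ?g = "\<lambda>p. (hnorm (l2_space UNIV H) (G (slice k a p)))\<^sup>2"
  have "?g summable_on multi (A - {k})"
  proof (rule summable_on_comparison_test)
    show "(\<lambda>p. C\<^sup>2 * (hnorm (l2_space UNIV E) (slice k a p))\<^sup>2) summable_on multi (A - {k})"
      by (intro summable_on_cmult_right has_sum_imp_summable[OF E.slice_hnorm_has_sum[OF k a]])
    show "?g p \<le> C\<^sup>2 * (hnorm (l2_space UNIV E) (slice k a p))\<^sup>2" if "p \<in> multi (A - {k})" for p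
      using power_mono[OF G(2)[OF sm[OF that]], of 2] LH.hnorm_nonneg[OF G(1)[OF sm[OF that]]]
      by (simp add: power_mult_distrib)
  qed simp
  then have "(?g has_sum infsum ?g (multi (A - {k}))) (multi (A - {k}))" by simp
  then have "((\<lambda>p. (hnorm H (tensor_op A k G a p))\<^sup>2) has_sum infsum ?g (multi (A - {k}))) (multi A)"
  proof (rule multi_split_sum_nonneg[OF k, rotated])
    fix p assume p: "p \<in> multi (A - {k})"
    have "tensor_op A k G a (p(k := q)) = G (slice k a p) q" for q
      using fun_cong[OF slice_tensor_op[OF k p, of G a], of q] by (simp add: slice_def)
    then show "((\<lambda>q. (hnorm H (tensor_op A k G a (p(k := q))))\<^sup>2) has_sum ?g p) UNIV"
      using l2_hnorm_has_sum[OF G(1)[OF sm[OF p]]] by simp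
  qed simp
  then show "(\<lambda>p. (hnorm H (tensor_op A k G a p))\<^sup>2) summable_on multi A"
    by (rule has_sum_imp_summable)
qed

lemma slice_embed_mem:
  assumes k: "k \<in> A" and r: "r \<in> multi (A - {k})" and b: "b \<in> hcarrier (l2_space UNIV H)"
  shows "slice_embed A k r b \<in> hcarrier (l2_space (multi A) H)"
proof (rule l2_carrierI)
  show "slice_embed A k r b p \<in> hcarrier H" for p
    using l2_carrierD(1)[OF b] by (simp add: slice_embed_def)
  show "slice_embed A k r b p = 0" if "p \<notin> multi A" for p using that by (simp add: slice_embed_def)
  let ?N = "(hnorm (l2_space UNIV H) b)\<^sup>2"
  let ?g = "\<lambda>p. if p = r then ?N else 0"
  have "(?g has_sum ?N) {r}" using has_sum_finite[of "{r}" ?g] by simp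
  then have "(?g has_sum ?N) (multi (A - {k}))"
    by (rule has_sum_cong_neutral[THEN iffD1, rotated -1]) (use r in auto)
  then have "((\<lambda>p. (hnorm H (slice_embed A k r b p))\<^sup>2) has_sum ?N) (multi A)"
  proof (rule multi_split_sum_nonneg[OF k, rotated])
    fix p assume p: "p \<in> multi (A - {k})"
    have "slice_embed A k r b (p(k := q)) = (if p = r then b q else 0)" for q
      using fun_cong[OF slice_slice_embed[OF k p, of r b], of q] by (simp add: slice_def split: if_splits)
    then show "((\<lambda>q. (hnorm H (slice_embed A k r b (p(k := q))))\<^sup>2) has_sum ?g p) UNIV"
      using l2_hnorm_has_sum[OF b] by simp
  qed simp
  then show "(\<lambda>p. (hnorm H (slice_embed A k r b p))\<^sup>2) summable_on multi A"
    by (rule has_sum_imp_summable)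
qed

end

abbreviation disc_synth :: "'e::complex_vector hilbert \<Rightarrow> nat \<Rightarrow> (nat \<Rightarrow> 'e) \<Rightarrow> complex \<Rightarrow> 'e"
  where "disc_synth E m \<equiv> feature_kernel.synth E unit_disc UNIV (disc_feature m)"

abbreviation polydisc_synth ::
    "'e::complex_vector hilbert \<Rightarrow> nat \<Rightarrow> (nat \<Rightarrow> nat) \<Rightarrow> ((nat \<Rightarrow> nat) \<Rightarrow> 'e) \<Rightarrow> (nat \<Rightarrow> complex) \<Rightarrow> 'e"
  where "polydisc_synth E n m \<equiv>
    feature_kernel.synth E (polydisc n) (multi {1..n}) (polydisc_feature {1..n} m)"

locale polydisc_space = hilbert_space D for D :: "'e::complex_vector hilbert" +
  fixes n :: nat and m :: "nat \<Rightarrow> nat"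
  assumes m: "\<And>i. i \<in> {1..n} \<Longrightarrow> m i \<ge> 1"
begin

lemma kernel_eq: "polydisc_kernel n m = (\<lambda>z w. \<Prod>i\<in>{1..n}. disc_kernel (m i) (z i) (w i))"
  by (simp add: polydisc_kernel_def fun_eq_iff)

sublocale F: feature_kernel D "polydisc n" "polydisc_kernel n m" "multi {1..n}" "polydisc_feature {1..n} m"
  unfolding polydisc_def kernel_eq
  by (rule polydisc_feature_kernel[OF hilbert_space_axioms]) (use m in auto)

abbreviation "K \<equiv> A2_polydisc n m D"

lemma K_def: "K = rkhs (polydisc n) (polydisc_kernel n m) D"
  by (simp add: A2_polydisc_def)

lemma K_carrier: "hcarrier K = F.synth ` hcarrier F.L"
  by (simp add: K_def F.rkhs_carrier)

lemma K_inner: "\<lbrakk>a \<in> hcarrier F.L; b \<in> hcarrier F.L\<rbrakk> \<Longrightarrow> hinner K (F.synth a) (F.synth b) = hinner F.L a b"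
  by (simp add: K_def F.rkhs_inner)

lemma K_rkhs: "is_rkhs (polydisc n) (polydisc_kernel n m) D K"
  using F.rkhs_is_rkhs by (simp add: K_def)

sublocale K: hilbert_space K
  by (rule is_rkhsD(1)[OF K_rkhs])

lemma synth_slice_has_sum:
  assumes k: "k \<in> {1..n}" and z: "z \<in> polydisc n" and a: "a \<in> hcarrier F.L" and e: "e \<in> hcarrier D"
  shows "((\<lambda>p. polydisc_feature ({1..n} - {k}) m p z * hinner D (disc_synth D (m k) (slice k a p) (z k)) e)
    has_sum hinner D (F.synth a z) e) (multi ({1..n} - {k}))"
proof (rule multi_split_sum_unique[OF k F.synth_inner[OF z a e]])
  interpret d: disc_space D "m k" by unfold_locales (rule m[OF k])
  fix p assume p: "p \<in> multi ({1..n} - {k})"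
  have zk: "z k \<in> unit_disc" using z k by (auto simp: polydisc_def)
  have "((\<lambda>q. polydisc_feature ({1..n} - {k}) m p z *
        (disc_feature (m k) q (z k) * hinner D (slice k a p q) e)) has_sum
      polydisc_feature ({1..n} - {k}) m p z * hinner D (disc_synth D (m k) (slice k a p) (z k)) e) UNIV"
    by (intro has_sum_cmult_right d.F.synth_inner zk slice_mem[OF k a p] e)
  then show "((\<lambda>q. polydisc_feature {1..n} m (p(k := q)) z * hinner D (a (p(k := q))) e) has_sum
      polydisc_feature ({1..n} - {k}) m p z * hinner D (disc_synth D (m k) (slice k a p) (z k)) e) UNIV"
    using k by (simp add: polydisc_feature_update slice_def mult_ac)
qed

end

text \<open>
  In the expansion of a function over the multi-indices of the other variables, the coefficients are the
  values of its slices at \<open>z\<^sub>k\<close>. The operator \<open>\<theta>(z\<^sub>k)\<close> passes through this expansion by means of its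
  adjoint, and on the slices it is \<open>G\<close>.
\<close>

lemma tensor_multiplier:
  assumes E: "hilbert_space E" and D: "hilbert_space D" and k: "k \<in> {1..n}"
    and m: "\<And>i. i \<in> {1..n} \<Longrightarrow> m i \<ge> 1" and m': "\<And>i. i \<in> {1..n} \<Longrightarrow> m' i \<ge> 1"
    and agree: "\<And>i. i \<noteq> k \<Longrightarrow> m' i = m i"
    and \<theta>: "\<And>w. w \<in> unit_disc \<Longrightarrow> bounded_operator E D (\<theta> w)"
    and G: "\<And>b. b \<in> hcarrier (l2_space UNIV E) \<Longrightarrow> G b \<in> hcarrier (l2_space UNIV D)"
      "\<And>b. b \<in> hcarrier (l2_space UNIV E) \<Longrightarrow> hnorm (l2_space UNIV D) (G b) \<le> C * hnorm (l2_space UNIV E) b"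
    and G\<theta>: "\<And>b w. \<lbrakk>b \<in> hcarrier (l2_space UNIV E); w \<in> unit_disc\<rbrakk> \<Longrightarrow>
        disc_synth D (m k) (G b) w = \<theta> w (disc_synth E (m' k) b w)"
    and a: "a \<in> hcarrier (l2_space (multi {1..n}) E)"
  shows "polydisc_synth D n m (tensor_op {1..n} k G a)
    = mult_operator (polydisc n) (\<lambda>z. \<theta> (z k)) (polydisc_synth E n m' a)"
proof -
  interpret PE: polydisc_space E n m' by (intro polydisc_space.intro polydisc_space_axioms.intro E m')
  interpret PD: polydisc_space D n m by (intro polydisc_space.intro polydisc_space_axioms.intro D m)
  interpret dE: disc_space E "m' k" by (intro disc_space.intro disc_space_axioms.intro E m' k)
  interpret dD: disc_space D "m k" by (intro disc_space.intro disc_space_axioms.intro D m k)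
  have T: "tensor_op {1..n} k G a \<in> hcarrier PD.F.L"
    by (rule PD.tensor_op_mem[OF k PE.pre_hilbert_axioms a G])
  show ?thesis
  proof (rule PD.F.synth_eqI[OF T])
    fix z assume z: "z \<in> polydisc n"
    have zk: "z k \<in> unit_disc" using z k by (auto simp: polydisc_def)
    note b = bounded_operatorD[OF \<theta>[OF zk]]
    have s: "PE.F.synth a z \<in> hcarrier E" by (rule PE.F.synth_mem[OF z a])
    show "mult_operator (polydisc n) (\<lambda>z. \<theta> (z k)) (PE.F.synth a) z \<in> hcarrier D"
      using b(1)[OF s] z by (simp add: mult_operator_def)
    fix d assume d: "d \<in> hcarrier D"
    define d' where "d' = adjoint E D (\<theta> (z k)) d"
    note d' = adjoint[OF E PD.pre_hilbert_axioms \<theta>[OF zk] d, folded d'_def]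
    have feat: "polydisc_feature ({1..n} - {k}) m' p z = polydisc_feature ({1..n} - {k}) m p z" for p
      unfolding polydisc_feature_def by (intro prod.cong) (auto simp: agree)
    have "((\<lambda>p. polydisc_feature ({1..n} - {k}) m p z *
        hinner E (disc_synth E (m' k) (slice k a p) (z k)) d') has_sum
        hinner E (PE.F.synth a z) d') (multi ({1..n} - {k}))"
      using PE.synth_slice_has_sum[OF k z a d'(1)] unfolding feat .
    then have 1: "((\<lambda>p. polydisc_feature ({1..n} - {k}) m p z *
        hinner D (disc_synth D (m k) (slice k (tensor_op {1..n} k G a) p) (z k)) d) has_sum
        hinner E (PE.F.synth a z) d') (multi ({1..n} - {k}))"
    proof (rule has_sum_cong[THEN iffD1, rotated])
      fix p assume p: "p \<in> multi ({1..n} - {k})"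
      note sl = PE.slice_mem[OF k a p]
      have "hinner D (disc_synth D (m k) (slice k (tensor_op {1..n} k G a) p) (z k)) d
          = hinner E (disc_synth E (m' k) (slice k a p) (z k)) d'"
        unfolding slice_tensor_op[OF k p] G\<theta>[OF sl zk] by (rule d'(2)[OF dE.F.synth_mem[OF zk sl]])
      then show "polydisc_feature ({1..n} - {k}) m p z *
          hinner E (disc_synth E (m' k) (slice k a p) (z k)) d' =
          polydisc_feature ({1..n} - {k}) m p z *
          hinner D (disc_synth D (m k) (slice k (tensor_op {1..n} k G a) p) (z k)) d" by simp
    qed
    have "hinner D (PD.F.synth (tensor_op {1..n} k G a) z) d = hinner E (PE.F.synth a z) d'"
      using has_sum_unique[OF PD.synth_slice_has_sum[OF k z T d] 1] .
    also have "\<dots> = hinner D (mult_operator (polydisc n) (\<lambda>z. \<theta> (z k)) (PE.F.synth a) z) d"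
      using d'(2)[OF s] z by (simp add: mult_operator_def)
    finally show "((\<lambda>p. polydisc_feature {1..n} m p z * hinner D (tensor_op {1..n} k G a p) d) has_sum
        hinner D (mult_operator (polydisc n) (\<lambda>z. \<theta> (z k)) (PE.F.synth a) z) d) (multi {1..n})"
      using PD.F.synth_inner[OF z T d] by simp
  qed (simp add: mult_operator_def)
qed

context polydisc_space
begin

lemma mult_coordinate_synth:
  assumes i: "i \<in> {1..n}" and a: "a \<in> hcarrier F.L"
  shows "tensor_op {1..n} i (l2_shift (m i)) a \<in> hcarrier F.L"
    and "mult_coordinate i (F.synth a) = F.synth (tensor_op {1..n} i (l2_shift (m i)) a)"
proof -
  interpret d: disc_space D "m i" by unfold_locales (rule m[OF i])
  show "tensor_op {1..n} i (l2_shift (m i)) a \<in> hcarrier F.L"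
    by (rule tensor_op_mem[OF i pre_hilbert_axioms a, where C = 1]) (use d.l2_shift_mem in auto)
  have "F.synth (tensor_op {1..n} i (l2_shift (m i)) a)
      = mult_operator (polydisc n) (\<lambda>z. (*\<^sub>C) (z i)) (F.synth a)"
  proof (rule tensor_multiplier[OF hilbert_space_axioms hilbert_space_axioms i m m, where C = 1])
    show "bounded_operator D D ((*\<^sub>C) w)" for w
      by (rule bounded_operatorI[where C = "cmod w"])
        (auto simp: hnorm_scaleC scaleC_add_right scaleC_scaleC mult.commute)
    show "disc_synth D (m i) (l2_shift (m i) b) w = w *\<^sub>C disc_synth D (m i) b w"
      if "b \<in> hcarrier (l2_space UNIV D)" for b w
      using d.synth_l2_shift[OF that] by (simp add: mult_z_def)
  qed (use a d.l2_shift_mem in auto)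
  also have "\<dots> = mult_coordinate i (F.synth a)"
    by (auto simp: mult_operator_def mult_coordinate_def fun_eq_iff F.synth_def)
  finally show "mult_coordinate i (F.synth a) = F.synth (tensor_op {1..n} i (l2_shift (m i)) a)" by simp
qed

text \<open>
  The multiplier of the polydisc acts on each slice by the multiplier of the disc, and the inner
  product is the sum of the inner products of the slices. So orthogonality can be tested on the
  functions with a single nonzero slice.
\<close>

lemma
  assumes k: "k \<in> {1..n}" and E: "hilbert_space E"
    and \<theta>: "partially_isometric_multiplier 1 E (m k) D \<theta>"
  defines "\<Theta> \<equiv> mult_operator (polydisc n) (\<lambda>z. \<theta> (z k))"
  shows variable_multiplier_mem: "g \<in> hcarrier (A2_polydisc n (m(k := 1)) E) \<Longrightarrow> \<Theta> g \<in> hcarrier K"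
    and variable_multiplier_zero: "0 \<in> \<Theta> ` hcarrier (A2_polydisc n (m(k := 1)) E)"
    and orth_variable_multiplier_iff: "a \<in> hcarrier F.L \<Longrightarrow>
      (\<forall>g\<in>hcarrier (A2_polydisc n (m(k := 1)) E). hinner K (F.synth a) (\<Theta> g) = 0) \<longleftrightarrow>
      (\<forall>p\<in>multi ({1..n} - {k}). \<forall>f\<in>hcarrier (A2_disc 1 E).
        hinner (A2_disc (m k) D) (disc_synth D (m k) (slice k a p)) (mult_operator unit_disc \<theta> f) = 0)"
proof -
  interpret PE: polydisc_space E n "m(k := 1)"
    by (intro polydisc_space.intro polydisc_space_axioms.intro E) (use m in auto)
  interpret dE: disc_space E 1 by (intro disc_space.intro disc_space_axioms.intro E) simp
  interpret dD: disc_space D "m k" by unfold_locales (rule m[OF k])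
  let ?M = "mult_operator unit_disc \<theta>"
  have M: "bounded_operator (A2_disc 1 E) dD.R ?M"
    using \<theta> unfolding partially_isometric_multiplier_def partial_isometry_def by blast
  note Md = bounded_operatorD[OF M]
  have \<theta>b: "bounded_operator E D (\<theta> w)" if "w \<in> unit_disc" for w
    using \<theta> that unfolding partially_isometric_multiplier_def multipliers_def operator_holomorphic_on_def
    by blast
  obtain C where C: "C > 0" "\<And>x. x \<in> hcarrier (A2_disc 1 E) \<Longrightarrow> hnorm dD.R (?M x) \<le> C * hnorm (A2_disc 1 E) x"
    using bounded_operator_bound[OF M dE.R.pre_hilbert_axioms] by blast
  have "\<forall>b. \<exists>c. b \<in> hcarrier dE.F.L \<longrightarrow> c \<in> hcarrier dD.F.L \<and> dD.F.synth c = ?M (dE.F.synth b)"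
  proof
    fix b
    show "\<exists>c. b \<in> hcarrier dE.F.L \<longrightarrow> c \<in> hcarrier dD.F.L \<and> dD.F.synth c = ?M (dE.F.synth b)"
    proof (cases "b \<in> hcarrier dE.F.L")
      case True
      then have "dE.F.synth b \<in> hcarrier (A2_disc 1 E)" unfolding dE.R_carrier by blast
      then have "?M (dE.F.synth b) \<in> hcarrier dD.R" by (rule Md(1))
      then show ?thesis unfolding dD.R_carrier by (metis imageE)
    qed simp
  qed
  then obtain G where G: "\<And>b. b \<in> hcarrier dE.F.L \<Longrightarrow> G b \<in> hcarrier dD.F.L"
    "\<And>b. b \<in> hcarrier dE.F.L \<Longrightarrow> dD.F.synth (G b) = ?M (dE.F.synth b)" by metis
  have synthE: "dE.F.synth b \<in> hcarrier (A2_disc 1 E)" if "b \<in> hcarrier dE.F.L" for b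
    using that unfolding dE.R_carrier by blast
  have G_norm: "hnorm dD.F.L (G b) \<le> C * hnorm dE.F.L b" if b: "b \<in> hcarrier dE.F.L" for b
    using C(2)[OF synthE[OF b]] G[OF b] dD.R_hnorm[OF G(1)[OF b]] dE.R_hnorm[OF b] by simp
  have G0: "G 0 = 0"
  proof (rule dD.F.synth_eq_0)
    show "G 0 \<in> hcarrier dD.F.L" by (rule G(1)) simp
    have "dE.F.synth 0 = 0" using dE.F.synth_scaleC[of 0 0] by simp
    then show "dD.F.synth (G 0) = 0"
      using G(2)[of 0] bounded_operator_zero[OF M dE.R.pre_hilbert_axioms] by simp
  qed
  let ?T = "tensor_op {1..n} k G"
  have T: "?T b \<in> hcarrier F.L" if "b \<in> hcarrier PE.F.L" for b
    by (rule tensor_op_mem[OF k PE.pre_hilbert_axioms that G(1) G_norm])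
  have \<Theta>: "\<Theta> (PE.F.synth b) = F.synth (?T b)" if b: "b \<in> hcarrier PE.F.L" for b
    unfolding \<Theta>_def
  proof (rule tensor_multiplier[OF E hilbert_space_axioms k m PE.m _ \<theta>b G(1) G_norm _ b, symmetric])
    show "disc_synth D (m k) (G b) w = \<theta> w (disc_synth E ((m(k := 1)) k) b w)"
      if "b \<in> hcarrier dE.F.L" "w \<in> unit_disc" for b w
      using fun_cong[OF G(2)[OF that(1)], of w] that(2) by (simp add: mult_operator_def)
  qed auto
  show "\<Theta> g \<in> hcarrier K" if "g \<in> hcarrier (A2_polydisc n (m(k := 1)) E)" for g
    using that T \<Theta> unfolding PE.K_carrier K_carrier by auto
  have "PE.F.synth 0 = 0" using PE.F.synth_scaleC[of 0 0] by simp
  moreover have "\<Theta> 0 = 0"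
  proof
    fix z
    have "\<theta> (z k) 0 = 0" if "z \<in> polydisc n"
      using that k by (intro bounded_operator_zero[OF \<theta>b PE.pre_hilbert_axioms]) (auto simp: polydisc_def)
    then show "\<Theta> 0 z = 0 z" by (simp add: \<Theta>_def mult_operator_def)
  qed
  moreover have "0 \<in> hcarrier PE.K" by simp
  ultimately show "0 \<in> \<Theta> ` hcarrier (A2_polydisc n (m(k := 1)) E)" by (metis image_eqI)
  assume a: "a \<in> hcarrier F.L"
  have inner: "((\<lambda>p. hinner dD.R (dD.F.synth (slice k a p)) (?M (dE.F.synth (slice k b p)))) has_sum
      hinner K (F.synth a) (\<Theta> (PE.F.synth b))) (multi ({1..n} - {k}))" if b: "b \<in> hcarrier PE.F.L" for b
  proof -
    have "((\<lambda>p. hinner dD.F.L (slice k a p) (slice k (?T b) p)) has_sum hinner F.L a (?T b))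
        (multi ({1..n} - {k}))"
      by (rule slice_inner_has_sum[OF k a T[OF b]])
    also have "hinner F.L a (?T b) = hinner K (F.synth a) (\<Theta> (PE.F.synth b))"
      using a b T by (simp add: \<Theta> K_inner)
    finally show ?thesis
    proof (rule has_sum_cong[THEN iffD1, rotated])
      fix p assume p: "p \<in> multi ({1..n} - {k})"
      note sl = PE.slice_mem[OF k b p]
      show "hinner dD.F.L (slice k a p) (slice k (?T b) p) =
          hinner dD.R (dD.F.synth (slice k a p)) (?M (dE.F.synth (slice k b p)))"
        unfolding slice_tensor_op[OF k p] G(2)[OF sl, symmetric]
        by (rule dD.R_inner[OF slice_mem[OF k a p] G(1)[OF sl], symmetric])
    qed
  qed
  show "(\<forall>g\<in>hcarrier (A2_polydisc n (m(k := 1)) E). hinner K (F.synth a) (\<Theta> g) = 0) \<longleftrightarrow>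
      (\<forall>p\<in>multi ({1..n} - {k}). \<forall>f\<in>hcarrier (A2_disc 1 E).
        hinner dD.R (dD.F.synth (slice k a p)) (?M f) = 0)"
  proof
    assume L: "\<forall>g\<in>hcarrier (A2_polydisc n (m(k := 1)) E). hinner K (F.synth a) (\<Theta> g) = 0"
    show "\<forall>p\<in>multi ({1..n} - {k}). \<forall>f\<in>hcarrier (A2_disc 1 E).
        hinner dD.R (dD.F.synth (slice k a p)) (?M f) = 0"
    proof (intro ballI)
      fix r f assume r: "r \<in> multi ({1..n} - {k})" and "f \<in> hcarrier (A2_disc 1 E)"
      then obtain c where c: "c \<in> hcarrier dE.F.L" "f = dE.F.synth c" unfolding dE.R_carrier by blast
      let ?b = "slice_embed {1..n} k r c"
      let ?h = "\<lambda>p. hinner dD.F.L (slice k a p) (slice k (?T ?b) p)"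
      have b: "?b \<in> hcarrier PE.F.L" by (rule PE.slice_embed_mem[OF k r c(1)])
      have sl: "slice k (?T ?b) p = (if p = r then G c else 0)" if "p \<in> multi ({1..n} - {k})" for p
        using slice_tensor_op[OF k that, of G ?b] slice_slice_embed[OF k that, of r c] G0 by simp
      have "(?h has_sum (\<Sum>p\<in>{r}. ?h p)) {r}" by (rule has_sum_finite) simp
      then have "(?h has_sum (\<Sum>p\<in>{r}. ?h p)) (multi ({1..n} - {k}))"
        by (rule has_sum_cong_neutral[THEN iffD1, rotated -1])
          (use r sl dD.F.L.inner_zero_right slice_mem[OF k a] in auto)
      from has_sum_unique[OF this slice_inner_has_sum[OF k a T[OF b]]]
      have "hinner dD.F.L (slice k a r) (G c) = hinner F.L a (?T ?b)" using sl[OF r] by simp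
      also have "\<dots> = hinner K (F.synth a) (\<Theta> (PE.F.synth ?b))"
        unfolding \<Theta>[OF b] by (rule K_inner[OF a T[OF b], symmetric])
      also have "\<dots> = 0" using L b unfolding PE.K_carrier by blast
      finally show "hinner dD.R (dD.F.synth (slice k a r)) (?M f) = 0"
        using dD.R_inner[OF slice_mem[OF k a r] G(1)[OF c(1)]] G(2)[OF c(1)] c(2) by simp
    qed
  next
    assume R: "\<forall>p\<in>multi ({1..n} - {k}). \<forall>f\<in>hcarrier (A2_disc 1 E).
        hinner dD.R (dD.F.synth (slice k a p)) (?M f) = 0"
    show "\<forall>g\<in>hcarrier (A2_polydisc n (m(k := 1)) E). hinner K (F.synth a) (\<Theta> g) = 0"
    proof
      fix g assume "g \<in> hcarrier (A2_polydisc n (m(k := 1)) E)"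
      then obtain b where b: "b \<in> hcarrier PE.F.L" "g = PE.F.synth b" unfolding PE.K_carrier by blast
      have "((\<lambda>_. 0) has_sum hinner K (F.synth a) (\<Theta> (PE.F.synth b))) (multi ({1..n} - {k}))"
        by (rule has_sum_cong[THEN iffD1, OF _ inner[OF b(1)]])
          (use R synthE PE.slice_mem[OF k b(1)] in blast)
      then show "hinner K (F.synth a) (\<Theta> g) = 0"
        using has_sum_unique[OF has_sum_0_simp] b(2) by metis
    qed
  qed
qed

end

section \<open>Resolution of the identity by a hypercontraction\<close>

lemma neg_binom_hockey_stick: "(\<Sum>q\<le>s. neg_binom m q) = neg_binom (Suc m) s"
proof (cases m)
  case 0
  have "(\<Sum>q\<le>s. neg_binom 0 q) = 1"
    by (induction s) (auto simp: neg_binom_def)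
  then show ?thesis by (simp add: 0 neg_binom_def)
next
  case (Suc j)
  have "(\<Sum>q\<le>s. (j + q) choose q) = Suc (j + s) choose s" by (rule sum_choose_lower)
  then have "(\<Sum>q\<le>s. real ((j + q) choose q)) = real (Suc (j + s) choose s)"
    by (metis of_nat_sum)
  then show ?thesis by (simp add: neg_binom_def Suc)
qed

text \<open>
  A scalar form of the inversion of \<open>(1 - x)\<^sup>m\<close>: a null sequence whose \<open>m\<close>-th differences are
  nonnegative is the sum of these differences with the weights of \<open>(1 - x)\<^bsup>-m\<^esup>\<close>. By induction, the
  lower differences are nonnegative as well, so that all rearrangements are allowed.
\<close>

lemma difference_resolution:
  fixes a :: "nat \<Rightarrow> nat \<Rightarrow> real"
  assumes null: "a 0 \<longlonglongrightarrow> 0"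
    and step: "\<And>j l. a (Suc j) l = a j l - a j (Suc l)"
    and pos: "\<And>l. 0 \<le> a m l"
  shows "((\<lambda>q. neg_binom m q * a m (l + q)) has_sum a 0 l) UNIV"
  using pos
proof (induction m arbitrary: l)
  case 0
  have "((\<lambda>q. neg_binom 0 q * a 0 (l + q)) has_sum (\<Sum>q\<in>{0}. neg_binom 0 q * a 0 (l + q))) {0}"
    by (rule has_sum_finite) simp
  then have "((\<lambda>q. neg_binom 0 q * a 0 (l + q)) has_sum a 0 l) {0}" by simp
  then show ?case
    by (rule has_sum_cong_neutral[THEN iffD1, rotated -1]) (auto simp: neg_binom_def binomial_eq_0)
next
  case (Suc m)
  have null_j: "a j \<longlonglongrightarrow> 0" for j
  proof (induction j)
    case (Suc j)
    have "(\<lambda>l. a j l - a j (Suc l)) \<longlonglongrightarrow> 0 - 0" by (intro tendsto_diff Suc LIMSEQ_Suc)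
    moreover have "a (Suc j) = (\<lambda>l. a j l - a j (Suc l))" using step by blast
    ultimately show ?case by simp
  qed (rule null)
  have tail: "((\<lambda>r. a (Suc m) (l + r)) has_sum a m l) UNIV" for l
  proof (rule sums_nonneg_imp_has_sum)
    have "(\<lambda>r. a m (r + l)) \<longlonglongrightarrow> 0" by (rule LIMSEQ_ignore_initial_segment[OF null_j])
    then have "(\<lambda>r. a m (l + r)) \<longlonglongrightarrow> 0" by (simp add: add.commute)
    from telescope_sums'[OF this] show "(\<lambda>r. a (Suc m) (l + r)) sums a m l"
      by (simp add: step)
  qed (rule Suc.prems)
  have pos_m: "0 \<le> a m l" for l by (rule has_sum_nonneg[OF tail]) (rule Suc.prems)
  define f where "f = (\<lambda>(q, r). neg_binom m q * a (Suc m) (l + q + r))"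
  have f_inner: "((\<lambda>r. f (q, r)) has_sum (neg_binom m q * a m (l + q))) UNIV" for q
    unfolding f_def by (simp add: has_sum_cmult_right tail)
  have f_outer: "((\<lambda>q. neg_binom m q * a m (l + q)) has_sum a 0 l) UNIV"
    by (rule Suc.IH[OF pos_m])
  have nb: "0 \<le> neg_binom m q" for q by (simp add: neg_binom_def)
  have "f summable_on UNIV \<times> UNIV"
    by (rule summable_on_SigmaI[OF f_inner has_sum_imp_summable[OF f_outer]])
      (use nb Suc.prems in \<open>auto simp: f_def\<close>)
  then have f: "(f has_sum a 0 l) (UNIV \<times> UNIV)"
    by (intro has_sum_SigmaI[OF f_inner f_outer])
  have bij: "bij_betw (\<lambda>(s, q). (q, s - q)) (SIGMA s:UNIV. {..s}) (UNIV \<times> (UNIV :: nat set))"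
    by (rule bij_betwI[where g = "\<lambda>(q, r). (q + r, q)"]) auto
  have "((\<lambda>(s, q). f (q, s - q)) has_sum a 0 l) (SIGMA s:UNIV. {..s})"
    using has_sum_reindex_bij_betw[OF bij, of f "a 0 l"] f by (simp add: case_prod_unfold)
  then show ?case
  proof (rule has_sum_SigmaD)
    fix s :: nat
    have "((\<lambda>q. f (q, s - q)) has_sum (\<Sum>q\<le>s. f (q, s - q))) {..s}" by (rule has_sum_finite) simp
    also have "(\<Sum>q\<le>s. f (q, s - q)) = (\<Sum>q\<le>s. neg_binom m q) * a (Suc m) (l + s)"
      unfolding sum_distrib_right by (intro sum.cong) (auto simp: f_def)
    finally show "((\<lambda>q. case (s, q) of (s, q) \<Rightarrow> f (q, s - q)) has_sum
        neg_binom (Suc m) s * a (Suc m) (l + s)) {..s}"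
      by (simp add: neg_binom_hockey_stick)
  qed
qed

lemma alternating_binomial_step:
  fixes b :: "nat \<Rightarrow> real"
  shows "(\<Sum>k\<le>Suc j. (- 1) ^ k * real (Suc j choose k) * b (l + k)) =
    (\<Sum>k\<le>j. (- 1) ^ k * real (j choose k) * b (l + k)) -
    (\<Sum>k\<le>j. (- 1) ^ k * real (j choose k) * b (Suc l + k))"
proof -
  have "(\<Sum>k\<le>Suc j. (- 1) ^ k * real (Suc j choose k) * b (l + k)) =
      b l + (\<Sum>k\<le>j. (- 1) ^ Suc k * real (Suc j choose Suc k) * b (l + Suc k))"
    by (subst sum.atMost_Suc_shift) simp
  also have "(\<Sum>k\<le>j. (- 1) ^ Suc k * real (Suc j choose Suc k) * b (l + Suc k)) =
      (\<Sum>k\<le>j. (- 1) ^ Suc k * real (j choose Suc k) * b (l + Suc k)) -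
      (\<Sum>k\<le>j. (- 1) ^ k * real (j choose k) * b (Suc l + k))"
    unfolding sum_subtractf[symmetric] by (intro sum.cong) (auto simp: algebra_simps)
  also have "b l + ((\<Sum>k\<le>j. (- 1) ^ Suc k * real (j choose Suc k) * b (l + Suc k)) -
      (\<Sum>k\<le>j. (- 1) ^ k * real (j choose k) * b (Suc l + k))) =
      (b l + (\<Sum>k\<le>j. (- 1) ^ Suc k * real (j choose Suc k) * b (l + Suc k))) -
      (\<Sum>k\<le>j. (- 1) ^ k * real (j choose k) * b (Suc l + k))" by simp
  also have "b l + (\<Sum>k\<le>j. (- 1) ^ Suc k * real (j choose Suc k) * b (l + Suc k)) =
      (\<Sum>k\<le>Suc j. (- 1) ^ k * real (j choose k) * b (l + k))"
    by (subst sum.atMost_Suc_shift) simp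
  also have "\<dots> = (\<Sum>k\<le>j. (- 1) ^ k * real (j choose k) * b (l + k))" by simp
  finally show ?thesis .
qed

text \<open>
  On the diagonal, the series of the resolutions of the identity have nonnegative terms and can be
  rearranged. Polarization transfers the result to arbitrary pairs of vectors.
\<close>

lemma (in pre_hilbert) has_sum_polarization:
  fixes F :: "'i \<Rightarrow> 'a \<Rightarrow> 'a \<Rightarrow> complex"
  assumes F: "\<And>i x y z. \<lbrakk>i \<in> I; x \<in> hcarrier H; y \<in> hcarrier H; z \<in> hcarrier H\<rbrakk> \<Longrightarrow> F i (x + y) z = F i x z + F i y z"
    "\<And>i x y z. \<lbrakk>i \<in> I; x \<in> hcarrier H; y \<in> hcarrier H; z \<in> hcarrier H\<rbrakk> \<Longrightarrow> F i x (y + z) = F i x y + F i x z"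
    "\<And>i c x y. \<lbrakk>i \<in> I; x \<in> hcarrier H; y \<in> hcarrier H\<rbrakk> \<Longrightarrow> F i (c *\<^sub>C x) y = c * F i x y"
    "\<And>i c x y. \<lbrakk>i \<in> I; x \<in> hcarrier H; y \<in> hcarrier H\<rbrakk> \<Longrightarrow> F i x (c *\<^sub>C y) = cnj c * F i x y"
    and diag: "\<And>x. x \<in> hcarrier H \<Longrightarrow> ((\<lambda>i. F i x x) has_sum hinner H x x) I"
    and x: "x \<in> hcarrier H" and y: "y \<in> hcarrier H"
  shows "((\<lambda>i. F i x y) has_sum hinner H x y) I"
proof -
  let ?D = "\<lambda>c f. f (x + c *\<^sub>C y) (x + c *\<^sub>C y)"
  have expand: "f x y = (1 / 4) * (?D 1 f + (- 1) * ?D (- 1) f + \<i> * ?D \<i> f + (- \<i>) * ?D (- \<i>) f)"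
    if "\<And>u v z. \<lbrakk>u \<in> hcarrier H; v \<in> hcarrier H; z \<in> hcarrier H\<rbrakk> \<Longrightarrow> f (u + v) z = f u z + f v z"
      "\<And>u v z. \<lbrakk>u \<in> hcarrier H; v \<in> hcarrier H; z \<in> hcarrier H\<rbrakk> \<Longrightarrow> f u (v + z) = f u v + f u z"
      "\<And>c u v. \<lbrakk>u \<in> hcarrier H; v \<in> hcarrier H\<rbrakk> \<Longrightarrow> f (c *\<^sub>C u) v = c * f u v"
      "\<And>c u v. \<lbrakk>u \<in> hcarrier H; v \<in> hcarrier H\<rbrakk> \<Longrightarrow> f u (c *\<^sub>C v) = cnj c * f u v"
    for f :: "'a \<Rightarrow> 'a \<Rightarrow> complex"
  proof -
    have "?D c f = f x x + cnj c * f x y + c * f y x + c * cnj c * f y y" for c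
      using x y by (simp add: that algebra_simps del: cvec.scale_minus_left)
    then show ?thesis by (simp only:) (simp add: algebra_simps)
  qed
  have "((\<lambda>i. (1 / 4) * (?D 1 (F i) + (- 1) * ?D (- 1) (F i) + \<i> * ?D \<i> (F i) + (- \<i>) * ?D (- \<i>) (F i))) has_sum
      (1 / 4) * (?D 1 (hinner H) + (- 1) * ?D (- 1) (hinner H) + \<i> * ?D \<i> (hinner H) + (- \<i>) * ?D (- \<i>) (hinner H))) I"
    using x y by (intro has_sum_cmult_right has_sum_add diag) auto
  also have "(1 / 4) * (?D 1 (hinner H) + (- 1) * ?D (- 1) (hinner H) + \<i> * ?D \<i> (hinner H) + (- \<i>) * ?D (- \<i>) (hinner H))
      = hinner H x y"
    by (rule expand[symmetric]) (simp_all add: inner_simps)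
  finally show ?thesis
    by (rule has_sum_cong[THEN iffD1, rotated]) (rule expand[symmetric]; simp add: F)
qed

definition hyper_defect :: "'a::complex_vector hilbert \<Rightarrow> nat \<Rightarrow> ('a \<Rightarrow> 'a) \<Rightarrow> 'a \<Rightarrow> 'a"
  where "hyper_defect H m T = (\<lambda>x. \<Sum>k\<le>m. ((- 1) ^ k * of_nat (m choose k)) *\<^sub>C
    (T ^^ k) ((adjoint H H T ^^ k) x))"

lemma (in hilbert_space) adjoint_funpow_inner:
  assumes T: "bounded_operator H H T" and x: "x \<in> hcarrier H" and y: "y \<in> hcarrier H"
  shows "hinner H ((T ^^ k) x) y = hinner H x ((adjoint H H T ^^ k) y)"
  using x y
proof (induction k arbitrary: x)
  case (Suc k)
  note adj = adjoint[OF hilbert_space_axioms pre_hilbert_axioms T]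
  have Tx: "T x \<in> hcarrier H" by (rule bounded_operatorD(1)[OF T Suc.prems(1)])
  have Sy: "(adjoint H H T ^^ k) y \<in> hcarrier H"
    using bounded_operatorD(1)[OF bounded_operator_funpow[OF adjoint_bounded_operator[OF
          hilbert_space_axioms pre_hilbert_axioms T] pre_hilbert_axioms]] Suc.prems by blast
  have "hinner H ((T ^^ Suc k) x) y = hinner H ((T ^^ k) (T x)) y" by (simp add: funpow_swap1)
  also have "\<dots> = hinner H (T x) ((adjoint H H T ^^ k) y)" by (rule Suc.IH[OF Tx Suc.prems(2)])
  also have "\<dots> = hinner H x (adjoint H H T ((adjoint H H T ^^ k) y))"
    by (rule adj(2)[OF Sy Suc.prems(1)])
  finally show ?case by simp
qed simp

text \<open>
  The quadratic form of the \<open>q\<close>-th term is the \<open>m\<close>-th difference of the squares of the norms of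
  \<open>T\<^sup>*\<^sup>l x\<close> at \<open>l = q\<close>. These squares tend to 0 and their \<open>m\<close>-th differences are nonnegative.
\<close>

theorem (in hilbert_space) hypercontraction_resolution:
  assumes T: "B_contraction H m T" and x: "x \<in> hcarrier H" and y: "y \<in> hcarrier H"
  shows "((\<lambda>q. complex_of_real (neg_binom m q) *
      hinner H (hyper_defect H m T ((adjoint H H T ^^ q) x)) ((adjoint H H T ^^ q) y)) has_sum hinner H x y) UNIV"
proof -
  define S where "S = adjoint H H T"
  have Tb: "bounded_operator H H T" using T by (simp add: B_contraction_def)
  note P = pre_hilbert_axioms
  have Sb: "bounded_operator H H (S ^^ k)" for k
    unfolding S_def
    by (intro bounded_operator_funpow adjoint_bounded_operator hilbert_space_axioms P Tb)
  note t = bounded_operatorD[OF bounded_operator_funpow[OF Tb P]] and s = bounded_operatorD[OF Sb]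
  have pos: "positive_operator H (hyper_defect H m T)"
    using T by (simp add: B_contraction_def hyper_defect_def)
  note d = bounded_operatorD[OF positive_operatorD(1)[OF pos]]
  have pure: "(\<lambda>l. hnorm H ((S ^^ l) x)) \<longlonglongrightarrow> 0" if "x \<in> hcarrier H" for x
    using T that by (simp add: B_contraction_def S_def)
  have diag: "((\<lambda>q. complex_of_real (neg_binom m q) *
      hinner H (hyper_defect H m T ((S ^^ q) x)) ((S ^^ q) x)) has_sum hinner H x x) UNIV"
    if x: "x \<in> hcarrier H" for x
  proof -
    define b where "b l = (hnorm H ((S ^^ l) x))\<^sup>2" for l
    define a where "a j l = (\<Sum>k\<le>j. (- 1) ^ k * real (j choose k) * b (l + k))" for j l
    have a_m: "hinner H (hyper_defect H m T ((S ^^ l) x)) ((S ^^ l) x) = complex_of_real (a m l)" for l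
    proof -
      have "hinner H ((T ^^ k) ((S ^^ k) ((S ^^ l) x))) ((S ^^ l) x) = complex_of_real (b (l + k))" for k
      proof -
        have "hinner H ((T ^^ k) ((S ^^ k) ((S ^^ l) x))) ((S ^^ l) x)
            = hinner H ((S ^^ k) ((S ^^ l) x)) ((S ^^ k) ((S ^^ l) x))"
          unfolding S_def by (rule adjoint_funpow_inner[OF Tb]) (use s(1) x in \<open>auto simp flip: S_def\<close>)
        also have "\<dots> = complex_of_real (b (l + k))"
          using inner_self[OF s(1)[OF x, of "l + k"]] by (simp add: b_def funpow_add add.commute[of l])
        finally show ?thesis .
      qed
      then show ?thesis
        using s(1) t(1) x
        by (simp add: hyper_defect_def S_def[symmetric] inner_sum_left inner_scaleC_left a_def)
    qed
    have "((\<lambda>q. neg_binom m q * a m (0 + q)) has_sum a 0 0) UNIV"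
    proof (rule difference_resolution)
      have "(\<lambda>l. (hnorm H ((S ^^ l) x))\<^sup>2) \<longlonglongrightarrow> 0\<^sup>2" by (intro tendsto_power pure x)
      moreover have "a 0 = (\<lambda>l. (hnorm H ((S ^^ l) x))\<^sup>2)" by (simp add: a_def b_def fun_eq_iff)
      ultimately show "a 0 \<longlonglongrightarrow> 0" by simp
      show "a (Suc j) l = a j l - a j (Suc l)" for j l
        unfolding a_def by (rule alternating_binomial_step)
      show "0 \<le> a m l" for l
        using positive_operatorD(2)[OF pos s(1)[OF x, of l]] by (simp add: a_m)
    qed
    from has_sum_of_real[OF this, where 'a = complex]
    show ?thesis using inner_self[OF x] by (simp add: a_m a_def b_def)
  qed
  show ?thesis
    unfolding S_def[symmetric]
    by (rule has_sum_polarization[where F = "\<lambda>q x y. complex_of_real (neg_binom m q) *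
          hinner H (hyper_defect H m T ((S ^^ q) x)) ((S ^^ q) y)", OF _ _ _ _ diag x y])
      (simp_all add: s d inner_simps algebra_simps)
qed

section \<open>Doubly commuting tuples\<close>

text \<open>The list \<open>[1..<Suc n]\<close> of all variables must not be split at its end by simplification.\<close>

declare upt_Suc [simp del]

definition commute_on :: "'a hilbert \<Rightarrow> ('a \<Rightarrow> 'a) \<Rightarrow> ('a \<Rightarrow> 'a) \<Rightarrow> bool"
  where "commute_on H A B \<longleftrightarrow> (\<forall>x\<in>hcarrier H. A (B x) = B (A x))"

text \<open>
  Products of operators are indexed by lists of variables, because inductions then run over the tails
  of the list and the factors keep a definite order, the one of \<^const>\<open>tuple_power\<close>.
\<close>

definition power_list :: "(nat \<Rightarrow> 'a \<Rightarrow> 'a) \<Rightarrow> nat list \<Rightarrow> (nat \<Rightarrow> nat) \<Rightarrow> 'a \<Rightarrow> 'a"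
  where "power_list A xs r = foldr (\<lambda>i B. (A i ^^ r i) \<circ> B) xs id"

definition product_list :: "(nat \<Rightarrow> 'a \<Rightarrow> 'a) \<Rightarrow> nat list \<Rightarrow> 'a \<Rightarrow> 'a"
  where "product_list A xs = power_list A xs (\<lambda>_. Suc 0)"

lemma power_list_simps [simp]:
  "power_list A [] r x = x"
  "power_list A (k # xs) r x = (A k ^^ r k) (power_list A xs r x)"
  by (simp_all add: power_list_def)

lemma product_list_simps [simp]:
  "product_list A [] x = x"
  "product_list A (k # xs) x = A k (product_list A xs x)"
  by (simp_all add: product_list_def)

lemma product_list_append: "product_list A (xs @ ys) x = product_list A xs (product_list A ys x)"
  by (induction xs) auto

lemma tuple_power_eq: "tuple_power n A p = power_list A [1..<Suc n] (Poly_Mapping.lookup p)"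
  by (simp add: tuple_power_def power_list_def)

lemma power_list_cong:
  "(\<And>i. i \<in> set xs \<Longrightarrow> r i = s i) \<Longrightarrow> power_list A xs r x = power_list A xs s x"
  by (induction xs) auto

context hilbert_space
begin

lemma commute_on_sym: "commute_on H A B \<Longrightarrow> commute_on H B A"
  by (simp add: commute_on_def)

lemma commute_on_funpow:
  assumes "commute_on H A B" "bounded_operator H H A" "bounded_operator H H B"
  shows "commute_on H A (B ^^ k)"
  unfolding commute_on_def
proof
  fix x assume x: "x \<in> hcarrier H"
  show "A ((B ^^ k) x) = (B ^^ k) (A x)"
  proof (induction k)
    case (Suc k)
    have "(B ^^ k) x \<in> hcarrier H"
      using bounded_operatorD(1)[OF bounded_operator_funpow[OF assms(3) pre_hilbert_axioms] x] .
    then show ?case using assms(1) Suc by (simp add: commute_on_def)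
  qed simp
qed

lemma bounded_power_list:
  assumes "\<And>i. i \<in> set xs \<Longrightarrow> bounded_operator H H (A i)"
  shows "bounded_operator H H (power_list A xs r)"
  using assms
proof (induction xs)
  case Nil
  have "power_list A [] r = (\<lambda>x. x)" by auto
  then show ?case using bounded_operator_id[of H] by simp
next
  case (Cons k xs)
  have "power_list A (k # xs) r = (\<lambda>x. (A k ^^ r k) (power_list A xs r x))" by auto
  moreover have "bounded_operator H H (\<lambda>x. (A k ^^ r k) (power_list A xs r x))"
    by (rule bounded_operator_compose[OF Cons.IH bounded_operator_funpow[OF Cons.prems
            pre_hilbert_axioms] pre_hilbert_axioms pre_hilbert_axioms])
      (use Cons.prems in auto)
  ultimately show ?case by simp
qed

lemma commute_on_power_list:
  assumes B: "bounded_operator H H B" and A: "\<And>i. i \<in> set xs \<Longrightarrow> bounded_operator H H (A i)"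
    and c: "\<And>i. i \<in> set xs \<Longrightarrow> commute_on H B (A i)"
  shows "commute_on H B (power_list A xs r)"
  using A c
proof (induction xs)
  case (Cons k xs)
  show ?case
    unfolding commute_on_def
  proof
    fix x assume x: "x \<in> hcarrier H"
    have m: "power_list A xs r x \<in> hcarrier H"
      using bounded_operatorD(1)[OF bounded_power_list x] Cons.prems(1) by simp
    have "commute_on H B (A k ^^ r k)"
      using Cons.prems B by (intro commute_on_funpow) auto
    then show "B (power_list A (k # xs) r x) = power_list A (k # xs) r (B x)"
      using Cons m x by (simp add: commute_on_def)
  qed
qed (simp add: commute_on_def)

lemma power_list_extract:
  assumes k: "k \<in> set xs" and d: "distinct xs"
    and A: "\<And>i. i \<in> set xs \<Longrightarrow> bounded_operator H H (A i)"
    and c: "\<And>i j. \<lbrakk>i \<in> set xs; j \<in> set xs\<rbrakk> \<Longrightarrow> commute_on H (A i) (A j)"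
    and x: "x \<in> hcarrier H"
  shows "power_list A xs r x = (A k ^^ r k) (power_list A (remove1 k xs) r x)"
  using k d A c
proof (induction xs)
  case (Cons j xs)
  show ?case
  proof (cases "j = k")
    case False
    have "power_list A xs r x = (A k ^^ r k) (power_list A (remove1 k xs) r x)"
      using Cons False by simp
    moreover have "commute_on H (A j ^^ r j) (A k ^^ r k)"
    proof -
      have b: "bounded_operator H H (A j)" "bounded_operator H H (A k)" and c: "commute_on H (A j) (A k)"
        using Cons.prems by auto
      note c' = commute_on_sym[OF commute_on_funpow[OF c b, of "r k"]]
      show ?thesis
        by (rule commute_on_sym[OF commute_on_funpow[OF c' bounded_operator_funpow[OF b(2) pre_hilbert_axioms] b(1)]])
    qed
    moreover have "power_list A (remove1 k xs) r x \<in> hcarrier H"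
      using bounded_operatorD(1)[OF bounded_power_list x, of "remove1 k xs"] Cons.prems(3)
        set_remove1_subset[of k xs] by auto
    ultimately show ?thesis using False by (simp add: commute_on_def)
  qed simp
qed simp

end

locale doubly_commuting_tuple = hilbert_space H for H :: "'a::complex_vector hilbert" +
  fixes n :: nat and m :: "nat \<Rightarrow> nat" and T :: "nat \<Rightarrow> 'a \<Rightarrow> 'a"
  assumes m: "\<And>i. i \<in> {1..n} \<Longrightarrow> m i \<ge> 1"
    and dc: "doubly_commuting n H T"
    and bc: "B_contractive n m H T"
begin

definition S :: "nat \<Rightarrow> 'a \<Rightarrow> 'a" where "S i = adjoint H H (T i)"

definition \<Delta> :: "nat \<Rightarrow> 'a \<Rightarrow> 'a" where "\<Delta> i = hyper_defect H (m i) (T i)"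

lemma T_bounded: "i \<in> {1..n} \<Longrightarrow> bounded_operator H H (T i)"
  using dc by (simp add: doubly_commuting_def commuting_tuple_def)

lemma S_bounded: "i \<in> {1..n} \<Longrightarrow> bounded_operator H H (S i)"
  unfolding S_def by (rule adjoint_bounded_operator[OF hilbert_space_axioms pre_hilbert_axioms T_bounded])

lemma contraction: "i \<in> {1..n} \<Longrightarrow> B_contraction H (m i) (T i)"
  using bc by (simp add: B_contractive_def)

lemma \<Delta>_positive: "i \<in> {1..n} \<Longrightarrow> positive_operator H (\<Delta> i)"
  using contraction[of i] by (simp add: B_contraction_def \<Delta>_def hyper_defect_def)

lemma \<Delta>_bounded: "i \<in> {1..n} \<Longrightarrow> bounded_operator H H (\<Delta> i)"
  by (rule positive_operatorD(1)[OF \<Delta>_positive])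

lemma S_inner: "\<lbrakk>i \<in> {1..n}; x \<in> hcarrier H; y \<in> hcarrier H\<rbrakk> \<Longrightarrow> hinner H (T i x) y = hinner H x (S i y)"
  unfolding S_def by (rule adjoint(2)[OF hilbert_space_axioms pre_hilbert_axioms T_bounded])

lemma S_pow_inner:
  "\<lbrakk>i \<in> {1..n}; x \<in> hcarrier H; y \<in> hcarrier H\<rbrakk> \<Longrightarrow> hinner H ((T i ^^ k) x) y = hinner H x ((S i ^^ k) y)"
  unfolding S_def by (rule adjoint_funpow_inner[OF T_bounded])

lemma TT: "\<lbrakk>i \<in> {1..n}; j \<in> {1..n}\<rbrakk> \<Longrightarrow> commute_on H (T i) (T j)"
  using dc by (simp add: doubly_commuting_def commuting_tuple_def commute_on_def)

lemma TS: "\<lbrakk>i \<in> {1..n}; j \<in> {1..n}; i \<noteq> j\<rbrakk> \<Longrightarrow> commute_on H (T i) (S j)"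
  using dc by (simp add: doubly_commuting_def commute_on_def S_def)

lemma SS: "\<lbrakk>i \<in> {1..n}; j \<in> {1..n}\<rbrakk> \<Longrightarrow> commute_on H (S i) (S j)"
  unfolding commute_on_def
proof
  fix x assume i: "i \<in> {1..n}" and j: "j \<in> {1..n}" and x: "x \<in> hcarrier H"
  note s = bounded_operatorD(1)[OF S_bounded] and t = bounded_operatorD(1)[OF T_bounded]
  show "S i (S j x) = S j (S i x)"
  proof (rule eq_if_inner_eq_right)
    fix u assume u: "u \<in> hcarrier H"
    show "hinner H u (S i (S j x)) = hinner H u (S j (S i x))"
      using TT[OF i j] u x i j s t by (simp add: commute_on_def flip: S_inner)
  qed (use s i j x in auto)
qed

lemma pow_bounded:
  "i \<in> {1..n} \<Longrightarrow> bounded_operator H H (T i ^^ k)" "i \<in> {1..n} \<Longrightarrow> bounded_operator H H (S i ^^ k)"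
  by (intro bounded_operator_funpow T_bounded S_bounded pre_hilbert_axioms; assumption)+

text \<open>
  A defect is a polynomial in its operator and the adjoint. Double commutativity supplies both premises
  when \<open>B\<close> is an operator, an adjoint or a defect of another index.
\<close>

lemma commute_\<Delta>:
  assumes B: "bounded_operator H H B" and j: "j \<in> {1..n}"
    and c: "commute_on H B (T j)" "commute_on H B (S j)"
  shows "commute_on H B (\<Delta> j)"
  unfolding commute_on_def
proof
  fix x assume x: "x \<in> hcarrier H"
  note b = bounded_operatorD[OF B]
  have s: "(S j ^^ k) y \<in> hcarrier H" and t: "(T j ^^ k) y \<in> hcarrier H" if "y \<in> hcarrier H" for k y
    using bounded_operatorD(1)[OF pow_bounded(2)[OF j] that] bounded_operatorD(1)[OF pow_bounded(1)[OF j] that] .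
  have "B ((T j ^^ k) ((S j ^^ k) x)) = (T j ^^ k) ((S j ^^ k) (B x))" for k
    using commute_on_funpow[OF c(1) B T_bounded[OF j]] commute_on_funpow[OF c(2) B S_bounded[OF j]] x s
    by (simp add: commute_on_def)
  then show "B (\<Delta> j x) = \<Delta> j (B x)"
    using x s t b by (simp add: \<Delta>_def hyper_defect_def S_def[symmetric] bounded_operator_sum[OF B pre_hilbert_axioms])
qed

lemma commute_distinct:
  assumes "i \<in> {1..n}" "j \<in> {1..n}" "i \<noteq> j"
  shows T\<Delta>: "commute_on H (T i) (\<Delta> j)" and S\<Delta>: "commute_on H (S i) (\<Delta> j)"
    and \<Delta>\<Delta>': "commute_on H (\<Delta> i) (\<Delta> j)"
proof -
  show T: "commute_on H (T i) (\<Delta> j)"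
    by (rule commute_\<Delta>[OF T_bounded[OF assms(1)] assms(2) TT[OF assms(1,2)] TS[OF assms]])
  show S: "commute_on H (S i) (\<Delta> j)"
    by (rule commute_\<Delta>[OF S_bounded[OF assms(1)] assms(2) commute_on_sym[OF TS[OF assms(2,1)]] SS[OF assms(1,2)]])
      (use assms in simp)
  show "commute_on H (\<Delta> i) (\<Delta> j)"
    by (rule commute_on_sym[OF commute_\<Delta>[OF \<Delta>_bounded[OF assms(2)] assms(1) commute_on_sym[OF T] commute_on_sym[OF S]]])
qed

lemma \<Delta>\<Delta>: "\<lbrakk>i \<in> {1..n}; j \<in> {1..n}\<rbrakk> \<Longrightarrow> commute_on H (\<Delta> i) (\<Delta> j)"
  using \<Delta>\<Delta>' by (cases "i = j") (auto simp: commute_on_def)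

abbreviation "Sl \<equiv> power_list S"
abbreviation "Dl \<equiv> product_list \<Delta>"

lemma Sl_bounded: "set xs \<subseteq> {1..n} \<Longrightarrow> bounded_operator H H (Sl xs r)"
  by (rule bounded_power_list) (use S_bounded in auto)

lemma Dl_bounded: "set xs \<subseteq> {1..n} \<Longrightarrow> bounded_operator H H (Dl xs)"
  unfolding product_list_def by (rule bounded_power_list) (use \<Delta>_bounded in auto)

lemma commute_lists:
  assumes "k \<in> {1..n}" "set xs \<subseteq> {1..n}" "k \<notin> set xs"
  shows S_Sl: "commute_on H (S k) (Sl xs r)" and T_Sl: "commute_on H (T k) (Sl xs r)"
    and \<Delta>_Sl: "commute_on H (\<Delta> k) (Sl xs r)" and S_Dl: "commute_on H (S k) (Dl xs)"
    and T_Dl: "commute_on H (T k) (Dl xs)" and \<Delta>_Dl: "commute_on H (\<Delta> k) (Dl xs)"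
proof -
  have i: "i \<in> {1..n}" "i \<noteq> k" "k \<noteq> i" if "i \<in> set xs" for i using assms that by auto
  have c: "commute_on H (S k) (S i)" "commute_on H (T k) (S i)" "commute_on H (\<Delta> k) (S i)"
    "commute_on H (S k) (\<Delta> i)" "commute_on H (T k) (\<Delta> i)" "commute_on H (\<Delta> k) (\<Delta> i)"
    if "i \<in> set xs" for i
    using SS[OF assms(1) i(1)[OF that]] TS[OF assms(1) i(1)[OF that] i(3)[OF that]]
      commute_on_sym[OF S\<Delta>[OF i(1)[OF that] assms(1) i(2)[OF that]]]
      S\<Delta>[OF assms(1) i(1)[OF that] i(3)[OF that]] T\<Delta>[OF assms(1) i(1)[OF that] i(3)[OF that]]
      \<Delta>\<Delta>[OF assms(1) i(1)[OF that]] by simp_all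
  note kb = S_bounded[OF assms(1)] T_bounded[OF assms(1)] \<Delta>_bounded[OF assms(1)]
    and sb = S_bounded[OF i(1)] and db = \<Delta>_bounded[OF i(1)]
  show "commute_on H (S k) (Sl xs r)" by (rule commute_on_power_list[OF kb(1) sb c(1)])
  show "commute_on H (T k) (Sl xs r)" by (rule commute_on_power_list[OF kb(2) sb c(2)])
  show "commute_on H (\<Delta> k) (Sl xs r)" by (rule commute_on_power_list[OF kb(3) sb c(3)])
  show "commute_on H (S k) (Dl xs)" unfolding product_list_def by (rule commute_on_power_list[OF kb(1) db c(4)])
  show "commute_on H (T k) (Dl xs)" unfolding product_list_def by (rule commute_on_power_list[OF kb(2) db c(5)])
  show "commute_on H (\<Delta> k) (Dl xs)" unfolding product_list_def by (rule commute_on_power_list[OF kb(3) db c(6)])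
qed

lemma Dl_extract:
  assumes "k \<in> set xs" "distinct xs" "set xs \<subseteq> {1..n}" "x \<in> hcarrier H"
  shows "Dl xs x = \<Delta> k (Dl (remove1 k xs) x)"
  using power_list_extract[OF assms(1,2) _ _ assms(4), of \<Delta> "\<lambda>_. Suc 0"] \<Delta>_bounded \<Delta>\<Delta> assms(3)
  unfolding product_list_def by (simp add: subset_iff)

lemma Sl_extract:
  assumes "k \<in> set xs" "distinct xs" "set xs \<subseteq> {1..n}" "x \<in> hcarrier H"
  shows "Sl xs r x = (S k ^^ r k) (Sl (remove1 k xs) r x)"
  using power_list_extract[OF assms(1,2) _ _ assms(4), of S r] S_bounded SS assms(3)
  by (simp add: subset_iff)

lemma Dl_hermitian:
  assumes "set xs \<subseteq> {1..n}" "distinct xs" "x \<in> hcarrier H" "y \<in> hcarrier H"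
  shows "hinner H (Dl xs x) y = hinner H x (Dl xs y)"
  using assms
proof (induction xs arbitrary: x y)
  case (Cons k xs)
  have k: "k \<in> {1..n}" "set xs \<subseteq> {1..n}" "k \<notin> set xs" "distinct xs" using Cons.prems by auto
  note dl = bounded_operatorD(1)[OF Dl_bounded[OF k(2)]] and d = bounded_operatorD(1)[OF \<Delta>_bounded[OF k(1)]]
  have "hinner H (\<Delta> k (Dl xs x)) y = hinner H (Dl xs x) (\<Delta> k y)"
    using positive_operator_hermitian[OF \<Delta>_positive[OF k(1)] pre_hilbert_axioms] dl Cons.prems by simp
  also have "\<dots> = hinner H x (Dl xs (\<Delta> k y))" using Cons k d by simp
  also have "Dl xs (\<Delta> k y) = \<Delta> k (Dl xs y)"
    using \<Delta>_Dl[OF k(1-3)] Cons.prems by (simp add: commute_on_def)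
  finally show ?case by simp
qed simp

lemma single_resolution:
  assumes "k \<in> {1..n}" "x \<in> hcarrier H" "y \<in> hcarrier H"
  shows "((\<lambda>q. complex_of_real (neg_binom (m k) q) * hinner H (\<Delta> k ((S k ^^ q) x)) ((S k ^^ q) y))
    has_sum hinner H x y) UNIV"
  using hypercontraction_resolution[OF contraction[OF assms(1)] assms(2,3)]
  by (simp add: \<Delta>_def S_def)

text \<open>
  The resolution of the identity for a removed variable writes \<open>\<langle>Dl xs x, x\<rangle>\<close> as a series of values of the
  form of the longer product, which are nonnegative.
\<close>

lemma Dl_positive_tail:
  assumes "set (ys @ xs) \<subseteq> {1..n}" "distinct (ys @ xs)" "positive_operator H (Dl (ys @ xs))"
  shows "positive_operator H (Dl xs)"
  using assms
proof (induction ys)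
  case (Cons k ys)
  let ?zs = "ys @ xs"
  have k: "k \<in> {1..n}" "set ?zs \<subseteq> {1..n}" "k \<notin> set ?zs" "distinct ?zs" using Cons.prems by auto
  have "positive_operator H (Dl ?zs)"
    unfolding positive_operator_def
  proof (intro conjI ballI Dl_bounded k(2))
    fix x assume x: "x \<in> hcarrier H"
    note dl = bounded_operatorD(1)[OF Dl_bounded[OF k(2)]] and d = bounded_operatorD(1)[OF \<Delta>_bounded[OF k(1)]]
      and s = bounded_operatorD(1)[OF pow_bounded(2)[OF k(1)]]
    have "((\<lambda>q. complex_of_real (neg_binom (m k) q) *
        hinner H (\<Delta> k ((S k ^^ q) (Dl ?zs x))) ((S k ^^ q) x)) has_sum hinner H (Dl ?zs x) x) UNIV"
      by (rule single_resolution[OF k(1) dl[OF x] x])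
    moreover have "(S k ^^ q) (Dl ?zs x) = Dl ?zs ((S k ^^ q) x)" for q
      using commute_on_funpow[OF commute_on_sym[OF S_Dl[OF k(1-3)]] Dl_bounded[OF k(2)] S_bounded[OF k(1)]] x
      by (simp add: commute_on_def)
    ultimately have sum: "((\<lambda>q. complex_of_real (neg_binom (m k) q) *
        hinner H (Dl (k # ?zs) ((S k ^^ q) x)) ((S k ^^ q) x)) has_sum hinner H (Dl ?zs x) x) UNIV"
      by simp
    have nn: "complex_of_real (neg_binom (m k) q) *
        hinner H (Dl (k # ?zs) ((S k ^^ q) x)) ((S k ^^ q) x) \<in> \<real>\<^sub>\<ge>\<^sub>0" for q
      using positive_operatorD(2)[OF Cons.prems(3) s[OF x, of q]] neg_binom_pos[OF m[OF k(1)], of q]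
      by (intro nonneg_Reals_mult_I) (auto simp: complex_nonneg_Reals_iff)
    have "0 \<le> Re (hinner H (Dl ?zs x) x)"
      by (rule has_sum_nonneg[OF has_sum_Re[OF sum]]) (use nn in \<open>auto simp: complex_nonneg_Reals_iff\<close>)
    moreover have "Im (hinner H (Dl ?zs x) x) = 0"
      using Dl_hermitian[OF k(2,4) x x] inner_commute[of x "Dl ?zs x"] dl x by (simp add: complex_eq_iff)
    ultimately show "hinner H (Dl ?zs x) x \<in> \<real>\<^sub>\<ge>\<^sub>0" by (simp add: complex_nonneg_Reals_iff)
  qed
  then show ?case using Cons.IH k by simp
qed simp

definition weight_list :: "nat list \<Rightarrow> (nat \<Rightarrow> nat) \<Rightarrow> real"
  where "weight_list xs r = (\<Prod>i\<in>set xs. neg_binom (m i) (r i))"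

lemma weight_list_Cons:
  "k \<notin> set xs \<Longrightarrow> weight_list (k # xs) (r(k := q)) = neg_binom (m k) q * weight_list xs r"
proof -
  assume k: "k \<notin> set xs"
  then have "(\<Prod>i\<in>set xs. neg_binom (m i) ((r(k := q)) i)) = (\<Prod>i\<in>set xs. neg_binom (m i) (r i))"
    by (intro prod.cong) auto
  then show ?thesis using k by (simp add: weight_list_def)
qed

lemma weight_list_nonneg: "0 \<le> weight_list xs r"
  by (auto simp: weight_list_def neg_binom_def intro!: prod_nonneg)

text \<open>
  One variable is resolved at a time. The defects of the other variables commute with the powers of the
  adjoint and move into place, and the sums can be iterated because the products over the tails of the
  list are positive.
\<close>

theorem joint_resolution:
  assumes xs: "set xs \<subseteq> {1..n}" "distinct xs" and pos: "positive_operator H (Dl xs)"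
    and x: "x \<in> hcarrier H" and y: "y \<in> hcarrier H"
  shows "((\<lambda>r. complex_of_real (weight_list xs r) * hinner H (Dl xs (Sl xs r x)) (Sl xs r y))
    has_sum hinner H x y) (multi (set xs))"
  using xs pos x y
proof (induction xs arbitrary: x y)
  case Nil
  have "((\<lambda>r. complex_of_real (weight_list [] r) * hinner H (Dl [] (Sl [] r x)) (Sl [] r y)) has_sum
     (\<Sum>r\<in>{\<lambda>_. undefined}. complex_of_real (weight_list [] r) * hinner H (Dl [] (Sl [] r x)) (Sl [] r y)))
      {\<lambda>_. undefined}" by (rule has_sum_finite) simp
  then show ?case by (simp add: weight_list_def)
next
  case (Cons k xs)
  have k: "k \<in> {1..n}" "set xs \<subseteq> {1..n}" "k \<notin> set xs" "distinct xs" using Cons.prems by auto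
  have A: "set (k # xs) - {k} = set xs" "k \<in> set (k # xs)" using k by auto
  have pos: "positive_operator H (Dl xs)"
    using Dl_positive_tail[of "[k]" xs] Cons.prems by simp
  note dl = bounded_operatorD[OF Dl_bounded[OF Cons.prems(1)]] and dl' = bounded_operatorD(1)[OF Dl_bounded[OF k(2)]]
    and sl = bounded_operatorD[OF Sl_bounded[OF Cons.prems(1)]] and sl' = bounded_operatorD(1)[OF Sl_bounded[OF k(2)]]
  let ?F = "\<lambda>r x y. complex_of_real (weight_list (k # xs) r) *
      hinner H (Dl (k # xs) (Sl (k # xs) r x)) (Sl (k # xs) r y)"
  have diag: "((\<lambda>r. ?F r x x) has_sum hinner H x x) (multi (set (k # xs)))"
    if x: "x \<in> hcarrier H" for x
  proof -
    have Fpos: "?F r x x \<in> \<real>\<^sub>\<ge>\<^sub>0" for r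
      using positive_operatorD(2)[OF Cons.prems(3) sl(1)[OF x, of r]] weight_list_nonneg[of "k # xs" r]
      by (intro nonneg_Reals_mult_I) (auto simp: complex_nonneg_Reals_iff)
    have "((\<lambda>r. Re (?F r x x)) has_sum Re (hinner H x x)) (multi (set (k # xs)))"
    proof (rule multi_split_sum_nonneg[OF A(2), unfolded A(1)])
      show "((\<lambda>r. Re (complex_of_real (weight_list xs r) * hinner H (Dl xs (Sl xs r x)) (Sl xs r x))) has_sum
          Re (hinner H x x)) (multi (set xs))"
        by (rule has_sum_Re[OF Cons.IH[OF k(2,4) pos x x]])
      show "0 \<le> Re (?F r x x)" for r using Fpos[of r] by (simp add: complex_nonneg_Reals_iff)
      fix r :: "nat \<Rightarrow> nat"
      let ?u = "Sl xs r x"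
      have u: "?u \<in> hcarrier H" by (rule sl'[OF x])
      have F: "?F (r(k := q)) x x = complex_of_real (weight_list xs r) * (complex_of_real (neg_binom (m k) q) *
          hinner H (\<Delta> k ((S k ^^ q) (Dl xs ?u))) ((S k ^^ q) ?u))" for q
      proof -
        have "Sl xs (r(k := q)) x = ?u" using k(3) by (intro power_list_cong) auto
        moreover have "(S k ^^ q) (Dl xs ?u) = Dl xs ((S k ^^ q) ?u)"
          using commute_on_funpow[OF commute_on_sym[OF S_Dl[OF k(1-3)]] Dl_bounded[OF k(2)] S_bounded[OF k(1)]] u
          by (simp add: commute_on_def)
        ultimately show ?thesis using weight_list_Cons[OF k(3), of r q] by simp
      qed
      show "((\<lambda>q. Re (?F (r(k := q)) x x)) has_sum
          Re (complex_of_real (weight_list xs r) * hinner H (Dl xs (Sl xs r x)) (Sl xs r x))) UNIV"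
        unfolding F by (intro has_sum_Re has_sum_cmult_right single_resolution k(1) dl' u)
    qed
    from has_sum_of_real[OF this, where 'a = complex]
    have "((\<lambda>r. complex_of_real (Re (?F r x x))) has_sum complex_of_real (Re (hinner H x x))) (multi (set (k # xs)))" .
    moreover have "complex_of_real (Re (?F r x x)) = ?F r x x" for r
      using Fpos[of r] by (simp add: complex_nonneg_Reals_iff complex_eq_iff)
    moreover have "complex_of_real (Re (hinner H x x)) = hinner H x x" using x by (simp add: complex_eq_iff)
    ultimately show ?thesis by (simp only:)
  qed
  show ?case
    by (rule has_sum_polarization[where F = ?F, OF _ _ _ _ diag Cons.prems(4,5)])
      (simp_all only: sl dl inner_simps algebra_simps complex_cnj_mult)
qed

end

section \<open>The hereditary calculus for the inverse kernel\<close>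

lemma poly_mapping_sum_singles:
  "p = (\<Sum>k\<in>Poly_Mapping.keys p. Poly_Mapping.single k (Poly_Mapping.lookup p k))"
  for p :: "'b \<Rightarrow>\<^sub>0 'c::comm_monoid_add"
  by (rule poly_mapping_eqI) (auto simp: lookup_sum lookup_single when_def in_keys_iff)

lemma inverse_kernel_factor:
  "(1 - z_var i * w_cnj_var i) ^ k = (\<Sum>j\<le>k. Poly_Mapping.single
    (Poly_Mapping.single i j, Poly_Mapping.single i j) ((- 1) ^ j * of_nat (k choose j)))"
proof -
  let ?M = "z_var i * w_cnj_var i"
  have M: "?M = Poly_Mapping.single (Poly_Mapping.single i 1, Poly_Mapping.single i 1) 1"
    by (simp add: z_var_def w_cnj_var_def mult_single)
  have pow: "?M ^ j = Poly_Mapping.single (Poly_Mapping.single i j, Poly_Mapping.single i j) 1" for j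
    by (induction j) (simp_all add: M mult_single zero_prod_def[symmetric] plus_1_eq_Suc flip: single_add)
  have "(1 - ?M) ^ k = (- ?M + 1) ^ k" by simp
  also have "\<dots> = (\<Sum>j\<le>k. of_nat (k choose j) * (- ?M) ^ j * 1 ^ (k - j))" by (rule binomial_ring)
  also have "\<dots> = (\<Sum>j\<le>k. Poly_Mapping.single
      (Poly_Mapping.single i j, Poly_Mapping.single i j) ((- 1) ^ j * of_nat (k choose j)))"
  proof (rule sum.cong)
    fix j
    have c: "(- 1) ^ j * of_nat (k choose j) = (Poly_Mapping.single 0 ((- 1) ^ j * of_nat (k choose j)) :: hereditary_poly)"
    proof -
      have "(- 1 :: hereditary_poly) ^ j = Poly_Mapping.single 0 ((- 1) ^ j)"
        by (induction j) (simp_all add: single_one mult_single single_uminus flip: single_one)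
      moreover have "(of_nat (k choose j) :: hereditary_poly) = Poly_Mapping.single 0 (of_nat (k choose j))"
        by simp
      ultimately show ?thesis by (simp only: mult_single) simp
    qed
    have "of_nat (k choose j) * (- ?M) ^ j * 1 ^ (k - j) = ((- 1) ^ j * of_nat (k choose j)) * ?M ^ j"
      by (subst power_minus) simp
    also have "\<dots> = Poly_Mapping.single (Poly_Mapping.single i j, Poly_Mapping.single i j) ((- 1) ^ j * of_nat (k choose j))"
      unfolding c pow by (simp add: mult_single)
    finally show "of_nat (k choose j) * (- ?M) ^ j * 1 ^ (k - j) = Poly_Mapping.single
      (Poly_Mapping.single i j, Poly_Mapping.single i j) ((- 1) ^ j * of_nat (k choose j))" .
  qed simp
  finally show ?thesis .
qed

lemma hereditary_eval_superset:
  assumes "finite X" "Poly_Mapping.keys P \<subseteq> X"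
  shows "hereditary_eval n H T P x = (\<Sum>(p, q)\<in>X. Poly_Mapping.lookup P (p, q) *\<^sub>C
    tuple_power n T p (tuple_power n (\<lambda>i. adjoint H H (T i)) q x))"
  unfolding hereditary_eval_def
  by (rule sum.mono_neutral_left) (use assms in \<open>auto simp: in_keys_iff\<close>)

lemma hereditary_eval_add:
  "hereditary_eval n H T (P + Q) x = hereditary_eval n H T P x + hereditary_eval n H T Q x"
proof -
  let ?X = "Poly_Mapping.keys P \<union> Poly_Mapping.keys Q"
  have "finite ?X" "Poly_Mapping.keys P \<subseteq> ?X" "Poly_Mapping.keys Q \<subseteq> ?X" "Poly_Mapping.keys (P + Q) \<subseteq> ?X"
    using Poly_Mapping.keys_add[of P Q] by auto
  then show ?thesis
    by (simp add: hereditary_eval_superset[of ?X] lookup_add scaleC_add_left case_prod_unfold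
        flip: sum.distrib)
qed

lemma hereditary_eval_sum:
  "hereditary_eval n H T (sum P I) x = (\<Sum>i\<in>I. hereditary_eval n H T (P i) x)"
  by (induction I rule: infinite_finite_induct) (auto simp: hereditary_eval_add hereditary_eval_def[of n H T 0])

lemma hereditary_eval_single:
  "hereditary_eval n H T (Poly_Mapping.single (p, q) c) x =
    c *\<^sub>C tuple_power n T p (tuple_power n (\<lambda>i. adjoint H H (T i)) q x)"
  by (subst hereditary_eval_superset[of "{(p, q)}"]) (auto simp: keys_single)

context doubly_commuting_tuple
begin

text \<open>
  In the hereditary calculus all powers of \<open>T\<close> stand to the left of all powers of the adjoints, so
  multiplication of polynomials is not composition of operators. But the factor of a variable that does
  not occur in \<open>P\<close> can be moved to the right: it has to pass powers of the adjoints of other variables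
  only.
\<close>

lemma hereditary_eval_mult_single:
  assumes i: "i \<in> {1..n}" and x: "x \<in> hcarrier H"
    and zero: "\<And>p q. (p, q) \<in> Poly_Mapping.keys P \<Longrightarrow> Poly_Mapping.lookup p i = 0 \<and> Poly_Mapping.lookup q i = 0"
  shows "hereditary_eval n H T (P * Poly_Mapping.single (Poly_Mapping.single i k, Poly_Mapping.single i k) c) x
    = c *\<^sub>C hereditary_eval n H T P ((T i ^^ k) ((S i ^^ k) x))"
proof -
  let ?e = "Poly_Mapping.single i k"
  let ?X = "Poly_Mapping.keys P"
  let ?xs = "[1..<Suc n]"
  have Seq: "(\<lambda>i. adjoint H H (T i)) = S" by (simp add: S_def fun_eq_iff)
  have xs: "set ?xs = {1..n}" by auto
  have ik: "i \<in> set ?xs" "distinct ?xs" using i by auto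
  have lookup_step: "power_list A ?xs (Poly_Mapping.lookup (p + ?e)) y = (A i ^^ k) (power_list A ?xs (Poly_Mapping.lookup p) y)"
    if "\<And>j. j \<in> {1..n} \<Longrightarrow> bounded_operator H H (A j)"
      "\<And>j l. j \<in> {1..n} \<Longrightarrow> l \<in> {1..n} \<Longrightarrow> commute_on H (A j) (A l)"
      "Poly_Mapping.lookup p i = 0" "y \<in> hcarrier H" for A p y
  proof -
    have ex: "power_list A ?xs r y = (A i ^^ r i) (power_list A (remove1 i ?xs) r y)" for r
      by (rule power_list_extract[OF ik]) (use that xs in auto)
    have "power_list A (remove1 i ?xs) (Poly_Mapping.lookup (p + ?e)) y
        = power_list A (remove1 i ?xs) (Poly_Mapping.lookup p) y"
      by (rule power_list_cong) (auto simp: lookup_add lookup_single when_def)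
    then show ?thesis using that(3) by (simp add: ex lookup_add)
  qed
  have key: "tuple_power n T (p + ?e) (tuple_power n S (q + ?e) x)
      = tuple_power n T p (tuple_power n S q ((T i ^^ k) ((S i ^^ k) x)))"
    if pq: "(p, q) \<in> ?X" for p q
  proof -
    have p0: "Poly_Mapping.lookup p i = 0" and q0: "Poly_Mapping.lookup q i = 0" using zero[OF pq] by auto
    let ?q = "Poly_Mapping.lookup q" and ?ys = "remove1 i ?xs"
    have ys: "set ?ys \<subseteq> {1..n}" "i \<notin> set ?ys" using xs by auto
    have sq: "Sl ?xs ?q u = Sl ?ys ?q u" if "u \<in> hcarrier H" for u
      using Sl_extract[OF ik, of u ?q] that xs q0 by simp
    have s: "(S i ^^ k) x \<in> hcarrier H" using bounded_operatorD(1)[OF pow_bounded(2)[OF i] x] .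
    have t: "(T i ^^ k) ((S i ^^ k) x) \<in> hcarrier H" using bounded_operatorD(1)[OF pow_bounded(1)[OF i] s] .
    note sl = Sl_bounded[OF ys(1), of ?q]
    have slm: "Sl ?ys ?q x \<in> hcarrier H" using bounded_operatorD(1)[OF sl x] .
    have sslm: "(S i ^^ k) (Sl ?ys ?q x) \<in> hcarrier H" using bounded_operatorD(1)[OF pow_bounded(2)[OF i] slm] .
    have "Sl ?ys ?q ((T i ^^ k) ((S i ^^ k) x)) = (T i ^^ k) (Sl ?ys ?q ((S i ^^ k) x))"
      using commute_on_funpow[OF commute_on_sym[OF T_Sl[OF i ys]] sl T_bounded[OF i]] s
      by (simp add: commute_on_def)
    also have "Sl ?ys ?q ((S i ^^ k) x) = (S i ^^ k) (Sl ?ys ?q x)"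
      using commute_on_funpow[OF commute_on_sym[OF S_Sl[OF i ys]] sl S_bounded[OF i]] x
      by (simp add: commute_on_def)
    finally have comm: "Sl ?xs ?q ((T i ^^ k) ((S i ^^ k) x)) = (T i ^^ k) ((S i ^^ k) (Sl ?xs ?q x))"
      using sq[OF t] sq[OF x] by simp
    have "power_list S ?xs (Poly_Mapping.lookup (q + ?e)) x = (S i ^^ k) (Sl ?xs ?q x)"
      by (rule lookup_step) (use S_bounded SS q0 x in auto)
    moreover have "power_list T ?xs (Poly_Mapping.lookup (p + ?e)) ((S i ^^ k) (Sl ?xs ?q x))
        = (T i ^^ k) (power_list T ?xs (Poly_Mapping.lookup p) ((S i ^^ k) (Sl ?xs ?q x)))"
      by (rule lookup_step) (use T_bounded TT p0 sslm sq[OF x] in auto)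
    moreover have "(T i ^^ k) (power_list T ?xs (Poly_Mapping.lookup p) ((S i ^^ k) (Sl ?xs ?q x)))
        = power_list T ?xs (Poly_Mapping.lookup p) ((T i ^^ k) ((S i ^^ k) (Sl ?xs ?q x)))"
    proof -
      have "commute_on H (T i ^^ k) (power_list T ?xs (Poly_Mapping.lookup p))"
        by (rule commute_on_power_list)
          (use pow_bounded(1)[OF i] T_bounded TT i in \<open>auto intro!: commute_on_sym[OF commute_on_funpow]\<close>)
      then show ?thesis using sslm sq[OF x] by (simp add: commute_on_def)
    qed
    ultimately show ?thesis unfolding tuple_power_eq comm by simp
  qed
  have "hereditary_eval n H T (P * Poly_Mapping.single (?e, ?e) c) x
      = hereditary_eval n H T (\<Sum>\<kappa>\<in>?X. Poly_Mapping.single (\<kappa> + (?e, ?e)) (Poly_Mapping.lookup P \<kappa> * c)) x"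
    by (subst (1) poly_mapping_sum_singles[of P]) (simp add: sum_distrib_right mult_single)
  also have "\<dots> = (\<Sum>(p, q)\<in>?X. (Poly_Mapping.lookup P (p, q) * c) *\<^sub>C
      tuple_power n T (p + ?e) (tuple_power n S (q + ?e) x))"
    unfolding hereditary_eval_sum
    by (intro sum.cong) (auto simp: hereditary_eval_single Seq)
  also have "\<dots> = (\<Sum>(p, q)\<in>?X. c *\<^sub>C (Poly_Mapping.lookup P (p, q) *\<^sub>C
      tuple_power n T p (tuple_power n S q ((T i ^^ k) ((S i ^^ k) x)))))"
    by (intro sum.cong) (auto simp: key scaleC_scaleC mult.commute)
  also have "\<dots> = c *\<^sub>C hereditary_eval n H T P ((T i ^^ k) ((S i ^^ k) x))"
    by (simp add: hereditary_eval_def Seq case_prod_unfold cvec.scale_sum_right)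
  finally show ?thesis .
qed

lemma hereditary_eval_linear:
  shows "bounded_operator H H (hereditary_eval n H T P)"
proof -
  have Seq: "(\<lambda>i. adjoint H H (T i)) = S" by (simp add: S_def fun_eq_iff)
  have b: "bounded_operator H H (\<lambda>x. tuple_power n T p (tuple_power n S q x))" for p q
    unfolding tuple_power_eq
    by (rule bounded_operator_compose[OF bounded_power_list bounded_power_list])
      (use S_bounded T_bounded pre_hilbert_axioms in auto)
  have "bounded_operator H H (\<lambda>x. \<Sum>(p, q)\<in>X. Poly_Mapping.lookup P (p, q) *\<^sub>C
      tuple_power n T p (tuple_power n S q x))" if "finite X" for X
    using that
  proof (induction X)
    case empty
    show ?case by (rule bounded_operatorI[where C = 0]) auto
  next
    case (insert k X)
    then show ?case
      using bounded_operator_add[OF bounded_operator_scaleC[OF b pre_hilbert_axioms pre_hilbert_axioms]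
          insert.IH pre_hilbert_axioms pre_hilbert_axioms]
      by (cases k) simp
  qed
  from this[of "Poly_Mapping.keys P"] show ?thesis
    unfolding hereditary_eval_def Seq by simp
qed

text \<open>
  The factors \<open>(1 - z\<^sub>i w\<^sub>i)\<^bsup>m\<^sub>i\<^esup>\<close> are multiplied one by one, each of them in a fresh variable.
\<close>

theorem hereditary_eval_inverse_kernel:
  assumes x: "x \<in> hcarrier H"
  shows "hereditary_eval n H T (inverse_kernel_poly n m) x = Dl [1..<Suc n] x"
proof -
  let ?P = "\<lambda>j. \<Prod>i\<in>{1..j}. (1 - z_var i * w_cnj_var i) ^ m i"
  have "(\<forall>p q i. (p, q) \<in> Poly_Mapping.keys (?P j) \<longrightarrow> i > j \<longrightarrow>
      Poly_Mapping.lookup p i = 0 \<and> Poly_Mapping.lookup q i = 0) \<and>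
    (\<forall>x\<in>hcarrier H. hereditary_eval n H T (?P j) x = Dl [1..<Suc j] x)" if "j \<le> n" for j
    using that
  proof (induction j)
    case 0
    have one: "(1 :: hereditary_poly) = Poly_Mapping.single (0, 0) 1"
      by (simp add: zero_prod_def flip: single_one)
    have triv: "tuple_power n A 0 x = x" for A x
    proof -
      have "power_list A xs (Poly_Mapping.lookup 0) x = x" for xs by (induction xs) auto
      then show ?thesis by (simp add: tuple_power_eq)
    qed
    show ?case
      by (simp add: one keys_single hereditary_eval_single triv scaleC_one)
  next
    case (Suc j)
    let ?k = "Suc j"
    have k: "?k \<in> {1..n}" using Suc.prems by auto
    have IH: "\<And>p q i. (p, q) \<in> Poly_Mapping.keys (?P j) \<Longrightarrow> i > j \<Longrightarrow>
        Poly_Mapping.lookup p i = 0 \<and> Poly_Mapping.lookup q i = 0"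
      "\<And>x. x \<in> hcarrier H \<Longrightarrow> hereditary_eval n H T (?P j) x = Dl [1..<Suc j] x"
      using Suc by auto
    let ?F = "\<Sum>l\<le>m ?k. Poly_Mapping.single
      (Poly_Mapping.single ?k l, Poly_Mapping.single ?k l) ((- 1) ^ l * of_nat (m ?k choose l)) :: hereditary_poly"
    have P: "?P ?k = ?P j * ?F"
    proof -
      have "?P ?k = (1 - z_var ?k * w_cnj_var ?k) ^ m ?k * ?P j" by (simp add: atLeastAtMostSuc_conv)
      also have "\<dots> = ?F * ?P j" unfolding inverse_kernel_factor[of ?k] ..
      also have "\<dots> = ?P j * ?F" by (rule mult.commute)
      finally show ?thesis .
    qed
    have keysF: "Poly_Mapping.keys ?F \<subseteq> (\<Union>l. {(Poly_Mapping.single ?k l, Poly_Mapping.single ?k l)})"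
      using Poly_Mapping.keys_sum[of "\<lambda>l. Poly_Mapping.single
      (Poly_Mapping.single ?k l, Poly_Mapping.single ?k l) ((- 1) ^ l * of_nat (m ?k choose l) :: complex)" "{..m ?k}"]
      by (auto split: if_splits)
    have 1: "Poly_Mapping.lookup p i = 0 \<and> Poly_Mapping.lookup q i = 0"
      if pq: "(p, q) \<in> Poly_Mapping.keys (?P ?k)" and i: "i > ?k" for p q i
    proof -
      have "(p, q) \<in> {a + b |a b. a \<in> Poly_Mapping.keys (?P j) \<and> b \<in> Poly_Mapping.keys ?F}"
        using pq keys_mult[of "?P j" ?F] unfolding P by blast
      then obtain p' q' l where pq': "(p', q') \<in> Poly_Mapping.keys (?P j)"
        "p = p' + Poly_Mapping.single ?k l" "q = q' + Poly_Mapping.single ?k l"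
        using keysF by fastforce
      then show ?thesis using IH(1)[OF pq'(1), of i] i by (simp add: lookup_add lookup_single when_def)
    qed
    have 2: "hereditary_eval n H T (?P ?k) x = Dl [1..<Suc ?k] x" if x: "x \<in> hcarrier H" for x
    proof -
      have m: "(T ?k ^^ l) ((S ?k ^^ l) x) \<in> hcarrier H" for l
        using bounded_operatorD(1)[OF pow_bounded(1)[OF k] bounded_operatorD(1)[OF pow_bounded(2)[OF k] x]] .
      have "hereditary_eval n H T (?P ?k) x = (\<Sum>l\<le>m ?k. ((- 1) ^ l * of_nat (m ?k choose l)) *\<^sub>C
          hereditary_eval n H T (?P j) ((T ?k ^^ l) ((S ?k ^^ l) x)))"
        unfolding P sum_distrib_left hereditary_eval_sum
        by (intro sum.cong hereditary_eval_mult_single[OF k x]) (use IH(1) in auto)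
      also have "\<dots> = hereditary_eval n H T (?P j) (\<Sum>l\<le>m ?k. ((- 1) ^ l * of_nat (m ?k choose l)) *\<^sub>C
          (T ?k ^^ l) ((S ?k ^^ l) x))"
        using m by (simp add: bounded_operator_sum[OF hereditary_eval_linear pre_hilbert_axioms]
            bounded_operatorD(3)[OF hereditary_eval_linear])
      also have "(\<Sum>l\<le>m ?k. ((- 1) ^ l * of_nat (m ?k choose l)) *\<^sub>C (T ?k ^^ l) ((S ?k ^^ l) x)) = \<Delta> ?k x"
        by (simp add: \<Delta>_def hyper_defect_def S_def)
      also have "hereditary_eval n H T (?P j) (\<Delta> ?k x) = Dl [1..<Suc j] (\<Delta> ?k x)"
        by (rule IH(2)) (rule bounded_operatorD(1)[OF \<Delta>_bounded[OF k] x])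
      also have "\<dots> = Dl [1..<Suc ?k] x" by (simp add: product_list_append upt_Suc[of 1 ?k])
      finally show ?thesis .
    qed
    show ?case using 1 2 by blast
  qed
  from this[of n] x show ?thesis by (simp add: inverse_kernel_poly_def)
qed

lemma Dl_all_positive: "positive_operator H (Dl [1..<Suc n])"
proof -
  have p: "positive_operator H (hereditary_eval n H T (inverse_kernel_poly n m))"
    using bc by (simp add: B_contractive_def)
  show ?thesis
    unfolding positive_operator_def
  proof (intro conjI ballI)
    show "bounded_operator H H (Dl [1..<Suc n])" by (rule Dl_bounded) auto
    show "hinner H (Dl [1..<Suc n] x) x \<in> \<real>\<^sub>\<ge>\<^sub>0" if "x \<in> hcarrier H" for x
      using positive_operatorD(2)[OF p that] hereditary_eval_inverse_kernel[OF that] by simp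
  qed
qed

end

section \<open>The dilation on the defect space\<close>

context doubly_commuting_tuple
begin

abbreviation "all \<equiv> [1..<Suc n]"

definition B :: "'a \<Rightarrow> 'a" where "B = defect_operator n m H T"

definition Dsp :: "'a hilbert" where "Dsp = defect_space n m H T"

lemma set_all: "set all = {1..n}" and distinct_all: "distinct all" and all_subset: "set all \<subseteq> {1..n}"
  by auto

lemma B_positive: "positive_operator H B"
  and B_square: "x \<in> hcarrier H \<Longrightarrow> B (B x) = Dl all x"
proof -
  have "positive_operator H (hereditary_eval n H T (inverse_kernel_poly n m))"
    using bc by (simp add: B_contractive_def)
  note sq = operator_sqrt[OF hilbert_space_axioms this]
  show "positive_operator H B" using sq(1) by (simp add: B_def defect_operator_def)
  show "x \<in> hcarrier H \<Longrightarrow> B (B x) = Dl all x"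
    using sq(2) hereditary_eval_inverse_kernel by (simp add: B_def defect_operator_def)
qed

lemma B_bounded: "bounded_operator H H B"
  by (rule positive_operatorD(1)[OF B_positive])

lemmas B_lin = bounded_operatorD[OF B_bounded]

lemma B_inner: "\<lbrakk>x \<in> hcarrier H; y \<in> hcarrier H\<rbrakk> \<Longrightarrow> hinner H (B x) (B y) = hinner H (Dl all x) y"
  using positive_operator_hermitian[OF B_positive pre_hilbert_axioms, of "B x" y] B_lin(1)
  by (simp add: B_square)

lemma B_hnorm: "x \<in> hcarrier H \<Longrightarrow> (hnorm H (B x))\<^sup>2 = Re (hinner H (Dl all x) x)"
  using B_inner[of x x] B_lin(1) by (simp add: hnorm_sq)

lemma Dsp_carrier: "hcarrier Dsp = hclosure H (B ` hcarrier H)"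
  and Dsp_inner [simp]: "hinner Dsp = hinner H" and Dsp_hnorm [simp]: "hnorm Dsp = hnorm H"
  by (simp_all add: Dsp_def defect_space_def B_def)

lemma range_B_subset: "B ` hcarrier H \<subseteq> hcarrier H"
  using B_lin(1) by blast

lemma Dsp_closed: "closed_subspace H (hcarrier Dsp)"
  unfolding Dsp_carrier
proof (rule hclosure_closed_subspace[OF range_B_subset])
  show "0 \<in> B ` hcarrier H"
    by (rule image_eqI[where x = 0]) (simp_all add: bounded_operator_zero[OF B_bounded pre_hilbert_axioms])
  show "x + y \<in> B ` hcarrier H" if "x \<in> B ` hcarrier H" "y \<in> B ` hcarrier H" for x y
  proof -
    from that obtain u v where uv: "u \<in> hcarrier H" "v \<in> hcarrier H" "x = B u" "y = B v" by blast
    then have "x + y = B (u + v)" by (simp add: B_lin(2))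
    then show ?thesis using uv by simp
  qed
  show "c *\<^sub>C x \<in> B ` hcarrier H" if "x \<in> B ` hcarrier H" for c x
  proof -
    from that obtain u where u: "u \<in> hcarrier H" "x = B u" by blast
    then have "c *\<^sub>C x = B (c *\<^sub>C u)" by (simp add: B_lin(3))
    then show ?thesis using u by simp
  qed
qed

lemma Dsp_hilbert: "hilbert_space Dsp"
  using closed_subspace_hilbert[OF Dsp_closed] unfolding Dsp_def defect_space_def by simp

lemma Dsp_mem: "x \<in> hcarrier Dsp \<Longrightarrow> x \<in> hcarrier H"
  using closed_subspaceD(2)[OF Dsp_closed] .

lemma B_Dsp: "x \<in> hcarrier H \<Longrightarrow> B x \<in> hcarrier Dsp"
  using subset_hclosure[OF range_B_subset] unfolding Dsp_carrier by blast

lemma Dsp_zero_if_orth: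
  assumes x: "x \<in> hcarrier Dsp" and orth: "\<And>y. y \<in> hcarrier H \<Longrightarrow> hinner H x (B y) = 0"
  shows "x = 0"
proof -
  have "hinner H x x = 0"
    by (rule orth_hclosure[OF range_B_subset Dsp_mem[OF x] _ x[unfolded Dsp_carrier]]) (use orth in auto)
  then show ?thesis using inner_eq_zero[OF Dsp_mem[OF x]] by blast
qed

sublocale D: hilbert_space Dsp by (rule Dsp_hilbert)

abbreviation "L1 \<equiv> l2_space (UNIV :: nat set) Dsp"

abbreviation "L \<equiv> l2_space (multi {1..n}) Dsp"

sublocale L1: hilbert_space L1 by (rule D.l2_hilbert)

sublocale L: hilbert_space L by (rule D.l2_hilbert)

text \<open>
  The coefficients of \<open>z \<mapsto> B (1 - z T\<^sub>k\<^sup>*)\<^bsup>-m\<^sub>k\<^esup> h\<close>, in the orthonormal coordinates of the disc space.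
  The closure of the set of these functions is \<open>Q\<^sub>k\<close>.
\<close>

definition W :: "nat \<Rightarrow> 'a \<Rightarrow> nat \<Rightarrow> 'a"
  where "W k h = (\<lambda>q. complex_of_real (sqrt (neg_binom (m k) q)) *\<^sub>C B ((S k ^^ q) h))"

lemma sqrt_neg_binom_sq: "complex_of_real (sqrt (neg_binom j q)) * complex_of_real (sqrt (neg_binom j q))
    = complex_of_real (neg_binom j q)"
  by (simp add: neg_binom_def flip: of_real_mult)

lemma remaining_factors:
  assumes k: "k \<in> {1..n}"
  shows "set (remove1 k all) \<subseteq> {1..n}" "k \<notin> set (remove1 k all)" "distinct (remove1 k all)"
    "x \<in> hcarrier H \<Longrightarrow> Dl all x = \<Delta> k (Dl (remove1 k all) x)"
  using Dl_extract[of k all x] k set_all by auto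

text \<open>
  Moving the product of the other defects through the powers of the adjoint turns the series into the
  resolution of the identity by \<open>T\<^sub>k\<close>.
\<close>

lemma W_term:
  assumes k: "k \<in> {1..n}" and x: "x \<in> hcarrier H" and y: "y \<in> hcarrier H"
  shows "((\<lambda>q. hinner H (W k x q) (W k y q)) has_sum hinner H (Dl (remove1 k all) x) y) UNIV"
proof -
  let ?C = "Dl (remove1 k all)"
  note C = Dl_bounded[OF remaining_factors(1)[OF k]]
  have s: "(S k ^^ q) z \<in> hcarrier H" if "z \<in> hcarrier H" for q z
    using bounded_operatorD(1)[OF pow_bounded(2)[OF k] that] .
  have "((\<lambda>q. complex_of_real (neg_binom (m k) q) * hinner H (\<Delta> k ((S k ^^ q) (?C x))) ((S k ^^ q) y))
      has_sum hinner H (?C x) y) UNIV"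
    by (rule single_resolution[OF k bounded_operatorD(1)[OF C x] y])
  then show ?thesis
  proof (rule has_sum_cong[THEN iffD1, rotated])
    fix q
    have "(S k ^^ q) (?C x) = ?C ((S k ^^ q) x)"
      using commute_on_funpow[OF commute_on_sym[OF S_Dl[OF k remaining_factors(1,2)[OF k]]] C S_bounded[OF k]] x
      by (simp add: commute_on_def)
    then have "hinner H (\<Delta> k ((S k ^^ q) (?C x))) ((S k ^^ q) y) = hinner H (B ((S k ^^ q) x)) (B ((S k ^^ q) y))"
      using remaining_factors(4)[OF k s[OF x]] by (simp add: B_inner s x y)
    then show "complex_of_real (neg_binom (m k) q) * hinner H (\<Delta> k ((S k ^^ q) (?C x))) ((S k ^^ q) y) =
        hinner H (W k x q) (W k y q)"
      using s[OF x] s[OF y] B_lin(1)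
      by (simp add: W_def inner_scaleC_left inner_scaleC_right sqrt_neg_binom_sq[symmetric] mult.assoc)
  qed
qed

lemma W_mem: "\<lbrakk>k \<in> {1..n}; x \<in> hcarrier H\<rbrakk> \<Longrightarrow> W k x \<in> hcarrier L1"
proof (rule l2_carrierI)
  assume k: "k \<in> {1..n}" and x: "x \<in> hcarrier H"
  show Wm: "W k x q \<in> hcarrier Dsp" for q
    using B_Dsp bounded_operatorD(1)[OF pow_bounded(2)[OF k] x] by (simp add: W_def)
  have "((\<lambda>q. Re (hinner H (W k x q) (W k x q))) has_sum Re (hinner H (Dl (remove1 k all) x) x)) UNIV"
    by (rule has_sum_Re[OF W_term[OF k x x]])
  then show "(\<lambda>q. (hnorm Dsp (W k x q))\<^sup>2) summable_on UNIV"
    using Wm Dsp_mem by (auto simp: hnorm_sq dest: has_sum_imp_summable)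
qed simp

lemma W_inner:
  assumes "k \<in> {1..n}" "x \<in> hcarrier H" "y \<in> hcarrier H"
  shows "hinner L1 (W k x) (W k y) = hinner H (Dl (remove1 k all) x) y"
  using has_sum_unique[OF D.l2_inner_has_sum[OF W_mem[OF assms(1,2)] W_mem[OF assms(1,3)]]] W_term[OF assms]
  by simp

lemma W_shift:
  assumes k: "k \<in> {1..n}" and t: "t \<in> hcarrier L1" and h: "h \<in> hcarrier H"
  shows "hinner L1 (l2_shift (m k) t) (W k h) = hinner L1 t (W k (S k h))"
proof -
  interpret d: disc_space Dsp "m k" by unfold_locales (rule m[OF k])
  have sh: "S k h \<in> hcarrier H" using bounded_operatorD(1)[OF S_bounded[OF k] h] .
  have tm: "t q \<in> hcarrier H" for q using l2_carrierD(1)[OF t] Dsp_mem by simp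
  have bm: "B ((S k ^^ q) z) \<in> hcarrier H" if "z \<in> hcarrier H" for q z
    using B_lin(1) bounded_operatorD(1)[OF pow_bounded(2)[OF k] that] by simp
  have "((\<lambda>q. hinner H (l2_shift (m k) t q) (W k h q)) has_sum hinner L1 t (W k (S k h))) UNIV"
  proof (rule has_sum_SucI)
    show "hinner H (l2_shift (m k) t 0) (W k h 0) = 0"
      using bm[OF h, of 0] by (simp add: l2_shift_def W_def)
    have "hinner H (l2_shift (m k) t (Suc q)) (W k h (Suc q)) = hinner H (t q) (W k (S k h) q)" for q
    proof -
      let ?a = "sqrt (neg_binom (m k) q)" and ?b = "sqrt (neg_binom (m k) (Suc q))"
      have ab: "complex_of_real (?a / ?b) * complex_of_real ?b = complex_of_real ?a"
      proof -
        have "?a / ?b * ?b = ?a" using neg_binom_pos[OF m[OF k], of "Suc q"] by simp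
        then show ?thesis by (simp only: of_real_mult[symmetric])
      qed
      have "hinner H (l2_shift (m k) t (Suc q)) (W k h (Suc q))
          = (complex_of_real (?a / ?b) * complex_of_real ?b) * hinner H (t q) (B ((S k ^^ Suc q) h))"
        using tm bm[OF h, of "Suc q"]
        by (simp add: l2_shift_def W_def inner_scaleC_left inner_scaleC_right)
      also have "\<dots> = hinner H (t q) (W k (S k h) q)"
        unfolding ab using tm bm[OF sh, of q] by (simp add: W_def inner_scaleC_right funpow_swap1)
      finally show ?thesis .
    qed
    then show "((\<lambda>q. hinner H (l2_shift (m k) t (Suc q)) (W k h (Suc q))) has_sum hinner L1 t (W k (S k h))) UNIV"
      using D.l2_inner_has_sum[OF t W_mem[OF k sh]] by simp
  qed
  then show ?thesis
    using has_sum_unique[OF D.l2_inner_has_sum[OF d.l2_shift_mem(1)[OF t] W_mem[OF k h]]] by simp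
qed

text \<open>
  The coefficients of the functions orthogonal to \<open>Q\<^sub>k\<close>, which form the invariant subspace that the \<open>k\<close>-th
  multiplier parametrizes.
\<close>

definition annihilator :: "nat \<Rightarrow> (nat \<Rightarrow> 'a) set"
  where "annihilator k = {t \<in> hcarrier L1. \<forall>h\<in>hcarrier H. hinner L1 t (W k h) = 0}"

text \<open>
  The projection of \<open>z\<^sup>q B y\<close> onto the closure of the range of \<open>W k\<close> is a vector of this range, because
  the product of the defects is \<open>\<Delta>\<^sub>k\<close> times an operator that commutes with \<open>T\<^sub>k\<close>. Up to the normalization
  of the monomial, it is the image of \<open>T\<^sub>k\<^sup>q \<Delta>\<^sub>k y\<close>.
\<close>

lemma annihilator_orth_component:
  assumes k: "k \<in> {1..n}" and s: "s \<in> hcarrier L1" and orth: "\<And>t. t \<in> annihilator k \<Longrightarrow> hinner L1 s t = 0"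
    and y: "y \<in> hcarrier H"
  shows "hinner H (s q) (B y) =
    hinner L1 s (W k (complex_of_real (sqrt (neg_binom (m k) q)) *\<^sub>C (T k ^^ q) (\<Delta> k y)))"
proof -
  let ?c = "complex_of_real (sqrt (neg_binom (m k) q))"
  let ?C = "Dl (remove1 k all)"
  define x where "x = ?c *\<^sub>C (T k ^^ q) (\<Delta> k y)"
  have dy: "\<Delta> k y \<in> hcarrier H" using bounded_operatorD(1)[OF \<Delta>_bounded[OF k] y] .
  have tdy: "(T k ^^ q) (\<Delta> k y) \<in> hcarrier H" using bounded_operatorD(1)[OF pow_bounded(1)[OF k] dy] .
  have x: "x \<in> hcarrier H" using tdy by (simp add: x_def)
  note C = Dl_bounded[OF remaining_factors(1)[OF k]]
  have By: "B y \<in> hcarrier Dsp" by (rule B_Dsp[OF y])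
  let ?e = "D.l2_single q (B y)"
  have e: "?e \<in> hcarrier L1" by (rule D.l2_single_mem) (use By in auto)
  have "?e - W k x \<in> annihilator k"
    unfolding annihilator_def
  proof (intro CollectI conjI ballI)
    show "?e - W k x \<in> hcarrier L1" using e W_mem[OF k x] by simp
    fix h assume h: "h \<in> hcarrier H"
    have sh: "(S k ^^ q) h \<in> hcarrier H" using bounded_operatorD(1)[OF pow_bounded(2)[OF k] h] .
    have "hinner L1 ?e (W k h) = cnj (hinner L1 (W k h) ?e)"
      by (rule L1.inner_commute[OF e W_mem[OF k h]])
    also have "\<dots> = cnj (hinner H (W k h q) (B y))"
      using D.l2_single_inner[of q UNIV "B y" "W k h"] By W_mem[OF k h] by simp
    also have "\<dots> = ?c * hinner H (B y) (B ((S k ^^ q) h))"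
      using inner_commute[of "B y" "B ((S k ^^ q) h)"] B_lin(1) y sh by (simp add: W_def inner_scaleC_left)
    also have "\<dots> = ?c * hinner H (Dl all y) ((S k ^^ q) h)" using y sh by (simp add: B_inner)
    also have "Dl all y = ?C (\<Delta> k y)"
      using remaining_factors(4)[OF k y] \<Delta>_Dl[OF k remaining_factors(1,2)[OF k]] y by (simp add: commute_on_def)
    also have "hinner H (?C (\<Delta> k y)) ((S k ^^ q) h) = hinner H ((T k ^^ q) (?C (\<Delta> k y))) h"
      using S_pow_inner[OF k bounded_operatorD(1)[OF C dy] h] by simp
    also have "(T k ^^ q) (?C (\<Delta> k y)) = ?C ((T k ^^ q) (\<Delta> k y))"
      using commute_on_funpow[OF commute_on_sym[OF T_Dl[OF k remaining_factors(1,2)[OF k]]] C T_bounded[OF k]] dy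
      by (simp add: commute_on_def)
    also have "?c * hinner H (?C ((T k ^^ q) (\<Delta> k y))) h = hinner H (?C x) h"
      using bounded_operatorD(1,3)[OF C tdy] h by (simp add: x_def inner_scaleC_left)
    also have "\<dots> = hinner L1 (W k x) (W k h)" by (rule W_inner[OF k x h, symmetric])
    finally show "hinner L1 (?e - W k x) (W k h) = 0"
      using L1.inner_diff_left[OF e W_mem[OF k x] W_mem[OF k h]] by simp
  qed
  from orth[OF this] have "hinner L1 s ?e = hinner L1 s (W k x)"
    using L1.inner_diff_right[OF s e W_mem[OF k x]] by simp
  then show ?thesis
    using D.l2_single_inner[of q UNIV "B y" s] By s by (simp add: x_def)
qed

text \<open>
  The coefficients of \<open>B \<Prod>\<^sub>i (1 - z\<^sub>i T\<^sub>i\<^sup>*)\<^bsup>-m\<^sub>i\<^esup> h\<close>. The joint resolution of the identity says that \<open>V\<close> is an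
  isometry.
\<close>

definition V :: "'a \<Rightarrow> (nat \<Rightarrow> nat) \<Rightarrow> 'a"
  where "V h = (\<lambda>p. if p \<in> multi {1..n} then complex_of_real (sqrt (weight_list all p)) *\<^sub>C B (Sl all p h) else 0)"

lemma V_sum:
  assumes h: "h \<in> hcarrier H"
  shows "((\<lambda>p. (hnorm H (V h p))\<^sup>2) has_sum (hnorm H h)\<^sup>2) (multi {1..n})"
proof -
  have "((\<lambda>r. Re (complex_of_real (weight_list all r) * hinner H (Dl all (Sl all r h)) (Sl all r h)))
      has_sum Re (hinner H h h)) (multi {1..n})"
    using has_sum_Re[OF joint_resolution[OF all_subset distinct_all Dl_all_positive h h]] set_all by simp
  then have "((\<lambda>p. (hnorm H (V h p))\<^sup>2) has_sum Re (hinner H h h)) (multi {1..n})"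
  proof (rule has_sum_cong[THEN iffD1, rotated])
    fix p :: "nat \<Rightarrow> nat" assume p: "p \<in> multi {1..n}"
    have s: "Sl all p h \<in> hcarrier H" using bounded_operatorD(1)[OF Sl_bounded[OF all_subset] h] .
    show "Re (complex_of_real (weight_list all p) * hinner H (Dl all (Sl all p h)) (Sl all p h)) = (hnorm H (V h p))\<^sup>2"
      using p s weight_list_nonneg[of all p] B_lin(1)
      by (simp add: V_def hnorm_scaleC power_mult_distrib B_hnorm)
  qed
  then show ?thesis using h by (simp add: hnorm_sq)
qed

lemma V_mem: "h \<in> hcarrier H \<Longrightarrow> V h \<in> hcarrier L"
proof (rule l2_carrierI)
  assume h: "h \<in> hcarrier H"
  show "V h p \<in> hcarrier Dsp" for p
    using B_Dsp bounded_operatorD(1)[OF Sl_bounded[OF all_subset] h] by (simp add: V_def)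
  show "V h p = 0" if "p \<notin> multi {1..n}" for p using that by (simp add: V_def)
  show "(\<lambda>p. (hnorm Dsp (V h p))\<^sup>2) summable_on multi {1..n}"
    using has_sum_imp_summable[OF V_sum[OF h]] by simp
qed

lemma V_hnorm: "h \<in> hcarrier H \<Longrightarrow> hnorm L (V h) = hnorm H h"
proof (rule power2_eq_imp_eq)
  assume h: "h \<in> hcarrier H"
  show "(hnorm L (V h))\<^sup>2 = (hnorm H h)\<^sup>2"
    using has_sum_unique[OF D.l2_hnorm_has_sum[OF V_mem[OF h]]] V_sum[OF h] by simp
qed (simp_all add: V_mem)

lemma V_bounded: "bounded_operator H L V"
proof (rule bounded_operatorI[where C = 1])
  note s = bounded_operatorD[OF Sl_bounded[OF all_subset]]
  show "V (x + y) = V x + V y" if "x \<in> hcarrier H" "y \<in> hcarrier H" for x y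
    using that s B_lin by (simp add: V_def fun_eq_iff scaleC_add_right)
  show "V (c *\<^sub>C x) = c *\<^sub>C V x" if "x \<in> hcarrier H" for c x
    using that s B_lin by (simp add: V_def fun_eq_iff scaleC_fun_apply scaleC_scaleC mult.commute)
qed (simp_all add: V_mem V_hnorm)

lemma V_inner: "\<lbrakk>x \<in> hcarrier H; y \<in> hcarrier H\<rbrakk> \<Longrightarrow> hinner L (V x) (V y) = hinner H x y"
  by (rule isometry_preserves_inner[OF pre_hilbert_axioms L.pre_hilbert_axioms, where V = V])
    (use V_mem V_hnorm bounded_operatorD[OF V_bounded] in simp_all)

lemma slice_V:
  assumes k: "k \<in> {1..n}" and p: "p \<in> multi ({1..n} - {k})" and h: "h \<in> hcarrier H"
  shows "slice k (V h) p =
    complex_of_real (sqrt (weight_list (remove1 k all) p)) *\<^sub>C W k (Sl (remove1 k all) p h)"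
proof
  fix q
  let ?ys = "remove1 k all"
  have "set all = set (k # ?ys)" using k set_all by (auto simp: set_remove1_eq)
  then have "weight_list all (p(k := q)) = weight_list (k # ?ys) (p(k := q))" by (simp only: weight_list_def)
  also have "\<dots> = neg_binom (m k) q * weight_list ?ys p" by (rule weight_list_Cons[OF remaining_factors(2)[OF k]])
  finally have w: "weight_list all (p(k := q)) = neg_binom (m k) q * weight_list ?ys p" .
  have "Sl all (p(k := q)) h = (S k ^^ q) (Sl ?ys (p(k := q)) h)"
    using Sl_extract[of k all h "p(k := q)"] k set_all h by simp
  also have "Sl ?ys (p(k := q)) h = Sl ?ys p h"
    by (rule power_list_cong) (use remaining_factors(2)[OF k] in auto)
  finally have s: "Sl all (p(k := q)) h = (S k ^^ q) (Sl ?ys p h)" .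
  show "slice k (V h) p q = (complex_of_real (sqrt (weight_list ?ys p)) *\<^sub>C W k (Sl ?ys p h)) q"
    using multi_update[OF k p, of q]
    by (simp add: slice_def V_def w s W_def scaleC_fun_apply scaleC_scaleC real_sqrt_mult mult.commute)
qed

section \<open>The joint model space\<close>

text \<open>
  The coefficients of the quotient space: the complement of a sum of ranges is the intersection of the
  complements, and each of them is a condition on the slices in one variable.
\<close>

definition model_coeffs :: "((nat \<Rightarrow> nat) \<Rightarrow> 'a) set"
  where "model_coeffs = {a \<in> hcarrier L. \<forall>k\<in>{1..n}. \<forall>p\<in>multi ({1..n} - {k}). \<forall>t\<in>annihilator k.
    hinner L1 (slice k a p) t = 0}"

lemma V_model: "h \<in> hcarrier H \<Longrightarrow> V h \<in> model_coeffs"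
  unfolding model_coeffs_def
proof (intro CollectI conjI ballI V_mem)
  fix k p t assume h: "h \<in> hcarrier H" and k: "k \<in> {1..n}" and p: "p \<in> multi ({1..n} - {k})"
    and t: "t \<in> annihilator k"
  let ?u = "Sl (remove1 k all) p h"
  have u: "?u \<in> hcarrier H" using bounded_operatorD(1)[OF Sl_bounded[OF remaining_factors(1)[OF k]] h] .
  have tL: "t \<in> hcarrier L1" and "hinner L1 t (W k ?u) = 0" using t u by (auto simp: annihilator_def)
  then have "hinner L1 (W k ?u) t = 0" using L1.inner_commute[OF W_mem[OF k u] tL] by simp
  then show "hinner L1 (slice k (V h) p) t = 0"
    unfolding slice_V[OF k p h] using L1.inner_scaleC_left[OF W_mem[OF k u] tL] by simp
qed

text \<open>
  The vector collected by projecting the monomial \<open>z\<^sup>p B x\<close> in the variables of the list, one after the other.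
\<close>

primrec absorb :: "(nat \<Rightarrow> nat) \<Rightarrow> nat list \<Rightarrow> 'a \<Rightarrow> 'a" where
  "absorb p [] x = x"
| "absorb p (k # xs) x =
    complex_of_real (sqrt (neg_binom (m k) (p k))) *\<^sub>C (T k ^^ p k) (\<Delta> k (absorb p xs x))"

text \<open>
  The summation index after these projections: the entries of the list run, the others are still those of \<open>p\<close>.
\<close>

definition patch :: "nat list \<Rightarrow> (nat \<Rightarrow> nat) \<Rightarrow> (nat \<Rightarrow> nat) \<Rightarrow> nat \<Rightarrow> nat"
  where "patch xs p r = (\<lambda>i. if i \<in> set xs then r i else p i)"

lemma absorb_mem: "\<lbrakk>set xs \<subseteq> {1..n}; x \<in> hcarrier H\<rbrakk> \<Longrightarrow> absorb p xs x \<in> hcarrier H"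
proof (induction xs)
  case (Cons k xs)
  then have k: "k \<in> {1..n}" and IH: "absorb p xs x \<in> hcarrier H" by auto
  show ?case
    using bounded_operatorD(1)[OF pow_bounded(1)[OF k] bounded_operatorD(1)[OF \<Delta>_bounded[OF k] IH]] by simp
qed simp

lemma patch_mem:
  assumes "set xs \<subseteq> {1..n}" "p \<in> multi {1..n}"
  shows "patch xs p r \<in> multi {1..n}"
  using assms by (auto simp: patch_def PiE_iff extensional_def)

text \<open>
  The inner product of a function of the joint model with a monomial does not change when the monomial
  is projected in the variables of the list. One more variable is added by the formula for a single
  component, applied to the slices in this variable; the double sum converges absolutely because the
  weighted vectors are square summable by the joint resolution of the identity.
\<close>

lemma tail_expansion:
  assumes a: "a \<in> model_coeffs" and xs: "all = ys @ xs"
    and p: "p \<in> multi {1..n}" and x: "x \<in> hcarrier H"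
  shows "((\<lambda>r. hinner H (a (patch xs p r))
      (complex_of_real (sqrt (weight_list xs r)) *\<^sub>C B (Sl xs r (absorb p xs x)))) has_sum
    hinner H (a p) (B x)) (multi (set xs))"
  using xs
proof (induction xs arbitrary: ys)
  case Nil
  let ?f = "\<lambda>r. hinner H (a (patch [] p r)) (complex_of_real (sqrt (weight_list [] r)) *\<^sub>C B (Sl [] r (absorb p [] x)))"
  have "(?f has_sum (\<Sum>r\<in>{\<lambda>_. undefined}. ?f r)) {\<lambda>_. undefined}" by (rule has_sum_finite) simp
  then show ?case by (simp add: patch_def weight_list_def scaleC_one)
next
  case (Cons k xs)
  let ?ks = "k # xs"
  have "set (ys @ ?ks) = {1..n}" "distinct (ys @ ?ks)" using Cons.prems set_all distinct_all by metis+
  then have k: "k \<in> {1..n}" and sub: "set xs \<subseteq> {1..n}" "set ?ks \<subseteq> {1..n}" "set ys \<subseteq> {1..n}"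
    and nk: "k \<notin> set xs" and dist: "distinct ?ks" "distinct ys" "set ys \<inter> set ?ks = {}"
    and sys: "set (ys @ ?ks) \<subseteq> {1..n}" "distinct (ys @ ?ks)" by auto
  have A: "set ?ks - {k} = set xs" "k \<in> set ?ks" using nk by auto
  have aL: "a \<in> hcarrier L" using a by (simp add: model_coeffs_def)
  have am: "a r \<in> hcarrier H" if "r \<in> multi {1..n}" for r using l2_carrierD(1)[OF aL that] Dsp_mem by blast
  have IH: "((\<lambda>r. hinner H (a (patch xs p r))
      (complex_of_real (sqrt (weight_list xs r)) *\<^sub>C B (Sl xs r (absorb p xs x)))) has_sum
      hinner H (a p) (B x)) (multi (set xs))"
    using Cons.IH[of "ys @ [k]"] Cons.prems by simp
  define z where "z = absorb p ?ks x"
  have z: "z \<in> hcarrier H" unfolding z_def by (rule absorb_mem[OF sub(2) x])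
  note sl = bounded_operatorD[OF Sl_bounded[OF sub(1)]] and sl' = bounded_operatorD[OF Sl_bounded[OF sub(2)]]
  let ?f = "\<lambda>r. hinner H (a (patch ?ks p r)) (complex_of_real (sqrt (weight_list ?ks r)) *\<^sub>C B (Sl ?ks r z))"
  have abs: "(\<lambda>r. norm (?f r)) summable_on multi (set ?ks)"
  proof (rule summable_on_comparison_test)
    have inj: "inj_on (patch ?ks p) (multi (set ?ks))"
    proof (rule inj_onI)
      fix r r' assume r: "r \<in> multi (set ?ks)" "r' \<in> multi (set ?ks)" and eq: "patch ?ks p r = patch ?ks p r'"
      show "r = r'"
      proof (rule PiE_ext[OF r])
        fix i assume "i \<in> set ?ks"
        then show "r i = r' i" using fun_cong[OF eq, of i] by (simp add: patch_def)
      qed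
    qed
    have "(\<lambda>r. (hnorm Dsp (a r))\<^sup>2) summable_on patch ?ks p ` multi (set ?ks)"
      by (rule summable_on_subset_banach[OF l2_carrierD(3)[OF aL]]) (use patch_mem[OF sub(2) p] in blast)
    then have 1: "(\<lambda>r. (hnorm H (a (patch ?ks p r)))\<^sup>2) summable_on multi (set ?ks)"
      by (subst (asm) summable_on_reindex[OF inj]) (simp add: o_def)
    have pos: "positive_operator H (Dl ?ks)"
      by (rule Dl_positive_tail[OF sys]) (use Dl_all_positive Cons.prems in simp)
    have dz: "Dl ys z \<in> hcarrier H" using bounded_operatorD(1)[OF Dl_bounded[OF sub(3)] z] .
    have "(\<lambda>r. Re (complex_of_real (weight_list ?ks r) * hinner H (Dl ?ks (Sl ?ks r z)) (Sl ?ks r (Dl ys z))))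
        summable_on multi (set ?ks)"
      by (rule has_sum_imp_summable[OF has_sum_Re[OF joint_resolution[OF sub(2) dist(1) pos z dz]]])
    moreover have "Re (complex_of_real (weight_list ?ks r) * hinner H (Dl ?ks (Sl ?ks r z)) (Sl ?ks r (Dl ys z)))
        = weight_list ?ks r * (hnorm H (B (Sl ?ks r z)))\<^sup>2" for r
    proof -
      let ?u = "Sl ?ks r z"
      have u: "?u \<in> hcarrier H" by (rule sl'(1)[OF z])
      have "commute_on H (Sl ?ks r) (Dl ys)"
        unfolding product_list_def
      proof (rule commute_on_power_list[OF Sl_bounded[OF sub(2)]])
        fix i assume i: "i \<in> set ys"
        then have i': "i \<in> {1..n}" "i \<notin> set ?ks" using sub(3) dist(3) by auto
        show "bounded_operator H H (\<Delta> i)" by (rule \<Delta>_bounded[OF i'(1)])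
        show "commute_on H (Sl ?ks r) (\<Delta> i)" by (rule commute_on_sym[OF \<Delta>_Sl[OF i'(1) sub(2) i'(2)]])
      qed
      then have "Sl ?ks r (Dl ys z) = Dl ys ?u" using z unfolding commute_on_def by blast
      moreover have "hinner H (Dl ?ks ?u) (Dl ys ?u) = hinner H (Dl ys (Dl ?ks ?u)) ?u"
        by (rule Dl_hermitian[OF sub(3) dist(2) bounded_operatorD(1)[OF Dl_bounded[OF sub(2)] u] u, symmetric])
      moreover have "Dl ys (Dl ?ks ?u) = Dl all ?u"
        unfolding Cons.prems by (rule product_list_append[symmetric])
      ultimately show ?thesis using B_hnorm[OF u] by (simp only: Re_complex_of_real Re_divide_of_real times_complex.sel) simp
    qed
    ultimately have 2: "(\<lambda>r. weight_list ?ks r * (hnorm H (B (Sl ?ks r z)))\<^sup>2) summable_on multi (set ?ks)"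
      by (simp only:)
    show "(\<lambda>r. (hnorm H (a (patch ?ks p r)))\<^sup>2 + weight_list ?ks r * (hnorm H (B (Sl ?ks r z)))\<^sup>2)
        summable_on multi (set ?ks)"
      by (rule summable_on_add[OF 1 2])
    fix r :: "nat \<Rightarrow> nat" assume r: "r \<in> multi (set ?ks)"
    have u: "B (Sl ?ks r z) \<in> hcarrier H" using B_lin(1) sl'(1)[OF z] by simp
    have pa: "a (patch ?ks p r) \<in> hcarrier H" by (rule am[OF patch_mem[OF sub(2) p]])
    define \<alpha> \<beta> where "\<alpha> = hnorm H (a (patch ?ks p r))" and "\<beta> = sqrt (weight_list ?ks r) * hnorm H (B (Sl ?ks r z))"
    have "norm (?f r) \<le> \<alpha> * hnorm H (complex_of_real (sqrt (weight_list ?ks r)) *\<^sub>C B (Sl ?ks r z))"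
      unfolding \<alpha>_def by (rule Cauchy_Schwarz[OF pa scaleC_mem[OF u]])
    also have "hnorm H (complex_of_real (sqrt (weight_list ?ks r)) *\<^sub>C B (Sl ?ks r z)) = \<beta>"
      using hnorm_scaleC[OF u] weight_list_nonneg[of ?ks r] unfolding \<beta>_def by (simp only: norm_of_real) simp
    also have "\<alpha> * \<beta> \<le> \<alpha>\<^sup>2 + \<beta>\<^sup>2"
      using sum_squares_bound[of \<alpha> \<beta>] zero_le_power2[of \<alpha>] zero_le_power2[of \<beta>] by linarith
    also have "\<beta>\<^sup>2 = weight_list ?ks r * (hnorm H (B (Sl ?ks r z)))\<^sup>2"
      using weight_list_nonneg[of ?ks r] unfolding \<beta>_def power_mult_distrib by (simp only: real_sqrt_pow2)
    finally show "norm (?f r) \<le> (hnorm H (a (patch ?ks p r)))\<^sup>2 + weight_list ?ks r * (hnorm H (B (Sl ?ks r z)))\<^sup>2"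
      by (simp only: \<alpha>_def)
  qed simp
  show ?case
    unfolding z_def[symmetric]
  proof (rule multi_split_sum_abs[OF A(2) abs, unfolded A(1), OF _ IH])
    fix r :: "nat \<Rightarrow> nat" assume r: "r \<in> multi (set xs)"
    let ?P = "patch xs p r"
    have P: "?P \<in> multi {1..n}" by (rule patch_mem[OF sub(1) p])
    define s where "s = slice k a ?P"
    have s: "s \<in> hcarrier L1" unfolding s_def by (rule D.slice_mem'[OF k aL P])
    have s_orth: "hinner L1 s t = 0" if "t \<in> annihilator k" for t
    proof -
      have "hinner L1 (slice k a (?P(k := undefined))) t = 0"
        using a k that multi_restrict[OF P, of k] unfolding model_coeffs_def by blast
      then show ?thesis by (simp only: s_def slice_update)
    qed
    define u where "u = absorb p xs x"
    have u: "u \<in> hcarrier H" unfolding u_def by (rule absorb_mem[OF sub(1) x])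
    define y where "y = Sl xs r u"
    have y: "y \<in> hcarrier H" unfolding y_def by (rule sl(1)[OF u])
    let ?c = "complex_of_real (sqrt (neg_binom (m k) (p k)))"
    define y' where "y' = ?c *\<^sub>C (T k ^^ p k) (\<Delta> k y)"
    have du: "\<Delta> k u \<in> hcarrier H" using bounded_operatorD(1)[OF \<Delta>_bounded[OF k] u] .
    have tdu: "(T k ^^ p k) (\<Delta> k u) \<in> hcarrier H" using bounded_operatorD(1)[OF pow_bounded(1)[OF k] du] .
    have dy: "\<Delta> k y \<in> hcarrier H" using bounded_operatorD(1)[OF \<Delta>_bounded[OF k] y] .
    have y'm: "y' \<in> hcarrier H" using bounded_operatorD(1)[OF pow_bounded(1)[OF k] dy] by (simp add: y'_def)
    have z_eq: "z = ?c *\<^sub>C (T k ^^ p k) (\<Delta> k u)" by (simp add: z_def u_def)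
    have "Sl xs r z = ?c *\<^sub>C Sl xs r ((T k ^^ p k) (\<Delta> k u))" unfolding z_eq by (rule sl(3)[OF tdu])
    also have "Sl xs r ((T k ^^ p k) (\<Delta> k u)) = (T k ^^ p k) (Sl xs r (\<Delta> k u))"
      using commute_on_funpow[OF commute_on_sym[OF T_Sl[OF k sub(1) nk]] Sl_bounded[OF sub(1)] T_bounded[OF k]] du
      unfolding commute_on_def by blast
    also have "Sl xs r (\<Delta> k u) = \<Delta> k y"
      using \<Delta>_Sl[OF k sub(1) nk, of r] u by (simp add: commute_on_def y_def)
    finally have slz: "Sl xs r z = y'" by (simp only: y'_def)
    let ?w = "complex_of_real (sqrt (weight_list xs r))"
    have f: "?f (r(k := q)) = ?w * hinner H (s q) (W k y' q)" for q
    proof -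
      have 1: "patch ?ks p (r(k := q)) = ?P(k := q)" using nk by (auto simp: patch_def fun_eq_iff)
      have 2: "Sl ?ks (r(k := q)) z = (S k ^^ q) y'"
      proof -
        have "Sl xs (r(k := q)) z = Sl xs r z" using nk by (intro power_list_cong) auto
        then show ?thesis by (simp add: slz)
      qed
      have sq: "a (?P(k := q)) = s q" by (simp add: s_def slice_def)
      have sm: "s q \<in> hcarrier H" using l2_carrierD(1)[OF s, of q] Dsp_mem by simp
      have bm: "B ((S k ^^ q) y') \<in> hcarrier H"
        using B_lin(1) bounded_operatorD(1)[OF pow_bounded(2)[OF k] y'm] by simp
      show ?thesis
        unfolding 1 2 sq weight_list_Cons[OF nk] W_def real_sqrt_mult
        using sm bm by (simp add: inner_scaleC_right)
    qed
    have "((\<lambda>q. ?w * hinner H (s q) (W k y' q)) has_sum ?w * hinner L1 s (W k y')) UNIV"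
      using D.l2_inner_has_sum[OF s W_mem[OF k y'm]] by (intro has_sum_cmult_right) simp
    also have "hinner L1 s (W k y') = hinner H (s (p k)) (B y)"
      unfolding y'_def by (rule annihilator_orth_component[OF k s s_orth y, symmetric])
    also have "s (p k) = a ?P"
    proof -
      have "?P(k := p k) = ?P" using nk by (auto simp: patch_def fun_eq_iff)
      then show ?thesis by (simp add: s_def slice_def)
    qed
    also have "?w * hinner H (a ?P) (B y) = hinner H (a ?P) (?w *\<^sub>C B y)"
      using am[OF P] B_lin(1)[OF y] by (simp add: inner_scaleC_right)
    finally show "((\<lambda>q. ?f (r(k := q))) has_sum
        hinner H (a ?P) (?w *\<^sub>C B (Sl xs r (absorb p xs x)))) UNIV"
      unfolding f y_def u_def .
  qed
qed

text \<open>
  The difference \<open>b\<close> between an element of the joint model and its projection onto the range of \<open>V\<close> lies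
  in the joint model again. By the expansion over all variables, its inner product with any monomial is
  an inner product with an element of the range of \<open>V\<close>, so it is 0.
\<close>

theorem model_coeffs_eq: "model_coeffs = V ` hcarrier H"
proof
  show "V ` hcarrier H \<subseteq> model_coeffs" using V_model by blast
  show "model_coeffs \<subseteq> V ` hcarrier H"
  proof
    fix a assume a: "a \<in> model_coeffs"
    then have aL: "a \<in> hcarrier L" by (simp add: model_coeffs_def)
    define h where "h = adjoint H L V a"
    note adj = adjoint[OF hilbert_space_axioms L.pre_hilbert_axioms V_bounded aL, folded h_def]
    have h: "h \<in> hcarrier H" by (rule adj(1))
    define b where "b = a - V h"
    have bL: "b \<in> hcarrier L" using aL V_mem[OF h] by (simp add: b_def)
    have b: "b \<in> model_coeffs"
      unfolding model_coeffs_def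
    proof (intro CollectI conjI ballI bL)
      fix k p t assume k: "k \<in> {1..n}" and p: "p \<in> multi ({1..n} - {k})" and t: "t \<in> annihilator k"
      have "slice k b p = slice k a p - slice k (V h) p" by (simp add: b_def slice_def fun_eq_iff)
      moreover have "hinner L1 (slice k a p) t = 0" "hinner L1 (slice k (V h) p) t = 0"
        using a V_model[OF h] k p t unfolding model_coeffs_def by blast+
      moreover have "t \<in> hcarrier L1" using t by (simp add: annihilator_def)
      ultimately show "hinner L1 (slice k b p) t = 0"
        using L1.inner_diff_left[OF D.slice_mem[OF k aL p] D.slice_mem[OF k V_mem[OF h] p]] by simp
    qed
    have orth: "hinner L b (V g) = 0" if g: "g \<in> hcarrier H" for g
      using adj(3)[OF g] V_inner[OF h g] L.inner_diff_left[OF aL V_mem[OF h] V_mem[OF g]] by (simp add: b_def)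
    have "b p = 0" if p: "p \<in> multi {1..n}" for p
    proof (rule Dsp_zero_if_orth)
      show "b p \<in> hcarrier Dsp" by (rule l2_carrierD(1)[OF bL p])
      fix x assume x: "x \<in> hcarrier H"
      let ?g = "absorb p all x"
      have g: "?g \<in> hcarrier H" by (rule absorb_mem[OF all_subset x])
      have "((\<lambda>r. hinner H (b (patch all p r))
          (complex_of_real (sqrt (weight_list all r)) *\<^sub>C B (Sl all r ?g))) has_sum hinner H (b p) (B x)) (multi {1..n})"
        using tail_expansion[OF b _ p x, of "[]" all] unfolding set_all by simp
      moreover have "hinner H (b (patch all p r)) (complex_of_real (sqrt (weight_list all r)) *\<^sub>C B (Sl all r ?g))
          = hinner H (b r) (V ?g r)" if r: "r \<in> multi {1..n}" for r
      proof -
        have "patch all p r = r"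
        proof
          fix i
          show "patch all p r i = r i"
            using PiE_arb[OF p, of i] PiE_arb[OF r, of i] by (cases "i \<in> {1..n}") (simp_all add: patch_def set_all del: set_upt)
        qed
        then show ?thesis using r by (simp add: V_def)
      qed
      ultimately have "((\<lambda>r. hinner H (b r) (V ?g r)) has_sum hinner H (b p) (B x)) (multi {1..n})"
        by (rule has_sum_cong[THEN iffD1, rotated])
      from has_sum_unique[OF this] D.l2_inner_has_sum[OF bL V_mem[OF g]]
      show "hinner H (b p) (B x) = 0" using orth[OF g] by simp
    qed
    moreover have "b p = 0" if "p \<notin> multi {1..n}" for p using l2_carrierD(2)[OF bL that] .
    ultimately have "b p = 0" for p by blast
    then have "b = 0" by (simp add: fun_eq_iff)
    then have "a = V h" by (simp add: b_def)
    then show "a \<in> V ` hcarrier H" using h by blast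
  qed
qed

text \<open>
  The relation \<open>V T\<^sub>i\<^sup>* = M\<^bsub>z\<^sub>i\<^esub>\<^sup>* V\<close>, in the form that identifies \<open>T\<^sub>i\<close> as a compression of \<open>M\<^bsub>z\<^sub>i\<^esub>\<close>.
\<close>

lemma V_shift:
  assumes i: "i \<in> {1..n}" and h: "h \<in> hcarrier H" and g: "g \<in> hcarrier H"
    and T: "tensor_op {1..n} i (l2_shift (m i)) (V h) \<in> hcarrier L"
  shows "hinner L (tensor_op {1..n} i (l2_shift (m i)) (V h)) (V g) = hinner H (T i h) g"
proof -
  let ?ys = "remove1 i all"
  have sg: "S i g \<in> hcarrier H" using bounded_operatorD(1)[OF S_bounded[OF i] g] .
  have "((\<lambda>p. hinner L1 (slice i (tensor_op {1..n} i (l2_shift (m i)) (V h)) p) (slice i (V g) p)) has_sum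
      hinner L (tensor_op {1..n} i (l2_shift (m i)) (V h)) (V g)) (multi ({1..n} - {i}))"
    by (rule D.slice_inner_has_sum[OF i T V_mem[OF g]])
  moreover have "hinner L1 (slice i (tensor_op {1..n} i (l2_shift (m i)) (V h)) p) (slice i (V g) p) =
      hinner L1 (slice i (V h) p) (slice i (V (S i g)) p)" if p: "p \<in> multi ({1..n} - {i})" for p
  proof -
    interpret d: disc_space Dsp "m i" by unfold_locales (rule m[OF i])
    let ?c = "complex_of_real (sqrt (weight_list ?ys p))"
    let ?u = "Sl ?ys p g"
    have u: "?u \<in> hcarrier H" using bounded_operatorD(1)[OF Sl_bounded[OF remaining_factors(1)[OF i]] g] .
    have su: "S i ?u \<in> hcarrier H" using bounded_operatorD(1)[OF S_bounded[OF i] u] .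
    have comm: "Sl ?ys p (S i g) = S i ?u"
      using S_Sl[OF i remaining_factors(1,2)[OF i], of p] g by (simp add: commute_on_def)
    note t = D.slice_mem[OF i V_mem[OF h] p]
    have "hinner L1 (l2_shift (m i) (slice i (V h) p)) (?c *\<^sub>C W i ?u)
        = hinner L1 (slice i (V h) p) (?c *\<^sub>C W i (S i ?u))"
      using W_shift[OF i t u] L1.inner_scaleC_right[OF d.l2_shift_mem(1)[OF t] W_mem[OF i u]]
        L1.inner_scaleC_right[OF t W_mem[OF i su]] by simp
    then show ?thesis
      unfolding slice_tensor_op[OF i p] slice_V[OF i p g] slice_V[OF i p sg] comm .
  qed
  ultimately have "((\<lambda>p. hinner L1 (slice i (V h) p) (slice i (V (S i g)) p)) has_sum
      hinner L (tensor_op {1..n} i (l2_shift (m i)) (V h)) (V g)) (multi ({1..n} - {i}))"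
    by (rule has_sum_cong[THEN iffD1, rotated])
  from has_sum_unique[OF this D.slice_inner_has_sum[OF i V_mem[OF h] V_mem[OF sg]]]
  show ?thesis using V_inner[OF h sg] S_inner[OF i h g] by simp
qed

text \<open>
  The coefficient space of the \<open>k\<close>-th multiplier is the invariant subspace itself, which is why its
  vectors are functions of one variable.
\<close>

theorem doubly_commuting_model:
  "\<exists>(E :: nat \<Rightarrow> (complex \<Rightarrow> 'a) hilbert) \<theta>.
    let Q = quotient_space n m Dsp E \<theta> in
      (\<forall>k\<in>{1..n}. hilbert_space (E k) \<and> partially_isometric_multiplier 1 (E k) (m k) Dsp (\<theta> k)) \<and>
      hilbert_isomorphic H Q \<and>
      jointly_unitarily_equivalent n H T Q (compressed_shift n m Dsp (hcarrier Q))"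
proof -
  interpret P: polydisc_space Dsp n m by unfold_locales (rule m)
  define M where "M k = orth_compl (A2_disc (m k) Dsp) ((\<lambda>h. disc_synth Dsp (m k) (W k h)) ` hcarrier H)" for k
  define E where "E k = subspace_of (A2_disc (m k) Dsp) (M k)" for k
  have M: "closed_subspace (A2_disc (m k) Dsp) (M k)"
    "f \<in> M k \<Longrightarrow> mult_z f \<in> M k"
    "M k = disc_synth Dsp (m k) ` annihilator k" if k: "k \<in> {1..n}" for k f
  proof -
    interpret d: disc_space Dsp "m k" by unfold_locales (rule m[OF k])
    have W_R: "(\<lambda>h. d.F.synth (W k h)) ` hcarrier H \<subseteq> hcarrier d.R"
      using W_mem[OF k] unfolding d.R_carrier by blast
    show "closed_subspace d.R (M k)"
      unfolding M_def by (rule d.R.orth_compl_closed_subspace[OF W_R])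
    show eq: "M k = d.F.synth ` annihilator k"
    proof
      show "M k \<subseteq> d.F.synth ` annihilator k"
      proof
        fix f assume f: "f \<in> M k"
        then obtain t where t: "t \<in> hcarrier L1" "f = d.F.synth t"
          unfolding M_def orth_compl_def d.R_carrier by blast
        have "hinner L1 t (W k h) = 0" if h: "h \<in> hcarrier H" for h
        proof -
          have "hinner d.R f (d.F.synth (W k h)) = 0" using f h unfolding M_def orth_compl_def by blast
          then show ?thesis using d.R_inner[OF t(1) W_mem[OF k h]] t(2) by simp
        qed
        then show "f \<in> d.F.synth ` annihilator k" using t by (auto simp: annihilator_def)
      qed
      show "d.F.synth ` annihilator k \<subseteq> M k"
        unfolding M_def orth_compl_def d.R_carrier
        using d.R_inner W_mem[OF k] by (auto simp: annihilator_def)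
    qed
    show "mult_z f \<in> M k" if f: "f \<in> M k"
    proof -
      obtain t where t: "t \<in> annihilator k" "f = d.F.synth t" using f unfolding eq by blast
      have tL: "t \<in> hcarrier L1" using t(1) by (simp add: annihilator_def)
      have "l2_shift (m k) t \<in> annihilator k"
        using t(1) d.l2_shift_mem(1)[OF tL] W_shift[OF k tL] bounded_operatorD(1)[OF S_bounded[OF k]]
        by (simp add: annihilator_def)
      then show ?thesis unfolding eq t(2) using d.synth_l2_shift[OF tL] by (metis image_eqI)
    qed
  qed
  have E: "hilbert_space (E k)" if k: "k \<in> {1..n}" for k
  proof -
    interpret d: disc_space Dsp "m k" by unfold_locales (rule m[OF k])
    show ?thesis unfolding E_def by (rule d.R.closed_subspace_hilbert[OF M(1)[OF k]])
  qed
  have "\<forall>k\<in>{1..n}. \<exists>\<theta>. partially_isometric_multiplier 1 (E k) (m k) Dsp \<theta> \<and>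
      mult_operator unit_disc \<theta> ` hcarrier (A2_disc 1 (E k)) = M k"
  proof
    fix k assume k: "k \<in> {1..n}"
    interpret d: disc_space Dsp "m k" by unfold_locales (rule m[OF k])
    show "\<exists>\<theta>. partially_isometric_multiplier 1 (E k) (m k) Dsp \<theta> \<and>
        mult_operator unit_disc \<theta> ` hcarrier (A2_disc 1 (E k)) = M k"
      unfolding E_def by (rule d.invariant_subspace_multiplier[OF M(1)[OF k] M(2)[OF k]])
  qed
  then obtain \<theta> where \<theta>: "\<And>k. k \<in> {1..n} \<Longrightarrow> partially_isometric_multiplier 1 (E k) (m k) Dsp (\<theta> k)"
    "\<And>k. k \<in> {1..n} \<Longrightarrow> mult_operator unit_disc (\<theta> k) ` hcarrier (A2_disc 1 (E k)) = M k"
    by metis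
  let ?K = "A2_polydisc n m Dsp"
  define Rg where "Rg i = mult_operator (polydisc n) (\<lambda>z. \<theta> i (z i)) ` hcarrier (A2_polydisc n (m(i := 1)) (E i))" for i
  have Rg: "Rg i \<subseteq> hcarrier ?K" "0 \<in> Rg i" if i: "i \<in> {1..n}" for i
    unfolding Rg_def
    using P.variable_multiplier_mem[OF i E[OF i] \<theta>(1)[OF i]] P.variable_multiplier_zero[OF i E[OF i] \<theta>(1)[OF i]]
    by blast+
  have slices: "(\<forall>g\<in>Rg k. hinner ?K (P.F.synth a) g = 0) \<longleftrightarrow>
      (\<forall>p\<in>multi ({1..n} - {k}). \<forall>t\<in>annihilator k. hinner L1 (slice k a p) t = 0)"
    if a: "a \<in> hcarrier L" and k: "k \<in> {1..n}" for a k
  proof -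
    interpret d: disc_space Dsp "m k" by unfold_locales (rule m[OF k])
    have "(\<forall>g\<in>Rg k. hinner ?K (P.F.synth a) g = 0) \<longleftrightarrow>
        (\<forall>p\<in>multi ({1..n} - {k}). \<forall>f\<in>M k. hinner d.R (d.F.synth (slice k a p)) f = 0)"
      using P.orth_variable_multiplier_iff[OF k E[OF k] \<theta>(1)[OF k] a]
      unfolding Rg_def \<theta>(2)[OF k, symmetric] ball_simps .
    also have "\<dots> \<longleftrightarrow> (\<forall>p\<in>multi ({1..n} - {k}). \<forall>t\<in>annihilator k. hinner L1 (slice k a p) t = 0)"
    proof (intro ball_cong refl)
      fix p assume p: "p \<in> multi ({1..n} - {k})"
      have "hinner d.R (d.F.synth (slice k a p)) (d.F.synth t) = hinner L1 (slice k a p) t"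
        if "t \<in> annihilator k" for t
        using that by (intro d.R_inner D.slice_mem[OF k a p]) (simp add: annihilator_def)
      then show "(\<forall>f\<in>M k. hinner d.R (d.F.synth (slice k a p)) f = 0) \<longleftrightarrow>
          (\<forall>t\<in>annihilator k. hinner L1 (slice k a p) t = 0)"
        unfolding M(3)[OF k] by simp
    qed
    finally show ?thesis .
  qed
  define Sm where "Sm = sum_of_subspaces n Rg"
  have Sm_sub: "Sm \<subseteq> hcarrier ?K"
  proof
    fix f assume "f \<in> Sm"
    then obtain g where g: "f = (\<Sum>i\<in>{1..n}. g i)" "\<forall>i\<in>{1..n}. g i \<in> Rg i"
      unfolding Sm_def sum_of_subspaces_def by blast
    show "f \<in> hcarrier ?K" unfolding g(1) by (rule P.K.sum_mem) (use g(2) Rg(1) in blast)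
  qed
  have Rg_Sm: "Rg k \<subseteq> Sm" if k: "k \<in> {1..n}" for k
  proof
    fix f assume f: "f \<in> Rg k"
    have "(\<Sum>i\<in>{1..n}. if i = k then f else 0) = f" using k by simp
    moreover have "\<forall>i\<in>{1..n}. (if i = k then f else 0) \<in> Rg i" using f Rg(2) by auto
    ultimately show "f \<in> Sm" unfolding Sm_def sum_of_subspaces_def
      by (intro CollectI exI[of _ "\<lambda>i. if i = k then f else 0"]) simp
  qed
  define U where "U h = P.F.synth (V h)" for h
  define Qc where "Qc = orth_compl ?K Sm"
  have Qc_closed: "closed_subspace ?K Qc"
    unfolding Qc_def by (rule P.K.orth_compl_closed_subspace[OF Sm_sub])
  have Qc: "Qc = U ` hcarrier H"
  proof -
    have iff: "P.F.synth a \<in> Qc \<longleftrightarrow> a \<in> model_coeffs" if a: "a \<in> hcarrier L" for a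
    proof -
      have aK: "P.F.synth a \<in> hcarrier ?K" using a unfolding P.K_carrier by blast
      have "P.F.synth a \<in> Qc \<longleftrightarrow> (\<forall>k\<in>{1..n}. \<forall>g\<in>Rg k. hinner ?K (P.F.synth a) g = 0)"
      proof
        assume "P.F.synth a \<in> Qc"
        then show "\<forall>k\<in>{1..n}. \<forall>g\<in>Rg k. hinner ?K (P.F.synth a) g = 0"
          using Rg_Sm unfolding Qc_def orth_compl_def by blast
      next
        assume *: "\<forall>k\<in>{1..n}. \<forall>g\<in>Rg k. hinner ?K (P.F.synth a) g = 0"
        show "P.F.synth a \<in> Qc"
          unfolding Qc_def orth_compl_def
        proof (intro CollectI conjI ballI aK)
          fix f assume "f \<in> Sm"
          then obtain g where g: "f = (\<Sum>i\<in>{1..n}. g i)" "\<forall>i\<in>{1..n}. g i \<in> Rg i"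
            unfolding Sm_def sum_of_subspaces_def by blast
          have "hinner ?K (P.F.synth a) f = (\<Sum>i\<in>{1..n}. hinner ?K (P.F.synth a) (g i))"
            unfolding g(1) by (rule P.K.inner_sum_right[OF _ aK]) (use g(2) Rg(1) in blast)
          also have "\<dots> = 0" using g(2) * by (intro sum.neutral) auto
          finally show "hinner ?K (P.F.synth a) f = 0" .
        qed
      qed
      also have "\<dots> \<longleftrightarrow> a \<in> model_coeffs"
        unfolding model_coeffs_def using slices[OF a] a by auto
      finally show ?thesis .
    qed
    have "Qc \<subseteq> hcarrier ?K" unfolding Qc_def orth_compl_def by blast
    then have "Qc = P.F.synth ` model_coeffs"
      unfolding P.K_carrier using iff by (auto simp: model_coeffs_def)
    then show ?thesis unfolding model_coeffs_eq U_def by blast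
  qed
  define Q where "Q = quotient_space n m Dsp E \<theta>"
  have Q: "Q = subspace_of ?K Qc" "hcarrier Q = Qc" "hinner Q = hinner ?K" "hnorm Q = hnorm ?K"
    by (simp_all add: Q_def quotient_space_def Qc_def Sm_def Rg_def[abs_def])
  have U_inner: "hinner ?K (U x) (U y) = hinner H x y" if "x \<in> hcarrier H" "y \<in> hcarrier H" for x y
    unfolding U_def using that P.K_inner V_mem V_inner by simp
  have U_Qc: "U x \<in> Qc" if "x \<in> hcarrier H" for x using that unfolding Qc by blast
  have U_K: "U x \<in> hcarrier ?K" if "x \<in> hcarrier H" for x
    using P.K.closed_subspaceD(2)[OF Qc_closed U_Qc[OF that]] .
  note v = bounded_operatorD[OF V_bounded]
  have U: "unitary H Q U"
    unfolding unitary_def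
  proof (intro conjI ballI)
    show "bounded_operator H Q U"
    proof (rule bounded_operatorI[where C = 1])
      show "U (x + y) = U x + U y" if "x \<in> hcarrier H" "y \<in> hcarrier H" for x y
        using that v by (simp add: U_def P.F.synth_add)
      show "U (c *\<^sub>C x) = c *\<^sub>C U x" if "x \<in> hcarrier H" for c x
        using that v by (simp add: U_def P.F.synth_scaleC)
      show "hnorm Q (U x) \<le> 1 * hnorm H x" if "x \<in> hcarrier H" for x
        using that U_inner by (simp add: Q hnorm_def)
    qed (simp add: Q U_Qc)
    show "U ` hcarrier H = hcarrier Q" by (simp add: Q Qc)
  qed (simp add: Q U_inner)
  have "jointly_unitarily_equivalent n H T Q (compressed_shift n m Dsp (hcarrier Q))"
    unfolding jointly_unitarily_equivalent_def
  proof (intro exI[of _ U] conjI U ballI)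
    fix i h assume i: "i \<in> {1..n}" and h: "h \<in> hcarrier H"
    let ?s = "tensor_op {1..n} i (l2_shift (m i)) (V h)"
    note sh = P.mult_coordinate_synth[OF i V_mem[OF h]]
    have Th: "T i h \<in> hcarrier H" using bounded_operatorD(1)[OF T_bounded[OF i] h] .
    have mK: "mult_coordinate i (U h) \<in> hcarrier ?K"
      unfolding U_def sh(2) P.K_carrier using sh(1) by blast
    have "orth_proj ?K Qc (mult_coordinate i (U h)) = U (T i h)"
    proof (rule P.K.orth_proj_eqI[OF Qc_closed mK U_Qc[OF Th]])
      show "mult_coordinate i (U h) - U (T i h) \<in> orth_compl ?K Qc"
        unfolding orth_compl_def
      proof (intro CollectI conjI ballI)
        show "mult_coordinate i (U h) - U (T i h) \<in> hcarrier ?K" using mK U_K[OF Th] by simp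
        fix f assume "f \<in> Qc"
        then obtain g where g: "g \<in> hcarrier H" "f = U g" unfolding Qc by blast
        have "hinner ?K (mult_coordinate i (U h)) (U g) = hinner H (T i h) g"
          unfolding U_def sh(2) using P.K_inner[OF sh(1) V_mem[OF g(1)]] V_shift[OF i h g(1) sh(1)] by simp
        then show "hinner ?K (mult_coordinate i (U h) - U (T i h)) f = 0"
          using P.K.inner_diff_left[OF mK U_K[OF Th] U_K[OF g(1)]] U_inner[OF Th g(1)] g(2) by simp
      qed
    qed
    then show "U (T i h) = compressed_shift n m Dsp (hcarrier Q) i (U h)"
      by (simp add: compressed_shift_def Q)
  qed
  moreover have "hilbert_isomorphic H Q" unfolding hilbert_isomorphic_def using U by blast
  ultimately show ?thesis
    unfolding Let_def using E \<theta>(1) Q_def by blast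
qed

end

theorem theorem4p5:
  fixes n :: nat and m :: "nat \<Rightarrow> nat"
    and H :: "'a::complex_vector hilbert" and T :: "nat \<Rightarrow> 'a \<Rightarrow> 'a"
  assumes "n \<ge> 2"
    and "\<And>j. j \<in> {1..n} \<Longrightarrow> m j \<ge> 1"
    and "hilbert_space H"
    and "doubly_commuting n H T"
    and "B_contractive n m H T"
  shows "\<exists>(E :: nat \<Rightarrow> (complex \<Rightarrow> 'a) hilbert) \<theta>.
    let D = defect_space n m H T; Q = quotient_space n m D E \<theta> in
      (\<forall>k\<in>{1..n}. hilbert_space (E k) \<and>
        partially_isometric_multiplier 1 (E k) (m k) D (\<theta> k)) \<and>
      hilbert_isomorphic H Q \<and>
      jointly_unitarily_equivalent n H T Q (compressed_shift n m D (hcarrier Q))"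
proof -
  interpret doubly_commuting_tuple H n m T
    by (intro doubly_commuting_tuple.intro doubly_commuting_tuple_axioms.intro) (use assms in auto)
  show ?thesis using doubly_commuting_model unfolding Dsp_def Let_def .
qed

end
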